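(* If two topologically trivial (oriented) Legendrian knots $L_1$ and $L_2$ in $(\mathbb{R}^3,\xi_{std})$ have the same Thurston-Bennequin invariant, then for every $n\in\mathbb{N}$ the corresponding $n$-Legendrian racks $LR_n(L_1)$ and $LR_n(L_2)$ are isomorphic.
   Context: Racks. $\mathbb{N}=\{0,1,2,\dots\}$. A rack is a set $R$ with two binary operations $*$ and $/$ such that for all $x,y,z\in R$: $(x*y)*z=(x*z)*(y*z)$, $(x/y)/z=(x/z)/(y/z)$, $(x*y)/y=x$, $(x/y)*y=x$. Powers: $x^1=x$, $x^m=x^{m-1}*x$ for $m>1$. For $n\in\mathbb{N}$, an $n$-Legendrian rack is a rack such that $x^{2n+2}=x$ for all $x$. Legendrian knots. $\xi_{std}=\ker(dz-y\,dx)$ on $\mathbb{R}^3$. A smooth knot $L$ is Legendrian if $T_pL\subset\xi_{std}|_p$ for all $p\in L$. A Legendrian isotopy is an isotopy through Legendrian knots. $L$ is topologically trivial if it is topologically isotopic to the unknot. A front projection $D_L$ of $L$ is a generic projection to the $xz$-plane (obtained after a Legendrian isotopy if necessary): it has no vertical tangencies, finitely many cusps, and finitely many transverse double points (crossings). Since $y=dz/dx$, at each crossing the branch with smaller slope $dz/dx$ is the over-branch. The Thurston-Bennequin number $tb(L)$ is the writhe minus half the number of cusps of a front. The associated racks. The strands of an oriented front projection $D_L$ are the connected segments of the diagram that begin and end at an under-crossing or a cusp. $LR_n(D_L)$ is the $n$-Legendrian rack presented (in the class of $n$-Legendrian racks) by one generator for each strand and the following relations. At each crossing with over-strand $y$,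 incoming under-strand $x$ and outgoing under-strand $x'$: $x'=x*y$ if the crossing is positive and $x'=x/y$ if it is negative. At each cusp at which the strand $a$ is followed, along the orientation, by the strand $b$: $b=a^{n+1}$. Up to isomorphism $LR_n(D_L)$ depends only on the oriented Legendrian isotopy class of $L$, and is denoted $LR_n(L)$. *)

theory Defs
  imports "HOL-Analysis.Analysis"
begin

section \<open>Racks\<close>

record 'a rack_struct =
  carrier :: "'a set"
  mult :: "'a \<Rightarrow> 'a \<Rightarrow> 'a"
  quot :: "'a \<Rightarrow> 'a \<Rightarrow> 'a"

definition rack :: "'a rack_struct \<Rightarrow> bool" where
  "rack R \<longleftrightarrow>
     (\<forall>x\<in>carrier R. \<forall>y\<in>carrier R. mult R x y \<in> carrier R \<and> quot R x y \<in> carrier R) \<and>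
     (\<forall>x\<in>carrier R. \<forall>y\<in>carrier R. \<forall>z\<in>carrier R.
        mult R (mult R x y) z = mult R (mult R x z) (mult R y z) \<and>
        quot R (quot R x y) z = quot R (quot R x z) (quot R y z)) \<and>
     (\<forall>x\<in>carrier R. \<forall>y\<in>carrier R.
        quot R (mult R x y) y = x \<and> mult R (quot R x y) y = x)"

text \<open>Powers are only meaningful for positive exponents; the value at 0 is a dummy.\<close>

fun rack_power :: "'a rack_struct \<Rightarrow> 'a \<Rightarrow> nat \<Rightarrow> 'a" where
  "rack_power R x 0 = x"
| "rack_power R x (Suc 0) = x"
| "rack_power R x (Suc (Suc m)) = mult R (rack_power R x (Suc m)) x"

definition legendrian_rack :: "nat \<Rightarrow> 'a rack_struct \<Rightarrow> bool" where
  "legendrian_rack n R \<longleftrightarrow>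
     rack R \<and> (\<forall>x\<in>carrier R. rack_power R x (2 * n + 2) = x)"

definition rack_hom :: "'a rack_struct \<Rightarrow> 'b rack_struct \<Rightarrow> ('a \<Rightarrow> 'b) \<Rightarrow> bool" where
  "rack_hom R S f \<longleftrightarrow> f ` carrier R \<subseteq> carrier S \<and>
     (\<forall>x\<in>carrier R. \<forall>y\<in>carrier R.
        f (mult R x y) = mult S (f x) (f y) \<and> f (quot R x y) = quot S (f x) (f y))"

definition rack_isomorphic :: "'a rack_struct \<Rightarrow> 'b rack_struct \<Rightarrow> bool" where
  "rack_isomorphic R S \<longleftrightarrow> (\<exists>f. rack_hom R S f \<and> bij_betw f (carrier R) (carrier S))"

section \<open>Presentations of \<open>n\<close>-Legendrian racks\<close>

datatype 'g rack_term =
    Gen 'g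
  | Mult "'g rack_term" "'g rack_term"
  | Quot "'g rack_term" "'g rack_term"

definition term_struct :: "'g set \<Rightarrow> 'g rack_term rack_struct" where
  "term_struct X = \<lparr>carrier = {t. set_rack_term t \<subseteq> X}, mult = Mult, quot = Quot\<rparr>"

text \<open>The least congruence on the terms over \<open>X\<close> that contains the given relations and whose
  quotient is an \<open>n\<close>-Legendrian rack.\<close>

inductive pres_eq ::
    "nat \<Rightarrow> 'g set \<Rightarrow> ('g rack_term \<times> 'g rack_term) set \<Rightarrow> 'g rack_term \<Rightarrow> 'g rack_term \<Rightarrow> bool"
  for n X Rels where
  rel: "\<lbrakk>(s, t) \<in> Rels; s \<in> carrier (term_struct X); t \<in> carrier (term_struct X)\<rbrakk>
      \<Longrightarrow> pres_eq n X Rels s t"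
| refl: "s \<in> carrier (term_struct X) \<Longrightarrow> pres_eq n X Rels s s"
| sym: "pres_eq n X Rels s t \<Longrightarrow> pres_eq n X Rels t s"
| trans: "\<lbrakk>pres_eq n X Rels s t; pres_eq n X Rels t u\<rbrakk> \<Longrightarrow> pres_eq n X Rels s u"
| mult_cong: "\<lbrakk>pres_eq n X Rels s s'; pres_eq n X Rels t t'\<rbrakk>
      \<Longrightarrow> pres_eq n X Rels (Mult s t) (Mult s' t')"
| quot_cong: "\<lbrakk>pres_eq n X Rels s s'; pres_eq n X Rels t t'\<rbrakk>
      \<Longrightarrow> pres_eq n X Rels (Quot s t) (Quot s' t')"
| mult_distrib: "\<lbrakk>s \<in> carrier (term_struct X); t \<in> carrier (term_struct X);
        u \<in> carrier (term_struct X)\<rbrakk>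
      \<Longrightarrow> pres_eq n X Rels (Mult (Mult s t) u) (Mult (Mult s u) (Mult t u))"
| quot_distrib: "\<lbrakk>s \<in> carrier (term_struct X); t \<in> carrier (term_struct X);
        u \<in> carrier (term_struct X)\<rbrakk>
      \<Longrightarrow> pres_eq n X Rels (Quot (Quot s t) u) (Quot (Quot s u) (Quot t u))"
| quot_mult: "\<lbrakk>s \<in> carrier (term_struct X); t \<in> carrier (term_struct X)\<rbrakk>
      \<Longrightarrow> pres_eq n X Rels (Quot (Mult s t) t) s"
| mult_quot: "\<lbrakk>s \<in> carrier (term_struct X); t \<in> carrier (term_struct X)\<rbrakk>
      \<Longrightarrow> pres_eq n X Rels (Mult (Quot s t) t) s"
| legendrian: "s \<in> carrier (term_struct X)
      \<Longrightarrow> pres_eq n X Rels (rack_power (term_struct X) s (2 * n + 2)) s"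

definition pres_class ::
    "nat \<Rightarrow> 'g set \<Rightarrow> ('g rack_term \<times> 'g rack_term) set \<Rightarrow> 'g rack_term \<Rightarrow> 'g rack_term set" where
  "pres_class n X Rels s = {t. pres_eq n X Rels s t}"

definition presented_rack ::
    "nat \<Rightarrow> 'g set \<Rightarrow> ('g rack_term \<times> 'g rack_term) set \<Rightarrow> 'g rack_term set rack_struct" where
  "presented_rack n X Rels =
     \<lparr>carrier = pres_class n X Rels ` carrier (term_struct X),
      mult = (\<lambda>P Q. \<Union>s\<in>P. \<Union>t\<in>Q. pres_class n X Rels (Mult s t)),
      quot = (\<lambda>P Q. \<Union>s\<in>P. \<Union>t\<in>Q. pres_class n X Rels (Quot s t))\<rparr>"

text \<open>Sanity checks: the presented structure is an \<open>n\<close>-Legendrian rack, and it has the universal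
  property of a presentation.\<close>

lemma term_carrier_simps [simp]:
  "Gen x \<in> carrier (term_struct X) \<longleftrightarrow> x \<in> X"
  "Mult s t \<in> carrier (term_struct X) \<longleftrightarrow>
     s \<in> carrier (term_struct X) \<and> t \<in> carrier (term_struct X)"
  "Quot s t \<in> carrier (term_struct X) \<longleftrightarrow>
     s \<in> carrier (term_struct X) \<and> t \<in> carrier (term_struct X)"
  by (auto simp: term_struct_def)

lemma term_power_in_carrier:
  "s \<in> carrier (term_struct X) \<Longrightarrow> rack_power (term_struct X) s m \<in> carrier (term_struct X)"
  by (induction "term_struct X" s m rule: rack_power.induct)
     (simp_all, simp add: term_struct_def)

lemma pres_eq_carrier:
  "pres_eq n X Rels s t \<Longrightarrow> s \<in> carrier (term_struct X) \<and> t \<in> carrier (term_struct X)"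
  by (induction rule: pres_eq.induct) (auto intro: term_power_in_carrier simp del: rack_power.simps add_2_eq_Suc')

lemma pres_class_eq_iff:
  assumes "s \<in> carrier (term_struct X)"
  shows "pres_class n X Rels s = pres_class n X Rels t \<longleftrightarrow> pres_eq n X Rels s t"
proof
  assume "pres_class n X Rels s = pres_class n X Rels t"
  moreover have "s \<in> pres_class n X Rels s"
    using assms by (simp add: pres_class_def pres_eq.refl)
  ultimately show "pres_eq n X Rels s t"
    by (simp add: pres_class_def pres_eq.sym)
next
  assume "pres_eq n X Rels s t"
  then show "pres_class n X Rels s = pres_class n X Rels t"
    unfolding pres_class_def
    using pres_eq.trans[of n X Rels s t] pres_eq.trans[of n X Rels t s] pres_eq.sym[of n X Rels s t]
    by blast
qed

lemma presented_rack_mult: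
  assumes "s \<in> carrier (term_struct X)" "t \<in> carrier (term_struct X)"
  shows "mult (presented_rack n X Rels) (pres_class n X Rels s) (pres_class n X Rels t)
         = pres_class n X Rels (Mult s t)"
proof -
  have eq: "pres_class n X Rels (Mult s' t') = pres_class n X Rels (Mult s t)"
    if "s' \<in> pres_class n X Rels s" "t' \<in> pres_class n X Rels t" for s' t'
  proof -
    have "pres_eq n X Rels (Mult s' t') (Mult s t)"
      using that by (simp add: pres_class_def pres_eq.mult_cong pres_eq.sym)
    then show ?thesis
      by (simp add: pres_class_eq_iff[OF pres_eq_carrier[THEN conjunct1]])
  qed
  have mem: "s \<in> pres_class n X Rels s" "t \<in> pres_class n X Rels t"
    using assms by (simp_all add: pres_class_def pres_eq.refl)
  have "(\<Union>s'\<in>pres_class n X Rels s. \<Union>t'\<in>pres_class n X Rels t. pres_class n X Rels (Mult s' t'))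
      = (\<Union>s'\<in>pres_class n X Rels s. \<Union>t'\<in>pres_class n X Rels t. pres_class n X Rels (Mult s t))"
    by (intro SUP_cong HOL.refl eq)
  also have "\<dots> = pres_class n X Rels (Mult s t)"
    using mem by auto
  finally show ?thesis
    by (simp add: presented_rack_def)
qed

lemma presented_rack_quot:
  assumes "s \<in> carrier (term_struct X)" "t \<in> carrier (term_struct X)"
  shows "quot (presented_rack n X Rels) (pres_class n X Rels s) (pres_class n X Rels t)
         = pres_class n X Rels (Quot s t)"
proof -
  have eq: "pres_class n X Rels (Quot s' t') = pres_class n X Rels (Quot s t)"
    if "s' \<in> pres_class n X Rels s" "t' \<in> pres_class n X Rels t" for s' t'
  proof -
    have "pres_eq n X Rels (Quot s' t') (Quot s t)"
      using that by (simp add: pres_class_def pres_eq.quot_cong pres_eq.sym)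
    then show ?thesis
      by (simp add: pres_class_eq_iff[OF pres_eq_carrier[THEN conjunct1]])
  qed
  have mem: "s \<in> pres_class n X Rels s" "t \<in> pres_class n X Rels t"
    using assms by (simp_all add: pres_class_def pres_eq.refl)
  have "(\<Union>s'\<in>pres_class n X Rels s. \<Union>t'\<in>pres_class n X Rels t. pres_class n X Rels (Quot s' t'))
      = (\<Union>s'\<in>pres_class n X Rels s. \<Union>t'\<in>pres_class n X Rels t. pres_class n X Rels (Quot s t))"
    by (intro SUP_cong HOL.refl eq)
  also have "\<dots> = pres_class n X Rels (Quot s t)"
    using mem by auto
  finally show ?thesis
    by (simp add: presented_rack_def)
qed

lemma presented_rack_carrier:
  "carrier (presented_rack n X Rels) = pres_class n X Rels ` carrier (term_struct X)"
  by (simp add: presented_rack_def)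

lemma presented_rack_power:
  assumes "s \<in> carrier (term_struct X)"
  shows "rack_power (presented_rack n X Rels) (pres_class n X Rels s) m
         = pres_class n X Rels (rack_power (term_struct X) s m)"
  using assms
proof (induction "term_struct X" s m rule: rack_power.induct)
  case (3 x m)
  then show ?case
    using term_power_in_carrier[of x X "Suc m"]
    by (simp add: presented_rack_mult) (simp add: term_struct_def)
qed simp_all

lemma legendrian_rack_presented: "legendrian_rack n (presented_rack n X Rels)"
proof -
  let ?R = "presented_rack n X Rels" and ?c = "pres_class n X Rels" and ?T = "carrier (term_struct X)"
  have eqI: "?c s = ?c t" if "pres_eq n X Rels s t" for s t
    using that by (simp add: pres_class_eq_iff pres_eq_carrier)
  have mult: "mult ?R (?c s) (?c t) = ?c (Mult s t)" if "s \<in> ?T" "t \<in> ?T" for s t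
    using that by (rule presented_rack_mult)
  have quot: "quot ?R (?c s) (?c t) = ?c (Quot s t)" if "s \<in> ?T" "t \<in> ?T" for s t
    using that by (rule presented_rack_quot)
  have closed: "mult ?R (?c s) (?c t) \<in> ?c ` ?T \<and> quot ?R (?c s) (?c t) \<in> ?c ` ?T"
    if "s \<in> ?T" "t \<in> ?T" for s t
    using that by (simp add: mult quot)
  have distrib: "mult ?R (mult ?R (?c s) (?c t)) (?c u)
        = mult ?R (mult ?R (?c s) (?c u)) (mult ?R (?c t) (?c u)) \<and>
      quot ?R (quot ?R (?c s) (?c t)) (?c u)
        = quot ?R (quot ?R (?c s) (?c u)) (quot ?R (?c t) (?c u))"
    if "s \<in> ?T" "t \<in> ?T" "u \<in> ?T" for s t u
    using that
    by (simp add: mult quot eqI[OF pres_eq.mult_distrib, of s t u]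
        eqI[OF pres_eq.quot_distrib, of s t u])
  have cancel: "quot ?R (mult ?R (?c s) (?c t)) (?c t) = ?c s \<and>
      mult ?R (quot ?R (?c s) (?c t)) (?c t) = ?c s"
    if "s \<in> ?T" "t \<in> ?T" for s t
    using that
    by (simp add: mult quot eqI[OF pres_eq.quot_mult] eqI[OF pres_eq.mult_quot])
  have power: "rack_power ?R (?c s) (2 * n + 2) = ?c s" if "s \<in> ?T" for s
    unfolding presented_rack_power[OF that] by (rule eqI[OF pres_eq.legendrian[OF that]])
  show ?thesis
    unfolding legendrian_rack_def rack_def presented_rack_carrier
    by (intro conjI ballI; elim imageE; hypsubst;
        rule closed[THEN conjunct1] closed[THEN conjunct2] distrib[THEN conjunct1]
          distrib[THEN conjunct2] cancel[THEN conjunct1] cancel[THEN conjunct2] power;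
        assumption)
qed

primrec eval_term :: "'a rack_struct \<Rightarrow> ('g \<Rightarrow> 'a) \<Rightarrow> 'g rack_term \<Rightarrow> 'a" where
  "eval_term R g (Gen x) = g x"
| "eval_term R g (Mult s t) = mult R (eval_term R g s) (eval_term R g t)"
| "eval_term R g (Quot s t) = quot R (eval_term R g s) (eval_term R g t)"

lemma eval_term_in_carrier:
  assumes "rack R" "g ` X \<subseteq> carrier R"
  shows "s \<in> carrier (term_struct X) \<Longrightarrow> eval_term R g s \<in> carrier R"
proof -
  have closed: "mult R a b \<in> carrier R \<and> quot R a b \<in> carrier R"
    if "a \<in> carrier R" "b \<in> carrier R" for a b
    using assms(1) that unfolding rack_def by blast
  show "s \<in> carrier (term_struct X) \<Longrightarrow> eval_term R g s \<in> carrier R"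
    using assms(2) by (induction s) (auto simp: closed)
qed

lemma eval_term_power:
  "eval_term R g (rack_power (term_struct X) s m) = rack_power R (eval_term R g s) m"
  by (induction "term_struct X" s m rule: rack_power.induct)
     (simp_all, simp add: term_struct_def)

lemma eval_term_pres_eq:
  assumes R: "legendrian_rack n R" and g: "g ` X \<subseteq> carrier R"
    and rels: "\<And>s t. (s, t) \<in> Rels \<Longrightarrow> eval_term R g s = eval_term R g t"
  shows "pres_eq n X Rels s t \<Longrightarrow> eval_term R g s = eval_term R g t"
proof (induction rule: pres_eq.induct)
  case (legendrian s)
  then show ?case
    using R g eval_term_in_carrier[of R g X s] by (simp only: eval_term_power legendrian_rack_def)
next
  case (mult_distrib s t u)
  then have "eval_term R g s \<in> carrier R" "eval_term R g t \<in> carrier R"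
      "eval_term R g u \<in> carrier R"
    using R g eval_term_in_carrier[of R g X] by (auto simp: legendrian_rack_def)
  then show ?case
    using R unfolding legendrian_rack_def rack_def eval_term.simps by blast
next
  case (quot_distrib s t u)
  then have "eval_term R g s \<in> carrier R" "eval_term R g t \<in> carrier R"
      "eval_term R g u \<in> carrier R"
    using R g eval_term_in_carrier[of R g X] by (auto simp: legendrian_rack_def)
  then show ?case
    using R unfolding legendrian_rack_def rack_def eval_term.simps by blast
next
  case (quot_mult s t)
  then have "eval_term R g s \<in> carrier R" "eval_term R g t \<in> carrier R"
    using R g eval_term_in_carrier[of R g X] by (auto simp: legendrian_rack_def)
  then show ?case
    using R unfolding legendrian_rack_def rack_def eval_term.simps by blast
next
  case (mult_quot s t)
  then have "eval_term R g s \<in> carrier R" "eval_term R g t \<in> carrier R"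
    using R g eval_term_in_carrier[of R g X] by (auto simp: legendrian_rack_def)
  then show ?case
    using R unfolding legendrian_rack_def rack_def eval_term.simps by blast
qed (simp_all add: rels)

lemma presented_rack_universal:
  assumes R: "legendrian_rack n R" and g: "g ` X \<subseteq> carrier R"
    and rels: "\<And>s t. (s, t) \<in> Rels \<Longrightarrow> eval_term R g s = eval_term R g t"
  shows "\<exists>f. rack_hom (presented_rack n X Rels) R f \<and>
             (\<forall>x\<in>X. f (pres_class n X Rels (Gen x)) = g x)"
proof -
  define f where "f P = eval_term R g (SOME s. s \<in> P)" for P
  have f: "f (pres_class n X Rels s) = eval_term R g s"
    if "s \<in> carrier (term_struct X)" for s
  proof -
    have "pres_eq n X Rels s (SOME t. t \<in> pres_class n X Rels s)"
      using someI[of "\<lambda>t. t \<in> pres_class n X Rels s" s] pres_eq.refl[OF that]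
      by (simp add: pres_class_def)
    from eval_term_pres_eq[OF R g rels this] show ?thesis by (simp add: f_def)
  qed
  have "rack R" using R by (simp add: legendrian_rack_def)
  then show ?thesis
    by (intro exI[of _ f])
       (auto simp: rack_hom_def presented_rack_carrier presented_rack_mult presented_rack_quot f
          intro: eval_term_in_carrier[OF _ g])
qed

lemma presented_rack_unique:
  assumes "rack_hom (presented_rack n X Rels) R f" "rack_hom (presented_rack n X Rels) R f'"
    and "\<And>x. x \<in> X \<Longrightarrow> f (pres_class n X Rels (Gen x)) = f' (pres_class n X Rels (Gen x))"
    and "P \<in> carrier (presented_rack n X Rels)"
  shows "f P = f' P"
proof -
  have "f (pres_class n X Rels s) = f' (pres_class n X Rels s)"
    if "s \<in> carrier (term_struct X)" for s
    using that
  proof (induction s)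
    case (Mult s t)
    then show ?case
      using assms(1,2) by (simp add: rack_hom_def presented_rack_carrier
          presented_rack_mult[symmetric])
  next
    case (Quot s t)
    then show ?case
      using assms(1,2) by (simp add: rack_hom_def presented_rack_carrier
          presented_rack_quot[symmetric])
  qed (use assms(3) in simp)
  with assms(4) show ?thesis by (auto simp: presented_rack_carrier)
qed

section \<open>Smooth and Legendrian knots\<close>

primrec cont_diff ::
    "nat \<Rightarrow> ('a::real_normed_vector \<Rightarrow> 'b::real_normed_vector) \<Rightarrow> bool" where
  "cont_diff 0 f \<longleftrightarrow> continuous_on UNIV f"
| "cont_diff (Suc k) f \<longleftrightarrow>
     (\<forall>x. f differentiable (at x)) \<and> (\<forall>v. cont_diff k (\<lambda>x. frechet_derivative f (at x) v))"

definition smooth :: "('a::real_normed_vector \<Rightarrow> 'b::real_normed_vector) \<Rightarrow> bool" where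
  "smooth f \<longleftrightarrow> (\<forall>k. cont_diff k f)"

text \<open>An oriented knot is given by an orientation-compatible regular parametrization, i.e. a
  smooth embedding of the circle \<open>\<real>/\<int>\<close> into \<open>\<real>\<^sup>3\<close>, written as a 1-periodic map. The coordinates
  \<open>x, y, z\<close> are the components \<open>1, 2, 3\<close>.\<close>

definition velocity :: "(real \<Rightarrow> real^3) \<Rightarrow> real \<Rightarrow> real^3" where
  "velocity K t = vector_derivative K (at t)"

definition smooth_knot :: "(real \<Rightarrow> real^3) \<Rightarrow> bool" where
  "smooth_knot K \<longleftrightarrow> smooth K \<and> (\<forall>t. K (t + 1) = K t) \<and>
     inj_on K {0..<1} \<and> (\<forall>t. velocity K t \<noteq> 0)"

text \<open>The plane \<open>ker (dz - y dx)\<close> at the point \<open>p\<close>.\<close>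

definition xi_std :: "real^3 \<Rightarrow> (real^3) set" where
  "xi_std p = {v. v$3 - p$2 * v$1 = 0}"

definition legendrian_knot :: "(real \<Rightarrow> real^3) \<Rightarrow> bool" where
  "legendrian_knot K \<longleftrightarrow> smooth_knot K \<and> (\<forall>t. velocity K t \<in> xi_std (K t))"

text \<open>Smoothness is required on the whole plane only to avoid one-sided derivatives at the ends of
  the time interval; the knot condition is imposed for times in \<open>[0,1]\<close>. Changes of parametrization
  that preserve the orientation are isotopies in this sense.\<close>

definition isotopic_through ::
    "((real \<Rightarrow> real^3) \<Rightarrow> bool) \<Rightarrow> (real \<Rightarrow> real^3) \<Rightarrow> (real \<Rightarrow> real^3) \<Rightarrow> bool" where
  "isotopic_through P K0 K1 \<longleftrightarrow>
     (\<exists>H :: real \<Rightarrow> real \<Rightarrow> real^3.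
        smooth (\<lambda>(s, t). H s t) \<and> (\<forall>s\<in>{0..1}. P (H s)) \<and> H 0 = K0 \<and> H 1 = K1)"

definition legendrian_isotopic :: "(real \<Rightarrow> real^3) \<Rightarrow> (real \<Rightarrow> real^3) \<Rightarrow> bool" where
  "legendrian_isotopic = isotopic_through legendrian_knot"

text \<open>Topological isotopy means smooth isotopy of knots, disregarding the contact structure. An
  isotopy through merely continuous embeddings would identify all tame knots.\<close>

definition topologically_isotopic :: "(real \<Rightarrow> real^3) \<Rightarrow> (real \<Rightarrow> real^3) \<Rightarrow> bool" where
  "topologically_isotopic = isotopic_through smooth_knot"

definition unknot :: "real \<Rightarrow> real^3" where
  "unknot t = vector [cos (2 * pi * t), sin (2 * pi * t), 0]"

definition topologically_trivial :: "(real \<Rightarrow> real^3) \<Rightarrow> bool" where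
  "topologically_trivial K \<longleftrightarrow> topologically_isotopic K unknot"

section \<open>Front projections\<close>

definition front :: "(real \<Rightarrow> real^3) \<Rightarrow> real \<Rightarrow> real^2" where
  "front K t = vector [K t $ 1, K t $ 3]"

text \<open>The determinant of the front velocities at the parameters \<open>s\<close> and \<open>t\<close>, in the
  \<open>xz\<close>-plane with \<open>x\<close> pointing right and \<open>z\<close> pointing up.\<close>

definition front_det :: "(real \<Rightarrow> real^3) \<Rightarrow> real \<Rightarrow> real \<Rightarrow> real" where
  "front_det K s t =
     velocity K s $ 1 * velocity K t $ 3 - velocity K s $ 3 * velocity K t $ 1"

definition cusps :: "(real \<Rightarrow> real^3) \<Rightarrow> real set" where
  "cusps K = {t\<in>{0..<1}. velocity K t $ 1 = 0}"

text \<open>A crossing is recorded as the pair of the parameter of its over-branch and the parameter of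
  its under-branch. For a Legendrian curve \<open>K t $ 2\<close> is the slope \<open>dz/dx\<close> of the front, and the
  branch with smaller slope is the over-branch.\<close>

definition crossings :: "(real \<Rightarrow> real^3) \<Rightarrow> (real \<times> real) set" where
  "crossings K =
     {(p, q). p \<in> {0..<1} \<and> q \<in> {0..<1} \<and> front K p = front K q \<and> K p $ 2 < K q $ 2}"

text \<open>At a zero of \<open>x'\<close> the Legendrian condition also gives \<open>z' = 0\<close>, so the front is never
  vertical; \<open>x'' \<noteq> 0\<close> says that every singular point of the front is an ordinary (semicubical) cusp.
  Transversality of the double points excludes cusps on other branches.\<close>

definition generic_front :: "(real \<Rightarrow> real^3) \<Rightarrow> bool" where
  "generic_front K \<longleftrightarrow>
     finite (cusps K) \<and>
     (\<forall>t\<in>cusps K. vector_derivative (velocity K) (at t) $ 1 \<noteq> 0) \<and>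
     finite (crossings K) \<and>
     (\<forall>s\<in>{0..<1}. \<forall>t\<in>{0..<1}. s \<noteq> t \<and> front K s = front K t \<longrightarrow> front_det K s t \<noteq> 0) \<and>
     (\<forall>r\<in>{0..<1}. \<forall>s\<in>{0..<1}. \<forall>t\<in>{0..<1}.
        front K r = front K s \<and> front K s = front K t \<longrightarrow> r = s \<or> s = t \<or> r = t)"

text \<open>A front projection of \<open>L\<close> is represented by the Legendrian curve \<open>D\<close> that projects to it.\<close>

definition front_projection_of :: "(real \<Rightarrow> real^3) \<Rightarrow> (real \<Rightarrow> real^3) \<Rightarrow> bool" where
  "front_projection_of L D \<longleftrightarrow> legendrian_isotopic L D \<and> generic_front D"

text \<open>A crossing is positive if its over-branch turns counterclockwise to the under-branch.\<close>

definition crossing_sign :: "(real \<Rightarrow> real^3) \<Rightarrow> real \<times> real \<Rightarrow> real" where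
  "crossing_sign D = (\<lambda>(p, q). sgn (front_det D p q))"

definition writhe :: "(real \<Rightarrow> real^3) \<Rightarrow> real" where
  "writhe D = (\<Sum>c\<in>crossings D. crossing_sign D c)"

definition tb_front :: "(real \<Rightarrow> real^3) \<Rightarrow> real" where
  "tb_front D = writhe D - real (card (cusps D)) / 2"

text \<open>The number below does not depend on the front, so that the description is proper.\<close>

definition tb :: "(real \<Rightarrow> real^3) \<Rightarrow> real" where
  "tb L = (THE k. \<exists>D. front_projection_of L D \<and> k = tb_front D)"

section \<open>The rack of a front\<close>

text \<open>Strands are realized as arcs of the space curve above the segments of the diagram: unlike in
  the plane, the over- and under-branch of a crossing are disjoint there, so that strands are
  the connected components left after removing the under-crossing points and the cusps.\<close>

definition breaks :: "(real \<Rightarrow> real^3) \<Rightarrow> real set" where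
  "breaks D = cusps D \<union> snd ` crossings D"

definition strands :: "(real \<Rightarrow> real^3) \<Rightarrow> (real^3) set set" where
  "strands D = components (range D - D ` breaks D)"

definition strand_into :: "(real \<Rightarrow> real^3) \<Rightarrow> real \<Rightarrow> (real^3) set \<Rightarrow> bool" where
  "strand_into D t S \<longleftrightarrow> S \<in> strands D \<and> (\<exists>e>0. D ` {t - e<..<t} \<subseteq> S)"

definition strand_out_of :: "(real \<Rightarrow> real^3) \<Rightarrow> real \<Rightarrow> (real^3) set \<Rightarrow> bool" where
  "strand_out_of D t S \<longleftrightarrow> S \<in> strands D \<and> (\<exists>e>0. D ` {t<..<t + e} \<subseteq> S)"

definition positive_crossing_relations ::
    "(real \<Rightarrow> real^3) \<Rightarrow> ((real^3) set rack_term \<times> (real^3) set rack_term) set" where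
  "positive_crossing_relations D =
     {(Gen x', Mult (Gen x) (Gen y)) | x x' y. \<exists>(p, q)\<in>crossings D.
        crossing_sign D (p, q) = 1 \<and> y \<in> strands D \<and> D p \<in> y \<and>
        strand_into D q x \<and> strand_out_of D q x'}"

definition negative_crossing_relations ::
    "(real \<Rightarrow> real^3) \<Rightarrow> ((real^3) set rack_term \<times> (real^3) set rack_term) set" where
  "negative_crossing_relations D =
     {(Gen x', Quot (Gen x) (Gen y)) | x x' y. \<exists>(p, q)\<in>crossings D.
        crossing_sign D (p, q) = -1 \<and> y \<in> strands D \<and> D p \<in> y \<and>
        strand_into D q x \<and> strand_out_of D q x'}"

definition cusp_relations ::
    "nat \<Rightarrow> (real \<Rightarrow> real^3) \<Rightarrow> ((real^3) set rack_term \<times> (real^3) set rack_term) set" where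
  "cusp_relations n D =
     {(Gen b, rack_power (term_struct (strands D)) (Gen a) (n + 1)) | a b.
        \<exists>c\<in>cusps D. strand_into D c a \<and> strand_out_of D c b}"

definition LR :: "nat \<Rightarrow> (real \<Rightarrow> real^3) \<Rightarrow> (real^3) set rack_term set rack_struct" where
  "LR n D = presented_rack n (strands D)
     (positive_crossing_relations D \<union> negative_crossing_relations D \<union> cusp_relations n D)"

end

theory Submission
  imports Defs
begin

text \<open>Each strand arises from its predecessor along the front by \<open>x * y\<close>,
  \<open>x / y\<close> or \<open>x\<^sup>n\<^sup>+\<^sup>1\<close>, and the right translations by the strands define a flat principal bundle on
  the complement of the knot: a loop around the knot has the colour of a strand, or its inverse on
  parts running to the left, as monodromy. The complement of an unknot is homeomorphic to that of a
  round circle, where all flat bundles have cyclic monodromy; so all right translations of the rack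
  agree with one map \<open>\<sigma>\<close>. The presentation then reduces to the powers of \<open>\<sigma>\<close> met along the front,
  i.e. to the residue modulo \<open>2n + 1\<close> of the writhe plus \<open>n\<close> times the number of cusps. This residue
  is \<open>- n\<close> times twice the Thurston-Bennequin number of the front.

  That number does not depend on the front. For small \<open>\<epsilon> \<noteq> 0\<close> count, with signs, the pairs \<open>(t, t')\<close>
  such that the front at \<open>t'\<close> lies \<open>\<epsilon>\<close> above the front at \<open>t\<close> and has smaller slope. A crossing
  contributes its sign for both signs of \<open>\<epsilon>\<close>, a cusp contributes \<open>- 1\<close> for one sign of \<open>\<epsilon>\<close>, so the
  counts for \<open>\<epsilon>\<close> and \<open>- \<epsilon>\<close> add up to twice the Thurston-Bennequin number. The count is an integral over
  the pairs \<open>(t, t')\<close>, and it is constant under Legendrian isotopies because a pair with equal slopes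
  would be a chord in the direction of \<open>z\<close>, and the lengths of these are bounded from below.\<close>

section \<open>Smooth and Legendrian curves\<close>

text \<open>The curves in the middle of an isotopy can have arbitrarily degenerate fronts, so
  strands and crossings cannot be followed in time. This is why the topological input is only a
  homeomorphism of the space that matches the two curves, and why chords are counted by an integral
  that makes sense for every Legendrian curve. The integral is a mollified degree: the density is
  the Jacobian of the displacement \<open>(x t' - x t, z t' - z t)\<close> times a bump of mass 1
  near \<open>(0, \<epsilon>)\<close>, and it becomes a count only at generic fronts.

  From cyclic monodromy to a single \<open>\<sigma>\<close>: the colours lie in one common conjugate
  of a cyclic group, hence commute. A crossing conjugates the incoming colour by the colour of the
  over-strand, and a cusp passes to a power, which has the same right translation. So commuting
  colours do not change along the one closed curve.

  The passage from writhe and cusps to the Thurston-Bennequin number rests on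
  \<open>- 2 * n = 1\<close> modulo \<open>2 * n + 1\<close>. The resulting rack is the cyclic shift
  on as many elements as the gcd of \<open>2 * n + 1\<close> and the total exponent.\<close>

lemma smooth_differentiable: "smooth f \<Longrightarrow> f differentiable (at x)"
  unfolding smooth_def by (metis cont_diff.simps(2))

lemma smooth_frechet_derivative:
  "smooth f \<Longrightarrow> smooth (\<lambda>x. frechet_derivative f (at x) v)"
  unfolding smooth_def using cont_diff.simps(2) by blast

lemma smooth_continuous_on: "smooth f \<Longrightarrow> continuous_on S f"
  using smooth_def cont_diff.simps(1) continuous_on_subset by blast

lemma frechet_derivative_one:
  assumes "f differentiable (at t)"
  shows "frechet_derivative f (at t) 1 = vector_derivative f (at t)"
  using assms has_derivative_unique frechet_derivative_works vector_derivative_works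
  unfolding has_vector_derivative_def by (metis scaleR_one)

lemma smooth_velocity:
  assumes "smooth K"
  shows "smooth (velocity K)"
proof -
  have "velocity K = (\<lambda>t. frechet_derivative K (at t) 1)"
    using frechet_derivative_one[OF smooth_differentiable[OF assms]] by (auto simp: velocity_def)
  then show ?thesis
    using smooth_frechet_derivative[OF assms] by simp
qed

lemma smooth_has_vector_derivative:
  assumes "smooth f"
  shows "(f has_vector_derivative vector_derivative f (at t)) (at t)"
  using smooth_differentiable[OF assms] vector_derivative_works by blast

lemma periodic_int:
  fixes f :: "real \<Rightarrow> 'a"
  assumes "\<And>t. f (t + 1) = f t"
  shows "f (t + of_int k) = f t"
proof -
  have nat: "f (t + real m) = f t" for t m
  proof (induction m)
    case (Suc m)
    then show ?case using assms[of "t + real m"] by (simp add: algebra_simps)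
  qed simp
  show ?thesis
  proof (cases "k \<ge> 0")
    case True
    then show ?thesis using nat[of t "nat k"] by simp
  next
    case False
    then show ?thesis using nat[of "t + of_int k" "nat (- k)"] by simp
  qed
qed

lemma has_vector_derivative_component:
  fixes f :: "real \<Rightarrow> real^'n"
  assumes "(f has_vector_derivative v) (at t)"
  shows "((\<lambda>s. f s $ i) has_real_derivative v $ i) (at t)"
  using bounded_linear.has_vector_derivative[OF bounded_linear_vec_nth assms]
  by (simp add: has_real_derivative_iff_has_vector_derivative)

section \<open>Periodic parametrizations of knots and Legendrian curves\<close>

locale knot =
  fixes D :: "real \<Rightarrow> real^3"
  assumes knot: "smooth_knot D"
begin

abbreviation "V \<equiv> velocity D"

lemma smooth_D: "smooth D"
  using knot by (simp add: smooth_knot_def)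

lemma D_has_vector_derivative: "(D has_vector_derivative V t) (at t)"
  unfolding velocity_def by (rule smooth_has_vector_derivative[OF smooth_D])

lemma D_component_derivative: "((\<lambda>t. D t $ i) has_real_derivative V t $ i) (at t)"
  by (rule has_vector_derivative_component[OF D_has_vector_derivative])

lemma V_has_vector_derivative: "(V has_vector_derivative vector_derivative V (at t)) (at t)"
  by (rule smooth_has_vector_derivative[OF smooth_velocity[OF smooth_D]])

lemma V_component_derivative:
  "((\<lambda>t. V t $ i) has_real_derivative vector_derivative V (at t) $ i) (at t)"
  by (rule has_vector_derivative_component[OF V_has_vector_derivative])

lemma continuous_D: "continuous_on S D"
  by (rule smooth_continuous_on[OF smooth_D])

lemma continuous_V: "continuous_on S V"
  by (rule smooth_continuous_on[OF smooth_velocity[OF smooth_D]])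

lemma continuous_D_component: "continuous_on S (\<lambda>t. D t $ i)"
  by (intro continuous_intros continuous_D)

lemma continuous_V_component: "continuous_on S (\<lambda>t. V t $ i)"
  by (intro continuous_intros continuous_V)

lemma D_periodic: "D (t + 1) = D t"
  using knot by (simp add: smooth_knot_def)

lemma D_periodic_int: "D (t + of_int k) = D t"
  by (rule periodic_int) (rule D_periodic)

lemma V_periodic: "V (t + 1) = V t"
proof -
  have "((\<lambda>s. D (s + 1)) has_vector_derivative V (t + 1)) (at t)"
    using vector_diff_chain_at[of "\<lambda>s. s + 1" 1 t D "V (t + 1)"] D_has_vector_derivative[of "t + 1"]
      has_vector_derivative_add_const[of "\<lambda>s. s" 1 1 "at t"] has_vector_derivative_id[of "at t"]
    by (simp add: o_def)
  then show ?thesis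
    using D_has_vector_derivative[of t] by (simp add: D_periodic vector_derivative_unique_at)
qed

lemma V_periodic_int: "V (t + of_int k) = V t"
  by (rule periodic_int) (rule V_periodic)

lemma V_nonzero: "V t \<noteq> 0"
  using knot by (simp add: smooth_knot_def)

lemma D_frac: "D (frac t) = D t"
  using D_periodic_int[of "frac t" "\<lfloor>t\<rfloor>"] by (simp add: frac_def)

lemma V_frac: "V (frac t) = V t"
  using V_periodic_int[of "frac t" "\<lfloor>t\<rfloor>"] by (simp add: frac_def)

lemma D_eq_iff: "D s = D t \<longleftrightarrow> s - t \<in> \<int>"
proof
  assume "D s = D t"
  then have "D (frac s) = D (frac t)" by (simp add: D_frac)
  moreover have "frac s \<in> {0..<1}" "frac t \<in> {0..<1}"
    by (simp_all add: frac_lt_1)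
  ultimately have "frac s = frac t"
    using knot by (auto simp: smooth_knot_def inj_on_def)
  then show "s - t \<in> \<int>"
    by (metis Ints_of_int add_diff_cancel_left add_diff_cancel_right' diff_add_cancel frac_def
        of_int_diff add.commute diff_diff_eq2)
next
  assume "s - t \<in> \<int>"
  then obtain k where "s = t + of_int k"
    by (metis Ints_cases add.commute diff_add_cancel)
  then show "D s = D t" by (simp add: D_periodic_int)
qed

lemma D_eq_near:
  assumes "D s = D t" "\<bar>s - t\<bar> < 1"
  shows "s = t"
proof -
  obtain k :: int where k: "s - t = of_int k" using assms(1) by (auto simp: D_eq_iff Ints_def)
  with assms(2) have "\<bar>real_of_int k\<bar> < 1" by simp
  then have "k = 0" by linarith
  with k show ?thesis by simp
qed

end

locale legendrian = knot +
  assumes legendrian: "legendrian_knot D"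
begin

lemma V3: "V t $ 3 = D t $ 2 * V t $ 1"
  using legendrian by (simp add: legendrian_knot_def xi_std_def)

text \<open>The contact condition turns \<open>x' = 0\<close> into \<open>z' = 0\<close>, so
  regularity leaves only \<open>y'\<close>. Hence the slope is strictly monotone near a cusp, which
  later tells its two branches apart.\<close>

lemma V2_nonzero:
  assumes "V t $ 1 = 0"
  shows "V t $ 2 \<noteq> 0"
  using V_nonzero[of t] V3[of t] assms by (auto simp: vec_eq_iff forall_3)

text \<open>Cauchy's mean value theorem for the front. The product form survives zeros of
  \<open>x'\<close> between the end points.\<close>

lemma front_mean_value:
  assumes "a < b"
  obtains \<xi> where "a < \<xi>" "\<xi> < b"
    "(D b $ 3 - D a $ 3) * V \<xi> $ 1 = (D b $ 1 - D a $ 1) * (D \<xi> $ 2 * V \<xi> $ 1)"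
proof -
  have "\<exists>c. a < c \<and> c < b \<and> (D b $ 3 - D a $ 3) * V c $ 1 = (D b $ 1 - D a $ 1) * V c $ 3"
    using GMVT'[of a b "\<lambda>t. D t $ 3" "\<lambda>t. D t $ 1" "\<lambda>t. V t $ 1" "\<lambda>t. V t $ 3"]
      assms D_component_derivative DERIV_isCont by blast
  then show ?thesis
    using that V3 by metis
qed

end

section \<open>Isotopic knots have homeomorphic complements\<close>

lemma vector_derivative_bound:
  fixes f :: "real \<Rightarrow> 'a::real_normed_vector"
  assumes "\<And>t. t \<in> S \<Longrightarrow> (f has_vector_derivative f' t) (at t)" "convex S"
    and "\<And>t. t \<in> S \<Longrightarrow> norm (f' t) \<le> B" "x \<in> S" "y \<in> S"
  shows "norm (f x - f y) \<le> B * \<bar>x - y\<bar>"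
proof -
  have "norm (f x - f y) \<le> B * norm (x - y)"
  proof (rule differentiable_bound[OF assms(2) _ _ assms(4,5)])
    show "(f has_derivative (\<lambda>h. h *\<^sub>R f' t)) (at t within S)" if "t \<in> S" for t
      using assms(1)[OF that] has_derivative_at_withinI by (auto simp: has_vector_derivative_def)
    show "onorm (\<lambda>h. h *\<^sub>R f' t) \<le> B" if "t \<in> S" for t
      using assms(3)[OF that] by (intro onorm_le) (simp add: mult.commute[of B] mult_left_mono)
  qed
  then show ?thesis by simp
qed

text \<open>McShane's extension: the lower envelope of the cones \<open>f p + L * dist x p\<close>
  with vertices over \<open>C\<close>.\<close>

lemma lipschitz_extension_real:
  fixes f :: "'a::metric_space \<Rightarrow> real"
  assumes "C \<noteq> {}" "L \<ge> 0" and f: "\<And>x y. x \<in> C \<Longrightarrow> y \<in> C \<Longrightarrow> \<bar>f x - f y\<bar> \<le> L * dist x y"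
  obtains g where "\<And>x. x \<in> C \<Longrightarrow> g x = f x" "\<And>x y. \<bar>g x - g y\<bar> \<le> L * dist x y"
proof -
  define g where "g x = (INF p\<in>C. f p + L * dist x p)" for x
  obtain p0 where p0: "p0 \<in> C" using assms(1) by auto
  have tri: "L * dist a b \<le> L * dist a c + L * dist c b" for a b c :: 'a
    using mult_left_mono[OF dist_triangle[of a b c] assms(2)] by (simp add: distrib_left)
  have bdd: "bdd_below ((\<lambda>p. f p + L * dist x p) ` C)" for x
  proof (rule bdd_belowI2)
    fix p assume "p \<in> C"
    then show "f p0 - L * dist x p0 \<le> f p + L * dist x p"
      using f[OF p0 \<open>p \<in> C\<close>] tri[of p0 p x] by (simp add: dist_commute)
  qed
  have upper: "g x \<le> f p + L * dist x p" if "p \<in> C" for x p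
    unfolding g_def by (rule cINF_lower[OF bdd that])
  have eq: "g x = f x" if "x \<in> C" for x
  proof (rule antisym)
    show "g x \<le> f x" using upper[OF that, of x] by simp
    show "f x \<le> g x"
      unfolding g_def
    proof (rule cINF_greatest[OF assms(1)])
      fix p assume "p \<in> C"
      then show "f x \<le> f p + L * dist x p" using f[OF that \<open>p \<in> C\<close>] by simp
    qed
  qed
  have le: "g x - L * dist x y \<le> g y" for x y
    unfolding g_def[of y]
  proof (rule cINF_greatest[OF assms(1)])
    fix p assume "p \<in> C"
    then show "g x - L * dist x y \<le> f p + L * dist y p"
      using upper[OF \<open>p \<in> C\<close>, of x] tri[of x p y] by simp
  qed
  have "\<bar>g x - g y\<bar> \<le> L * dist x y" for x y
    using le[of x y] le[of y x] by (simp add: dist_commute)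
  with eq show ?thesis using that by blast
qed

text \<open>McShane's extension in each coordinate; bounding the norm by the sum of the coordinates
  costs the factor \<open>CARD('n)\<close>.\<close>

lemma lipschitz_extension_cart:
  fixes f :: "'a::metric_space \<Rightarrow> real^'n"
  assumes "C \<noteq> {}" "(L::real) \<ge> 0" and f: "\<And>x y. x \<in> C \<Longrightarrow> y \<in> C \<Longrightarrow> norm (f x - f y) \<le> L * dist x y"
  obtains g where "\<And>x. x \<in> C \<Longrightarrow> g x = f x" "\<And>x y. norm (g x - g y) \<le> real CARD('n) * L * dist x y"
proof -
  have "\<exists>h. (\<forall>x\<in>C. h x = f x $ i) \<and> (\<forall>x y. \<bar>h x - h y\<bar> \<le> L * dist x y)" for i
  proof -
    have "\<bar>f x $ i - f y $ i\<bar> \<le> L * dist x y" if "x \<in> C" "y \<in> C" for x y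
      using f[OF that] component_le_norm_cart[of "f x - f y" i] by simp
    then show ?thesis
      by (rule lipschitz_extension_real[OF assms(1,2), of "\<lambda>x. f x $ i"]) blast+
  qed
  then obtain h where h: "\<And>i x. x \<in> C \<Longrightarrow> h i x = f x $ i" "\<And>i x y. \<bar>h i x - h i y\<bar> \<le> L * dist x y"
    by metis
  define g where "g x = (\<chi> i. h i x)" for x
  have "norm (g x - g y) \<le> real CARD('n) * L * dist x y" for x y
  proof -
    have "norm (g x - g y) \<le> (\<Sum>i\<in>UNIV. \<bar>(g x - g y) $ i\<bar>)" by (rule norm_le_l1_cart)
    also have "\<dots> \<le> (\<Sum>i\<in>(UNIV::'n set). L * dist x y)"
      by (intro sum_mono) (simp add: g_def h(2))
    finally show ?thesis by simp
  qed
  moreover have "g x = f x" if "x \<in> C" for x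
    using that by (simp add: g_def h(1) vec_eq_iff)
  ultimately show ?thesis using that by blast
qed

text \<open>Distances shrink at most by the factor \<open>1 - c\<close>, which gives injectivity and
  a Lipschitz inverse. Surjectivity is Banach's fixed point theorem for the map
  \<open>y - u x\<close>.\<close>

lemma homeomorphism_add_contraction:
  fixes u :: "'a::banach \<Rightarrow> 'a"
  assumes "0 \<le> c" "c < 1" and u: "\<And>x y. norm (u x - u y) \<le> c * dist x y"
  obtains h where "homeomorphism UNIV UNIV (\<lambda>x. x + u x) h"
proof -
  let ?f = "\<lambda>x. x + u x"
  have lower: "(1 - c) * dist x y \<le> dist (?f x) (?f y)" for x y
  proof -
    have "norm (x - y) \<le> norm (?f x - ?f y) + norm (u y - u x)"
      using norm_triangle_ineq[of "?f x - ?f y" "u y - u x"] by simp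
    then show ?thesis
      using u[of y x] by (simp add: dist_norm norm_minus_commute algebra_simps)
  qed
  have "inj ?f"
  proof (rule injI)
    fix x y assume "?f x = ?f y"
    then have "(1 - c) * dist x y \<le> 0" using lower[of x y] by simp
    then show "x = y" using assms(2) by (simp add: mult_le_0_iff)
  qed
  moreover have "surj ?f"
  proof (rule surjI)
    fix y
    have "\<exists>!x. y - u x = x"
    proof (rule banach_fix_type[OF assms(1,2)])
      show "\<forall>x z. dist (y - u x) (y - u z) \<le> c * dist x z"
        using u by (simp add: dist_norm norm_minus_commute)
    qed
    then have "\<exists>x. ?f x = y" by (auto simp: algebra_simps)
    then show "?f (SOME x. ?f x = y) = y" by (rule someI_ex)
  qed
  ultimately have "bij ?f" by (rule bijI)
  define h where "h = inv ?f"
  have h: "?f (h y) = y" "h (?f x) = x" for x y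
    using surj_f_inv_f[OF bij_is_surj[OF \<open>bij ?f\<close>]] inv_f_f[OF bij_is_inj[OF \<open>bij ?f\<close>]]
    unfolding h_def by blast+
  have "(1 / (1 - c))-lipschitz_on UNIV h"
  proof (rule lipschitz_onI)
    fix x y
    show "dist (h x) (h y) \<le> 1 / (1 - c) * dist x y"
      using lower[of "h x" "h y"] assms(2) unfolding h(1) by (simp add: field_simps)
  qed (use assms in auto)
  moreover have "c-lipschitz_on UNIV u"
    by (rule lipschitz_onI) (use u assms in \<open>auto simp: dist_norm\<close>)
  ultimately have "homeomorphism UNIV UNIV ?f h"
    using h by (intro homeomorphismI continuous_intros) (auto intro: lipschitz_on_continuous_on)
  then show ?thesis by (rule that)
qed

text \<open>Near the diagonal the velocity, bounded away from 0, dominates; farther away injectivity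
  and compactness give a positive chord length. The range is half a period because the curve closes
  up at parameter distance 1.\<close>

lemma (in knot) bilipschitz:
  obtains c where "c > 0" "\<And>s t. \<bar>s - t\<bar> \<le> 1/2 \<Longrightarrow> c * \<bar>s - t\<bar> \<le> norm (D s - D t)"
proof -
  obtain m where m: "m > 0" "\<And>t. t \<in> {0..1} \<Longrightarrow> m \<le> norm (V t)"
  proof -
    have "continuous_on {0..1::real} (\<lambda>t. norm (V t))" by (intro continuous_intros continuous_V)
    then obtain t0 where "\<forall>t\<in>{0..1}. norm (V t0) \<le> norm (V t)"
      using continuous_attains_inf[of "{0..1::real}" "\<lambda>t. norm (V t)"] by auto
    then show ?thesis using that[of "norm (V t0)"] V_nonzero by auto
  qed
  have "uniformly_continuous_on {-1..2} V"
    by (intro compact_uniformly_continuous continuous_V) auto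
  then obtain \<eta> where \<eta>: "\<eta> > 0" "\<And>s t. s \<in> {-1..2} \<Longrightarrow> t \<in> {-1..2} \<Longrightarrow> dist s t < \<eta> \<Longrightarrow> dist (V s) (V t) < m / 2"
    using m(1) unfolding uniformly_continuous_on_def by (metis half_gt_zero)
  have near: "m / 2 * \<bar>s - t\<bar> \<le> norm (D s - D t)" if "t \<in> {0..1}" "\<bar>s - t\<bar> \<le> 1/2" "\<bar>s - t\<bar> < \<eta>" for s t
  proof -
    \<comment> \<open>Subtracting the uniform motion with velocity \<open>V t\<close> leaves a curve
      of speed at most \<open>m / 2\<close> on the segment.\<close>
    let ?g = "\<lambda>r. D r - r *\<^sub>R V t"
    have "norm (?g s - ?g t) \<le> m / 2 * \<bar>s - t\<bar>"
    proof (rule vector_derivative_bound[where S = "closed_segment s t" and f' = "\<lambda>r. V r - V t"])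
      fix r assume r: "r \<in> closed_segment s t"
      then have "\<bar>r - t\<bar> \<le> \<bar>s - t\<bar>" by (auto simp: closed_segment_eq_real_ivl split: if_splits)
      then have "\<bar>r - t\<bar> \<le> 1/2" "\<bar>r - t\<bar> < \<eta>" using that by auto
      moreover from this(1) have "r \<in> {-1..2}" using that(1) unfolding abs_le_iff atLeastAtMost_iff by linarith
      ultimately show "norm (V r - V t) \<le> m / 2"
        using \<eta>(2)[of r t] that(1) by (auto simp: dist_norm)
      show "((\<lambda>r. D r - r *\<^sub>R V t) has_vector_derivative V r - V t) (at r)"
        by (auto intro!: derivative_eq_intros D_has_vector_derivative)
    qed auto
    moreover have "m * \<bar>s - t\<bar> \<le> norm ((s - t) *\<^sub>R V t)"
      using m(2)[OF that(1)] by (simp add: mult.commute[of m] mult_left_mono)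
    moreover have "norm ((s - t) *\<^sub>R V t) \<le> norm (D s - D t) + norm (?g s - ?g t)"
      using norm_triangle_ineq4[of "D s - D t" "?g s - ?g t"] by (simp add: scaleR_diff_left algebra_simps)
    ultimately show ?thesis by simp
  qed
  let ?C = "{p::real\<times>real. fst p \<in> {0..1} \<and> \<eta> \<le> \<bar>snd p\<bar> \<and> \<bar>snd p\<bar> \<le> (1/2::real)}"
  have "compact ?C"
  proof -
    have C: "?C = ({0..1} \<times> {-1/2..1/2}) \<inter> {p. \<eta> \<le> \<bar>snd p\<bar>}" by auto
    have "closed {p::real\<times>real. \<eta> \<le> \<bar>snd p\<bar>}"
      by (intro closed_Collect_le continuous_intros)
    then show ?thesis unfolding C by (intro compact_Int_closed compact_Times) auto
  qed
  obtain k where k: "k > 0" "\<And>t h. (t, h) \<in> ?C \<Longrightarrow> k \<le> norm (D (t + h) - D t)"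
  proof (cases "?C = {}")
    case False
    have cont: "continuous_on ?C (\<lambda>p. norm (D (fst p + snd p) - D (fst p)))"
      by (intro continuous_intros continuous_on_compose2[OF continuous_D[of UNIV]]) auto
    obtain p where p: "p \<in> ?C" "\<forall>q\<in>?C. norm (D (fst p + snd p) - D (fst p)) \<le> norm (D (fst q + snd q) - D (fst q))"
      using continuous_attains_inf[OF \<open>compact ?C\<close> False cont] by auto
    have "D (fst p + snd p) \<noteq> D (fst p)"
      using D_eq_near[of "fst p + snd p" "fst p"] p(1) \<eta>(1) by auto
    then show ?thesis using that[of "norm (D (fst p + snd p) - D (fst p))"] p by force
  qed (use that[of 1] in auto)
  define c where "c = min (m / 2) k"
  have "c * \<bar>s - t\<bar> \<le> norm (D s - D t)" if st: "\<bar>s - t\<bar> \<le> 1/2" for s t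
  proof -
    define n where "n = \<lfloor>t\<rfloor>"
    have D: "D s = D (s - of_int n)" "D t = D (t - of_int n)"
      using D_periodic_int[of "s - of_int n" n] D_periodic_int[of "t - of_int n" n] by auto
    have t: "t - of_int n \<in> {0..1}" unfolding n_def by (auto intro: less_imp_le simp: le_floor_iff) linarith
    show ?thesis
    proof (cases "\<bar>s - t\<bar> < \<eta>")
      case True
      then have "m / 2 * \<bar>s - t\<bar> \<le> norm (D s - D t)"
        using near[OF t, of "s - of_int n"] st unfolding D by simp
      then show ?thesis
        using mult_right_mono[of c "m / 2" "\<bar>s - t\<bar>"] unfolding c_def by linarith
    next
      case False
      then have "k \<le> norm (D s - D t)"
        using k(2)[of "t - of_int n" "s - t"] t st unfolding D by (simp add: algebra_simps)
      moreover have "c * \<bar>s - t\<bar> \<le> k * 1"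
        using st k(1) m(1) by (intro mult_mono) (auto simp: c_def)
      ultimately show ?thesis by simp
    qed
  qed
  then show ?thesis using that[of c] m(1) k(1) by (auto simp: c_def)
qed

section \<open>Ambient homeomorphisms along an isotopy\<close>

locale knot_isotopy =
  fixes H :: "real \<Rightarrow> real \<Rightarrow> real^3"
  assumes smooth_H: "smooth (\<lambda>(s, t). H s t)"
    and knot_H: "\<And>s. s \<in> {0..1} \<Longrightarrow> smooth_knot (H s)"
begin

lemma continuous_H: "continuous_on S (\<lambda>p. H (fst p) (snd p))"
  using smooth_continuous_on[OF smooth_H] by (simp add: case_prod_beta')

text \<open>Expresses the velocity at a fixed time as a partial derivative of the joint map, so that
  it is continuous in both variables.\<close>

lemma velocity_H_frechet:
  "velocity (H s) t = frechet_derivative (\<lambda>(s, t). H s t) (at (s, t)) (0, 1)"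
proof -
  let ?F = "frechet_derivative (\<lambda>(s, t). H s t) (at (s, t))"
  have F: "((\<lambda>(s, t). H s t) has_derivative ?F) (at (s, t))"
    using smooth_differentiable[OF smooth_H] frechet_derivative_works by blast
  have "((\<lambda>t. (s, t)) has_derivative (\<lambda>h. (0, h))) (at t)"
    by (auto intro!: derivative_eq_intros)
  from has_derivative_compose[OF this F]
  have "(H s has_derivative (\<lambda>h. ?F (0, h))) (at t)" by simp
  moreover have "(\<lambda>h. ?F (0, h)) = (\<lambda>h. h *\<^sub>R ?F (0, 1))"
  proof
    show "?F (0, h) = h *\<^sub>R ?F (0, 1)" for h
      using linear_cmul[OF has_derivative_linear[OF F], of h "(0, 1)"] by simp
  qed
  ultimately have "(H s has_vector_derivative ?F (0, 1)) (at t)"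
    unfolding has_vector_derivative_def by (rule HOL.subst[rotated])
  then show ?thesis
    by (simp add: velocity_def vector_derivative_at)
qed

lemma continuous_velocity_H: "continuous_on S (\<lambda>p. velocity (H (fst p)) (snd p))"
  unfolding velocity_H_frechet
  using smooth_continuous_on[OF smooth_frechet_derivative[OF smooth_H]] by simp

text \<open>Uniform continuity on a compact square of times and parameters; periodicity carries the
  bound to all parameters.\<close>

lemma uniformly_close_time:
  fixes f :: "real \<Rightarrow> real \<Rightarrow> 'a::metric_space"
  assumes cont: "continuous_on UNIV (\<lambda>p. f (fst p) (snd p))"
    and per: "\<And>s t. s \<in> {0..1} \<Longrightarrow> f s (t + 1) = f s t"
    and e: "e > 0"
  obtains d where "d > 0" "\<And>s s' t. s \<in> {0..1} \<Longrightarrow> s' \<in> {0..1} \<Longrightarrow> \<bar>s - s'\<bar> < d \<Longrightarrow> dist (f s t) (f s' t) < e"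
proof -
  have "uniformly_continuous_on ({0..1} \<times> {0..1}) (\<lambda>p. f (fst p) (snd p))"
    by (intro compact_uniformly_continuous compact_Times continuous_on_subset[OF cont]) auto
  then obtain d where d: "d > 0" "\<And>p q. p \<in> {0..1} \<times> {0..1} \<Longrightarrow> q \<in> {0..1} \<times> {0..1} \<Longrightarrow> dist q p < d \<Longrightarrow>
      dist (f (fst q) (snd q)) (f (fst p) (snd p)) < e"
    using e unfolding uniformly_continuous_on_def by metis
  have "dist (f s t) (f s' t) < e" if "s \<in> {0..1}" "s' \<in> {0..1}" "\<bar>s - s'\<bar> < d" for s s' t
  proof -
    have fr: "f r (frac t) = f r t" if "r \<in> {0..1}" for r
      using periodic_int[of "f r" "frac t" "\<lfloor>t\<rfloor>"] per[OF that] by (simp add: frac_def)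
    have "frac t \<in> {0..1}" by (simp add: less_imp_le frac_lt_1)
    then show ?thesis
      using d(2)[of "(s', frac t)" "(s, frac t)"] that by (simp add: fr dist_Pair_Pair dist_real_def)
  qed
  with d(1) show ?thesis by (rule that)
qed

text \<open>Only images are matched, not parametrizations: the complement of the curve is what
  carries the bundle.\<close>

definition ambient_equivalent :: "real \<Rightarrow> real \<Rightarrow> bool" where
  "ambient_equivalent s s' \<longleftrightarrow> (\<exists>\<Phi> \<Psi>. homeomorphism UNIV UNIV \<Phi> \<Psi> \<and> \<Phi> ` range (H s) = range (H s'))"

text \<open>The displacement of a point of the curve is a Lipschitz function of the point, with a small
  constant for close times. So it extends to a contraction of the space.\<close>

lemma ambient_equivalent_nearby:
  assumes s0: "s0 \<in> {0..1}"
  obtains d where "d > 0" "\<And>s. s \<in> {0..1} \<Longrightarrow> \<bar>s0 - s\<bar> < d \<Longrightarrow> ambient_equivalent s0 s"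
proof -
  interpret K: knot "H s0" by unfold_locales (rule knot_H[OF s0])
  obtain c where c: "c > 0" "\<And>s t. \<bar>s - t\<bar> \<le> 1/2 \<Longrightarrow> c * \<bar>s - t\<bar> \<le> norm (H s0 s - H s0 t)"
    using K.bilipschitz by blast
  \<comment> \<open>If the velocities differ by less than \<open>c / 4\<close>, the displacement is
    \<open>1/4\<close>-Lipschitz in the point of the curve. Extending three coordinates raises the
    constant to \<open>3/4 < 1\<close>.\<close>
  obtain d where d: "d > 0" "\<And>s s' t. s \<in> {0..1} \<Longrightarrow> s' \<in> {0..1} \<Longrightarrow> \<bar>s - s'\<bar> < d \<Longrightarrow>
      dist (velocity (H s) t) (velocity (H s') t) < c / 4"
  proof (rule uniformly_close_time[where f = "\<lambda>s. velocity (H s)" and e = "c / 4"])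
    show "velocity (H s) (t + 1) = velocity (H s) t" if "s \<in> {0..1}" for s t
      using knot.V_periodic[of "H s"] knot_H[OF that] by (simp add: knot_def)
  qed (use c continuous_velocity_H in auto)
  have "ambient_equivalent s0 s" if s: "s \<in> {0..1}" "\<bar>s0 - s\<bar> < d" for s
  proof -
    interpret K': knot "H s" by unfold_locales (rule knot_H[OF s(1)])
    define v where "v t = H s t - H s0 t" for t
    have v_per: "v (t + of_int k) = v t" for t k
      by (simp add: v_def K.D_periodic_int K'.D_periodic_int)
    have lip: "norm (v t - v t') \<le> c / 4 * \<bar>t - t'\<bar>" for t t'
    proof (rule vector_derivative_bound[of UNIV v "\<lambda>t. velocity (H s) t - velocity (H s0) t"])
      show "(v has_vector_derivative velocity (H s) t - velocity (H s0) t) (at t)" for t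
        unfolding v_def by (intro derivative_intros K.D_has_vector_derivative K'.D_has_vector_derivative)
      show "norm (velocity (H s) t - velocity (H s0) t) \<le> c / 4" for t
        using d(2)[OF s0 s(1) s(2), of t] by (simp add: dist_norm norm_minus_commute)
    qed auto
    have lip': "norm (v t - v t') \<le> 1 / 4 * dist (H s0 t) (H s0 t')" for t t'
    proof -
      \<comment> \<open>A translate of \<open>t'\<close> lies within half a period of
        \<open>t\<close>, where \<open>c\<close> bounds the chord from below.\<close>
      define k where "k = round (t - t')"
      have "\<bar>t - (t' + of_int k)\<bar> \<le> 1/2"
        using of_int_round_abs_le[of "t - t'"] by (simp add: k_def abs_minus_commute algebra_simps)
      from c(2)[OF this] lip[of t "t' + of_int k"] show ?thesis
        by (simp add: v_per K.D_periodic_int dist_norm)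
    qed
    \<comment> \<open>By \<open>lip'\<close> the displacement depends only on the point of the
      curve, so any parameter of \<open>p\<close> may be chosen.\<close>
    define w where "w p = v (SOME t. H s0 t = p)" for p
    have w: "w (H s0 t) = v t" for t
    proof -
      have "H s0 (SOME t'. H s0 t' = H s0 t) = H s0 t" by (rule someI) simp
      then show ?thesis using lip'[of "SOME t'. H s0 t' = H s0 t" t] by (simp add: w_def)
    qed
    obtain u where u: "\<And>x. x \<in> range (H s0) \<Longrightarrow> u x = w x" "\<And>x y. norm (u x - u y) \<le> real CARD(3) * (1/4) * dist x y"
      by (rule lipschitz_extension_cart[where C = "range (H s0)" and L = "1/4" and f = w]) (auto simp: w lip'[simplified])
    have "0 \<le> (3/4::real)" "(3/4::real) < 1" by auto
    moreover have "norm (u x - u y) \<le> 3/4 * dist x y" for x y using u(2)[of x y] by simp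
    ultimately obtain h where h: "homeomorphism UNIV UNIV (\<lambda>x. x + u x) h"
      by (rule homeomorphism_add_contraction)
    moreover have "(\<lambda>x. x + u x) ` range (H s0) = range (H s)"
      by (auto simp: image_image u(1) w v_def)
    ultimately show ?thesis unfolding ambient_equivalent_def by blast
  qed
  with d(1) show ?thesis by (rule that)
qed

lemma ambient_equivalent_all:
  assumes "a \<in> {0..1}" "b \<in> {0..1}"
  shows "ambient_equivalent a b"
proof (rule connected_equivalence_relation[OF _ assms])
  show "ambient_equivalent t s" if st: "ambient_equivalent s t" for s t
  proof -
    obtain \<Phi> \<Psi> where h: "homeomorphism UNIV UNIV \<Phi> \<Psi>" "\<Phi> ` range (H s) = range (H t)"
      using st unfolding ambient_equivalent_def by blast
    have "homeomorphism UNIV UNIV \<Psi> \<Phi>" using h(1) by (simp add: homeomorphism_symD)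
    moreover have "\<Psi> ` range (H t) = range (H s)"
      using h(1) unfolding h(2)[symmetric] by (simp add: image_image homeomorphism_def)
    ultimately show ?thesis unfolding ambient_equivalent_def by blast
  qed
  show "ambient_equivalent r t" if st: "ambient_equivalent r s" "ambient_equivalent s t" for r s t
  proof -
    obtain \<Phi> \<Psi> where h: "homeomorphism UNIV UNIV \<Phi> \<Psi>" "\<Phi> ` range (H r) = range (H s)"
      using st unfolding ambient_equivalent_def by blast
    obtain \<Phi>' \<Psi>' where h': "homeomorphism UNIV UNIV \<Phi>' \<Psi>'" "\<Phi>' ` range (H s) = range (H t)"
      using st unfolding ambient_equivalent_def by blast
    have "homeomorphism UNIV UNIV (\<Phi>' \<circ> \<Phi>) (\<Psi> \<circ> \<Psi>')"
      using homeomorphism_compose[OF h(1) h'(1)] .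
    moreover have "(\<Phi>' \<circ> \<Phi>) ` range (H r) = range (H t)"
      by (simp only: image_comp[symmetric] h(2) h'(2))
    ultimately show ?thesis unfolding ambient_equivalent_def by blast
  qed
  show "\<exists>T. openin (top_of_set {0..1}) T \<and> s \<in> T \<and> (\<forall>s'\<in>T. ambient_equivalent s s')" if s: "s \<in> {0..1}" for s
  proof -
    obtain d where d: "d > 0" "\<And>s'. s' \<in> {0..1} \<Longrightarrow> \<bar>s - s'\<bar> < d \<Longrightarrow> ambient_equivalent s s'"
      using ambient_equivalent_nearby[OF s] by blast
    then show ?thesis
      using s by (intro exI[of _ "{0..1} \<inter> ball s d"]) (auto simp: dist_real_def)
  qed
qed simp

end

lemma isotopic_homeomorphism:
  assumes "isotopic_through smooth_knot K0 K1"
  obtains \<Phi> \<Psi> where "homeomorphism UNIV UNIV \<Phi> \<Psi>" "\<Phi> ` range K0 = range K1"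
proof -
  obtain H :: "real \<Rightarrow> real \<Rightarrow> real^3" where
    H: "smooth (\<lambda>(s, t). H s t)" "\<forall>s\<in>{0..1}. smooth_knot (H s)" "H 0 = K0" "H 1 = K1"
    using assms unfolding isotopic_through_def by blast
  interpret knot_isotopy H using H by unfold_locales auto
  show ?thesis
    using ambient_equivalent_all[of 0 1] H that unfolding ambient_equivalent_def by auto
qed

lemma trivial_front_homeomorphism:
  assumes "topologically_trivial L" "legendrian_isotopic L D"
  obtains \<Phi> \<Psi> where "homeomorphism UNIV UNIV \<Phi> \<Psi>" "\<Phi> ` range D = range unknot"
proof -
  have "isotopic_through smooth_knot L D"
    using assms(2) unfolding legendrian_isotopic_def isotopic_through_def legendrian_knot_def by blast
  then obtain \<Phi> \<Psi> where h: "homeomorphism UNIV UNIV \<Phi> \<Psi>" "\<Phi> ` range L = range D"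
    by (rule isotopic_homeomorphism)
  obtain \<Phi>' \<Psi>' where h': "homeomorphism UNIV UNIV \<Phi>' \<Psi>'" "\<Phi>' ` range L = range unknot"
    using assms(1) isotopic_homeomorphism unfolding topologically_trivial_def topologically_isotopic_def by metis
  have "homeomorphism UNIV UNIV (\<Phi>' \<circ> \<Psi>) (\<Phi> \<circ> \<Psi>')"
    using homeomorphism_compose[OF homeomorphism_symD[OF h(1)] h'(1)] .
  moreover have "\<Psi> ` range D = range L"
    using h(1) unfolding h(2)[symmetric] by (simp add: image_image homeomorphism_def)
  then have "(\<Phi>' \<circ> \<Psi>) ` range D = range unknot"
    by (simp only: image_comp[symmetric] h'(2))
  ultimately show ?thesis by (rule that)
qed

section \<open>Local systems on the complement of a round circle\<close>

lemma eventually_nhds_compose: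
  assumes "continuous_on UNIV f" "\<forall>\<^sub>F y in nhds (f x). P y"
  shows "\<forall>\<^sub>F y in nhds x. P (f y)"
proof -
  obtain U where U: "open U" "f x \<in> U" "\<forall>y\<in>U. P y"
    using assms(2) by (auto simp: eventually_nhds)
  then show ?thesis
    using open_vimage[OF U(1) assms(1)] by (auto simp: eventually_nhds intro!: exI[of _ "f -` U"])
qed

lemma locally_constant_imp_constant:
  assumes "connected W" "\<And>u. u \<in> W \<Longrightarrow> \<forall>\<^sub>F v in nhds u. v \<in> W \<longrightarrow> h v = h u"
    and "x \<in> W" "y \<in> W"
  shows "h x = h y"
proof -
  have "\<exists>T. openin (top_of_set W) T \<and> a \<in> T \<and> (\<forall>x\<in>T. h a = h x)" if a: "a \<in> W" for a
  proof -
    obtain U where U: "open U" "a \<in> U" "\<forall>v\<in>U. v \<in> W \<longrightarrow> h v = h a"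
      using assms(2)[OF a] by (auto simp: eventually_nhds)
    then show ?thesis
      using a openin_open_Int[OF U(1), of W] by (metis Int_iff)
  qed
  note nbhd = this
  show ?thesis
  proof (rule connected_equivalence_relation[OF assms(1,3,4), where R = "\<lambda>a b. h a = h b"])
    show "h b = h a" if "h a = h b" for a b using that by (rule HOL.sym)
    show "h a = h c" if "h a = h b" "h b = h c" for a b c using that by (rule HOL.trans)
  qed (rule nbhd)
qed

lemma minus_translate: "- (s + g) + (s + g') = - g + (g' :: 'g::group_add)"
  by (simp add: minus_add add.assoc del: add_uminus_conv_diff)

text \<open>\<open>S p\<close> is a section over a neighbourhood of \<open>p\<close> of a principal bundle with discrete structure
  group, written in a set-theoretic trivialization that need not be continuous. The sections are
  flat, so any two of them differ locally by a right translation.\<close>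

definition local_system :: "'a::topological_space set \<Rightarrow> ('a \<Rightarrow> 'a \<Rightarrow> 'g::group_add) \<Rightarrow> bool" where
  "local_system \<Omega> S \<longleftrightarrow> (\<forall>p\<in>\<Omega>. \<forall>\<^sub>F u in nhds p. \<exists>g. \<forall>\<^sub>F v in nhds u. S p v = S u v + g)"

text \<open>Continuity of \<open>f\<close> is not meaningful in the chosen trivialization; flatness
  is measured against the local sections instead.\<close>

definition flat_section ::
    "('a::topological_space \<Rightarrow> 'a \<Rightarrow> 'g::group_add) \<Rightarrow> 'a set \<Rightarrow> ('a \<Rightarrow> 'g) \<Rightarrow> bool" where
  "flat_section S W f \<longleftrightarrow> (\<forall>u\<in>W. \<exists>g. \<forall>\<^sub>F v in nhds u. f v = S u v + g)"

lemma flat_section_mono: "flat_section S W f \<Longrightarrow> W' \<subseteq> W \<Longrightarrow> flat_section S W' f"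
  by (auto simp: flat_section_def)

lemma flat_section_translate:
  assumes "flat_section S W f"
  shows "flat_section S W (\<lambda>v. f v + k)"
proof -
  have "\<exists>g'. \<forall>\<^sub>F v in nhds u. f v + k = S u v + g'" if "\<forall>\<^sub>F v in nhds u. f v = S u v + g" for u g
    using that by (intro exI[of _ "g + k"]) (auto elim!: eventually_mono simp: add.assoc)
  then show ?thesis
    using assms unfolding flat_section_def by blast
qed

lemma flat_section_cong:
  assumes "flat_section S W f" "open W" "\<And>v. v \<in> W \<Longrightarrow> f' v = f v"
  shows "flat_section S W f'"
  unfolding flat_section_def
proof
  fix u assume u: "u \<in> W"
  then obtain g where g: "\<forall>\<^sub>F v in nhds u. f v = S u v + g"
    using assms(1) by (auto simp: flat_section_def)
  have "\<forall>\<^sub>F v in nhds u. v \<in> W"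
    using assms(2) u by (rule eventually_nhds_in_open)
  with g have "\<forall>\<^sub>F v in nhds u. f' v = S u v + g"
    by eventually_elim (simp add: assms(3))
  then show "\<exists>g. \<forall>\<^sub>F v in nhds u. f' v = S u v + g" ..
qed

lemma flat_section_Un:
  "flat_section S A f \<Longrightarrow> flat_section S B f \<Longrightarrow> flat_section S (A \<union> B) f"
  by (auto simp: flat_section_def)

text \<open>Translations act on the right, so the trivialization \<open>S u v\<close> cancels in
  \<open>- f v + f' v\<close>, which is therefore locally constant.\<close>

lemma flat_section_diff_constant:
  assumes "flat_section S W f" "flat_section S W f'" "connected W" "x \<in> W" "y \<in> W"
  shows "- f x + f' x = - f y + f' y"
proof (rule locally_constant_imp_constant[OF assms(3) _ assms(4,5), where h = "\<lambda>v. - f v + f' v"])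
  fix u assume "u \<in> W"
  then obtain g g' where g: "\<forall>\<^sub>F v in nhds u. f v = S u v + g" and g': "\<forall>\<^sub>F v in nhds u. f' v = S u v + g'"
    using assms(1,2) unfolding flat_section_def by blast
  have "f u = S u u + g" "f' u = S u u + g'"
    using eventually_nhds_x_imp_x[OF g] eventually_nhds_x_imp_x[OF g'] by auto
  then have *: "- f u + f' u = - g + g'"
    by (simp add: minus_translate)
  from g g' show "\<forall>\<^sub>F v in nhds u. v \<in> W \<longrightarrow> - f v + f' v = - f u + f' u"
    unfolding * by eventually_elim (simp add: minus_translate)
qed

lemma flat_section_unique:
  assumes "flat_section S W f" "flat_section S W f'" "connected W" "x \<in> W" "y \<in> W" "f x = f' x"
  shows "f y = f' y"
proof -
  have "- f y + f' y = 0"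
    using flat_section_diff_constant[OF assms(1-5)] assms(6) by simp
  then show ?thesis by (simp add: neg_eq_iff_add_eq_0 eq_neg_iff_add_eq_0 add_eq_0_iff)
qed

text \<open>On a connected overlap the sections differ by a single constant \<open>k\<close>, and
  translating \<open>f'\<close> by it makes them agree.\<close>

lemma flat_section_glue:
  assumes "open A" "open B" "flat_section S A f" "flat_section S B f'" "connected (A \<inter> B)"
  obtains f'' where "flat_section S (A \<union> B) f''"
proof -
  obtain k where k: "\<And>v. v \<in> A \<inter> B \<Longrightarrow> f v = f' v + k"
  proof (cases "A \<inter> B = {}")
    case False
    then obtain p where p: "p \<in> A \<inter> B" by auto
    have "f v = f' v + (- f' p + f p)" if "v \<in> A \<inter> B" for v
      using flat_section_diff_constant[of S "A \<inter> B" f' f v p] assms that p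
        flat_section_mono[of S A f "A \<inter> B"] flat_section_mono[of S B f' "A \<inter> B"]
      by (metis Int_lower1 Int_lower2 add_minus_cancel)
    then show ?thesis using that by blast
  qed (use that in auto)
  define f'' where "f'' v = (if v \<in> A then f v else f' v + k)" for v
  have "flat_section S A f''"
    using flat_section_cong[OF assms(3,1)] by (simp add: f''_def)
  moreover have "flat_section S B f''"
    by (rule flat_section_cong[OF flat_section_translate[OF assms(4), of k] assms(2)])
       (auto simp: f''_def k)
  ultimately show ?thesis
    using that flat_section_Un by blast
qed

lemma local_system_flat_nbhd:
  assumes "local_system \<Omega> S" "open \<Omega>" "p \<in> \<Omega>"
  obtains r where "r > 0" "ball p r \<subseteq> \<Omega>" "flat_section S (ball p r) (S p)"
proof -
  obtain N where N: "open N" "p \<in> N" "\<forall>u\<in>N. \<exists>g. \<forall>\<^sub>F v in nhds u. S p v = S u v + g"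
    using assms(1,3) unfolding local_system_def eventually_nhds by blast
  have "open (N \<inter> \<Omega>)" "p \<in> N \<inter> \<Omega>" using N assms by auto
  then obtain r where "r > 0" "ball p r \<subseteq> N \<inter> \<Omega>"
    by (meson open_contains_ball)
  then show ?thesis using N that[of r] by (auto simp: flat_section_def subset_iff)
qed

lemma convex_open_thickening:
  fixes A :: "'a::real_normed_vector set"
  assumes "convex A"
  shows "convex (\<Union>x\<in>A. ball x e)" "open (\<Union>x\<in>A. ball x e)"
proof -
  have "ball x e = (\<Union>y\<in>ball 0 e. {x + y})" for x :: 'a
    using image_add_ball[of x 0 e] by (simp only: UNION_singleton_eq_range) simp
  then have "(\<Union>x\<in>A. ball x e) = (\<Union>x\<in>A. \<Union>y\<in>ball 0 e. {x + y})"
    by (intro SUP_cong HOL.refl)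
  then show "convex (\<Union>x\<in>A. ball x e)"
    using convex_sums[OF assms convex_ball, of 0 e] by (rule HOL.ssubst)
qed auto

text \<open>Continuation along the segment. The domain is kept convex so that it meets the next ball
  in a connected set; after gluing, the union is shrunk to a convex tube around the longer
  segment.\<close>

lemma flat_section_tube:
  fixes S :: "'a::real_normed_vector \<Rightarrow> 'a \<Rightarrow> 'g::group_add"
  assumes S: "local_system \<Omega> S" "open \<Omega>" and seg: "closed_segment 0 v \<subseteq> \<Omega>"
  obtains W f where "open W" "convex W" "closed_segment 0 v \<subseteq> W" "W \<subseteq> \<Omega>" "flat_section S W f"
proof -
  define P where "P t \<longleftrightarrow> (\<exists>W f. open W \<and> convex W \<and> closed_segment 0 (t *\<^sub>R v) \<subseteq> W \<and> W \<subseteq> \<Omega> \<and>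
    flat_section S W f)" for t
  have seg_eq: "closed_segment 0 (t *\<^sub>R v) = (\<lambda>s. s *\<^sub>R v) ` {0..t}" if "t \<ge> 0" for t
  proof -
    have "(\<lambda>u. u *\<^sub>R t *\<^sub>R v) ` {0..1} = (\<lambda>s. s *\<^sub>R v) ` ((\<lambda>u. u * t) ` {0..1})"
      by (simp add: image_image)
    also have "(\<lambda>u. u * t) ` {0..1} = {0..t}"
      using image_mult_atLeastAtMost_if[of t 0 1] that by (simp add: mult.commute)
    finally show ?thesis
      by (simp add: closed_segment_image_interval)
  qed
  have inO: "s *\<^sub>R v \<in> \<Omega>" if "s \<in> {0..1}" for s
  proof -
    have "s *\<^sub>R v \<in> (\<lambda>s. s *\<^sub>R v) ` {0..1}" using that by (rule imageI)
    then have "s *\<^sub>R v \<in> closed_segment 0 v" using seg_eq[of 1] by simp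
    then show ?thesis using seg by blast
  qed
  have "P 1"
  proof (rule connected_induction_simple[of "{0..1::real}" 0 1 P])
    fix t0 :: real assume t0: "t0 \<in> {0..1}"
    then obtain \<rho> where \<rho>: "\<rho> > 0" "ball (t0 *\<^sub>R v) \<rho> \<subseteq> \<Omega>" "flat_section S (ball (t0 *\<^sub>R v) \<rho>) (S (t0 *\<^sub>R v))"
      using local_system_flat_nbhd[OF S inO] by blast
    \<comment> \<open>Points \<open>s *\<^sub>R v\<close> with \<open>s\<close> within
      \<open>e\<close> of \<open>t0\<close> stay in the ball; the summand 1 covers
      \<open>v = 0\<close>.\<close>
    define e where "e = \<rho> / (2 * (norm v + 1))"
    have e: "e > 0" "e * norm v < \<rho> / 2"
      using \<rho>(1) by (auto simp: e_def field_simps add_pos_nonneg)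
    have "P t'" if "P t" "t \<in> {0..1} \<inter> ball t0 e" "t' \<in> {0..1} \<inter> ball t0 e" for t t'
    proof -
      have t: "0 \<le> t" "0 \<le> t'" using that by auto
      from that(1)[unfolded P_def] obtain W f where W: "open W" "convex W"
        "closed_segment 0 (t *\<^sub>R v) \<subseteq> W" "W \<subseteq> \<Omega>" "flat_section S W f"
        by (elim exE conjE)
      show ?thesis
    proof (cases "t' \<le> t")
      case True
      then have "closed_segment 0 (t' *\<^sub>R v) \<subseteq> closed_segment 0 (t *\<^sub>R v)"
        unfolding seg_eq[OF t(1)] seg_eq[OF t(2)] by (intro image_mono) auto
      then have "closed_segment 0 (t' *\<^sub>R v) \<subseteq> W" using W(3) by blast
      then show ?thesis unfolding P_def by (intro exI[of _ W] exI[of _ f] conjI W)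
    next
      case False
      have "connected (W \<inter> ball (t0 *\<^sub>R v) \<rho>)"
        by (intro convex_connected convex_Int convex_ball W)
      then obtain f' where f': "flat_section S (W \<union> ball (t0 *\<^sub>R v) \<rho>) f'"
        using flat_section_glue[OF W(1) open_ball W(5) \<rho>(3)] by metis
      have sub: "closed_segment 0 (t' *\<^sub>R v) \<subseteq> W \<union> ball (t0 *\<^sub>R v) \<rho>"
      proof
        fix x assume "x \<in> closed_segment 0 (t' *\<^sub>R v)"
        then obtain s where s: "x = s *\<^sub>R v" "0 \<le> s" "s \<le> t'"
          unfolding seg_eq[OF t(2)] by (auto simp del: scaleR_cancel_right)
        show "x \<in> W \<union> ball (t0 *\<^sub>R v) \<rho>"
        proof (cases "s \<le> t")
          case True
          then have "x \<in> closed_segment 0 (t *\<^sub>R v)" unfolding seg_eq[OF t(1)] using s by auto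
          then show ?thesis using W(3) by blast
        next
          case F: False
          have "\<bar>t0 - s\<bar> < e" using F s that(2,3) by (auto simp: dist_real_def)
          then have "norm ((t0 - s) *\<^sub>R v) \<le> e * norm v" by (simp add: mult_right_mono)
          then show ?thesis using e \<rho>(1) s(1) by (auto simp: dist_norm scaleR_diff_left)
        qed
      qed
      \<comment> \<open>Compactness of the segment yields a thin convex open tube inside the glued
        domain.\<close>
      then obtain \<eta> where \<eta>: "\<eta> > 0" "(\<Union>x\<in>closed_segment 0 (t' *\<^sub>R v). ball x \<eta>) \<subseteq> W \<union> ball (t0 *\<^sub>R v) \<rho>"
        using compact_subset_open_imp_ball_epsilon_subset[of "closed_segment 0 (t' *\<^sub>R v)"] W(1)
        by (metis compact_segment open_Un open_ball)
      let ?W = "\<Union>x\<in>closed_segment 0 (t' *\<^sub>R v). ball x \<eta>"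
      have "closed_segment 0 (t' *\<^sub>R v) \<subseteq> ?W" using \<eta>(1) by auto
      moreover have "?W \<subseteq> \<Omega>" using \<eta>(2) W(4) \<rho>(2) by blast
      ultimately show ?thesis
        unfolding P_def
        by (intro exI[of _ ?W] exI[of _ f'] conjI convex_open_thickening convex_closed_segment
            flat_section_mono[OF f' \<eta>(2)])
    qed
    qed
    then show "\<exists>T. openin (top_of_set {0..1}) T \<and> t0 \<in> T \<and> (\<forall>x\<in>T. \<forall>y\<in>T. P x \<longrightarrow> P y)"
      using t0 e(1) by (intro exI[of _ "{0..1} \<inter> ball t0 e"]) auto
  next
    obtain \<rho> where "\<rho> > 0" "ball 0 \<rho> \<subseteq> \<Omega>" "flat_section S (ball 0 \<rho>) (S 0)"
      using local_system_flat_nbhd[OF S inO, of 0] by auto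
    then show "P 0"
      unfolding P_def by (intro exI[of _ "ball 0 \<rho>"] exI[of _ "S 0"]) auto
  qed auto
  then show ?thesis using that unfolding P_def by auto
qed

text \<open>Sections on tubes around the rays are normalized to 0 at the centre. Two tubes meet in a
  convex set containing the centre, so the normalized sections agree there and the values
  \<open>FF v v\<close> fit together.\<close>

lemma flat_section_starlike:
  fixes S :: "'a::real_normed_vector \<Rightarrow> 'a \<Rightarrow> 'g::group_add"
  assumes S: "local_system \<Omega> S" "open \<Omega>" and star: "\<And>v. v \<in> \<Omega> \<Longrightarrow> closed_segment 0 v \<subseteq> \<Omega>"
  obtains f where "flat_section S \<Omega> f"
proof -
  define Q where "Q v W F \<longleftrightarrow> open W \<and> convex W \<and> closed_segment 0 v \<subseteq> W \<and> flat_section S W F \<and> F 0 = 0"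
    for v W and F :: "'a \<Rightarrow> 'g"
  have "\<exists>W F. Q v W F" if v: "v \<in> \<Omega>" for v
  proof -
    obtain W F where W: "open W" "convex W" "closed_segment 0 v \<subseteq> W" "W \<subseteq> \<Omega>" "flat_section S W F"
      using flat_section_tube[OF S star[OF v]] .
    then show ?thesis
      using flat_section_translate[OF W(5), of "- F 0"] W
      unfolding Q_def by (intro exI[of _ W] exI[of _ "\<lambda>v. F v + - F 0"]) simp
  qed
  then have "\<forall>v\<in>\<Omega>. \<exists>p. Q v (fst p) (snd p)" by simp
  from bchoice[OF this] obtain p where "\<forall>v\<in>\<Omega>. Q v (fst (p v)) (snd (p v))" ..
  moreover define WW FF where "WW v = fst (p v)" and "FF v = snd (p v)" for v
  ultimately have Q: "Q v (WW v) (FF v)" if "v \<in> \<Omega>" for v using that by (simp add: WW_def FF_def)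
  have agree: "FF v v = FF v0 v" if v: "v \<in> \<Omega>" and v0: "v0 \<in> \<Omega>" and vW: "v \<in> WW v0" for v v0
  proof -
    have "flat_section S (WW v \<inter> WW v0) (FF v)" "flat_section S (WW v \<inter> WW v0) (FF v0)"
      using Q[OF v] Q[OF v0] flat_section_mono unfolding Q_def by (metis Int_lower1, metis Int_lower2)
    moreover have "connected (WW v \<inter> WW v0)"
      using Q[OF v] Q[OF v0] unfolding Q_def by (simp add: convex_Int convex_connected)
    moreover have "0 \<in> WW v \<inter> WW v0" "v \<in> WW v \<inter> WW v0" "FF v 0 = FF v0 0"
      using Q[OF v] Q[OF v0] vW unfolding Q_def by auto
    ultimately show ?thesis by (rule flat_section_unique)
  qed
  have "\<exists>g. \<forall>\<^sub>F v in nhds u. FF v v = S u v + g" if u: "u \<in> \<Omega>" for u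
  proof -
    have "u \<in> WW u" "open (WW u)" "flat_section S (WW u) (FF u)" using Q[OF u] by (auto simp: Q_def)
    then obtain g where g: "\<forall>\<^sub>F v in nhds u. FF u v = S u v + g"
      unfolding flat_section_def by blast
    have "\<forall>\<^sub>F v in nhds u. v \<in> WW u \<inter> \<Omega>"
      using \<open>u \<in> WW u\<close> \<open>open (WW u)\<close> u S(2) by (intro eventually_nhds_in_open) auto
    with g have "\<forall>\<^sub>F v in nhds u. FF v v = S u v + g"
      by eventually_elim (use u agree in auto)
    then show ?thesis ..
  qed
  then show ?thesis using that[of "\<lambda>v. FF v v"] by (auto simp: flat_section_def)
qed

section \<open>Cyclic groups and the complement of the circle\<close>

inductive_set cyclic_subgroup :: "'g::group_add \<Rightarrow> 'g set" for g where
  zero: "0 \<in> cyclic_subgroup g"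
| add: "x \<in> cyclic_subgroup g \<Longrightarrow> g + x \<in> cyclic_subgroup g"
| sub: "x \<in> cyclic_subgroup g \<Longrightarrow> - g + x \<in> cyclic_subgroup g"

lemma cyclic_subgroup_gen: "g \<in> cyclic_subgroup g" "- g \<in> cyclic_subgroup g"
  using cyclic_subgroup.add[OF cyclic_subgroup.zero, of g] cyclic_subgroup.sub[OF cyclic_subgroup.zero, of g]
  by auto

lemma cyclic_subgroup_add:
  "x \<in> cyclic_subgroup g \<Longrightarrow> y \<in> cyclic_subgroup g \<Longrightarrow> x + y \<in> cyclic_subgroup g"
  by (induction rule: cyclic_subgroup.induct) (auto simp: add.assoc intro: cyclic_subgroup.intros)

lemma cyclic_subgroup_commute_gen: "x \<in> cyclic_subgroup g \<Longrightarrow> x + g = g + x"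
proof (induction rule: cyclic_subgroup.induct)
  case (sub x)
  then show ?case by (metis add.assoc add.right_neutral left_minus minus_add_cancel add_minus_cancel)
qed (simp_all add: add.assoc)

lemma cyclic_subgroup_commute:
  "x \<in> cyclic_subgroup g \<Longrightarrow> y \<in> cyclic_subgroup g \<Longrightarrow> x + y = y + x"
proof (induction rule: cyclic_subgroup.induct)
  case (add x)
  then show ?case by (metis add.assoc cyclic_subgroup_commute_gen)
next
  case (sub x)
  then have "y + - g = - g + y"
    by (metis add.assoc add_minus_cancel cyclic_subgroup_commute_gen minus_add_cancel add.right_neutral right_minus)
  then show ?case using sub by (metis add.assoc)
qed simp

lemma range_unknot: "range unknot = {v. v$3 = 0 \<and> (v$1)\<^sup>2 + (v$2)\<^sup>2 = 1}"
proof (intro equalityI subsetI)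
  fix v :: "real^3" assume "v \<in> {v. v$3 = 0 \<and> (v$1)\<^sup>2 + (v$2)\<^sup>2 = 1}"
  then obtain t where t: "v$3 = 0" "v$1 = cos t" "v$2 = sin t"
    using sincos_total_2pi[of "v$1" "v$2"] by auto
  then have "v = unknot (t / (2 * pi))"
    by (simp add: unknot_def vec_eq_iff forall_3)
  then show "v \<in> range unknot" by blast
qed (auto simp: unknot_def)

text \<open>Cutting along the part of the plane of the circle that lies outside of the circle leaves a
  set that is star-shaped about the centre, hence carries a flat section. The jump of this section
  across the cut is constant because the cut is connected.\<close>

lemma local_system_circle:
  fixes S :: "real^3 \<Rightarrow> real^3 \<Rightarrow> 'g::group_add"
  assumes S: "local_system (- range unknot) S"
  obtains g \<alpha> where "\<And>u. u \<in> - range unknot \<Longrightarrow>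
    \<exists>h. \<forall>\<^sub>F v in nhds u. \<alpha> v = (+) (S u v + h) ` cyclic_subgroup g"
proof -
  let ?\<Omega> = "- range unknot"
  \<comment> \<open>\<open>E\<close> is the cut, the plane of the circle minus the closed disc;
    \<open>A\<close> is what it leaves of the complement of the circle.\<close>
  define A where "A = {v::real^3. v$3 \<noteq> 0} \<union> {v. (v$1)\<^sup>2 + (v$2)\<^sup>2 < 1}"
  define E where "E = {v::real^3. v$3 = 0 \<and> (v$1)\<^sup>2 + (v$2)\<^sup>2 > 1}"
  have "open {v::real^3. v$3 \<noteq> 0}" "open {v::real^3. (v$1)\<^sup>2 + (v$2)\<^sup>2 < 1}"
    by (intro open_Collect_neq open_Collect_less continuous_intros)+
  then have "open A"
    by (simp add: A_def open_Un)
  have far: "open {v::real^3. (v$1)\<^sup>2 + (v$2)\<^sup>2 > 1}"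
    by (intro open_Collect_less continuous_intros)
  have \<Omega>: "?\<Omega> = A \<union> E"
    by (auto simp: A_def E_def range_unknot)
  have "open ?\<Omega>"
  proof -
    have "closed {v::real^3. v$3 = 0 \<and> (v$1)\<^sup>2 + (v$2)\<^sup>2 = 1}"
      by (intro closed_Collect_conj closed_Collect_eq continuous_intros)
    then show ?thesis by (simp add: range_unknot open_Compl)
  qed
  have "local_system A S"
    using S \<Omega> by (auto simp: local_system_def)
  moreover have "closed_segment 0 v \<subseteq> A" if v: "v \<in> A" for v
  proof
    fix w assume "w \<in> closed_segment 0 v"
    then obtain u where u: "w = u *\<^sub>R v" "0 \<le> u" "u \<le> 1" by (auto simp: closed_segment_def)
    show "w \<in> A"
    proof (cases "u = 0 \<or> v$3 \<noteq> 0")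
      case True
      then show ?thesis using u by (auto simp: A_def)
    next
      case False
      then have "(v$1)\<^sup>2 + (v$2)\<^sup>2 < 1" using v by (auto simp: A_def)
      moreover have "u\<^sup>2 * ((v$1)\<^sup>2 + (v$2)\<^sup>2) \<le> (v$1)\<^sup>2 + (v$2)\<^sup>2"
        using u by (intro mult_left_le_one_le) (auto simp: power_le_one)
      ultimately show ?thesis using u by (auto simp: A_def power_mult_distrib algebra_simps)
    qed
  qed
  ultimately obtain f where f: "flat_section S A f"
    using flat_section_starlike \<open>open A\<close> by blast
  \<comment> \<open>The two half balls at a point of the cut are connected, so relative to
    \<open>S e\<close> the section \<open>f\<close> has one constant above the plane and one
    below.\<close>
  have "\<exists>k k'. \<forall>\<^sub>F v in nhds e. (v$3 > 0 \<longrightarrow> f v = S e v + k) \<and> (v$3 < 0 \<longrightarrow> f v = S e v + k')"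
    if e: "e \<in> E" for e
  proof -
    obtain r where r: "r > 0" "ball e r \<subseteq> ?\<Omega>" "flat_section S (ball e r) (S e)"
      using local_system_flat_nbhd[OF S \<open>open ?\<Omega>\<close>, of e] e \<Omega> by auto
    have half: "\<exists>k. \<forall>v\<in>ball e r \<inter> H. f v = S e v + k" if H: "convex H" "H \<subseteq> {v. v$3 \<noteq> 0}" for H
    proof -
      have "flat_section S (ball e r \<inter> H) f"
        by (rule flat_section_mono[OF f]) (use H in \<open>auto simp: A_def\<close>)
      moreover have "flat_section S (ball e r \<inter> H) (S e)"
        by (rule flat_section_mono[OF r(3)]) auto
      moreover have "connected (ball e r \<inter> H)"
        by (intro convex_connected convex_Int convex_ball H)
      ultimately have "- S e v + f v = - S e w + f w" if "v \<in> ball e r \<inter> H" "w \<in> ball e r \<inter> H" for v w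
        using flat_section_diff_constant that by blast
      note diff = this
      show ?thesis
      proof (cases "ball e r \<inter> H = {}")
        case False
        then obtain w where w: "w \<in> ball e r \<inter> H" by blast
        have "f v = S e v + (- S e w + f w)" if "v \<in> ball e r \<inter> H" for v
          using add_minus_cancel[of "S e v" "f v"] unfolding diff[OF that w] by (rule HOL.sym)
        then show ?thesis by blast
      qed simp
    qed
    have conv: "convex {v::real^3. v$3 > 0}" "convex {v::real^3. v$3 < 0}"
      using convex_halfspace_gt[of 0 "axis 3 1 :: real^3"] convex_halfspace_lt[of "axis 3 1 :: real^3" 0]
      by (simp_all add: inner_axis' )
    obtain k where k: "\<forall>v\<in>ball e r \<inter> {v. v$3 > 0}. f v = S e v + k"
      using half[OF conv(1)] by (metis (mono_tags) mem_Collect_eq order_less_irrefl subsetI)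
    obtain k' where k': "\<forall>v\<in>ball e r \<inter> {v. v$3 < 0}. f v = S e v + k'"
      using half[OF conv(2)] by (metis (mono_tags) mem_Collect_eq order_less_irrefl subsetI)
    have "\<forall>\<^sub>F v in nhds e. v \<in> ball e r"
      using r(1) by (intro eventually_nhds_in_open) auto
    then have "\<forall>\<^sub>F v in nhds e. (v$3 > 0 \<longrightarrow> f v = S e v + k) \<and> (v$3 < 0 \<longrightarrow> f v = S e v + k')"
      by eventually_elim (use k k' in auto)
    then show ?thesis by blast
  qed
  then have "\<forall>e\<in>E. \<exists>p. \<forall>\<^sub>F v in nhds e. (v$3 > 0 \<longrightarrow> f v = S e v + fst p) \<and>
      (v$3 < 0 \<longrightarrow> f v = S e v + snd p)"
    by simp
  from bchoice[OF this] obtain p where p: "\<forall>e\<in>E. \<forall>\<^sub>F v in nhds e. (v$3 > 0 \<longrightarrow> f v = S e v + fst (p e)) \<and>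
      (v$3 < 0 \<longrightarrow> f v = S e v + snd (p e))" ..
  define kp km where "kp e = fst (p e)" and "km e = snd (p e)" for e
  have k: "\<forall>\<^sub>F v in nhds e. (v$3 > 0 \<longrightarrow> f v = S e v + kp e) \<and> (v$3 < 0 \<longrightarrow> f v = S e v + km e)"
    if "e \<in> E" for e
    using p that by (simp add: kp_def km_def)
  \<comment> \<open>A property that holds near a point of the cut also holds at some point strictly
    on the prescribed side of the plane.\<close>
  have push: "\<exists>v. P v \<and> v$3 * s > 0" if "\<forall>\<^sub>F v in nhds e. P v" "e \<in> E" "s \<noteq> 0" for P s and e :: "real^3"
  proof -
    have cont: "continuous_on UNIV (\<lambda>t. e + (t * s) *\<^sub>R axis 3 1)" by (intro continuous_intros)
    have "\<forall>\<^sub>F t in nhds 0. P (e + (t * s) *\<^sub>R axis 3 1)"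
      using eventually_nhds_compose[OF cont, where x = 0 and P = P] that(1) by simp
    then obtain d where "d > 0" and d: "\<forall>t. dist t 0 < d \<longrightarrow> P (e + (t * s) *\<^sub>R axis 3 1)"
      by (auto simp: eventually_nhds_metric)
    have "P (e + (d / 2 * s) *\<^sub>R axis 3 1)"
      using \<open>d > 0\<close> by (intro d[rule_format]) (simp add: dist_real_def)
    moreover have "(e + (d / 2 * s) *\<^sub>R axis 3 1) $ 3 * s > 0"
      using that(2,3) \<open>d > 0\<close> by (auto simp: E_def axis_def mult.assoc zero_less_mult_iff linorder_neq_iff)
    ultimately show ?thesis by blast
  qed
  \<comment> \<open>Moving the base point along the cut adds the same \<open>m\<close> on the left
    of both constants, and \<open>m\<close> cancels in \<open>- km e + kp e\<close>.\<close>
  have shift: "\<forall>\<^sub>F e' in nhds e. e' \<in> E \<longrightarrow> (\<exists>m. (\<forall>\<^sub>F v in nhds e'. S e v = S e' v + m) \<and>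
      kp e' = m + kp e \<and> km e' = m + km e)" if e: "e \<in> E" for e
  proof -
    have "\<forall>\<^sub>F u in nhds e. \<exists>g. \<forall>\<^sub>F v in nhds u. S e v = S u v + g"
      using S e \<Omega> by (auto simp: local_system_def)
    moreover have "\<forall>\<^sub>F u in nhds e. \<forall>\<^sub>F v in nhds u. (v$3 > 0 \<longrightarrow> f v = S e v + kp e) \<and> (v$3 < 0 \<longrightarrow> f v = S e v + km e)"
      using k[OF e] by (simp add: eventually_eventually)
    ultimately show ?thesis
    proof eventually_elim
      case (elim u)
      show ?case
      proof
        assume u: "u \<in> E"
        obtain m where m: "\<forall>\<^sub>F v in nhds u. S e v = S u v + m" using elim(1) by blast
        have ev: "\<forall>\<^sub>F v in nhds u. (v$3 > 0 \<longrightarrow> S u v + m + kp e = S u v + kp u) \<and>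
            (v$3 < 0 \<longrightarrow> S u v + m + km e = S u v + km u)"
          using elim(2) m k[OF u] by eventually_elim auto
        have "kp u = m + kp e" using push[OF ev u, of 1] by (auto simp: add.assoc)
        moreover have "km u = m + km e" using push[OF ev u, of "-1"] by (auto simp: add.assoc)
        ultimately show "\<exists>m. (\<forall>\<^sub>F v in nhds u. S e v = S u v + m) \<and> kp u = m + kp e \<and> km u = m + km e"
          using m by blast
      qed
    qed
  qed
  have "connected E"
  proof -
    let ?F = "\<lambda>p. (fst p * cos (snd p)) *\<^sub>R axis 1 1 + (fst p * sin (snd p)) *\<^sub>R axis 2 1 :: real^3"
    have "continuous_on ({1<..} \<times> UNIV) ?F"
      by (intro continuous_intros)
    then have "connected (?F ` ({1<..} \<times> UNIV))"
      by (intro connected_continuous_image connected_Times) auto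
    also have "?F ` ({1<..} \<times> UNIV) = E"
    proof (intro equalityI subsetI)
      fix v :: "real^3" assume v: "v \<in> E"
      define r where "r = sqrt ((v$1)\<^sup>2 + (v$2)\<^sup>2)"
      have r: "r > 1" "r\<^sup>2 = (v$1)\<^sup>2 + (v$2)\<^sup>2" using v by (auto simp: r_def E_def)
      have "(v$1 / r)\<^sup>2 + (v$2 / r)\<^sup>2 = ((v$1)\<^sup>2 + (v$2)\<^sup>2) / r\<^sup>2"
        by (simp only: power_divide add_divide_distrib)
      also have "\<dots> = 1" using r(1) by (simp flip: r(2))
      finally have "(v$1 / r)\<^sup>2 + (v$2 / r)\<^sup>2 = 1" .
      from sincos_total_2pi[OF this] obtain t where "v$1 / r = cos t" "v$2 / r = sin t" by metis
      then have "v$1 = r * cos t" "v$2 = r * sin t" using r(1) by (simp_all add: field_simps)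
      then have "v = ?F (r, t)"
        using v by (simp add: vec_eq_iff forall_3 E_def field_simps axis_def)
      then show "v \<in> ?F ` ({1<..} \<times> UNIV)" using r by blast
    next
      fix v assume "v \<in> ?F ` ({1<..} \<times> UNIV)"
      then obtain r t where v: "r > 1" "v = ?F (r, t)" by auto
      have "(v$1)\<^sup>2 + (v$2)\<^sup>2 = r\<^sup>2 * ((cos t)\<^sup>2 + (sin t)\<^sup>2)"
        using v by (simp add: power_mult_distrib distrib_left axis_def del: sin_cos_squared_add2 sin_cos_squared_add)
      then show "v \<in> E" using v by (simp add: E_def axis_def)
    qed
    finally show ?thesis .
  qed
  have gconst: "- km e + kp e = - km e' + kp e'" if "e \<in> E" "e' \<in> E" for e e'
  proof (rule locally_constant_imp_constant[OF \<open>connected E\<close> _ that, where h = "\<lambda>e. - km e + kp e"])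
    fix u assume "u \<in> E"
    from shift[OF this] show "\<forall>\<^sub>F v in nhds u. v \<in> E \<longrightarrow> - km v + kp v = - km u + kp u"
      by eventually_elim (auto simp: minus_translate simp del: minus_add)
  qed
  \<comment> \<open>The constant jump is the monodromy around the circle.\<close>
  then obtain g where g: "\<And>e. e \<in> E \<Longrightarrow> - km e + kp e = g"
    by metis
  let ?Z = "cyclic_subgroup g"
  \<comment> \<open>Modulo the cyclic group of \<open>g\<close> both sides agree, so the cosets of
    \<open>f\<close> extend across the cut. The result is a flat section of the quotient, i.e. a
    reduction of the structure group to a cyclic one.\<close>
  have coset: "(+) (b + km e) ` ?Z = (+) (b + kp e) ` ?Z" if "e \<in> E" for b e
  proof -
    have kp: "kp e = km e + g" using g[OF that] by (metis add_minus_cancel)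
    have "b + km e + z \<in> (+) (b + kp e) ` ?Z" if "z \<in> ?Z" for z
      using that by (intro image_eqI[of _ _ "- g + z"]) (auto simp: kp add.assoc intro: cyclic_subgroup.sub)
    moreover have "b + kp e + z \<in> (+) (b + km e) ` ?Z" if "z \<in> ?Z" for z
      using that by (intro image_eqI[of _ _ "g + z"]) (auto simp: kp add.assoc intro: cyclic_subgroup.add)
    ultimately show ?thesis by blast
  qed
  define \<alpha> where "\<alpha> v = (if v \<in> A then (+) (f v) ` ?Z else (+) (S v v + kp v) ` ?Z)" for v
  have "\<exists>h. \<forall>\<^sub>F v in nhds u. \<alpha> v = (+) (S u v + h) ` ?Z" if u: "u \<in> ?\<Omega>" for u
  proof (cases "u \<in> A")
    case True
    then obtain h where h: "\<forall>\<^sub>F v in nhds u. f v = S u v + h"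
      using f by (auto simp: flat_section_def)
    have "\<forall>\<^sub>F v in nhds u. v \<in> A"
      using \<open>open A\<close> True by (rule eventually_nhds_in_open)
    with h have "\<forall>\<^sub>F v in nhds u. \<alpha> v = (+) (S u v + h) ` ?Z"
      by eventually_elim (simp add: \<alpha>_def)
    then show ?thesis ..
  next
    case False
    then have u: "u \<in> E" using u \<Omega> by auto
    have "\<forall>\<^sub>F v in nhds u. v \<in> {v. (v$1)\<^sup>2 + (v$2)\<^sup>2 > 1}"
      using far u by (intro eventually_nhds_in_open) (auto simp: E_def)
    with k[OF u] shift[OF u] have "\<forall>\<^sub>F v in nhds u. \<alpha> v = (+) (S u v + kp u) ` ?Z"
    proof eventually_elim
      case (elim v)
      consider "v$3 > 0" | "v$3 < 0" | "v$3 = 0" by linarith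
      then show ?case
      proof cases
        case 3
        then have "v \<in> E" "v \<notin> A" using elim(3) by (auto simp: E_def A_def)
        then obtain m where m: "\<forall>\<^sub>F w in nhds v. S u w = S v w + m" "kp v = m + kp u"
          using elim(2) by blast
        have "S u v = S v v + m" using eventually_nhds_x_imp_x[OF m(1)] .
        then show ?thesis using \<open>v \<notin> A\<close> m(2) by (simp add: \<alpha>_def add.assoc)
      qed (use elim coset[OF u] in \<open>auto simp: \<alpha>_def A_def\<close>)
    qed
    then show ?thesis ..
  qed
  then show ?thesis using that by blast
qed

lemma local_system_homeomorphism:
  assumes h: "homeomorphism UNIV UNIV \<Phi> \<Psi>" and S: "local_system \<Omega> S"
  shows "local_system (\<Phi> ` \<Omega>) (\<lambda>p u. S (\<Psi> p) (\<Psi> u))"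
  unfolding local_system_def
proof
  have cont: "continuous_on UNIV \<Psi>" and inv: "\<And>x. \<Psi> (\<Phi> x) = x"
    using h by (auto simp: homeomorphism_def)
  fix p assume "p \<in> \<Phi> ` \<Omega>"
  then have "\<Psi> p \<in> \<Omega>" using inv by auto
  then have "\<forall>\<^sub>F u in nhds (\<Psi> p). \<exists>g. \<forall>\<^sub>F v in nhds u. S (\<Psi> p) v = S u v + g"
    using S by (auto simp: local_system_def)
  from eventually_nhds_compose[OF cont this]
  show "\<forall>\<^sub>F u in nhds p. \<exists>g. \<forall>\<^sub>F v in nhds u. S (\<Psi> p) (\<Psi> v) = S (\<Psi> u) (\<Psi> v) + g"
    by eventually_elim (use eventually_nhds_compose[OF cont] in blast)
qed

lemma local_system_unknotted:
  fixes S :: "real^3 \<Rightarrow> real^3 \<Rightarrow> 'g::group_add"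
  assumes S: "local_system (- C) S" and h: "homeomorphism UNIV UNIV \<Phi> \<Psi>" "\<Phi> ` C = range unknot"
  obtains g \<alpha> where "\<And>u. u \<notin> C \<Longrightarrow>
    \<exists>h. \<forall>\<^sub>F v in nhds u. \<alpha> v = (+) (S u v + h) ` cyclic_subgroup g"
proof -
  have cont: "continuous_on UNIV \<Phi>" and inv: "\<And>x. \<Psi> (\<Phi> x) = x" "\<And>x. \<Phi> (\<Psi> x) = x"
    using h(1) by (auto simp: homeomorphism_def)
  have "\<Phi> ` (- C) = - range unknot"
  proof -
    have "bij \<Phi>" by (rule bij_betw_byWitness[where f' = \<Psi>]) (auto simp: inv)
    then show ?thesis using bij_image_Compl_eq[of \<Phi> C] h(2) by simp
  qed
  then have "local_system (- range unknot) (\<lambda>p u. S (\<Psi> p) (\<Psi> u))"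
    using local_system_homeomorphism[OF h(1) S] by simp
  then obtain g \<beta> where \<beta>: "\<And>u. u \<in> - range unknot \<Longrightarrow>
      \<exists>h. \<forall>\<^sub>F v in nhds u. \<beta> v = (+) (S (\<Psi> u) (\<Psi> v) + h) ` cyclic_subgroup g"
    using local_system_circle by blast
  have "\<exists>h. \<forall>\<^sub>F v in nhds u. \<beta> (\<Phi> v) = (+) (S u v + h) ` cyclic_subgroup g" if "u \<notin> C" for u
  proof -
    have "\<Phi> u \<in> - range unknot" using that h(2) inv by (metis ComplI image_iff)
    then obtain k where "\<forall>\<^sub>F v in nhds (\<Phi> u). \<beta> v = (+) (S (\<Psi> (\<Phi> u)) (\<Psi> v) + k) ` cyclic_subgroup g"
      using \<beta> by blast
    from eventually_nhds_compose[OF cont this] show ?thesis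
      by (auto simp: inv)
  qed
  then show ?thesis using that[of "\<lambda>v. \<beta> (\<Phi> v)" g] by blast
qed

section \<open>Generic fronts\<close>

lemma has_real_derivative_nonzero_sign:
  fixes f :: "real \<Rightarrow> real"
  assumes "(f has_real_derivative d) (at c)" "d \<noteq> 0" "f c = 0"
  obtains e where "e > 0" "\<And>t. 0 < \<bar>t - c\<bar> \<Longrightarrow> \<bar>t - c\<bar> < e \<Longrightarrow> 0 < d * (t - c) * f t"
proof -
  have "((\<lambda>t. d * f t) has_real_derivative d * d) (at c)"
    using DERIV_cmult[OF assms(1)] by blast
  moreover have dd: "0 < d * d" using assms(2) by (auto simp: zero_less_mult_iff linorder_neq_iff)
  ultimately obtain e1 e2 where e: "e1 > 0" "\<And>h. 0 < h \<Longrightarrow> h < e1 \<Longrightarrow> d * f c < d * f (c + h)"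
      "e2 > 0" "\<And>h. 0 < h \<Longrightarrow> h < e2 \<Longrightarrow> d * f (c - h) < d * f c"
    using DERIV_pos_inc_right[of "\<lambda>t. d * f t" "d * d" c] DERIV_pos_inc_left[of "\<lambda>t. d * f t" "d * d" c]
    by metis
  have "0 < d * (t - c) * f t" if t: "0 < \<bar>t - c\<bar>" "\<bar>t - c\<bar> < min e1 e2" for t
  proof (cases "t > c")
    case True
    then have "0 < d * f t" using e(2)[of "t - c"] t assms(3) by auto
    then have "0 < (t - c) * (d * f t)" using True by simp
    then show ?thesis by (simp add: mult_ac)
  next
    case False
    then have "d * f t < 0" "t < c" using e(4)[of "c - t"] t assms(3) by auto
    then have "0 < (t - c) * (d * f t)" by (simp add: mult_neg_neg)
    then show ?thesis by (simp add: mult_ac)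
  qed
  then show ?thesis using that[of "min e1 e2"] e by auto
qed

text \<open>The points of \<open>A\<close> within distance 1 of \<open>t\<close> come from three
  consecutive periods, so they are finitely many.\<close>

lemma periodic_discrete:
  fixes A :: "real set"
  assumes fin: "finite (A \<inter> {0..<1})" and per: "\<And>t k. t \<in> A \<Longrightarrow> t + of_int k \<in> A"
  obtains e where "e > 0" "\<And>s. 0 < \<bar>s - t\<bar> \<Longrightarrow> \<bar>s - t\<bar> < e \<Longrightarrow> s \<notin> A"
proof -
  let ?B = "(\<lambda>(a, k). a + of_int k) ` ((A \<inter> {0..<1}) \<times> {\<lfloor>t\<rfloor> - 1..\<lfloor>t\<rfloor> + 1})"
  have "finite ?B" using fin by blast
  then obtain d where d: "d > 0" "\<And>s. s \<in> ?B \<Longrightarrow> s \<noteq> t \<Longrightarrow> d \<le> dist t s"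
    using finite_set_avoid by metis
  have "s \<notin> A" if s: "0 < \<bar>s - t\<bar>" "\<bar>s - t\<bar> < min d 1" for s
  proof
    assume "s \<in> A"
    then have "frac s \<in> A \<inter> {0..<1}"
      using per[of s "- \<lfloor>s\<rfloor>"] by (simp add: frac_def frac_lt_1[unfolded frac_def])
    moreover have "\<lfloor>s\<rfloor> \<in> {\<lfloor>t\<rfloor> - 1..\<lfloor>t\<rfloor> + 1}" using s(2) by (simp; linarith)
    ultimately have "s \<in> ?B"
      by (intro image_eqI[of _ _ "(frac s, \<lfloor>s\<rfloor>)"]) (simp_all add: frac_def)
    moreover have "s \<noteq> t" using s(1) by auto
    ultimately have "d \<le> dist t s" by (rule d(2))
    then show False using s(2) by (simp add: dist_real_def abs_minus_commute)
  qed
  then show ?thesis using that[of "min d 1"] d(1) by auto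
qed

section \<open>Crossings, cusps and branches of a generic front\<close>

locale front_diagram = legendrian +
  assumes generic: "generic_front D"
begin

abbreviation cusp :: "real \<Rightarrow> bool" where "cusp t \<equiv> V t $ 1 = 0"

text \<open>Crossings for arbitrary real parameters, so that neighbourhoods are not cut off at the
  ends of \<open>{0..<1}\<close>.\<close>

definition over :: "real \<Rightarrow> real \<Rightarrow> bool" where
  "over p q \<longleftrightarrow> front D p = front D q \<and> D p $ 2 < D q $ 2"

definition special :: "real \<Rightarrow> bool" where
  "special t \<longleftrightarrow> cusp t \<or> (\<exists>s. over s t \<or> over t s)"

lemma front_eq_iff: "front D s = front D t \<longleftrightarrow> D s $ 1 = D t $ 1 \<and> D s $ 3 = D t $ 3"
  by (simp add: front_def vec_eq_iff forall_2)

lemma front_periodic_int: "front D (t + of_int k) = front D t"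
  by (simp add: front_def D_periodic_int)

lemma front_frac: "front D (frac t) = front D t"
  by (simp add: front_def D_frac)

lemma frac_in: "frac (t::real) \<in> {0..<1}"
  by (simp add: frac_lt_1)

lemma frac_eq_iff: "frac (s::real) = frac t \<longleftrightarrow> s - t \<in> \<int>"
proof -
  have "\<bar>frac s - frac t\<bar> < 1"
    using frac_in[of s] frac_in[of t] unfolding atLeastLessThan_iff by linarith
  then show ?thesis
    using D_eq_iff[of s t] D_eq_near[of "frac s" "frac t"] by (metis D_frac)
qed

lemma over_periodic: "over (p + of_int j) (q + of_int k) \<longleftrightarrow> over p q"
  by (simp add: over_def front_periodic_int D_periodic_int)

lemma over_frac: "over (frac p) (frac q) \<longleftrightarrow> over p q"
  by (simp add: over_def front_frac D_frac)

lemma over_crossings: "over p q \<longleftrightarrow> (frac p, frac q) \<in> crossings D"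
  using over_frac[of p q] frac_in[of p] frac_in[of q] by (simp add: crossings_def over_def)

text \<open>On a Legendrian curve the transversality determinant factors, so its nonvanishing
  excludes cusps at double points and separates the slopes.\<close>

lemma front_det_eq: "front_det D s t = V s $ 1 * V t $ 1 * (D t $ 2 - D s $ 2)"
  by (simp add: front_det_def V3 algebra_simps)

lemma transverse:
  assumes "front D s = front D t" "s - t \<notin> \<int>"
  shows "V s $ 1 \<noteq> 0" "V t $ 1 \<noteq> 0" "D s $ 2 \<noteq> D t $ 2"
proof -
  have "front_det D (frac s) (frac t) \<noteq> 0"
    using generic assms frac_in[of s] frac_in[of t] unfolding generic_front_def
    by (metis front_frac frac_eq_iff)
  then show "V s $ 1 \<noteq> 0" "V t $ 1 \<noteq> 0" "D s $ 2 \<noteq> D t $ 2"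
    unfolding front_det_eq D_frac V_frac by auto
qed

lemma no_triple:
  assumes "front D r = front D s" "front D s = front D t"
  shows "r - s \<in> \<int> \<or> s - t \<in> \<int> \<or> r - t \<in> \<int>"
  using generic assms frac_in[of r] frac_in[of s] frac_in[of t] unfolding generic_front_def
  by (metis front_frac frac_eq_iff)

lemma over_not_int: "over p q \<Longrightarrow> p - q \<notin> \<int>"
  using D_eq_iff[of p q] by (auto simp: over_def)

lemma over_regular: "over p q \<Longrightarrow> \<not> cusp p \<and> \<not> cusp q"
  using over_not_int transverse unfolding over_def by blast

lemma same_front:
  assumes "front D s = front D t"
  shows "s - t \<in> \<int> \<or> over s t \<or> over t s"
  using assms transverse(3)[OF assms] by (auto simp: over_def)

lemma not_special_front:
  assumes "\<not> special t" "front D s = front D t"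
  shows "s - t \<in> \<int>"
  using same_front[OF assms(2)] assms(1) by (auto simp: special_def)

lemma special_periodic: "special (t + of_int k) \<longleftrightarrow> special t"
proof -
  have "over s (t + of_int k) \<longleftrightarrow> over s t" "over (t + of_int k) s \<longleftrightarrow> over t s" for s
    using over_periodic[of s 0 t k] over_periodic[of t k s 0] by auto
  then show ?thesis by (simp add: special_def V_periodic_int)
qed

lemma special_discrete:
  obtains e where "e > 0" "\<And>s. 0 < \<bar>s - t\<bar> \<Longrightarrow> \<bar>s - t\<bar> < e \<Longrightarrow> \<not> special s"
proof -
  let ?F = "cusps D \<union> fst ` crossings D \<union> snd ` crossings D"
  have "Collect special \<inter> {0..<1} \<subseteq> ?F"
  proof
    fix t assume "t \<in> Collect special \<inter> {0..<1}"
    then have t: "special t" "t \<in> {0..<1}" by auto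
    then have "frac t = t" by (simp add: frac_eq)
    then show "t \<in> ?F"
      using t by (force simp: special_def cusps_def over_crossings)
  qed
  moreover have "finite ?F" using generic by (simp add: generic_front_def)
  ultimately have "finite (Collect special \<inter> {0..<1})" by (rule finite_subset)
  then show ?thesis
    using periodic_discrete[of "Collect special" t] that by (auto simp: special_periodic)
qed

lemma x_inj:
  assumes "\<And>t. a < t \<Longrightarrow> t < b \<Longrightarrow> \<not> cusp t" "a \<le> b" "D a $ 1 = D b $ 1"
  shows "a = b"
proof (rule ccontr)
  assume "a \<noteq> b"
  then have "a < b" using assms(2) by simp
  then obtain z where z: "a < z" "z < b" "D b $ 1 - D a $ 1 = (b - a) * V z $ 1"
    using MVT2[of a b "\<lambda>t. D t $ 1" "\<lambda>t. V t $ 1"] D_component_derivative by blast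
  then show False using assms(1)[OF z(1,2)] assms(3) \<open>a < b\<close> by simp
qed

lemma x_inj_on:
  assumes "\<And>t. a < t \<Longrightarrow> t < b \<Longrightarrow> \<not> cusp t"
  shows "inj_on (\<lambda>t. D t $ 1) {a..b}"
proof (rule linorder_inj_onI)
  fix s t assume "s < t" "s \<in> {a..b}" "t \<in> {a..b}"
  then show "D s $ 1 \<noteq> D t $ 1"
    using x_inj[of s t] assms by auto
qed auto

section \<open>Position of a point relative to a branch of the front\<close>

definition below :: "real set \<Rightarrow> real^3 \<Rightarrow> bool" where
  "below I v \<longleftrightarrow> (\<exists>t\<in>I. D t $ 1 = v $ 1 \<and> v $ 3 < D t $ 3)"

lemma below_translate: "below ((\<lambda>t. t + of_int k) ` I) = below I"
  by (rule ext) (simp add: below_def D_periodic_int)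

lemma open_component: "open U \<Longrightarrow> open {v::real^3. v $ i \<in> U}"
  using open_vimage[of U "\<lambda>v::real^3. v $ i"] by (simp add: vimage_def continuous_intros)

lemma eventually_component:
  "open U \<Longrightarrow> u $ i \<in> U \<Longrightarrow> \<forall>\<^sub>F v::real^3 in nhds u. v $ i \<in> U"
  using eventually_nhds_in_open[of "{v. v $ i \<in> U}" u] open_component by simp

lemma x_open_image:
  assumes "open J" "inj_on (\<lambda>t. D t $ 1) J"
  shows "open ((\<lambda>t. D t $ 1) ` J)"
  by (rule invariance_of_domain[OF continuous_D_component assms])

lemma eventually_x_image:
  fixes u :: "real^3"
  assumes "open J" "inj_on (\<lambda>t. D t $ 1) J" "s \<in> J" "D s $ 1 = u $ 1"
  shows "\<forall>\<^sub>F v in nhds u. \<exists>t\<in>J. D t $ 1 = v $ 1"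
proof -
  have "\<forall>\<^sub>F v in nhds u. v $ 1 \<in> (\<lambda>t. D t $ 1) ` J"
    using assms by (intro eventually_component x_open_image) (auto intro: rev_image_eqI)
  then show ?thesis by eventually_elim force
qed

text \<open>The height \<open>m\<close> separates \<open>u\<close> from the branch near
  \<open>s\<close>, and injectivity of \<open>x\<close> on \<open>I\<close> leaves no other branch
  point over the points near \<open>u\<close>.\<close>

lemma below_off_branch:
  assumes I: "open I" "inj_on (\<lambda>t. D t $ 1) I" "s \<in> I" "D s $ 1 = u $ 1" and off: "D s $ 3 \<noteq> u $ 3"
  shows "\<forall>\<^sub>F v in nhds u. below I v = (u $ 3 < D s $ 3)"
proof -
  define m where "m = (D s $ 3 + u $ 3) / 2"
  have op: "open {t. m < D t $ 3}" "open {t. D t $ 3 < m}"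
    by (intro open_Collect_less continuous_D_component continuous_intros)+
  show ?thesis
  proof (cases "u $ 3 < D s $ 3")
    case True
    have "\<forall>\<^sub>F v in nhds u. \<exists>t\<in>I \<inter> {t. m < D t $ 3}. D t $ 1 = v $ 1"
      using True I by (intro eventually_x_image[of _ s] open_Int op inj_on_subset[OF I(2)]) (auto simp: m_def)
    moreover have "\<forall>\<^sub>F v in nhds u. v $ 3 \<in> {..<m}"
      using True by (intro eventually_component) (auto simp: m_def)
    ultimately show ?thesis
      by eventually_elim (use True in \<open>auto simp: below_def\<close>)
  next
    case False
    have "\<forall>\<^sub>F v in nhds u. \<exists>t\<in>I \<inter> {t. D t $ 3 < m}. D t $ 1 = v $ 1"
      using False off I by (intro eventually_x_image[of _ s] open_Int op inj_on_subset[OF I(2)]) (auto simp: m_def)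
    moreover have "\<forall>\<^sub>F v in nhds u. v $ 3 \<in> {m<..}"
      using False off by (intro eventually_component) (auto simp: m_def)
    ultimately show ?thesis
    proof eventually_elim
      case (elim v)
      then obtain t where t: "t \<in> I" "D t $ 3 < m" "D t $ 1 = v $ 1" by auto
      have "\<And>t'. t' \<in> I \<Longrightarrow> D t' $ 1 = v $ 1 \<Longrightarrow> t' = t"
        using inj_onD[OF I(2), of _ t] t by simp
      then have "\<not> below I v" using t(2) elim(2) unfolding below_def by force
      then show ?case using False by simp
    qed
  qed
qed

text \<open>The branch point over \<open>v\<close> is unique, and for \<open>v\<close> near
  \<open>u\<close> it already lies in \<open>I'\<close>, since an injective continuous function on
  an open set of reals is open.\<close>

lemma below_sub_branch:
  assumes "open I'" "inj_on (\<lambda>t. D t $ 1) I" "I' \<subseteq> I" "s \<in> I'" "D s $ 1 = u $ 1"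
  shows "\<forall>\<^sub>F v in nhds u. below I v = below I' v"
proof -
  have "\<forall>\<^sub>F v in nhds u. \<exists>t\<in>I'. D t $ 1 = v $ 1"
    using assms by (intro eventually_x_image[of _ s] inj_on_subset[OF assms(2)]) auto
  then show ?thesis
  proof eventually_elim
    case (elim v)
    then obtain t where t: "t \<in> I'" "D t $ 1 = v $ 1" by auto
    have "t' = t" if "t' \<in> I" "D t' $ 1 = v $ 1" for t'
      using inj_onD[OF assms(2), of t' t] assms(3) t that by auto
    then show ?case using t(1) assms(3) unfolding below_def by blast
  qed
qed

lemma below_germ_unique:
  assumes "open I" "inj_on (\<lambda>t. D t $ 1) I" "s \<in> I" "D s $ 1 = u $ 1"
    and "open I'" "inj_on (\<lambda>t. D t $ 1) I'" "s + of_int k \<in> I'"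
  shows "\<forall>\<^sub>F v in nhds u. below I v = below I' v"
proof -
  let ?J = "(\<lambda>t. t + of_int (- k)) ` I'"
  have J: "?J = (\<lambda>t. t + of_int k) -` I'" by (auto simp: image_iff algebra_simps)
  have "open ?J" unfolding J by (intro open_vimage assms continuous_intros)
  have "s \<in> ?J" using assms(7) by (intro image_eqI[of _ _ "s + of_int k"]) auto
  have inj: "inj_on (\<lambda>t. D t $ 1) ?J"
    using assms(6) by (auto simp: inj_on_def D_periodic_int simp flip: of_int_minus)
  have "\<forall>\<^sub>F v in nhds u. below I v = below (I \<inter> ?J) v" "\<forall>\<^sub>F v in nhds u. below ?J v = below (I \<inter> ?J) v"
    using assms \<open>open ?J\<close> \<open>s \<in> ?J\<close> inj by (intro below_sub_branch[of _ _ s]; auto)+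
  then show ?thesis
    by eventually_elim (simp only: below_translate)
qed

text \<open>\<open>d\<close> is \<open>x''\<close> at the cusp. As \<open>x'\<close> has a simple
  zero there, \<open>x\<close> has a strict local extremum, and both branches leave to the side
  given by the sign of \<open>d\<close>.\<close>

lemma cusp_side:
  assumes "cusp c"
  obtains d e where "d \<noteq> 0" "e > 0"
    "\<And>t. 0 < \<bar>t - c\<bar> \<Longrightarrow> \<bar>t - c\<bar> < e \<Longrightarrow> 0 < d * (D t $ 1 - D c $ 1) \<and> 0 < d * (t - c) * V t $ 1"
proof -
  define d where "d = vector_derivative V (at c) $ 1"
  have "d \<noteq> 0"
  proof -
    have "frac c \<in> cusps D" using assms frac_in[of c] by (simp add: cusps_def V_frac)
    then have "vector_derivative V (at (frac c)) $ 1 \<noteq> 0" using generic by (auto simp: generic_front_def)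
    moreover have "vector_derivative V (at (frac c)) = vector_derivative V (at c)"
    proof -
      have sm: "smooth V" by (rule smooth_velocity[OF smooth_D])
      have "(V has_vector_derivative vector_derivative V (at c)) (at (frac c + of_int \<lfloor>c\<rfloor>))"
        using V_has_vector_derivative[of c] by (simp add: frac_def)
      moreover have "((\<lambda>t. t + of_int \<lfloor>c\<rfloor>) has_vector_derivative 1) (at (frac c))"
        using has_vector_derivative_add_const[of "\<lambda>s. s" _ 1 "at (frac c)"] has_vector_derivative_id by simp
      ultimately have "(V has_vector_derivative vector_derivative V (at c)) (at (frac c))"
        using vector_diff_chain_at[of "\<lambda>t. t + of_int \<lfloor>c\<rfloor>" 1 "frac c" V] by (simp add: o_def V_periodic_int)
      then show ?thesis by (rule vector_derivative_at)
    qed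
    ultimately show ?thesis by (simp add: d_def)
  qed
  obtain e where e: "e > 0" "\<And>t. 0 < \<bar>t - c\<bar> \<Longrightarrow> \<bar>t - c\<bar> < e \<Longrightarrow> 0 < d * (t - c) * V t $ 1"
    using has_real_derivative_nonzero_sign[OF V_component_derivative[of 1 c] \<open>d \<noteq> 0\<close>[unfolded d_def] assms]
    unfolding d_def by blast
  have "0 < d * (D t $ 1 - D c $ 1)" if t: "0 < \<bar>t - c\<bar>" "\<bar>t - c\<bar> < e" for t
  proof -
    have "\<exists>s. \<bar>s - c\<bar> < e \<and> 0 < \<bar>s - c\<bar> \<and> (t - c) * (s - c) > 0 \<and> D t $ 1 - D c $ 1 = (t - c) * V s $ 1"
    proof (cases "c < t")
      case True
      then obtain s where "c < s" "s < t" "D t $ 1 - D c $ 1 = (t - c) * V s $ 1"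
        using MVT2[of c t "\<lambda>t. D t $ 1" "\<lambda>t. V t $ 1"] D_component_derivative by blast
      then show ?thesis using t True by (intro exI[of _ s]) auto
    next
      case False
      then have "t < c" using t by auto
      then obtain s where "t < s" "s < c" "D c $ 1 - D t $ 1 = (c - t) * V s $ 1"
        using MVT2[of t c "\<lambda>t. D t $ 1" "\<lambda>t. V t $ 1"] D_component_derivative by blast
      moreover from this have "(t - c) * (s - c) > 0" by (intro mult_neg_neg) auto
      ultimately show ?thesis using t by (intro exI[of _ s]) (auto simp: algebra_simps)
    qed
    then obtain s where s: "\<bar>s - c\<bar> < e" "0 < \<bar>s - c\<bar>" "(t - c) * (s - c) > 0" "D t $ 1 - D c $ 1 = (t - c) * V s $ 1"
      by blast
    \<comment> \<open>The intermediate \<open>s\<close> lies on the same side of \<open>c\<close> as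
      \<open>t\<close>, so the sign of \<open>x'\<close> at \<open>s\<close> decides the sign of the
      increment up to \<open>t\<close>.\<close>
    have "0 < (d * (s - c) * V s $ 1) * ((t - c) * (s - c))"
      using e(2)[OF s(2,1)] s(3) by (rule mult_pos_pos)
    then have "0 < (d * ((t - c) * V s $ 1)) * (s - c)\<^sup>2"
      by (simp add: power2_eq_square algebra_simps)
    then show ?thesis unfolding s(4) by (simp add: zero_less_mult_iff)
  qed
  then show ?thesis using that[OF \<open>d \<noteq> 0\<close> e(1)] e(2) by blast
qed

text \<open>The intermediate value theorem on each branch: both reach every \<open>x\<close>-value
  slightly to the side given by \<open>d\<close>.\<close>

lemma cusp_branches:
  assumes d: "\<And>t. 0 < \<bar>t - c\<bar> \<Longrightarrow> \<bar>t - c\<bar> < e \<Longrightarrow> 0 < d * (D t $ 1 - D c $ 1)" and "e > 0" "\<rho> > 0"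
  obtains \<eta> where "\<eta> > 0" "\<And>\<xi>. 0 < d * (\<xi> - D c $ 1) \<Longrightarrow> \<bar>\<xi> - D c $ 1\<bar> < \<eta> \<Longrightarrow>
    (\<exists>t. c - \<rho> < t \<and> t < c \<and> D t $ 1 = \<xi>) \<and> (\<exists>t. c < t \<and> t < c + \<rho> \<and> D t $ 1 = \<xi>)"
proof -
  define \<rho>' where "\<rho>' = min \<rho> e / 2"
  have \<rho>': "0 < \<rho>'" "\<rho>' < \<rho>" "\<rho>' < e" using assms by (auto simp: \<rho>'_def)
  define A B where "A = D (c - \<rho>') $ 1 - D c $ 1" and "B = D (c + \<rho>') $ 1 - D c $ 1"
  have AB: "0 < d * A" "0 < d * B" using d[of "c - \<rho>'"] d[of "c + \<rho>'"] \<rho>' by (auto simp: A_def B_def)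
  have cont: "continuous_on S (\<lambda>t. D t $ 1)" for S by (rule continuous_D_component)
  have "(\<exists>t. c - \<rho> < t \<and> t < c \<and> D t $ 1 = \<xi>) \<and> (\<exists>t. c < t \<and> t < c + \<rho> \<and> D t $ 1 = \<xi>)"
    if \<xi>: "0 < d * (\<xi> - D c $ 1)" "\<bar>\<xi> - D c $ 1\<bar> < min \<bar>A\<bar> \<bar>B\<bar>" for \<xi>
  proof -
    have cases: "D c $ 1 < \<xi> \<and> \<xi> < D c $ 1 + A \<and> \<xi> < D c $ 1 + B \<or> \<xi> < D c $ 1 \<and> D c $ 1 + A < \<xi> \<and> D c $ 1 + B < \<xi>"
      using \<xi> AB by (auto simp: zero_less_mult_iff)
    have "\<exists>t\<ge>c - \<rho>'. t \<le> c \<and> D t $ 1 = \<xi>"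
      using cases IVT'[of "\<lambda>t. D t $ 1" "c - \<rho>'" \<xi> c] IVT2'[of "\<lambda>t. D t $ 1" c \<xi> "c - \<rho>'"] cont \<rho>'(1)
      by (auto simp: A_def)
    then obtain t where t: "c - \<rho>' \<le> t" "t \<le> c" "D t $ 1 = \<xi>" by blast
    have "\<exists>t\<ge>c. t \<le> c + \<rho>' \<and> D t $ 1 = \<xi>"
      using cases IVT'[of "\<lambda>t. D t $ 1" c \<xi> "c + \<rho>'"] IVT2'[of "\<lambda>t. D t $ 1" "c + \<rho>'" \<xi> c] cont \<rho>'(1)
      by (auto simp: B_def)
    then obtain t' where t': "c \<le> t'" "t' \<le> c + \<rho>'" "D t' $ 1 = \<xi>" by blast
    have "t \<noteq> c" "t' \<noteq> c" using t t' \<xi>(1) by auto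
    then show ?thesis using t t' \<rho>' by (intro conjI exI[of _ t] exI[of _ t']) auto
  qed
  moreover have "0 < min \<bar>A\<bar> \<bar>B\<bar>" using AB by auto
  ultimately show ?thesis using that by blast
qed

text \<open>The front is viewed in the direction of the \<open>y\<close>-axis, so points with smaller \<open>y\<close> are in front.\<close>

definition front_of :: "real^3 \<Rightarrow> real set" where
  "front_of P = {t. D t $ 1 = P $ 1 \<and> D t $ 3 = P $ 3 \<and> D t $ 2 < P $ 2}"

lemma front_of_periodic: "t \<in> front_of P \<Longrightarrow> t + of_int k \<in> front_of P"
  by (simp add: front_of_def D_periodic_int)

lemma compact_range_D: "compact (range D)"
proof -
  have "range D = D ` {0..1}"
  proof (intro equalityI subsetI)
    fix p assume "p \<in> range D"
    then obtain t where "p = D (frac t)" by (auto simp: D_frac)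
    then show "p \<in> D ` {0..1}" using frac_in[of t] by auto
  qed auto
  moreover have "compact (D ` {0..1})" by (intro compact_continuous_image continuous_D) auto
  ultimately show ?thesis by simp
qed

lemma closed_range_D: "closed (range D)"
  by (rule compact_imp_closed[OF compact_range_D])

text \<open>The points that have a parameter outside \<open>U\<close> in front of them, or at equal
  depth, form the sum of a compact arc and a closed ray in the \<open>y\<close>-direction, which is
  closed.\<close>

lemma front_of_window:
  assumes P: "P \<notin> range D" and U: "open U" "\<And>t k. t \<in> U \<Longrightarrow> t + of_int k \<in> U" "front_of P \<subseteq> U"
  shows "\<forall>\<^sub>F v in nhds P. v \<notin> range D \<and> front_of v \<subseteq> U"
proof -
  let ?R = "{s *\<^sub>R axis 2 1 | s. (0::real) \<le> s} :: (real^3) set"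
  define C where "C = (\<Union>p\<in>D ` ({0..1} - U). \<Union>q\<in>?R. {p + q})"
  have mem: "v \<in> C \<longleftrightarrow> (\<exists>t\<in>{0..1} - U. D t $ 1 = v $ 1 \<and> D t $ 3 = v $ 3 \<and> D t $ 2 \<le> v $ 2)" for v
  proof
    assume "v \<in> C"
    then obtain t s where "t \<in> {0..1} - U" "0 \<le> s" "v = D t + s *\<^sub>R axis 2 1" by (auto simp: C_def)
    then show "\<exists>t\<in>{0..1} - U. D t $ 1 = v $ 1 \<and> D t $ 3 = v $ 3 \<and> D t $ 2 \<le> v $ 2"
      by (intro bexI[of _ t]) (auto simp: axis_def)
  next
    assume "\<exists>t\<in>{0..1} - U. D t $ 1 = v $ 1 \<and> D t $ 3 = v $ 3 \<and> D t $ 2 \<le> v $ 2"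
    then obtain t where t: "t \<in> {0..1} - U" "D t $ 1 = v $ 1" "D t $ 3 = v $ 3" "D t $ 2 \<le> v $ 2" by blast
    then have "v = D t + (v $ 2 - D t $ 2) *\<^sub>R axis 2 1" by (simp add: vec_eq_iff forall_3 axis_def)
    moreover have "0 \<le> v $ 2 - D t $ 2" using t(4) by simp
    ultimately show "v \<in> C" using t(1) unfolding C_def by blast
  qed
  have "closed ?R"
  proof -
    have "?R = {v. v $ 1 = 0 \<and> v $ 3 = 0 \<and> 0 \<le> v $ 2}"
      by (auto simp: axis_def vec_eq_iff forall_3 intro!: exI[of _ "_ $ 2"])
    moreover have "closed {v::real^3. v $ 1 = 0 \<and> v $ 3 = 0 \<and> 0 \<le> v $ 2}"
      by (intro closed_Collect_conj closed_Collect_eq closed_Collect_le continuous_intros)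
    ultimately show ?thesis by simp
  qed
  moreover have "compact (D ` ({0..1} - U))"
    using U(1) by (intro compact_continuous_image continuous_D compact_diff) auto
  ultimately have "closed C" unfolding C_def by (rule compact_closed_sums[rotated])
  \<comment> \<open>A parameter at equal depth would put \<open>P\<close> on the curve.\<close>
  have "P \<notin> C"
  proof
    assume "P \<in> C"
    then obtain t where t: "t \<notin> U" "D t $ 1 = P $ 1" "D t $ 3 = P $ 3" "D t $ 2 \<le> P $ 2" by (auto simp: mem)
    then have "t \<notin> front_of P" using U(3) by auto
    then have "D t = P" using t by (simp add: front_of_def vec_eq_iff forall_3)
    then show False using P by auto
  qed
  have "\<forall>\<^sub>F v in nhds P. v \<in> - C \<inter> - range D"
    using \<open>P \<notin> C\<close> P \<open>closed C\<close> closed_range_D by (intro eventually_nhds_in_open) auto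
  then show ?thesis
  proof eventually_elim
    case (elim v)
    have "t \<in> U" if t: "t \<in> front_of v" for t
    proof -
      have "frac t \<in> front_of v" using t by (simp add: front_of_def D_frac)
      then have "frac t \<in> U"
        using elim frac_in[of t] by (force simp: mem front_of_def)
      then show ?thesis using U(2)[of "frac t" "\<lfloor>t\<rfloor>"] by (simp add: frac_def)
    qed
    then show ?case using elim by auto
  qed
qed

lemma front_of_unique:
  assumes "\<not> special s" "s \<in> front_of u"
  shows "front_of u = {s + of_int k | k. True}"
proof (intro equalityI subsetI)
  fix t assume "t \<in> front_of u"
  then have "front D t = front D s" using assms(2) by (simp add: front_of_def front_eq_iff)
  from not_special_front[OF assms(1) this] obtain k where "t - s = of_int k" by (auto simp: Ints_def)
  then show "t \<in> {s + of_int k | k. True}" by (auto simp: algebra_simps intro!: exI[of _ k])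
qed (use assms(2) front_of_periodic in auto)

end

section \<open>The local system of a coloured front\<close>

text \<open>Because \<open>y\<close> is the slope of the front, heights of branches can be compared
  through \<open>y\<close> alone.\<close>

lemma (in legendrian) front_slope:
  assumes "s \<noteq> t" "\<And>r. r \<in> open_segment s t \<Longrightarrow> V r $ 1 \<noteq> 0"
  obtains r where "r \<in> open_segment s t" "D s $ 3 - D t $ 3 = D r $ 2 * (D s $ 1 - D t $ 1)"
proof -
  have *: "\<exists>r. r \<in> open_segment s t \<and> D b $ 3 - D a $ 3 = D r $ 2 * (D b $ 1 - D a $ 1)"
    if "a < b" "{a<..<b} = open_segment s t" for a b
  proof -
    obtain \<xi> where \<xi>: "a < \<xi>" "\<xi> < b"
      "(D b $ 3 - D a $ 3) * V \<xi> $ 1 = (D b $ 1 - D a $ 1) * (D \<xi> $ 2 * V \<xi> $ 1)"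
      using front_mean_value[OF \<open>a < b\<close>] .
    then have "\<xi> \<in> open_segment s t" unfolding that(2)[symmetric] by simp
    moreover from this have "V \<xi> $ 1 \<noteq> 0" by (rule assms(2))
    ultimately show ?thesis using \<xi>(3) by (intro exI[of _ \<xi>]) (simp add: mult.commute)
  qed
  show ?thesis
  proof (cases "s < t")
    case True
    then obtain r where "r \<in> open_segment s t" "D t $ 3 - D s $ 3 = D r $ 2 * (D t $ 1 - D s $ 1)"
      using *[of s t] by (auto simp: open_segment_eq_real_ivl)
    then show ?thesis using that[of r] by (simp add: right_diff_distrib)
  next
    case False
    then obtain r where "r \<in> open_segment s t" "D s $ 3 - D t $ 3 = D r $ 2 * (D s $ 1 - D t $ 1)"
      using *[of t s] assms(1) by (auto simp: open_segment_eq_real_ivl)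
    then show ?thesis by (rule that)
  qed
qed

text \<open>\<open>a t\<close> is the colour of the strand at \<open>t\<close> or its inverse, according to whether the front runs to
  the right or to the left at \<open>t\<close>: it is the change of a section when the strand is crossed downwards
  behind it. The condition at a crossing says that both ways of passing from above to below the
  crossing give the same change.\<close>

locale coloured_front = front_diagram D for D +
  fixes a :: "real \<Rightarrow> 'g::group_add"
  assumes a_periodic: "a (t + of_int k) = a t"
    and a_regular: "\<lbrakk>\<not> cusp t; \<nexists>p. over p t\<rbrakk> \<Longrightarrow> \<exists>e>0. \<forall>s. \<bar>s - t\<bar> < e \<longrightarrow> a s = a t"
    and a_cusp: "cusp t \<Longrightarrow> \<exists>e>0. \<exists>g. \<forall>s. (t - e < s \<and> s < t \<longrightarrow> a s = g) \<and> (t < s \<and> s < t + e \<longrightarrow> a s = - g)"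
    and a_crossing: "over p q \<Longrightarrow> \<exists>e>0. \<exists>g h. a p + h = g + a p \<and> (\<forall>s. \<bar>s - q\<bar> < e \<longrightarrow>
        (D s $ 1 < D q $ 1 \<longrightarrow> a s = g) \<and> (D q $ 1 < D s $ 1 \<longrightarrow> a s = h))"
begin

section \<open>Germs of a coloured front and the sections behind them\<close>

abbreviation Iv :: "real \<Rightarrow> real \<Rightarrow> real set" where "Iv t r \<equiv> {t - r<..<t + r}"

text \<open>\<open>t\<close> itself may be special: the over-branch of a crossing keeps its colour
  there.\<close>

definition regular_germ :: "real \<Rightarrow> real \<Rightarrow> bool" where
  "regular_germ t r \<longleftrightarrow> r > 0 \<and> (\<forall>s\<in>Iv t r. \<not> cusp s \<and> a s = a t \<and> (s \<noteq> t \<longrightarrow> \<not> special s))"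

text \<open>The bound \<open>1/2\<close> keeps both branches within one period, so that they are
  made of different points of the curve.\<close>

definition cusp_germ :: "real \<Rightarrow> real \<Rightarrow> 'g \<Rightarrow> bool" where
  "cusp_germ t r g \<longleftrightarrow> 0 < r \<and> r \<le> 1/2 \<and> cusp t \<and>
     (\<exists>d. \<forall>s\<in>Iv t r. s \<noteq> t \<longrightarrow> 0 < d * (D s $ 1 - D t $ 1)) \<and> (\<forall>s\<in>Iv t r. s \<noteq> t \<longrightarrow> \<not> special s) \<and>
     (\<forall>s\<in>{t - r<..<t}. a s = g) \<and> (\<forall>s\<in>{t<..<t + r}. a s = - g)"

text \<open>The depths of the branches are separated on both intervals as a whole; as
  \<open>y\<close> is the slope, this orders their heights on either side of the crossing.\<close>

definition crossing_germ :: "real \<Rightarrow> real \<Rightarrow> real \<Rightarrow> 'g \<Rightarrow> 'g \<Rightarrow> bool" where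
  "crossing_germ p q r g h \<longleftrightarrow> regular_germ p r \<and> over p q \<and> a p + h = g + a p \<and>
     (\<forall>s\<in>Iv q r. \<not> cusp s \<and> (s \<noteq> q \<longrightarrow> \<not> special s) \<and>
       (D s $ 1 < D q $ 1 \<longrightarrow> a s = g) \<and> (D q $ 1 < D s $ 1 \<longrightarrow> a s = h)) \<and>
     (\<forall>s\<in>Iv p r. \<forall>s'\<in>Iv q r. D s $ 2 < D s' $ 2)"

definition translates :: "real \<Rightarrow> real set" where
  "translates t = {t + of_int k | k. True}"

lemma translates_self: "t \<in> translates t"
  by (auto simp: translates_def intro!: exI[of _ 0])

lemma translates_iff: "s \<in> translates t \<longleftrightarrow> s - t \<in> \<int>"
proof
  assume "s - t \<in> \<int>"
  then obtain k where "s - t = of_int k" by (auto simp: Ints_def)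
  then show "s \<in> translates t" by (auto simp: translates_def algebra_simps intro!: exI[of _ k])
qed (auto simp: translates_def)

lemma translates_eq:
  assumes "s \<in> translates t"
  shows "translates s = translates t"
proof -
  have "r - s \<in> \<int> \<longleftrightarrow> r - t \<in> \<int>" for r
    using Ints_add[of "r - s" "s - t"] Ints_diff[of "r - t" "s - t"] assms by (auto simp: translates_iff)
  then show ?thesis by (auto simp: translates_iff)
qed

definition saturation :: "real set \<Rightarrow> real set" where
  "saturation I = {t. \<exists>k. t + of_int k \<in> I}"

lemma open_saturation: "open I \<Longrightarrow> open (saturation I)"
proof -
  assume "open I"
  then have "open ((\<lambda>t. t + of_int k) -` I)" for k by (intro open_vimage continuous_intros)
  moreover have "saturation I = (\<Union>k. (\<lambda>t. t + of_int k) -` I)" by (auto simp: saturation_def)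
  ultimately show ?thesis by auto
qed

lemma saturation_shift:
  assumes "t \<in> saturation I"
  shows "t + of_int j \<in> saturation I"
proof -
  obtain k where "t + of_int k \<in> I" using assms by (auto simp: saturation_def)
  then show ?thesis by (auto simp: saturation_def intro!: exI[of _ "k - j"])
qed

lemma translates_saturation:
  assumes "t \<in> I" "s \<in> translates t"
  shows "s \<in> saturation I"
proof -
  obtain k where "s = t + of_int k" using assms(2) by (auto simp: translates_def)
  then show ?thesis using assms(1) by (auto simp: saturation_def intro!: exI[of _ "- k"])
qed

lemma saturationE:
  assumes "t \<in> saturation I"
  obtains k s where "t = s + of_int k" "s \<in> I"
proof -
  obtain k where "t + of_int k \<in> I" using assms by (auto simp: saturation_def)
  then show ?thesis using that[of "t + of_int k" "- k"] by simp
qed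

definition regular_section :: "real \<Rightarrow> real \<Rightarrow> real^3 \<Rightarrow> 'g" where
  "regular_section t r v = (if below (Iv t r) v then a t else 0)"

text \<open>Below both branches \<open>g\<close> and \<open>- g\<close> cancel, so the section
  closes up around the tip of the cusp.\<close>

definition cusp_section :: "real \<Rightarrow> real \<Rightarrow> 'g \<Rightarrow> real^3 \<Rightarrow> 'g" where
  "cusp_section t r g v = (if below {t - r<..<t} v then g else 0) + (if below {t<..<t + r} v then - g else 0)"

text \<open>The summands follow the order to the right of the crossing: there a descending path
  meets the under-branch, of colour \<open>h\<close>, first, and later changes are added on the
  left.\<close>

definition crossing_section :: "real \<Rightarrow> real \<Rightarrow> real \<Rightarrow> 'g \<Rightarrow> real^3 \<Rightarrow> 'g" where
  "crossing_section p q r h v = (if below (Iv p r) v then a p else 0) + (if below (Iv q r) v then h else 0)"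

text \<open>A relation and not a function, because the representative parameter and the radius of
  the germ are arbitrary.\<close>

definition section_at :: "real^3 \<Rightarrow> (real^3 \<Rightarrow> 'g) \<Rightarrow> bool" where
  "section_at P f \<longleftrightarrow>
     (front_of P = {} \<and> f = (\<lambda>_. 0)) \<or>
     (\<exists>t r. front_of P = translates t \<and> regular_germ t r \<and> f = regular_section t r) \<or>
     (\<exists>t r g. front_of P = translates t \<and> cusp_germ t r g \<and> f = cusp_section t r g) \<or>
     (\<exists>p q r g h. front_of P = translates p \<union> translates q \<and> crossing_germ p q r g h \<and> f = crossing_section p q r h)"

lemma front_of_translates: "t \<in> front_of P \<Longrightarrow> translates t \<subseteq> front_of P"
  using front_of_periodic by (auto simp: translates_def)

lemma front_of_not_special:
  "\<not> special s \<Longrightarrow> s \<in> front_of u \<Longrightarrow> front_of u = translates s"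
  using front_of_unique by (simp add: translates_def)

lemma regular_germ_exists:
  assumes "\<not> cusp t" "\<nexists>p. over p t"
  obtains r where "regular_germ t r"
proof -
  obtain e where e: "e > 0" "\<forall>s. \<bar>s - t\<bar> < e \<longrightarrow> a s = a t" using a_regular[OF assms] by blast
  obtain e' where e': "e' > 0" "\<And>s. 0 < \<bar>s - t\<bar> \<Longrightarrow> \<bar>s - t\<bar> < e' \<Longrightarrow> \<not> special s"
    using special_discrete[of t] by blast
  have "regular_germ t (min e e')"
    unfolding regular_germ_def
  proof (intro conjI ballI)
    fix s assume s: "s \<in> Iv t (min e e')"
    then have *: "\<bar>s - t\<bar> < e" "\<bar>s - t\<bar> < e'" by auto
    then show "a s = a t" using e by blast
    show "s \<noteq> t \<longrightarrow> \<not> special s" using e'(2) * by auto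
    then show "\<not> cusp s" using assms(1) by (cases "s = t") (auto simp: special_def)
  qed (use e e' in auto)
  then show ?thesis by (rule that)
qed

lemma cusp_germ_exists:
  assumes "cusp t"
  obtains r g where "cusp_germ t r g"
proof -
  obtain e g where e: "e > 0" "\<forall>s. (t - e < s \<and> s < t \<longrightarrow> a s = g) \<and> (t < s \<and> s < t + e \<longrightarrow> a s = - g)"
    using a_cusp[OF assms] by blast
  obtain e' where e': "e' > 0" "\<And>s. 0 < \<bar>s - t\<bar> \<Longrightarrow> \<bar>s - t\<bar> < e' \<Longrightarrow> \<not> special s"
    using special_discrete[of t] by blast
  obtain d e'' where d: "e'' > 0" "\<And>s. 0 < \<bar>s - t\<bar> \<Longrightarrow> \<bar>s - t\<bar> < e'' \<Longrightarrow> 0 < d * (D s $ 1 - D t $ 1)"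
    using cusp_side[OF assms] by metis
  define r where "r = Min {e, e', e'', 1/2}"
  have r: "r > 0" "r \<le> e" "r \<le> e'" "r \<le> e''" "r \<le> 1/2"
    using e(1) e'(1) d(1) by (auto simp: r_def)
  have "cusp_germ t r g"
    unfolding cusp_germ_def
  proof (intro conjI ballI impI exI[of _ d])
    fix s assume s: "s \<in> Iv t r" "s \<noteq> t"
    then have "0 < \<bar>s - t\<bar>" "\<bar>s - t\<bar> < r" by auto
    then show "\<not> special s" "0 < d * (D s $ 1 - D t $ 1)" using e'(2) d(2) r by auto
  qed (use e(2) r assms in auto)
  then show ?thesis by (rule that)
qed

lemma crossing_germ_exists:
  assumes pq: "over p q"
  obtains r g h where "crossing_germ p q r g h"
proof -
  obtain e g h where e: "e > 0" "a p + h = g + a p" "\<forall>s. \<bar>s - q\<bar> < e \<longrightarrow>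
      (D s $ 1 < D q $ 1 \<longrightarrow> a s = g) \<and> (D q $ 1 < D s $ 1 \<longrightarrow> a s = h)"
    using a_crossing[OF pq] by blast
  \<comment> \<open>The over-branch of a crossing cannot also pass under a third branch at the same
    point, as there are no triple points.\<close>
  have "\<nexists>w. over w p"
  proof
    assume "\<exists>w. over w p"
    then obtain w where w: "over w p" ..
    then have "w - p \<in> \<int> \<or> p - q \<in> \<int> \<or> w - q \<in> \<int>"
      using pq no_triple[of w p q] by (auto simp: over_def)
    then show False
      using over_not_int[OF w] over_not_int[OF pq] over_not_int[of w q] w pq by (auto simp: over_def)
  qed
  then obtain r where r: "regular_germ p r"
    using regular_germ_exists over_regular[OF pq] by blast
  obtain e' where e': "e' > 0" "\<And>s. 0 < \<bar>s - q\<bar> \<Longrightarrow> \<bar>s - q\<bar> < e' \<Longrightarrow> \<not> special s"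
    using special_discrete[of q] by blast
  define m where "m = (D p $ 2 + D q $ 2) / 2"
  have m: "D p $ 2 < m" "m < D q $ 2" using pq by (auto simp: over_def m_def)
  have op: "open {s. D s $ 2 < m}" "open {s. m < D s $ 2}"
    by (intro open_Collect_less continuous_D_component continuous_intros)+
  obtain d where d: "d > 0" "ball p d \<subseteq> {s. D s $ 2 < m}" using openE[OF op(1), of p] m by blast
  obtain d' where d': "d' > 0" "ball q d' \<subseteq> {s. m < D s $ 2}" using openE[OF op(2), of q] m by blast
  define R where "R = Min {e, r, e', d, d'}"
  have R: "R > 0" "R \<le> e" "R \<le> r" "R \<le> e'" "R \<le> d" "R \<le> d'"
    using e(1) r e'(1) d(1) d'(1) by (auto simp: R_def regular_germ_def)
  have "Iv p R \<subseteq> Iv p r" using R(3) by auto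
  then have "regular_germ p R"
    using r R(1) unfolding regular_germ_def by blast
  moreover have "\<not> cusp s \<and> (s \<noteq> q \<longrightarrow> \<not> special s) \<and>
       (D s $ 1 < D q $ 1 \<longrightarrow> a s = g) \<and> (D q $ 1 < D s $ 1 \<longrightarrow> a s = h)" if s: "s \<in> Iv q R" for s
  proof (intro conjI)
    have *: "\<bar>s - q\<bar> < e" "\<bar>s - q\<bar> < e'" using s R by auto
    show "s \<noteq> q \<longrightarrow> \<not> special s" using e'(2) * by auto
    then show "\<not> cusp s" using over_regular[OF pq] by (cases "s = q") (auto simp: special_def)
    show "D s $ 1 < D q $ 1 \<longrightarrow> a s = g" "D q $ 1 < D s $ 1 \<longrightarrow> a s = h" using e(3) * by blast+
  qed
  moreover have "D s $ 2 < D s' $ 2" if "s \<in> Iv p R" "s' \<in> Iv q R" for s s'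
  proof -
    have "s \<in> ball p d" "s' \<in> ball q d'" using that R by (auto simp: dist_real_def)
    then have "D s $ 2 < m" "m < D s' $ 2" using d(2) d'(2) by auto
    then show ?thesis by simp
  qed
  ultimately have "crossing_germ p q R g h"
    using pq e(2) unfolding crossing_germ_def by blast
  then show ?thesis by (rule that)
qed

lemma section_at_exists:
  assumes "P \<notin> range D"
  obtains f where "section_at P f"
proof (cases "front_of P = {}")
  case True
  then show ?thesis using that[of "\<lambda>_. 0"] by (simp add: section_at_def)
next
  case False
  then obtain t where t: "t \<in> front_of P" by blast
  have fr: "front D s = front D s'" if "s \<in> front_of P" "s' \<in> front_of P" for s s'
    using that by (simp add: front_of_def front_eq_iff)
  show ?thesis
  proof (cases "front_of P = translates t")
    case True
    show ?thesis
    proof (cases "cusp t")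
      case True
      then obtain r g where "cusp_germ t r g" by (rule cusp_germ_exists)
      then show ?thesis
        using \<open>front_of P = translates t\<close> that[of "cusp_section t r g"] unfolding section_at_def by blast
    next
      case False
      have "\<nexists>p. over p t"
      proof
        assume "\<exists>p. over p t"
        then obtain p where p: "over p t" ..
        then have "p \<in> front_of P" using t by (auto simp: over_def front_of_def front_eq_iff)
        then show False using \<open>front_of P = translates t\<close> over_not_int[OF p] by (simp add: translates_iff)
      qed
      with False obtain r where "regular_germ t r" by (rule regular_germ_exists)
      then show ?thesis
        using \<open>front_of P = translates t\<close> that[of "regular_section t r"] unfolding section_at_def by blast
    qed
  next
    case False
    then obtain s where s: "s \<in> front_of P" "s \<notin> translates t"
      using front_of_translates[OF t] by blast
    obtain p q where pq: "p \<in> front_of P" "q \<in> front_of P" "over p q"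
      using same_front[OF fr[OF s(1) t]] s t translates_iff by blast
    have "front_of P = translates p \<union> translates q"
    proof (intro equalityI subsetI)
      fix r assume "r \<in> front_of P"
      then have "r - p \<in> \<int> \<or> p - q \<in> \<int> \<or> r - q \<in> \<int>"
        using no_triple fr pq by blast
      then show "r \<in> translates p \<union> translates q" using over_not_int[OF pq(3)] by (auto simp: translates_iff)
    qed (use front_of_translates pq in blast)
    moreover obtain r g h where "crossing_germ p q r g h" using crossing_germ_exists[OF pq(3)] .
    ultimately show ?thesis
      using that[of "crossing_section p q r h"] unfolding section_at_def by blast
  qed
qed

lemma Iv_inj_on:
  assumes "\<And>s. s \<in> Iv t r \<Longrightarrow> \<not> cusp s"
  shows "inj_on (\<lambda>t. D t $ 1) (Iv t r)"
  by (rule inj_on_subset[OF x_inj_on[of "t - r" "t + r"]]) (use assms in auto)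

text \<open>With a single class of regular parameters in front of \<open>u\<close>, a section at
  \<open>u\<close> cannot be of empty, cusp or crossing type; the germ of \<open>below\<close> does
  not depend on the interval.\<close>

lemma section_at_regular:
  assumes fo: "front_of u = translates s" and s: "\<not> cusp s" and f: "section_at u f"
    and I: "open I" "inj_on (\<lambda>t. D t $ 1) I" "s \<in> I"
  shows "\<forall>\<^sub>F v in nhds u. f v = (if below I v then a s else 0)"
proof -
  have "s \<in> front_of u" by (simp add: fo translates_self)
  then have su: "D s $ 1 = u $ 1" by (simp add: front_of_def)
  from f obtain t r where t: "front_of u = translates t" "regular_germ t r" "f = regular_section t r"
  proof (unfold section_at_def, elim disjE exE conjE)
    fix p q r g h assume "front_of u = translates p \<union> translates q" and g: "crossing_germ p q r g h"
    then have "p \<in> translates s" "q \<in> translates s" using translates_self fo by auto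
    then have "p \<in> translates q" using translates_eq translates_self by blast
    then show thesis using g over_not_int by (auto simp: crossing_germ_def translates_iff)
  next
    fix t r g assume "front_of u = translates t" and g: "cusp_germ t r g"
    then have "t \<in> translates s" using translates_self fo by auto
    then show thesis using g s by (auto simp: cusp_germ_def translates_def V_periodic_int)
  next
    assume "front_of u = {}"
    then show thesis using fo translates_self[of s] by simp
  qed (use that in blast)
  then have "t \<in> translates s" using fo translates_self[of t] by simp
  then obtain k where k: "t = s + of_int k" by (auto simp: translates_def)
  have "\<forall>\<^sub>F v in nhds u. below I v = below (Iv t r) v"
    using t(2) su I k unfolding regular_germ_def
    by (intro below_germ_unique[of I s u "Iv t r" k] Iv_inj_on) auto
  then show ?thesis
    by eventually_elim (simp add: t(3) regular_section_def k a_periodic)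
qed

section \<open>Compatibility of the sections at neighbouring points\<close>

lemma section_at_empty: "front_of u = {} \<Longrightarrow> section_at u f \<Longrightarrow> f = (\<lambda>_. 0)"
  using translates_self by (auto simp: section_at_def)

text \<open>Quantifies over all sections at \<open>u\<close>, so that the later choice of one
  section per point is harmless.\<close>

definition compatible_at :: "(real^3 \<Rightarrow> 'g) \<Rightarrow> real^3 \<Rightarrow> bool" where
  "compatible_at f u \<longleftrightarrow> (\<forall>f'. section_at u f' \<longrightarrow> (\<exists>g. \<forall>\<^sub>F v in nhds u. f v = f' v + g))"

lemma compatible_empty:
  assumes "front_of u = {}" "\<forall>\<^sub>F v in nhds u. f v = c"
  shows "compatible_at f u"
  unfolding compatible_at_def
proof (intro allI impI exI[of _ c])
  fix f' assume "section_at u f'"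
  then have "f' = (\<lambda>_. 0)" by (rule section_at_empty[OF assms(1)])
  then show "\<forall>\<^sub>F v in nhds u. f v = f' v + c" using assms(2) by simp
qed

lemma compatible_on_branch:
  assumes "front_of u = translates s" "\<not> cusp s" "open I" "inj_on (\<lambda>t. D t $ 1) I" "s \<in> I"
    and "\<forall>\<^sub>F v in nhds u. f v = (if below I v then a s else 0) + c"
  shows "compatible_at f u"
  unfolding compatible_at_def
proof (intro allI impI exI[of _ c])
  fix f' assume "section_at u f'"
  from section_at_regular[OF assms(1,2) this assms(3-5)] assms(6)
  show "\<forall>\<^sub>F v in nhds u. f v = f' v + c" by eventually_elim simp
qed

text \<open>By continuity the depth \<open>m\<close> halfway between the strand and \<open>P\<close>
  still separates nearby points from the branch points in front of them.\<close>

lemma branch_behind: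
  assumes I: "open I" "inj_on (\<lambda>t. D t $ 1) I" "t \<in> I" and t: "t \<in> front_of P"
  shows "\<forall>\<^sub>F v in nhds P. (\<exists>s\<in>I. D s $ 1 = v $ 1) \<and> (\<forall>s\<in>I. D s $ 1 = v $ 1 \<longrightarrow> D s $ 2 < v $ 2)"
proof -
  define m where "m = (D t $ 2 + P $ 2) / 2"
  have m: "D t $ 2 < m" "m < P $ 2" "D t $ 1 = P $ 1" using t by (auto simp: front_of_def m_def)
  have "open {s. D s $ 2 < m}" by (intro open_Collect_less continuous_D_component continuous_intros)
  then have "\<forall>\<^sub>F v in nhds P. \<exists>s\<in>I \<inter> {s. D s $ 2 < m}. D s $ 1 = v $ 1"
    using m I by (intro eventually_x_image[of _ t] inj_on_subset[OF I(2)]) auto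
  moreover have "\<forall>\<^sub>F v in nhds P. v $ 2 \<in> {m<..}"
    using m by (intro eventually_component) auto
  ultimately show ?thesis
  proof eventually_elim
    case (elim v)
    then obtain s where s: "s \<in> I" "D s $ 2 < m" "D s $ 1 = v $ 1" by auto
    have "\<And>s'. s' \<in> I \<Longrightarrow> D s' $ 1 = v $ 1 \<Longrightarrow> s' = s" using inj_onD[OF I(2), of _ s] s by simp
    moreover have "D s $ 2 < v $ 2" using s(2) elim(2) by simp
    ultimately show ?case using s(1,3) by blast
  qed
qed

text \<open>A nearby point is either behind the strand, where its own sections are those of the
  branch, or off the strand in the front, where \<open>below\<close> is locally constant.\<close>

lemma compatible_regular:
  assumes P: "P \<notin> range D" and fo: "front_of P = translates t" and t: "regular_germ t r"
  shows "\<forall>\<^sub>F u in nhds P. compatible_at (regular_section t r) u"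
proof -
  let ?I = "Iv t r"
  let ?U = "saturation ?I"
  have tI: "t \<in> ?I" and inj: "inj_on (\<lambda>t. D t $ 1) ?I"
    using t by (auto simp: regular_germ_def intro!: Iv_inj_on)
  have U: "open ?U" "\<And>s k. s \<in> ?U \<Longrightarrow> s + of_int k \<in> ?U" "front_of P \<subseteq> ?U"
    using tI fo by (auto intro: open_saturation saturation_shift translates_saturation[OF tI])
  have tP: "t \<in> front_of P" using fo translates_self by simp
  have "\<forall>\<^sub>F v in nhds P. v \<notin> range D \<and> front_of v \<subseteq> ?U"
    by (rule front_of_window[OF P U(1) _ U(3)]) (rule U(2))
  then show ?thesis
    using branch_behind[OF open_greaterThanLessThan inj tI tP]
  proof eventually_elim
    case (elim u)
    obtain s where s: "s \<in> ?I" "D s $ 1 = u $ 1" using elim(2) by blast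
    have sub: "front_of u \<subseteq> translates s"
    proof
      fix s' assume s': "s' \<in> front_of u"
      then obtain k x where x: "s' = x + of_int k" "x \<in> ?I" using elim(1) by (blast elim: saturationE)
      then have "D x $ 1 = D s $ 1" using s' s by (simp add: front_of_def D_periodic_int)
      then have "x = s" using inj_onD[OF inj] s(1) x(2) by blast
      then show "s' \<in> translates s" using x by (auto simp: translates_def)
    qed
    show ?case
    proof (cases "D s $ 3 = u $ 3")
      case True
      then have "s \<in> front_of u" using s elim(2) by (simp add: front_of_def)
      then have fo: "front_of u = translates s" using sub front_of_translates by blast
      have "\<not> cusp s" "a s = a t" using t s(1) unfolding regular_germ_def by blast+
      then show ?thesis
        by (intro compatible_on_branch[OF fo _ open_greaterThanLessThan inj s(1), where c = 0])
           (simp_all add: regular_section_def)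
    next
      case False
      have "front_of u = {}"
      proof (rule ccontr)
        assume "front_of u \<noteq> {}"
        then obtain s' where "s' \<in> front_of u" "s' \<in> translates s" using sub by blast
        then show False using False by (auto simp: front_of_def translates_def D_periodic_int)
      qed
      moreover have "\<forall>\<^sub>F v in nhds u. regular_section t r v = (if u $ 3 < D s $ 3 then a t else 0)"
        using below_off_branch[OF open_greaterThanLessThan inj s False]
        by eventually_elim (simp add: regular_section_def)
      ultimately show ?thesis by (rule compatible_empty)
    qed
  qed
qed

lemma cusp_germ_inj_on:
  assumes "cusp_germ t r g"
  shows "inj_on (\<lambda>t. D t $ 1) {t - r<..<t}" "inj_on (\<lambda>t. D t $ 1) {t<..<t + r}"
proof -
  have "\<not> cusp s" if "s \<in> Iv t r" "s \<noteq> t" for s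
    using assms that by (auto simp: cusp_germ_def special_def)
  then show "inj_on (\<lambda>t. D t $ 1) {t - r<..<t}" "inj_on (\<lambda>t. D t $ 1) {t<..<t + r}"
    by (auto intro: inj_on_subset[OF x_inj_on[of "t - r" t]] inj_on_subset[OF x_inj_on[of t "t + r"]])
qed

lemma cusp_germ_branches:
  fixes u :: "real^3"
  assumes t: "cusp_germ t r g" and d: "\<And>s. s \<in> Iv t r \<Longrightarrow> s \<noteq> t \<Longrightarrow> 0 < d * (D s $ 1 - D t $ 1)"
    and U: "open U" "t \<in> U" and u: "u $ 1 = D t $ 1"
  shows "\<forall>\<^sub>F v in nhds u. 0 < d * (v $ 1 - D t $ 1) \<longrightarrow>
    (\<exists>s\<in>{t - r<..<t} \<inter> U. D s $ 1 = v $ 1) \<and> (\<exists>s\<in>{t<..<t + r} \<inter> U. D s $ 1 = v $ 1)"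
proof -
  obtain e where e: "e > 0" "ball t e \<subseteq> U" using U openE by blast
  define \<rho> where "\<rho> = min e r"
  have \<rho>: "\<rho> > 0" "\<rho> \<le> e" "\<rho> \<le> r" "r > 0" using e t by (auto simp: \<rho>_def cusp_germ_def)
  have "0 < d * (D s $ 1 - D t $ 1)" if "0 < \<bar>s - t\<bar>" "\<bar>s - t\<bar> < r" for s
    using that by (intro d) auto
  from cusp_branches[OF this \<rho>(4,1)] obtain \<eta> where \<eta>: "\<eta> > 0"
    "\<And>\<xi>. 0 < d * (\<xi> - D t $ 1) \<Longrightarrow> \<bar>\<xi> - D t $ 1\<bar> < \<eta> \<Longrightarrow>
    (\<exists>s. t - \<rho> < s \<and> s < t \<and> D s $ 1 = \<xi>) \<and> (\<exists>s. t < s \<and> s < t + \<rho> \<and> D s $ 1 = \<xi>)"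
    by metis
  have "\<forall>\<^sub>F v in nhds u. v $ 1 \<in> ball (D t $ 1) \<eta>"
    using \<eta>(1) u by (intro eventually_component) auto
  then show ?thesis
  proof eventually_elim
    case (elim v)
    have LU: "s \<in> U" if "t - \<rho> < s" "s < t + \<rho>" for s
    proof -
      have "\<bar>t - s\<bar> < e" using that \<rho>(2) by (simp add: abs_less_iff)
      then show ?thesis using e(2) by (auto simp: dist_real_def)
    qed
    show ?case
    proof
      assume "0 < d * (v $ 1 - D t $ 1)"
      then obtain s s' where "t - \<rho> < s" "s < t" "D s $ 1 = v $ 1" "t < s'" "s' < t + \<rho>" "D s' $ 1 = v $ 1"
        using \<eta>(2)[of "v $ 1"] elim by (auto simp: dist_real_def abs_minus_commute)
      then show "(\<exists>s\<in>{t - r<..<t} \<inter> U. D s $ 1 = v $ 1) \<and> (\<exists>s\<in>{t<..<t + r} \<inter> U. D s $ 1 = v $ 1)"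
        using LU[of s] LU[of s'] \<rho> by (intro conjI bexI[of _ s] bexI[of _ s']) auto
    qed
  qed
qed

text \<open>Near the vertical line through the tip, but at a different height, both branches lie on
  the same side of the point, so the two terms are both absent or cancel.\<close>

lemma cusp_section_vanishes:
  assumes t: "cusp_germ t r g" and u: "u $ 1 = D t $ 1" "u $ 3 \<noteq> D t $ 3"
  shows "\<forall>\<^sub>F v in nhds u. cusp_section t r g v = 0"
proof -
  obtain d where d: "\<And>s. s \<in> Iv t r \<Longrightarrow> s \<noteq> t \<Longrightarrow> 0 < d * (D s $ 1 - D t $ 1)"
    using t unfolding cusp_germ_def by blast
  define m where "m = (u $ 3 + D t $ 3) / 2"
  define U W where "U = (if u $ 3 < D t $ 3 then {s. m < D s $ 3} else {s. D s $ 3 < m})"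
    and "W = (if u $ 3 < D t $ 3 then {..<m} else {m<..})"
  have "open U" unfolding U_def by (auto intro!: open_Collect_less continuous_D_component continuous_intros)
  moreover have "t \<in> U" using u by (auto simp: U_def m_def)
  ultimately have "\<forall>\<^sub>F v in nhds u. 0 < d * (v $ 1 - D t $ 1) \<longrightarrow>
    (\<exists>s\<in>{t - r<..<t} \<inter> U. D s $ 1 = v $ 1) \<and> (\<exists>s\<in>{t<..<t + r} \<inter> U. D s $ 1 = v $ 1)"
    using cusp_germ_branches[OF t d _ _ u(1)] by blast
  moreover have "\<forall>\<^sub>F v in nhds u. v $ 3 \<in> W"
    using u by (intro eventually_component) (auto simp: W_def m_def)
  ultimately show ?thesis
  proof eventually_elim
    case (elim v)
    have "below {t - r<..<t} v = below {t<..<t + r} v"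
    proof (cases "0 < d * (v $ 1 - D t $ 1)")
      case True
      then obtain s s' where s: "s \<in> {t - r<..<t}" "s \<in> U" "D s $ 1 = v $ 1"
          "s' \<in> {t<..<t + r}" "s' \<in> U" "D s' $ 1 = v $ 1"
        using elim(1) by auto
      have "x = s" if "x \<in> {t - r<..<t}" "D x $ 1 = v $ 1" for x
        using inj_onD[OF cusp_germ_inj_on(1)[OF t], of x s] s that by simp
      then have "below {t - r<..<t} v = (v $ 3 < D s $ 3)"
        using s unfolding below_def by blast
      moreover have "x = s'" if "x \<in> {t<..<t + r}" "D x $ 1 = v $ 1" for x
        using inj_onD[OF cusp_germ_inj_on(2)[OF t], of x s'] s that by simp
      then have "below {t<..<t + r} v = (v $ 3 < D s' $ 3)"
        using s unfolding below_def by blast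
      ultimately show ?thesis using s(2,5) elim(2) by (auto simp: U_def W_def split: if_splits)
    next
      case False
      have "D s $ 1 \<noteq> v $ 1" if "s \<in> Iv t r" "s \<noteq> t" for s using d[OF that] False by auto
      then have "D s $ 1 \<noteq> v $ 1" if "s \<in> {t - r<..<t} \<or> s \<in> {t<..<t + r}" for s
        using that by auto
      then show ?thesis by (auto simp: below_def)
    qed
    then show ?case by (simp add: cusp_section_def)
  qed
qed

text \<open>The colour and the side of the cusp can be read off at a common parameter before the
  tip, so two germs at translated parameters have the same data.\<close>

lemma cusp_section_unique:
  assumes t: "cusp_germ t r g" and t': "cusp_germ t' r' g'" "t' = t + of_int k" and u: "u $ 1 = D t $ 1"
  shows "\<forall>\<^sub>F v in nhds u. cusp_section t r g v = cusp_section t' r' g' v"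
proof -
  obtain d where d: "\<And>s. s \<in> Iv t r \<Longrightarrow> s \<noteq> t \<Longrightarrow> 0 < d * (D s $ 1 - D t $ 1)"
    using t unfolding cusp_germ_def by blast
  obtain d' where d': "\<And>s. s \<in> Iv t' r' \<Longrightarrow> s \<noteq> t' \<Longrightarrow> 0 < d' * (D s $ 1 - D t' $ 1)"
    using t'(1) unfolding cusp_germ_def by blast
  define \<rho> where "\<rho> = min r r'"
  have \<rho>: "\<rho> > 0" "\<rho> \<le> r" "\<rho> \<le> r'" using t t' by (auto simp: \<rho>_def cusp_germ_def)
  have x: "D (s + of_int k) = D s" "a (s + of_int k) = a s" for s by (rule D_periodic_int a_periodic)+
  have "a (t - \<rho> / 2) = g" using t \<rho> by (auto simp: cusp_germ_def)
  moreover have "a (t - \<rho> / 2 + of_int k) = g'"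
  proof -
    have "t - \<rho> / 2 + of_int k \<in> {t' - r'<..<t'}" using t'(2) \<rho> by auto
    then show ?thesis using t'(1) unfolding cusp_germ_def by blast
  qed
  ultimately have g: "g' = g" by (simp only: x)
  have "0 < d * (D (t - \<rho> / 2) $ 1 - D t $ 1)" using d[of "t - \<rho> / 2"] \<rho> by auto
  moreover have "0 < d' * (D (t - \<rho> / 2) $ 1 - D t $ 1)"
    using d'[of "t - \<rho> / 2 + of_int k"] \<rho> unfolding t'(2) x by auto
  ultimately have dd: "0 < d * y \<longleftrightarrow> 0 < d' * y" for y by (auto simp: zero_less_mult_iff)
  have "\<forall>\<^sub>F v in nhds u. 0 < d * (v $ 1 - D t $ 1) \<longrightarrow>
    (\<exists>s\<in>{t - r<..<t} \<inter> Iv t \<rho>. D s $ 1 = v $ 1) \<and> (\<exists>s\<in>{t<..<t + r} \<inter> Iv t \<rho>. D s $ 1 = v $ 1)"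
    using \<rho> by (intro cusp_germ_branches[OF t d _ _ u]) auto
  then show ?thesis
  proof eventually_elim
    case (elim v)
    have "below {t - r<..<t} v = below {t' - r'<..<t'} v \<and> below {t<..<t + r} v = below {t'<..<t' + r'} v"
    proof (cases "0 < d * (v $ 1 - D t $ 1)")
      case True
      then obtain s s' where s: "s \<in> {t - r<..<t}" "s \<in> Iv t \<rho>" "D s $ 1 = v $ 1"
          "s' \<in> {t<..<t + r}" "s' \<in> Iv t \<rho>" "D s' $ 1 = v $ 1"
        using elim(1) by auto
      have *: "below I v = (v $ 3 < D y $ 3)" if "inj_on (\<lambda>t. D t $ 1) I" "y \<in> I" "D y $ 1 = v $ 1" for I y
      proof -
        have "z = y" if "z \<in> I" "D z $ 1 = v $ 1" for z
          using inj_onD[OF \<open>inj_on _ I\<close>, of z y] that \<open>y \<in> I\<close> \<open>D y $ 1 = v $ 1\<close> by simp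
        then show ?thesis using that unfolding below_def by blast
      qed
      have "s + of_int k \<in> {t' - r'<..<t'}" "s' + of_int k \<in> {t'<..<t' + r'}"
        using s \<rho> t'(2) by auto
      then show ?thesis
        using *[OF cusp_germ_inj_on(1)[OF t], of s] *[OF cusp_germ_inj_on(2)[OF t], of s'] s
          *[OF cusp_germ_inj_on(1)[OF t'(1)], of "s + of_int k"]
          *[OF cusp_germ_inj_on(2)[OF t'(1)], of "s' + of_int k"]
        by (simp add: x)
    next
      case False
      have "D s $ 1 \<noteq> v $ 1" if "s \<in> Iv t r" "s \<noteq> t" for s using d[OF that] False by auto
      moreover have "D s $ 1 \<noteq> v $ 1" if "s \<in> Iv t' r'" "s \<noteq> t'" for s
        using d'[OF that] False unfolding t'(2) x dd by auto
      ultimately have "D s $ 1 \<noteq> v $ 1"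
        if "s \<in> {t - r<..<t} \<or> s \<in> {t<..<t + r} \<or> s \<in> {t' - r'<..<t'} \<or> s \<in> {t'<..<t' + r'}" for s
        using that by auto
      then show ?thesis by (auto simp: below_def)
    qed
    then show ?case by (simp add: cusp_section_def g)
  qed
qed

end

context coloured_front
begin

lemma front_of_empty:
  assumes "front_of u \<subseteq> translates s \<union> translates s'" "D s $ 3 \<noteq> u $ 3" "D s' $ 3 \<noteq> u $ 3"
  shows "front_of u = {}"
proof (rule ccontr)
  assume "front_of u \<noteq> {}"
  then obtain w where "w \<in> front_of u" "w \<in> translates s \<union> translates s'" using assms(1) by blast
  then show False using assms(2,3) by (auto simp: front_of_def translates_def D_periodic_int)
qed

lemma front_of_branch:
  assumes "front_of u \<subseteq> translates s \<union> translates s'" "s \<in> front_of u" "D s' $ 3 \<noteq> u $ 3"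
  shows "front_of u = translates s"
proof
  show "front_of u \<subseteq> translates s"
  proof
    fix w assume "w \<in> front_of u"
    moreover from this have "w \<notin> translates s'"
      using assms(3) by (auto simp: front_of_def translates_def D_periodic_int)
    ultimately show "w \<in> translates s" using assms(1) by blast
  qed
qed (use assms(2) front_of_translates in blast)

text \<open>The point \<open>u\<close> can be on the vertical line through the tip, on the empty
  side, or over the branches. In the last case at most one branch runs through its front position,
  as the germ contains no crossing.\<close>

lemma compatible_cusp:
  assumes P: "P \<notin> range D" and fo: "front_of P = translates t" and t: "cusp_germ t r g"
  shows "\<forall>\<^sub>F u in nhds P. compatible_at (cusp_section t r g) u"
proof -
  let ?L = "{t - r<..<t}" and ?R = "{t<..<t + r}"
  obtain d where d: "\<And>s. s \<in> Iv t r \<Longrightarrow> s \<noteq> t \<Longrightarrow> 0 < d * (D s $ 1 - D t $ 1)"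
    using t unfolding cusp_germ_def by blast
  have r: "0 < r" "r \<le> 1/2" and ns: "\<And>s. s \<in> Iv t r \<Longrightarrow> s \<noteq> t \<Longrightarrow> \<not> special s"
    and a: "\<And>s. s \<in> ?L \<Longrightarrow> a s = g" "\<And>s. s \<in> ?R \<Longrightarrow> a s = - g"
    using t unfolding cusp_germ_def by blast+
  have tP: "t \<in> front_of P" using fo translates_self by simp
  then have P1: "P $ 1 = D t $ 1" by (simp add: front_of_def)
  define m where "m = (D t $ 2 + P $ 2) / 2"
  have m: "D t $ 2 < m" "m < P $ 2" using tP by (auto simp: front_of_def m_def)
  have "\<forall>\<^sub>F v in nhds P. v \<notin> range D \<and> front_of v \<subseteq> saturation (Iv t r)"
  proof (rule front_of_window[OF P])
    show "front_of P \<subseteq> saturation (Iv t r)"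
      using fo translates_saturation[of t "Iv t r"] r by auto
  qed (auto intro: open_saturation saturation_shift)
  moreover have "\<forall>\<^sub>F v in nhds P. 0 < d * (v $ 1 - D t $ 1) \<longrightarrow>
    (\<exists>s\<in>?L \<inter> {s. D s $ 2 < m}. D s $ 1 = v $ 1) \<and> (\<exists>s\<in>?R \<inter> {s. D s $ 2 < m}. D s $ 1 = v $ 1)"
    using m P1 by (intro cusp_germ_branches[OF t d] open_Collect_less continuous_D_component continuous_intros) auto
  moreover have "\<forall>\<^sub>F v in nhds P. v $ 2 \<in> {m<..}"
    using m by (intro eventually_component) auto
  ultimately show ?thesis
  proof eventually_elim
    case (elim u)
    have fo_u: "\<exists>x\<in>Iv t r. D x $ 1 = u $ 1 \<and> s \<in> translates x" if s: "s \<in> front_of u" for s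
    proof -
      obtain k x where "s = x + of_int k" "x \<in> Iv t r" using elim(1) s by (blast elim: saturationE)
      then show ?thesis using s by (auto simp: front_of_def D_periodic_int translates_def intro!: bexI[of _ x])
    qed
    consider "u $ 1 = D t $ 1" | "u $ 1 \<noteq> D t $ 1" "\<not> 0 < d * (u $ 1 - D t $ 1)" | "0 < d * (u $ 1 - D t $ 1)"
      by blast
    then show ?case
    proof cases
      case 1
      have sub: "front_of u \<subseteq> translates t"
      proof
        fix s assume "s \<in> front_of u"
        then obtain x where x: "x \<in> Iv t r" "D x $ 1 = u $ 1" "s \<in> translates x" using fo_u by blast
        then have "x = t" using d[OF x(1)] 1 by auto
        then show "s \<in> translates t" using x by simp
      qed
      show ?thesis
      proof (cases "u $ 3 = D t $ 3")
        case True
        then have "t \<in> front_of u" using 1 m elim(3) by (simp add: front_of_def)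
        then have fou: "front_of u = translates t" using sub front_of_translates by blast
        have cusp: "s \<in> translates t \<Longrightarrow> cusp s" for s
          using t by (auto simp: cusp_germ_def translates_def V_periodic_int)
        show ?thesis
          unfolding compatible_at_def
        proof (intro allI impI exI[of _ 0])
          fix f' assume f': "section_at u f'"
          obtain t' r' g' where t': "front_of u = translates t'" "cusp_germ t' r' g'" "f' = cusp_section t' r' g'"
            using f'[unfolded section_at_def]
          proof (elim disjE exE conjE)
            fix s r assume "front_of u = translates s" and g: "regular_germ s r"
            then have "cusp s" using cusp fou translates_self by blast
            then show thesis using g by (auto simp: regular_germ_def)
          next
            fix p q r g h assume "front_of u = translates p \<union> translates q" and g: "crossing_germ p q r g h"
            then have "cusp p" using cusp fou translates_self by blast
            then show thesis using g over_regular by (auto simp: crossing_germ_def)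
          next
            assume "front_of u = {}"
            then show thesis using fou translates_self[of t] by simp
          qed (use that in blast)
          then have "t' \<in> translates t" using fou translates_self[of t'] by simp
          then obtain k where "t' = t + of_int k" by (auto simp: translates_def)
          from cusp_section_unique[OF t t'(2) this 1]
          show "\<forall>\<^sub>F v in nhds u. cusp_section t r g v = f' v + 0" by (simp add: t'(3))
        qed
      next
        case False
        have "front_of u = {}" using front_of_empty[of u t t] sub False by simp
        then show ?thesis
          using cusp_section_vanishes[OF t 1 False] by (rule compatible_empty)
      qed
    next
      case 2
      have no: "D s $ 1 \<noteq> v $ 1" if "s \<in> Iv t r" "v $ 1 \<noteq> D t $ 1" "\<not> 0 < d * (v $ 1 - D t $ 1)" for s and v :: "real^3"
        using d[OF that(1)] that by (cases "s = t") auto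
      have "front_of u = {}" using fo_u no[OF _ 2] by blast
      moreover have "\<forall>\<^sub>F v in nhds u. v $ 1 \<in> {y. d * (y - D t $ 1) < 0}"
      proof (intro eventually_component open_Collect_less continuous_intros)
        have "d \<noteq> 0" using d[of "t + r / 2"] r by auto
        then have "d * (u $ 1 - D t $ 1) \<noteq> 0" using 2(1) by simp
        then show "u $ 1 \<in> {y. d * (y - D t $ 1) < 0}" using 2(2) unfolding mem_Collect_eq by linarith
      qed
      then have "\<forall>\<^sub>F v in nhds u. cusp_section t r g v = 0"
      proof eventually_elim
        case (elim v)
        then have "v $ 1 \<noteq> D t $ 1" "\<not> 0 < d * (v $ 1 - D t $ 1)" by auto
        then have "D s $ 1 \<noteq> v $ 1" if "s \<in> ?L \<or> s \<in> ?R" for s using no[of s v] that r by auto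
        then have "\<not> below ?L v" "\<not> below ?R v" by (auto simp: below_def)
        then show ?case by (simp add: cusp_section_def)
      qed
      ultimately show ?thesis by (rule compatible_empty)
    next
      case 3
      then obtain s s' where s: "s \<in> ?L" "D s $ 1 = u $ 1" "D s $ 2 < m" "s' \<in> ?R" "D s' $ 1 = u $ 1" "D s' $ 2 < m"
        using elim(2) by auto
      have inj: "inj_on (\<lambda>t. D t $ 1) ?L" "inj_on (\<lambda>t. D t $ 1) ?R" using cusp_germ_inj_on[OF t] by auto
      have sub: "front_of u \<subseteq> translates s \<union> translates s'"
      proof
        fix w assume "w \<in> front_of u"
        then obtain x where x: "x \<in> Iv t r" "D x $ 1 = u $ 1" "w \<in> translates x" using fo_u by blast
        have "x \<noteq> t" using 3 x(2) by auto
        then have "x \<in> ?L \<or> x \<in> ?R" using x(1) by auto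
        then have "x = s \<or> x = s'"
          using inj_onD[OF inj(1), of x s] inj_onD[OF inj(2), of x s'] s x(2) by auto
        then show "w \<in> translates s \<union> translates s'" using x(3) by auto
      qed
      have nsp: "\<not> special s" "\<not> special s'" using ns[of s] ns[of s'] s r by auto
      then have nc: "\<not> cusp s" "\<not> cusp s'" by (auto simp: special_def)
      \<comment> \<open>Equal heights would give a double point, but the parameters are not special
        and lie within one period.\<close>
      have ne: "D s $ 3 \<noteq> D s' $ 3"
      proof
        assume "D s $ 3 = D s' $ 3"
        then have "s' - s \<in> \<int>" using s by (intro not_special_front[OF nsp(1)]) (simp add: front_eq_iff)
        then have "D s' = D s" by (simp add: D_eq_iff)
        moreover have "\<bar>s' - s\<bar> < 1" using s(1,4) r by auto
        ultimately show False using D_eq_near[of s' s] s by auto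
      qed
      have offL: "\<forall>\<^sub>F v in nhds u. below ?L v = (u $ 3 < D s $ 3)" if "D s $ 3 \<noteq> u $ 3"
        using below_off_branch[OF open_greaterThanLessThan inj(1) s(1,2) that] .
      have offR: "\<forall>\<^sub>F v in nhds u. below ?R v = (u $ 3 < D s' $ 3)" if "D s' $ 3 \<noteq> u $ 3"
        using below_off_branch[OF open_greaterThanLessThan inj(2) s(4,5) that] .
      consider "D s $ 3 = u $ 3" "D s' $ 3 \<noteq> u $ 3" | "D s $ 3 \<noteq> u $ 3" "D s' $ 3 = u $ 3" | "D s $ 3 \<noteq> u $ 3" "D s' $ 3 \<noteq> u $ 3"
        using ne by metis
      then show ?thesis
      proof cases
        case 1
        then have "s \<in> front_of u" using s elim(3) by (simp add: front_of_def)
        then have fou: "front_of u = translates s" using front_of_branch[OF sub] 1 by blast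
        have "\<forall>\<^sub>F v in nhds u. cusp_section t r g v =
            (if below ?L v then a s else 0) + (if u $ 3 < D s' $ 3 then - g else 0)"
          using offR[OF 1(2)] by eventually_elim (simp add: cusp_section_def a(1)[OF s(1)])
        then show ?thesis
          by (rule compatible_on_branch[OF fou nc(1) open_greaterThanLessThan inj(1) s(1)])
      next
        case 2
        then have "s' \<in> front_of u" using s elim(3) by (simp add: front_of_def)
        then have fou: "front_of u = translates s'"
          using front_of_branch[of u s' s] sub 2 by (simp add: Un_commute)
        have "\<forall>\<^sub>F v in nhds u. cusp_section t r g v =
            (if below ?R v then a s' else 0) + (if u $ 3 < D s $ 3 then g else 0)"
          using offL[OF 2(1)] by eventually_elim (simp add: cusp_section_def a(2)[OF s(4)])
        then show ?thesis
          by (rule compatible_on_branch[OF fou nc(2) open_greaterThanLessThan inj(2) s(4)])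
      next
        case 3
        have "front_of u = {}" using front_of_empty[OF sub 3] .
        moreover have "\<forall>\<^sub>F v in nhds u. cusp_section t r g v =
            (if u $ 3 < D s $ 3 then g else 0) + (if u $ 3 < D s' $ 3 then - g else 0)"
          using offL[OF 3(1)] offR[OF 3(2)] by eventually_elim (simp add: cusp_section_def)
        ultimately show ?thesis by (rule compatible_empty)
      qed
    qed
  qed
qed

text \<open>The heights leave the crossing like slope times \<open>x\<close>-distance, and all
  slopes of the over-branch are smaller.\<close>

lemma crossing_branches_order:
  assumes c: "crossing_germ p q r g h" and s: "s \<in> Iv p r" "s' \<in> Iv q r" "D s $ 1 = D s' $ 1"
  shows "D s' $ 1 < D q $ 1 \<Longrightarrow> D s' $ 3 < D s $ 3" "D q $ 1 < D s' $ 1 \<Longrightarrow> D s $ 3 < D s' $ 3"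
proof -
  have pq: "D p $ 1 = D q $ 1" "D p $ 3 = D q $ 3"
    using c by (auto simp: crossing_germ_def over_def front_eq_iff)
  have slope: "\<exists>\<xi>\<in>Iv t r. D x $ 3 - D t $ 3 = D \<xi> $ 2 * (D x $ 1 - D t $ 1)"
    if x: "x \<in> Iv t r" and xt: "x \<noteq> t" and nc: "\<And>s. s \<in> Iv t r \<Longrightarrow> \<not> cusp s" for x t
  proof -
    have seg: "open_segment x t \<subseteq> Iv t r" using x by (auto simp: open_segment_eq_real_ivl split: if_splits)
    then have "\<And>s. s \<in> open_segment x t \<Longrightarrow> V s $ 1 \<noteq> 0" using nc by blast
    from front_slope[OF xt this]
    obtain \<xi> where "\<xi> \<in> open_segment x t" "D x $ 3 - D t $ 3 = D \<xi> $ 2 * (D x $ 1 - D t $ 1)" .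
    then show ?thesis using seg by blast
  qed
  have "\<exists>\<Delta>. D s $ 3 - D s' $ 3 = \<Delta> * (D s' $ 1 - D q $ 1) \<and> \<Delta> < 0" if ne: "D s' $ 1 \<noteq> D q $ 1"
  proof -
    have "s \<noteq> p" "s' \<noteq> q" using ne s(3) pq by auto
    moreover have nc: "x \<in> Iv p r \<Longrightarrow> \<not> cusp x" "x \<in> Iv q r \<Longrightarrow> \<not> cusp x" for x
      using c unfolding crossing_germ_def regular_germ_def by blast+
    ultimately obtain \<xi> \<xi>' where \<xi>: "\<xi> \<in> Iv p r" "D s $ 3 - D p $ 3 = D \<xi> $ 2 * (D s $ 1 - D p $ 1)"
      "\<xi>' \<in> Iv q r" "D s' $ 3 - D q $ 3 = D \<xi>' $ 2 * (D s' $ 1 - D q $ 1)"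
      using slope[OF s(1) _ nc(1)] slope[OF s(2) _ nc(2)] by metis
    have "D \<xi> $ 2 < D \<xi>' $ 2" using c \<xi> by (auto simp: crossing_germ_def)
    moreover have "D s $ 3 - D s' $ 3 = (D \<xi> $ 2 - D \<xi>' $ 2) * (D s' $ 1 - D q $ 1)"
      using \<xi>(2,4) s(3) pq by (simp add: algebra_simps)
    ultimately show ?thesis by (intro exI[of _ "D \<xi> $ 2 - D \<xi>' $ 2"]) auto
  qed
  note * = this
  show "D s' $ 3 < D s $ 3" if lt: "D s' $ 1 < D q $ 1"
  proof -
    obtain \<Delta> where \<Delta>: "D s $ 3 - D s' $ 3 = \<Delta> * (D s' $ 1 - D q $ 1)" "\<Delta> < 0" using * lt by (metis less_irrefl)
    have "0 < \<Delta> * (D s' $ 1 - D q $ 1)" using \<Delta>(2) lt by (intro mult_neg_neg) auto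
    then show ?thesis using \<Delta>(1) by simp
  qed
  show "D s $ 3 < D s' $ 3" if lt: "D q $ 1 < D s' $ 1"
  proof -
    obtain \<Delta> where \<Delta>: "D s $ 3 - D s' $ 3 = \<Delta> * (D s' $ 1 - D q $ 1)" "\<Delta> < 0" using * lt by (metis less_irrefl)
    have "\<Delta> * (D s' $ 1 - D q $ 1) < 0" using \<Delta>(2) lt by (intro mult_neg_pos) auto
    then show ?thesis using \<Delta>(1) by simp
  qed
qed

lemma crossing_germ_inj_on:
  assumes "crossing_germ p q r g h"
  shows "inj_on (\<lambda>t. D t $ 1) (Iv p r)" "inj_on (\<lambda>t. D t $ 1) (Iv q r)" "p \<in> Iv p r" "q \<in> Iv q r"
  using assms unfolding crossing_germ_def regular_germ_def by (auto intro!: Iv_inj_on)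

lemma crossing_section_unique:
  assumes c: "crossing_germ p q r g h" and c': "crossing_germ p' q' r' g' h'"
    and p': "p' = p + of_int j" and q': "q' = q + of_int k" and u: "u $ 1 = D q $ 1"
  shows "\<forall>\<^sub>F v in nhds u. crossing_section p q r h v = crossing_section p' q' r' h' v"
proof -
  have pu: "D p $ 1 = u $ 1" using c u by (auto simp: crossing_germ_def over_def front_eq_iff)
  define \<rho> where "\<rho> = min r r'"
  have \<rho>: "0 < \<rho>" "\<rho> \<le> r" "\<rho> \<le> r'"
    using c c' by (auto simp: \<rho>_def crossing_germ_def regular_germ_def)
  have "inj_on (\<lambda>t. D t $ 1) (Iv q \<rho>)"
    by (rule inj_on_subset[OF crossing_germ_inj_on(2)[OF c]]) (use \<rho> in auto)
  then have "open ((\<lambda>t. D t $ 1) ` Iv q \<rho>)" by (intro x_open_image) auto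
  moreover have "D q $ 1 \<in> (\<lambda>t. D t $ 1) ` Iv q \<rho>" using \<rho> by auto
  ultimately obtain e where e: "e > 0" "ball (D q $ 1) e \<subseteq> (\<lambda>t. D t $ 1) ` Iv q \<rho>" by (rule openE)
  have "D q $ 1 + e / 2 \<in> ball (D q $ 1) e" using e(1) by (simp add: dist_real_def)
  then obtain s where s: "s \<in> Iv q \<rho>" "D s $ 1 = D q $ 1 + e / 2" using e(2) by force
  have "a s = h" using c s \<rho> e(1) by (auto simp: crossing_germ_def)
  moreover have "a (s + of_int k) = h'"
  proof -
    have "s + of_int k \<in> Iv q' r'" using s(1) \<rho> q' by auto
    moreover have "D q' $ 1 < D (s + of_int k) $ 1" using s(2) e(1) by (simp add: q' D_periodic_int)
    ultimately show ?thesis using c' unfolding crossing_germ_def by blast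
  qed
  ultimately have h: "h' = h" by (simp only: a_periodic)
  have "\<forall>\<^sub>F v in nhds u. below (Iv p r) v = below (Iv p' r') v"
    using crossing_germ_inj_on[OF c] crossing_germ_inj_on[OF c'] pu p'
    by (intro below_germ_unique[of _ p u _ j]) auto
  moreover have "\<forall>\<^sub>F v in nhds u. below (Iv q r) v = below (Iv q' r') v"
    using crossing_germ_inj_on[OF c] crossing_germ_inj_on[OF c'] u q'
    by (intro below_germ_unique[of _ q u _ k]) auto
  ultimately show ?thesis
    by eventually_elim (simp add: crossing_section_def h p' a_periodic)
qed

text \<open>The order of the depths distinguishes the two branches, so any other germ at
  \<open>u\<close> matches \<open>p\<close> with \<open>p'\<close> and \<open>q\<close> with
  \<open>q'\<close> up to periods.\<close>

lemma section_at_crossing: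
  assumes f: "section_at u f" and fo: "front_of u = translates p \<union> translates q" and pq: "over p q"
  obtains p' q' r g h j k where "crossing_germ p' q' r g h" "f = crossing_section p' q' r h"
    "p' = p + of_int j" "q' = q + of_int k"
proof -
  have two: "translates t \<noteq> translates p \<union> translates q" for t
  proof
    assume *: "translates t = translates p \<union> translates q"
    then have "p \<in> translates t" "q \<in> translates t" using translates_self by auto
    then have "p \<in> translates q" using translates_eq translates_self by blast
    then show False using over_not_int[OF pq] by (simp add: translates_iff)
  qed
  obtain p' q' r g h where c: "front_of u = translates p' \<union> translates q'" "crossing_germ p' q' r g h"
      "f = crossing_section p' q' r h"
    using f[unfolded section_at_def]
  proof (elim disjE exE conjE)
    assume "front_of u = {}"
    then show thesis using fo translates_self[of p] by auto
  next
    fix t r assume "front_of u = translates t"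
    from this[unfolded fo, symmetric] two[of t] show thesis by contradiction
  next
    fix t r g assume "front_of u = translates t"
    from this[unfolded fo, symmetric] two[of t] show thesis by contradiction
  qed (rule that)
  have o': "over p' q'" using c(2) by (simp add: crossing_germ_def)
  have y: "D s $ 2 = D t $ 2" if "s \<in> translates t" for s t
    using that by (auto simp: translates_def D_periodic_int)
  have lt: "D p $ 2 < D q $ 2" "D p' $ 2 < D q' $ 2" using pq o' by (auto simp: over_def)
  have mem: "p' \<in> translates p \<union> translates q" "q' \<in> translates p \<union> translates q"
    using fo c(1) translates_self by blast+
  have "p' \<in> translates p"
  proof (rule ccontr)
    assume "p' \<notin> translates p"
    then have p'q: "p' \<in> translates q" using mem(1) by blast
    have "q' \<notin> translates p" using y[OF p'q] y[of q' p] lt by auto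
    then have "q' \<in> translates q" using mem(2) by blast
    then have "p' \<in> translates q'" using p'q translates_eq translates_self by blast
    then show False using over_not_int[OF o'] by (simp add: translates_iff)
  qed
  moreover have "q' \<in> translates q"
  proof (rule ccontr)
    assume "q' \<notin> translates q"
    then have "q' \<in> translates p" using mem(2) by blast
    then show False using y[of q' p] y[OF \<open>p' \<in> translates p\<close>] lt by auto
  qed
  ultimately obtain j k where "p' = p + of_int j" "q' = q + of_int k" by (auto simp: translates_def)
  then show ?thesis using that c(2,3) by blast
qed

text \<open>Off the crossing point at most one branch is met. Only along the under-branch does the
  colour depend on the side, and there the crossing relation enters.\<close>

lemma compatible_crossing:
  assumes P: "P \<notin> range D" and fo: "front_of P = translates p \<union> translates q" and c: "crossing_germ p q r g h"
  shows "\<forall>\<^sub>F u in nhds P. compatible_at (crossing_section p q r h) u"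
proof -
  let ?U = "saturation (Iv p r \<union> Iv q r)"
  note inj = crossing_germ_inj_on[OF c]
  have pq: "over p q" "D p $ 1 = D q $ 1" "D p $ 3 = D q $ 3"
    using c by (auto simp: crossing_germ_def over_def front_eq_iff)
  have "p \<in> front_of P" "q \<in> front_of P" using fo translates_self by auto
  note behind = branch_behind[OF open_greaterThanLessThan inj(1,3) this(1)]
    branch_behind[OF open_greaterThanLessThan inj(2,4) this(2)]
  have "\<forall>\<^sub>F v in nhds P. v \<notin> range D \<and> front_of v \<subseteq> ?U"
  proof (rule front_of_window[OF P])
    show "front_of P \<subseteq> ?U"
      using fo translates_saturation[of p "Iv p r \<union> Iv q r"] translates_saturation[of q "Iv p r \<union> Iv q r"] inj(3,4)
      by blast
  qed (auto intro: saturation_shift intro!: open_saturation open_Un)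
  then show ?thesis
    using behind
  proof eventually_elim
    case (elim u)
    obtain s s' where s: "s \<in> Iv p r" "D s $ 1 = u $ 1" "s' \<in> Iv q r" "D s' $ 1 = u $ 1"
      using elim(2,3) by blast
    have y: "D s $ 2 < u $ 2" "D s' $ 2 < u $ 2" "D s $ 2 < D s' $ 2"
      using elim(2,3) s c unfolding crossing_germ_def by blast+
    have sub: "front_of u \<subseteq> translates s \<union> translates s'"
    proof
      fix w assume w: "w \<in> front_of u"
      then obtain k x where x: "w = x + of_int k" "x \<in> Iv p r \<union> Iv q r"
        using elim(1) by (blast elim: saturationE)
      then have "D x $ 1 = u $ 1" using w by (simp add: front_of_def D_periodic_int)
      then have "x = s \<or> x = s'"
        using x(2) inj_onD[OF inj(1), of x s] inj_onD[OF inj(2), of x s'] s by auto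
      then show "w \<in> translates s \<union> translates s'" using x(1) by (auto simp: translates_def)
    qed
    have nc: "\<not> cusp s" "\<not> cusp s'" and as: "a s = a p"
      using c s unfolding crossing_germ_def regular_germ_def by blast+
    have off: "\<forall>\<^sub>F v in nhds u. below (Iv p r) v = (u $ 3 < D s $ 3)" if "D s $ 3 \<noteq> u $ 3"
      using below_off_branch[OF open_greaterThanLessThan inj(1) s(1,2) that] .
    have off': "\<forall>\<^sub>F v in nhds u. below (Iv q r) v = (u $ 3 < D s' $ 3)" if "D s' $ 3 \<noteq> u $ 3"
      using below_off_branch[OF open_greaterThanLessThan inj(2) s(3,4) that] .
    consider "D s $ 3 = u $ 3" "D s' $ 3 = u $ 3" | "D s $ 3 = u $ 3" "D s' $ 3 \<noteq> u $ 3"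
      | "D s $ 3 \<noteq> u $ 3" "D s' $ 3 = u $ 3" | "D s $ 3 \<noteq> u $ 3" "D s' $ 3 \<noteq> u $ 3"
      by blast
    then show ?case
    proof cases
      case 1
      then have "over s s'" using s y by (simp add: over_def front_eq_iff)
      then have "special s" "special s'" by (auto simp: special_def)
      then have "s = p" "s' = q" using c s unfolding crossing_germ_def regular_germ_def by blast+
      have "s \<in> front_of u" "s' \<in> front_of u" using 1 s y by (auto simp: front_of_def)
      then have fou: "front_of u = translates p \<union> translates q"
        using sub front_of_translates unfolding \<open>s = p\<close> \<open>s' = q\<close> by blast
      show ?thesis
        unfolding compatible_at_def
      proof (intro allI impI exI[of _ 0])
        fix f' assume "section_at u f'"
        then obtain p' q' r' g' h' j k where c': "crossing_germ p' q' r' g' h'" "f' = crossing_section p' q' r' h'"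
          "p' = p + of_int j" "q' = q + of_int k"
          using section_at_crossing[OF _ fou pq(1)] by metis
        have "u $ 1 = D q $ 1" using s \<open>s' = q\<close> by simp
        from crossing_section_unique[OF c c'(1,3,4) this]
        show "\<forall>\<^sub>F v in nhds u. crossing_section p q r h v = f' v + 0" by (simp add: c'(2))
      qed
    next
      case 2
      then have "s \<in> front_of u" using s y by (simp add: front_of_def)
      then have fou: "front_of u = translates s" using front_of_branch[OF sub] 2 by blast
      have "\<forall>\<^sub>F v in nhds u. crossing_section p q r h v =
          (if below (Iv p r) v then a s else 0) + (if u $ 3 < D s' $ 3 then h else 0)"
        using off'[OF 2(2)] by eventually_elim (simp add: crossing_section_def as)
      then show ?thesis
        by (rule compatible_on_branch[OF fou nc(1) open_greaterThanLessThan inj(1) s(1)])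
    next
      case 3
      then have "s' \<in> front_of u" using s y by (simp add: front_of_def)
      then have fou: "front_of u = translates s'"
        using front_of_branch[of u s' s] sub 3 by (simp add: Un_commute)
      have "D s' $ 1 \<noteq> D q $ 1"
      proof
        assume *: "D s' $ 1 = D q $ 1"
        then have "s' = q" "s = p" using inj_onD[OF inj(2), of s' q] inj_onD[OF inj(1), of s p] inj s pq by auto
        then show False using 3 pq by simp
      qed
      then consider "D s' $ 1 < D q $ 1" | "D q $ 1 < D s' $ 1" by linarith
      \<comment> \<open>Left of the crossing the over-branch is higher and has already contributed
        \<open>a p\<close>; the relation \<open>a p + h = g + a p\<close> moves this constant to the
        right. On the other side the constant is 0.\<close>
      then have "\<exists>k. \<forall>b. (if u $ 3 < D s $ 3 then a p else 0) + (if b then h else 0) = (if b then a s' else 0) + k"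
      proof cases
        case 1
        then have "u $ 3 < D s $ 3" using crossing_branches_order(1)[OF c s(1,3)] s 3 by simp
        moreover have "a s' = g" "a p + h = g + a p" using c s(3) 1 unfolding crossing_germ_def by blast+
        ultimately show ?thesis by (intro exI[of _ "a p"]) simp
      next
        case 2
        then have "\<not> u $ 3 < D s $ 3" using crossing_branches_order(2)[OF c s(1,3)] s 3 by simp
        moreover have "a s' = h" using c s(3) 2 unfolding crossing_germ_def by blast
        ultimately show ?thesis by (intro exI[of _ 0]) simp
      qed
      then obtain k where k: "\<And>b. (if u $ 3 < D s $ 3 then a p else 0) + (if b then h else 0) = (if b then a s' else 0) + k"
        by blast
      have "\<forall>\<^sub>F v in nhds u. crossing_section p q r h v = (if below (Iv q r) v then a s' else 0) + k"
        using off[OF 3(1)] by eventually_elim (simp only: crossing_section_def k)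
      then show ?thesis
        by (rule compatible_on_branch[OF fou nc(2) open_greaterThanLessThan inj(2) s(3)])
    next
      case 4
      have "front_of u = {}" using front_of_empty[OF sub 4] .
      moreover have "\<forall>\<^sub>F v in nhds u. crossing_section p q r h v =
          (if u $ 3 < D s $ 3 then a p else 0) + (if u $ 3 < D s' $ 3 then h else 0)"
        using off[OF 4(1)] off'[OF 4(2)] by eventually_elim (simp add: crossing_section_def)
      ultimately show ?thesis by (rule compatible_empty)
    qed
  qed
qed

lemma section_at_compatible:
  assumes P: "P \<notin> range D" and f: "section_at P f"
  shows "\<forall>\<^sub>F u in nhds P. compatible_at f u"
  using f[unfolded section_at_def]
proof (elim disjE exE conjE)
  assume *: "front_of P = {}" "f = (\<lambda>_. 0)"
  have "\<forall>\<^sub>F v in nhds P. v \<notin> range D \<and> front_of v \<subseteq> {}"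
    by (rule front_of_window[OF P]) (use * in auto)
  then show ?thesis
    by eventually_elim (auto simp: * intro!: compatible_empty[where c = 0])
qed (use compatible_regular[OF P] compatible_cusp[OF P] compatible_crossing[OF P] in blast)+

section \<open>The bundle of a coloured front and its monodromy\<close>

definition diagram_system :: "real^3 \<Rightarrow> real^3 \<Rightarrow> 'g" where
  "diagram_system P = (SOME f. section_at P f)"

lemma section_at_diagram_system: "P \<notin> range D \<Longrightarrow> section_at P (diagram_system P)"
  unfolding diagram_system_def by (metis section_at_exists someI_ex)

lemma local_system_diagram: "local_system (- range D) diagram_system"
  unfolding local_system_def
proof
  fix P assume "P \<in> - range D"
  then have P: "P \<notin> range D" by simp
  have "\<forall>\<^sub>F u in nhds P. u \<in> - range D"
    using P closed_range_D by (intro eventually_nhds_in_open) auto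
  with section_at_compatible[OF P section_at_diagram_system[OF P]]
  show "\<forall>\<^sub>F u in nhds P. \<exists>g. \<forall>\<^sub>F v in nhds u. diagram_system P v = diagram_system u v + g"
    by eventually_elim (use section_at_diagram_system in \<open>auto simp: compatible_at_def\<close>)
qed

text \<open>Moving towards smaller \<open>y\<close> keeps a visible point visible and ends in the
  convex half-space \<open>H\<close> in front of the whole curve.\<close>

lemma connected_visible: "connected {u. u \<notin> range D \<and> front_of u = {}}"
proof -
  let ?V = "{u. u \<notin> range D \<and> front_of u = {}}"
  let ?back = "\<lambda>s. s *\<^sub>R axis 2 1 :: real^3"
  have "bounded (range D)" by (rule compact_imp_bounded[OF compact_range_D])
  then obtain B where B: "\<And>t. norm (D t) \<le> B" by (auto simp: bounded_iff)
  define H where "H = {u::real^3. u $ 2 < - B}"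
  have "- B \<le> D t $ 2" for t using B[of t] component_le_norm_cart[of "D t" 2] by (simp add: abs_le_iff)
  note B2 = this
  have HV: "H \<subseteq> ?V"
  proof
    fix u assume "u \<in> H"
    then have "u $ 2 < D t $ 2" for t using B2[of t] by (simp add: H_def)
    then have "D t \<noteq> u" "t \<notin> front_of u" for t by (auto simp: front_of_def less_le_not_le)
    then show "u \<in> ?V" by auto
  qed
  have step: "u - ?back s \<in> ?V" if "u \<in> ?V" "s \<ge> 0" for u s
  proof (cases "s = 0")
    case False
    then have s: "s > 0" using that by simp
    have "D t \<noteq> u - ?back s" for t
    proof
      assume "D t = u - ?back s"
      then have "D t $ 1 = u $ 1" "D t $ 3 = u $ 3" "D t $ 2 = u $ 2 - s" by (simp_all add: axis_def)
      then have "t \<in> front_of u" using s by (simp add: front_of_def)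
      then show False using that(1) by simp
    qed
    moreover have "front_of (u - ?back s) \<subseteq> front_of u" using s by (auto simp: front_of_def axis_def)
    ultimately show ?thesis using that(1) by (metis (mono_tags, lifting) mem_Collect_eq rangeE subset_empty)
  qed (use that in simp)
  let ?T = "\<lambda>u. (\<lambda>s. u - ?back s) ` {0..} \<union> H"
  have "connected (\<Union>u\<in>?V. ?T u)"
  proof (rule connected_Union)
    fix T assume "T \<in> ?T ` ?V"
    then obtain u where T: "T = ?T u" by blast
    have "connected ((\<lambda>s. u - ?back s) ` {0..})"
      by (intro connected_continuous_image continuous_intros) auto
    moreover have "convex H"
      unfolding H_def using convex_halfspace_lt[of "axis 2 1 :: real^3" "- B"] by (simp add: inner_axis')
    moreover have "(\<lambda>s. u - ?back s) ` {0..} \<inter> H \<noteq> {}"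
    proof -
      have "u - ?back (\<bar>u $ 2 + B\<bar> + 1) \<in> H" unfolding H_def by (simp add: axis_def)
      moreover have "u - ?back (\<bar>u $ 2 + B\<bar> + 1) \<in> (\<lambda>s. u - ?back s) ` {0..}" by (rule imageI) simp
      ultimately show ?thesis by blast
    qed
    ultimately show "connected T" unfolding T by (intro connected_Un) (auto intro: convex_connected)
  next
    have "(- B - 1) *\<^sub>R axis 2 1 \<in> H" by (simp add: H_def axis_def)
    then show "\<Inter> (?T ` ?V) \<noteq> {}" by blast
  qed
  also have "(\<Union>u\<in>?V. ?T u) = ?V"
  proof
    show "(\<Union>u\<in>?V. ?T u) \<subseteq> ?V" using step HV by auto
    show "?V \<subseteq> (\<Union>u\<in>?V. ?T u)"
    proof
      fix u assume "u \<in> ?V"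
      then show "u \<in> (\<Union>u\<in>?V. ?T u)" by (intro UN_I[of u] UnI1 image_eqI[of _ _ 0]) auto
    qed
  qed
  finally show ?thesis .
qed

text \<open>The coset section is constant on the connected visible region. Going from above to below
  a strand multiplies its coset on the left by \<open>a s\<close> and returns to the same value, so
  \<open>a s\<close> lies in the cyclic group conjugated by a fixed \<open>k\<close>.\<close>

lemma unknotted_colours_commute:
  assumes h: "homeomorphism UNIV UNIV \<Phi> \<Psi>" "\<Phi> ` range D = range unknot"
    and s: "\<not> special s" "\<not> special s'"
  shows "a s + a s' = a s' + a s"
proof -
  let ?V = "{u. u \<notin> range D \<and> front_of u = {}}"
  obtain g \<alpha> where \<alpha>: "\<And>u. u \<notin> range D \<Longrightarrow>
      \<exists>h. \<forall>\<^sub>F v in nhds u. \<alpha> v = (+) (diagram_system u v + h) ` cyclic_subgroup g"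
    by (rule local_system_unknotted[OF local_system_diagram h]) (rule that)
  let ?Z = "cyclic_subgroup g"
  have const: "\<alpha> u = \<alpha> v" if "u \<in> ?V" "v \<in> ?V" for u v
  proof (rule locally_constant_imp_constant[OF connected_visible _ that])
    fix u assume u: "u \<in> ?V"
    then have "diagram_system u = (\<lambda>_. 0)"
      using section_at_empty[OF _ section_at_diagram_system] by simp
    then obtain k where k: "\<forall>\<^sub>F v in nhds u. \<alpha> v = (+) (0 + k) ` ?Z" using \<alpha>[of u] u by auto
    from eventually_nhds_x_imp_x[OF k] have "\<alpha> u = (+) (0 + k) ` ?Z" .
    with k show "\<forall>\<^sub>F v in nhds u. v \<in> ?V \<longrightarrow> \<alpha> v = \<alpha> u" by (auto elim: eventually_mono)
  qed
  have jump: "\<exists>k u. u \<in> ?V \<and> \<alpha> u = (+) k ` ?Z \<and> \<alpha> u = (+) (a s + k) ` ?Z" if s: "\<not> special s" for s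
  proof -
    \<comment> \<open>Any positive distance behind the strand would do, since no other strand has
      the same front position.\<close>
    define P where "P = D s + axis 2 1"
    have P: "P $ 1 = D s $ 1" "P $ 2 = D s $ 2 + 1" "P $ 3 = D s $ 3" by (simp_all add: P_def axis_def)
    have sP: "s \<in> front_of P" using P by (simp add: front_of_def)
    have "P \<notin> range D"
    proof
      assume "P \<in> range D"
      then obtain t where t: "P = D t" by blast
      then have "front D t = front D s" using P by (simp add: front_eq_iff)
      from not_special_front[OF s this] have "D t = D s" by (simp add: D_eq_iff)
      then show False using t P by simp
    qed
    then obtain k where k: "\<forall>\<^sub>F v in nhds P. \<alpha> v = (+) (diagram_system P v + k) ` ?Z" using \<alpha> by blast
    have fo: "front_of P = translates s" by (rule front_of_not_special[OF s sP])
    have nc: "\<not> cusp s" and nu: "\<nexists>p. over p s" using s by (auto simp: special_def)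
    obtain r where r: "regular_germ s r" using regular_germ_exists[OF nc nu] .
    have inj: "inj_on (\<lambda>t. D t $ 1) (Iv s r)" "s \<in> Iv s r" using r by (auto simp: regular_germ_def intro!: Iv_inj_on)
    have sec: "\<forall>\<^sub>F v in nhds P. diagram_system P v = (if below (Iv s r) v then a s else 0)"
      by (rule section_at_regular[OF fo nc section_at_diagram_system[OF \<open>P \<notin> range D\<close>] _ inj]) simp
    have win: "\<forall>\<^sub>F v in nhds P. v \<notin> range D \<and> front_of v \<subseteq> saturation (Iv s r)"
    proof (rule front_of_window[OF \<open>P \<notin> range D\<close>])
      show "front_of P \<subseteq> saturation (Iv s r)" using fo translates_saturation[OF inj(2)] by auto
    qed (auto intro: open_saturation saturation_shift)
    have "\<forall>\<^sub>F v in nhds P. \<alpha> v = (+) ((if below (Iv s r) v then a s else 0) + k) ` ?Z \<and> v \<notin> range D \<and>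
        front_of v \<subseteq> saturation (Iv s r)"
      using k sec win by eventually_elim simp
    then obtain e where e: "e > 0" "\<And>v. dist v P < e \<Longrightarrow> \<alpha> v =
        (+) ((if below (Iv s r) v then a s else 0) + k) ` ?Z \<and> v \<notin> range D \<and> front_of v \<subseteq> saturation (Iv s r)"
      unfolding eventually_nhds_metric by blast
    have near: "dist (P + \<eta> *\<^sub>R axis 3 1) P < e" if "\<bar>\<eta>\<bar> < e" for \<eta>
      using that by (simp add: dist_norm)
    have only: "t = s" if "t \<in> Iv s r" "D t $ 1 = P $ 1" for t
      using inj_onD[OF inj(1), of t s] that inj(2) P by simp
    have comp: "(P + \<eta> *\<^sub>R axis 3 1) $ 1 = P $ 1" "(P + \<eta> *\<^sub>R axis 3 1) $ 3 = P $ 3 + \<eta>" for \<eta>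
      by (simp_all add: axis_def)
    have fr: "D t $ 1 = P $ 1" "D t $ 3 = P $ 3 + \<eta>" if "t \<in> front_of (P + \<eta> *\<^sub>R axis 3 1)" for t \<eta>
      using that by (simp_all add: front_of_def axis_def)
    have below: "below (Iv s r) (P + \<eta> *\<^sub>R axis 3 1) \<longleftrightarrow> \<eta> < 0" for \<eta>
      unfolding below_def comp using only inj(2) P by fastforce
    have vis: "P + \<eta> *\<^sub>R axis 3 1 \<in> ?V" if \<eta>: "\<bar>\<eta>\<bar> < e" "\<eta> \<noteq> 0" for \<eta>
    proof -
      have "t \<notin> front_of (P + \<eta> *\<^sub>R axis 3 1)" for t
      proof
        assume t: "t \<in> front_of (P + \<eta> *\<^sub>R axis 3 1)"
        then obtain j x where x: "t = x + of_int j" "x \<in> Iv s r" using e(2)[OF near[OF \<eta>(1)]] by (blast elim: saturationE)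
        have D: "D t = D x" unfolding x(1) by (rule D_periodic_int)
        have "x = s" using only[OF x(2)] fr(1)[OF t] by (simp add: D)
        then show False using fr(2)[OF t] P \<eta>(2) by (simp add: D)
      qed
      then show ?thesis using e(2)[OF near[OF \<eta>(1)]] by auto
    qed
    \<comment> \<open>Slightly above and below the strand nothing is in front, and there the section
      behind the strand takes the values 0 and \<open>a s\<close>.\<close>
    have "\<alpha> (P + (e/2) *\<^sub>R axis 3 1) = (+) k ` ?Z" "\<alpha> (P + (- e/2) *\<^sub>R axis 3 1) = (+) (a s + k) ` ?Z"
      using e(2)[OF near[of "e/2"]] e(2)[OF near[of "- e/2"]] e(1) unfolding below by auto
    moreover have "\<alpha> (P + (e/2) *\<^sub>R axis 3 1) = \<alpha> (P + (- e/2) *\<^sub>R axis 3 1)"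
      using vis[of "e/2"] vis[of "- e/2"] e(1) by (intro const) auto
    moreover have "P + (e/2) *\<^sub>R axis 3 1 \<in> ?V" using vis[of "e/2"] e(1) by simp
    ultimately show ?thesis by (intro exI[of _ k] exI[of _ "P + (e/2) *\<^sub>R axis 3 1"] conjI) simp_all
  qed
  obtain k u where k: "u \<in> ?V" "\<alpha> u = (+) k ` ?Z" using jump[OF s(1)] by blast
  have conj: "\<exists>z\<in>?Z. a s = k + z - k" if "\<not> special s" for s
  proof -
    obtain k' u' where k': "u' \<in> ?V" "\<alpha> u' = (+) k' ` ?Z" "\<alpha> u' = (+) (a s + k') ` ?Z" using jump[OF \<open>\<not> special s\<close>] by blast
    then have A: "(+) k' ` ?Z = (+) k ` ?Z" "(+) (a s + k') ` ?Z = (+) k ` ?Z"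
      using const[OF k(1) k'(1)] k(2) by simp_all
    have "k \<in> (+) k ` ?Z" by (intro image_eqI[of _ _ 0]) (auto intro: cyclic_subgroup.zero)
    then obtain z where z: "z \<in> ?Z" "k = k' + z" using A(1) by auto
    have "a s + k \<in> (+) (a s + k') ` ?Z" using z by (simp add: add.assoc)
    then obtain w where "w \<in> ?Z" "a s + k = k + w" using A(2) by auto
    then show ?thesis by (intro bexI[of _ w]) (simp_all add: eq_diff_eq)
  qed
  obtain z z' where z: "z \<in> ?Z" "a s = k + z - k" "z' \<in> ?Z" "a s' = k + z' - k"
    using conj[OF s(1)] conj[OF s(2)] by blast
  have "a s + a s' = k + (z + z') - k" "a s' + a s = k + (z' + z) - k"
    using z by (simp_all add: diff_conv_add_uminus add.assoc del: add_uminus_conv_diff)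
  then show ?thesis using cyclic_subgroup_commute[OF z(1,3)] by simp
qed

end

section \<open>Counting chords with an integral\<close>

definition ramp :: "nat \<Rightarrow> real \<Rightarrow> real" where "ramp k a = max 0 a ^ k"

lemma ramp_derivative: "(ramp (Suc (Suc k)) has_real_derivative real (k + 2) * ramp (Suc k) a) (at a)"
proof -
  consider "a > 0" | "a < 0" | "a = 0" by linarith
  then show ?thesis
  proof cases
    case 1
    have "((\<lambda>a. a ^ (k + 2)) has_real_derivative real (k + 2) * ramp (Suc k) a) (at a)"
      using 1 DERIV_pow[of "k + 2" a] by (simp add: ramp_def)
    then show ?thesis
      by (rule DERIV_cong_ev[THEN iffD1, rotated -1])
        (use 1 eventually_nhds_in_open[of "{0<..}" a] in \<open>auto simp: ramp_def elim!: eventually_mono\<close>)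
  next
    case 2
    have "((\<lambda>a. 0) has_real_derivative real (k + 2) * ramp (Suc k) a) (at a)"
      using 2 by (simp add: ramp_def)
    then show ?thesis
      by (rule DERIV_cong_ev[THEN iffD1, rotated -1])
        (use 2 eventually_nhds_in_open[of "{..<0}" a] in \<open>auto simp: ramp_def elim!: eventually_mono\<close>)
  next
    case 3
    have "ramp (Suc (Suc k)) z - ramp (Suc (Suc k)) 0 = ramp (Suc k) z * (z - 0)" for z
      by (simp add: ramp_def max_def)
    moreover have "isCont (ramp (Suc k)) 0" unfolding ramp_def by (intro continuous_intros)
    moreover have "ramp (Suc k) 0 = real (k + 2) * ramp (Suc k) a" using 3 by (simp add: ramp_def)
    ultimately show ?thesis unfolding 3 CARAT_DERIV by blast
  qed
qed

text \<open>Third central differences with step 2 of truncated powers. Index 2 is a multiple of the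
  quadratic B-spline; index 3 is three times a primitive of index 2, with final value
  \<open>3! * 2 ^ 3 = 48\<close>.\<close>

definition spline :: "nat \<Rightarrow> real \<Rightarrow> real" where
  "spline k a = ramp k (a + 3) - 3 * ramp k (a + 1) + 3 * ramp k (a - 1) - ramp k (a - 3)"

lemma spline_derivative: "(spline (Suc (Suc k)) has_real_derivative real (k + 2) * spline (Suc k) a) (at a)"
  unfolding spline_def
  by (auto intro!: derivative_eq_intros DERIV_chain2[OF ramp_derivative] simp: algebra_simps)

lemma spline_far:
  "a \<le> - 3 \<Longrightarrow> spline (Suc k) a = 0"
  "3 \<le> a \<Longrightarrow> spline 3 a = 48" "3 \<le> a \<Longrightarrow> spline 2 a = 0" "3 \<le> a \<Longrightarrow> spline 1 a = 0"
  by (auto simp: spline_def ramp_def power2_eq_square power3_eq_cube algebra_simps)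

lemma spline_even: "spline 2 (- a) = spline 2 a"
proof -
  have neg: "ramp 2 (- u) = u\<^sup>2 - ramp 2 u" for u by (simp add: ramp_def max_def)
  have "- a + 3 = - (a - 3)" "- a + 1 = - (a - 1)" "- a - 1 = - (a + 1)" "- a - 3 = - (a + 3)" by simp_all
  then show ?thesis
    unfolding spline_def by (simp only: neg) (simp add: power2_eq_square algebra_simps)
qed

text \<open>The knots -3, -1, 1, 3 are rescaled to \<open>{- \<delta>..\<delta>}\<close>. The
  divisors 48, 16 and 8 let \<open>step\<close> rise from 0 to 1 with first and second derivatives
  \<open>bump\<close> and \<open>bump'\<close>.\<close>

definition step :: "real \<Rightarrow> real \<Rightarrow> real" where "step \<delta> a = spline 3 (3 / \<delta> * a) / 48"
definition bump :: "real \<Rightarrow> real \<Rightarrow> real" where "bump \<delta> a = 3 / \<delta> * (spline 2 (3 / \<delta> * a) / 16)"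
definition bump' :: "real \<Rightarrow> real \<Rightarrow> real" where "bump' \<delta> a = (3 / \<delta>)\<^sup>2 * (spline 1 (3 / \<delta> * a) / 8)"

lemma step_derivative: "(step \<delta> has_real_derivative bump \<delta> a) (at a)"
proof -
  have "(spline 3 has_real_derivative 3 * spline 2 b) (at b)" for b
    using spline_derivative[of 1 b] by (simp add: numeral_3_eq_3 numeral_2_eq_2)
  then have "((\<lambda>a. spline 3 (3 / \<delta> * a)) has_real_derivative 3 * spline 2 (3 / \<delta> * a) * (3 / \<delta>)) (at a)"
    by (rule DERIV_chain2[OF _ DERIV_cmult_Id])
  from DERIV_cdivide[OF this, of 48] show ?thesis
    by (simp add: step_def[abs_def] bump_def mult.commute)
qed

lemma bump_derivative: "(bump \<delta> has_real_derivative bump' \<delta> a) (at a)"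
proof -
  have "(spline 2 has_real_derivative 2 * spline 1 b) (at b)" for b
    using spline_derivative[of 0 b] by (simp add: numeral_2_eq_2)
  then have "((\<lambda>a. spline 2 (3 / \<delta> * a)) has_real_derivative 2 * spline 1 (3 / \<delta> * a) * (3 / \<delta>)) (at a)"
    by (rule DERIV_chain2[OF _ DERIV_cmult_Id])
  from DERIV_cmult[OF DERIV_cdivide[OF this, of 16], of "3 / \<delta>"] show ?thesis
    by (simp add: bump_def[abs_def] bump'_def power2_eq_square mult_ac)
qed

lemma continuous_bump': "continuous_on UNIV (bump' \<delta>)"
  unfolding bump'_def spline_def ramp_def divide_inverse by (intro continuous_intros)

lemma step_far:
  assumes "\<delta> > 0"
  shows "a \<le> - \<delta> \<Longrightarrow> step \<delta> a = 0" "\<delta> \<le> a \<Longrightarrow> step \<delta> a = 1"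
    and "\<delta> \<le> \<bar>a\<bar> \<Longrightarrow> bump \<delta> a = 0" "\<delta> \<le> \<bar>a\<bar> \<Longrightarrow> bump' \<delta> a = 0"
proof -
  have lo: "3 / \<delta> * a \<le> - 3" if "a \<le> - \<delta>" using assms that by (simp add: field_simps)
  have hi: "3 \<le> 3 / \<delta> * a" if "\<delta> \<le> a" using assms that by (simp add: field_simps)
  show "a \<le> - \<delta> \<Longrightarrow> step \<delta> a = 0" using spline_far(1)[OF lo, of 2] by (simp add: step_def numeral_3_eq_3)
  show "\<delta> \<le> a \<Longrightarrow> step \<delta> a = 1" using spline_far(2)[OF hi] by (simp add: step_def)
  have "a \<le> - \<delta> \<or> \<delta> \<le> a" if "\<delta> \<le> \<bar>a\<bar>" using that by linarith
  then show "\<delta> \<le> \<bar>a\<bar> \<Longrightarrow> bump \<delta> a = 0" "\<delta> \<le> \<bar>a\<bar> \<Longrightarrow> bump' \<delta> a = 0"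
    using spline_far(1)[OF lo, of 1] spline_far(1)[OF lo, of 0] spline_far(3)[OF hi] spline_far(4)[OF hi]
    by (auto simp: bump_def bump'_def numeral_2_eq_2)
qed

lemma bump_even: "bump \<delta> (- a) = bump \<delta> a"
  using spline_even[of "3 / \<delta> * a"] by (simp add: bump_def)

lemma isCont_bump: "isCont (bump \<delta>) a"
  using bump_derivative DERIV_isCont by blast

lemma continuous_on_bump: "continuous_on S (bump \<delta>)"
  by (simp add: isCont_bump continuous_at_imp_continuous_on)

lemma continuous_on_step: "continuous_on S (step \<delta>)"
  using step_derivative DERIV_isCont by (blast intro: continuous_at_imp_continuous_on)

text \<open>The density of the chords from \<open>t\<close> to \<open>t'\<close> of the plane curve \<open>(u, w)\<close> with displacement
  \<open>(e1, e2)\<close>, counted with sign, in the region \<open>Y > 0\<close>.\<close>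

definition density ::
  "real \<Rightarrow> (real \<times> real \<Rightarrow> real) \<Rightarrow> real \<Rightarrow> real \<Rightarrow> (real \<Rightarrow> real) \<Rightarrow> (real \<Rightarrow> real) \<Rightarrow> (real \<Rightarrow> real) \<Rightarrow> (real \<Rightarrow> real)
     \<Rightarrow> real \<times> real \<Rightarrow> real" where
  "density \<delta> Y e1 e2 u u' w w' p =
     of_bool (0 < Y p) * bump \<delta> (u (snd p) - u (fst p) - e1) * bump \<delta> (w (snd p) - w (fst p) - e2) *
       (u' (snd p) * w' (fst p) - u' (fst p) * w' (snd p))"

section \<open>Integrals of exact forms with a cutoff\<close>

lemma density_swap: "density \<delta> Y e1 e2 u u' w w' p = - density \<delta> Y e2 e1 w w' u u' p"
  by (simp add: density_def algebra_simps)

text \<open>Wherever \<open>f\<close> is nonzero, the jump at \<open>Y = 0\<close> can be replaced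
  by the continuous clipped function of \<open>Y / \<eta>\<close>.\<close>

lemma continuous_cutoff:
  fixes f Y :: "'a::topological_space \<Rightarrow> real"
  assumes f: "continuous_on UNIV f" and Y: "continuous_on UNIV Y" and "\<eta> > 0"
    and zero: "\<And>p. \<bar>Y p\<bar> < \<eta> \<Longrightarrow> f p = 0"
  shows "continuous_on UNIV (\<lambda>p. of_bool (0 < Y p) * f p)"
proof -
  have "of_bool (0 < Y p) * f p = max 0 (min 1 (Y p / \<eta>)) * f p" for p
  proof (cases "\<bar>Y p\<bar> < \<eta>")
    case False
    then have "\<eta> \<le> Y p \<or> Y p \<le> - \<eta>" by linarith
    then show ?thesis using \<open>\<eta> > 0\<close> by (auto simp: field_simps min_def max_def)
  qed (simp add: zero)
  moreover have "continuous_on UNIV (\<lambda>p. max 0 (min 1 (Y p / \<eta>)) * f p)"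
    using \<open>\<eta> > 0\<close> by (intro continuous_intros f Y) auto
  ultimately show ?thesis by (simp only:)
qed

lemma cutoff_derivative:
  fixes f Y :: "real \<Rightarrow> real"
  assumes f: "(f has_real_derivative f') (at t)" and Y: "continuous_on UNIV Y" and "\<eta> > 0"
    and zero: "\<And>s. \<bar>Y s\<bar> < \<eta> \<Longrightarrow> f s = 0"
  shows "((\<lambda>s. of_bool (0 < Y s) * f s) has_real_derivative of_bool (0 < Y t) * f') (at t)"
proof -
  have ev: "((\<lambda>s. of_bool (0 < Y s) * f s) has_real_derivative d) (at t)"
    if "open U" "t \<in> U" "\<And>s. s \<in> U \<Longrightarrow> of_bool (0 < Y s) * f s = g s" "(g has_real_derivative d) (at t)" for U g d
    by (rule has_field_derivative_transform_within_open[OF that(4,1,2)]) (simp add: that(3))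
  have op: "open {s. 0 < Y s}" "open {s. Y s < 0}" "open {s. \<bar>Y s\<bar> < \<eta>}"
    by (intro open_Collect_less continuous_intros Y)+
  consider "0 < Y t" | "Y t < 0" | "Y t = 0" by linarith
  then show ?thesis
  proof cases
    case 1
    then show ?thesis by (intro ev[OF op(1), of f]) (use f in auto)
  next
    case 2
    then show ?thesis by (intro ev[OF op(2), of "\<lambda>_. 0"]) auto
  next
    case 3
    then show ?thesis using \<open>\<eta> > 0\<close> by (intro ev[OF op(3), of "\<lambda>_. 0"]) (auto simp: zero)
  qed
qed

text \<open>Stokes on the torus, done by Fubini and the fundamental theorem: the periodic boundary
  values cancel.\<close>

lemma square_integral_derivative:
  fixes P p :: "real \<times> real \<Rightarrow> real"
  assumes cont: "continuous_on UNIV p"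
  shows "(\<And>t t'. ((\<lambda>t. P (t, t')) has_real_derivative p (t, t')) (at t)) \<Longrightarrow>
      (\<And>t'. P (a + 1, t') = P (a, t')) \<Longrightarrow> integral (cbox (a, a) (a + 1, a + 1)) p = 0"
    and "(\<And>t t'. ((\<lambda>t'. P (t, t')) has_real_derivative p (t, t')) (at t')) \<Longrightarrow>
      (\<And>t. P (t, a + 1) = P (t, a)) \<Longrightarrow> integral (cbox (a, a) (a + 1, a + 1)) p = 0"
proof -
  have c: "continuous_on (cbox (a, a) (a + 1, a + 1)) p" using cont continuous_on_subset by blast
  have iter: "integral (cbox (a, a) (a + 1, a + 1)) p = integral (cbox a (a + 1)) (\<lambda>t. integral (cbox a (a + 1)) (\<lambda>t'. p (t, t')))"
    using integral_prod_continuous[OF c] .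
  have swap: "integral (cbox a (a + 1)) (\<lambda>t. integral (cbox a (a + 1)) (\<lambda>t'. p (t, t'))) =
      integral (cbox a (a + 1)) (\<lambda>t'. integral (cbox a (a + 1)) (\<lambda>t. p (t, t')))"
    using integral_swap_continuous[of a a "a + 1" "a + 1" "\<lambda>t t'. p (t, t')"] c by simp
  have ftc: "integral (cbox a (a + 1)) g' = g (a + 1) - g a" if "\<And>t. (g has_real_derivative g' t) (at t)" for g g' :: "real \<Rightarrow> real"
  proof -
    have "(g' has_integral g (a + 1) - g a) {a..a + 1}"
      by (rule fundamental_theorem_of_calculus)
         (use that in \<open>auto simp: has_real_derivative_iff_has_vector_derivative intro: has_vector_derivative_at_within\<close>)
    then show ?thesis by (simp add: integral_unique)
  qed
  show "integral (cbox (a, a) (a + 1, a + 1)) p = 0"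
    if d: "\<And>t t'. ((\<lambda>t. P (t, t')) has_real_derivative p (t, t')) (at t)" and per: "\<And>t'. P (a + 1, t') = P (a, t')"
    using ftc[OF d] per unfolding iter swap by simp
  show "integral (cbox (a, a) (a + 1, a + 1)) p = 0"
    if d: "\<And>t t'. ((\<lambda>t'. P (t, t')) has_real_derivative p (t, t')) (at t')" and per: "\<And>t. P (t, a + 1) = P (t, a)"
    using ftc[OF d] per unfolding iter by simp
qed

lemma continuous_pair:
  fixes f :: "real \<Rightarrow> real"
  assumes "continuous_on UNIV f"
  shows "continuous_on UNIV (\<lambda>p::real\<times>real. f (fst p))" "continuous_on UNIV (\<lambda>p::real\<times>real. f (snd p))"
  by (intro continuous_on_compose2[OF assms] continuous_intros; simp)+

text \<open>Deforming one coordinate changes the density by the differential of a one-form that vanishes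
  near \<open>Y = 0\<close>.\<close>

lemma density_integral_change:
  fixes u u' v v' w w' :: "real \<Rightarrow> real"
  assumes "\<delta> > 0" "\<eta> > 0"
    and u: "\<And>t. (u has_real_derivative u' t) (at t)" "continuous_on UNIV u'" "\<And>t. u (t + 1) = u t"
    and v: "\<And>t. (v has_real_derivative v' t) (at t)" "continuous_on UNIV v'" "\<And>t. v (t + 1) = v t"
    and w: "\<And>t. (w has_real_derivative w' t) (at t)" "continuous_on UNIV w'" "\<And>t. w (t + 1) = w t" "\<And>t. w' (t + 1) = w' t"
    and Y: "continuous_on UNIV Y" "\<And>t t'. Y (t + 1, t') = Y (t, t')" "\<And>t t'. Y (t, t' + 1) = Y (t, t')"
    and margin: "\<And>t t'. \<bar>Y (t, t')\<bar> < \<eta> \<Longrightarrow> \<delta> \<le> \<bar>w t' - w t - e2\<bar> \<or>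
      (\<delta> \<le> u t' - u t - e1 \<and> \<delta> \<le> v t' - v t - e1) \<or> (u t' - u t - e1 \<le> - \<delta> \<and> v t' - v t - e1 \<le> - \<delta>)"
  shows "integral (cbox (a, a) (a + 1, a + 1)) (density \<delta> Y e1 e2 u u' w w') =
    integral (cbox (a, a) (a + 1, a + 1)) (density \<delta> Y e1 e2 v v' w w')"
proof -
  define U V W where "U p = u (snd p) - u (fst p) - e1" and "V p = v (snd p) - v (fst p) - e1"
    and "W p = w (snd p) - w (fst p) - e2" for p
  have cont: "continuous_on UNIV u" "continuous_on UNIV v" "continuous_on UNIV w"
    using u(1) v(1) w(1) by (meson DERIV_isCont continuous_at_imp_continuous_on)+
  have cUVW: "continuous_on UNIV U" "continuous_on UNIV V" "continuous_on UNIV W"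
    unfolding U_def V_def W_def by (intro continuous_intros continuous_pair cont)+
  have cb: "continuous_on UNIV (\<lambda>p. bump \<delta> (G p))" "continuous_on UNIV (\<lambda>p. step \<delta> (G p))"
      "continuous_on UNIV (\<lambda>p. bump' \<delta> (G p))" if "continuous_on UNIV G" for G :: "real \<times> real \<Rightarrow> real"
    using that by (auto intro!: continuous_on_compose2[OF continuous_on_bump[of UNIV]]
        continuous_on_compose2[OF continuous_on_step[of UNIV]] continuous_on_compose2[OF continuous_bump'])
  \<comment> \<open>Near \<open>Y = 0\<close> either the bump in \<open>w\<close> vanishes, or both
    displacements are on the same side of 0 and at distance \<open>\<delta>\<close>, where the steps
    agree and their bumps vanish.\<close>
  have far: "bump \<delta> (W p) = 0 \<and> bump' \<delta> (W p) = 0 \<or>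
      step \<delta> (V p) = step \<delta> (U p) \<and> bump \<delta> (U p) = 0 \<and> bump \<delta> (V p) = 0" if "\<bar>Y p\<bar> < \<eta>" for p
  proof (cases p)
    case (Pair t t')
    then show ?thesis
      using margin[of t t'] that step_far[OF \<open>\<delta> > 0\<close>] \<open>\<delta> > 0\<close> by (auto simp: U_def V_def W_def)
  qed
  \<comment> \<open>The one-form is \<open>\<omega>\<close> times the differential of the
    displacement of \<open>w\<close>, and \<open>\<omega>1\<close>, \<open>\<omega>2\<close> are the
    partial derivatives of \<open>\<omega>\<close>.\<close>
  define \<omega> where "\<omega> p = (step \<delta> (V p) - step \<delta> (U p)) * bump \<delta> (W p)" for p
  define \<omega>1 where "\<omega>1 p = (bump \<delta> (U p) * u' (fst p) - bump \<delta> (V p) * v' (fst p)) * bump \<delta> (W p) -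
    (step \<delta> (V p) - step \<delta> (U p)) * (bump' \<delta> (W p) * w' (fst p))" for p
  define \<omega>2 where "\<omega>2 p = (bump \<delta> (V p) * v' (snd p) - bump \<delta> (U p) * u' (snd p)) * bump \<delta> (W p) +
    (step \<delta> (V p) - step \<delta> (U p)) * (bump' \<delta> (W p) * w' (snd p))" for p
  have d1: "((\<lambda>t. \<omega> (t, t')) has_real_derivative \<omega>1 (t, t')) (at t)" for t t'
    unfolding \<omega>_def \<omega>1_def U_def V_def W_def fst_conv snd_conv
    by (auto intro!: derivative_eq_intros DERIV_chain2[OF step_derivative] DERIV_chain2[OF bump_derivative] u(1) v(1) w(1))
  have d2: "((\<lambda>t'. \<omega> (t, t')) has_real_derivative \<omega>2 (t, t')) (at t')" for t t'
    unfolding \<omega>_def \<omega>2_def U_def V_def W_def fst_conv snd_conv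
    by (auto intro!: derivative_eq_intros DERIV_chain2[OF step_derivative] DERIV_chain2[OF bump_derivative] u(1) v(1) w(1))
  let ?P = "\<lambda>p. of_bool (0 < Y p) * (\<omega> p * w' (snd p))" and ?p = "\<lambda>p. of_bool (0 < Y p) * (\<omega>1 p * w' (snd p))"
  let ?Q = "\<lambda>p. of_bool (0 < Y p) * (\<omega> p * w' (fst p))" and ?q = "\<lambda>p. of_bool (0 < Y p) * (\<omega>2 p * w' (fst p))"
  have c1: "continuous_on UNIV (\<lambda>p. \<omega>1 p * w' (snd p))" "continuous_on UNIV (\<lambda>p. \<omega>2 p * w' (fst p))"
    unfolding \<omega>1_def \<omega>2_def by (intro continuous_intros cb cUVW continuous_pair u(2) v(2) w(2))+
  have cp: "continuous_on UNIV ?p" "continuous_on UNIV ?q"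
    by (intro continuous_cutoff[OF c1(1) Y(1) \<open>\<eta> > 0\<close>] continuous_cutoff[OF c1(2) Y(1) \<open>\<eta> > 0\<close>];
        use far in \<open>fastforce simp: \<omega>1_def \<omega>2_def\<close>)+
  have Y1: "continuous_on UNIV (\<lambda>t. Y (t, t'))" "continuous_on UNIV (\<lambda>t. Y (t', t))" for t'
    by (intro continuous_on_compose2[OF Y(1)] continuous_intros; simp)+
  have \<omega>0: "\<omega> p = 0" if "\<bar>Y p\<bar> < \<eta>" for p using far[OF that] by (auto simp: \<omega>_def)
  have dP: "((\<lambda>t. ?P (t, t')) has_real_derivative ?p (t, t')) (at t)" for t t'
  proof (rule cutoff_derivative[OF _ Y1(1) \<open>\<eta> > 0\<close>])
    show "((\<lambda>t. \<omega> (t, t') * w' (snd (t, t'))) has_real_derivative \<omega>1 (t, t') * w' (snd (t, t'))) (at t)"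
      using DERIV_cmult_right[OF d1] by simp
  qed (simp add: \<omega>0)
  have dQ: "((\<lambda>t'. ?Q (t, t')) has_real_derivative ?q (t, t')) (at t')" for t t'
  proof (rule cutoff_derivative[OF _ Y1(2) \<open>\<eta> > 0\<close>])
    show "((\<lambda>t'. \<omega> (t, t') * w' (fst (t, t'))) has_real_derivative \<omega>2 (t, t') * w' (fst (t, t'))) (at t')"
      using DERIV_cmult_right[OF d2] by simp
  qed (simp add: \<omega>0)
  have per: "?P (a + 1, t') = ?P (a, t')" "?Q (t', a + 1) = ?Q (t', a)" for t'
    by (simp_all add: \<omega>_def U_def V_def W_def Y u(3) v(3) w(3,4))
  have ip: "integral (cbox (a, a) (a + 1, a + 1)) ?p = 0"
    by (rule square_integral_derivative(1)[OF cp(1) dP per(1)])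
  have iq: "integral (cbox (a, a) (a + 1, a + 1)) ?q = 0"
    by (rule square_integral_derivative(2)[OF cp(2) dQ per(2)])
  have dens: "continuous_on UNIV (density \<delta> Y e1 e2 f f' w w')"
    if f: "continuous_on UNIV f" "continuous_on UNIV f'" "f = u \<or> f = v" for f f'
  proof -
    have "continuous_on UNIV (\<lambda>p. of_bool (0 < Y p) * (bump \<delta> (f (snd p) - f (fst p) - e1) * bump \<delta> (W p) *
       (f' (snd p) * w' (fst p) - f' (fst p) * w' (snd p))))"
    proof (rule continuous_cutoff[OF _ Y(1) \<open>\<eta> > 0\<close>])
      show "continuous_on UNIV (\<lambda>p. bump \<delta> (f (snd p) - f (fst p) - e1) * bump \<delta> (W p) *
         (f' (snd p) * w' (fst p) - f' (fst p) * w' (snd p)))"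
        by (intro continuous_intros cb cUVW continuous_pair f w(2))
    qed (use far f(3) in \<open>fastforce simp: U_def V_def\<close>)
    then show ?thesis by (simp add: density_def[abs_def] W_def mult.assoc)
  qed
  have int: "f integrable_on cbox (a, a) (a + 1, a + 1)" if "continuous_on UNIV f" for f :: "real \<times> real \<Rightarrow> real"
    using that continuous_on_subset by (blast intro: integrable_continuous)
  \<comment> \<open>The two terms with \<open>bump'\<close> cancel: they contain the differential of
    the displacement of \<open>w\<close> twice.\<close>
  have "density \<delta> Y e1 e2 v v' w w' p - density \<delta> Y e1 e2 u u' w w' p = ?p p + ?q p" for p
    by (simp add: density_def \<omega>1_def \<omega>2_def U_def V_def W_def algebra_simps)
  then have "integral (cbox (a, a) (a + 1, a + 1)) (\<lambda>p. density \<delta> Y e1 e2 v v' w w' p - density \<delta> Y e1 e2 u u' w w' p) =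
      integral (cbox (a, a) (a + 1, a + 1)) (\<lambda>p. ?p p + ?q p)" by simp
  then show ?thesis
    using integral_diff[OF int[OF dens[OF cont(2) v(2)]] int[OF dens[OF cont(1) u(2)]]]
      integral_add[OF int[OF cp(1)] int[OF cp(2)]] ip iq by simp
qed

section \<open>Invariance of the chord integral under Legendrian isotopy\<close>

text \<open>The mollified degree over \<open>(0, \<epsilon>)\<close> of the displacement map of the
  front, restricted to pairs with the smaller slope at \<open>t'\<close>. The corner
  \<open>a\<close> allows the period square to avoid special parameters.\<close>

definition chord_integral :: "real \<Rightarrow> real \<Rightarrow> real \<Rightarrow> (real \<Rightarrow> real^3) \<Rightarrow> real" where
  "chord_integral a \<delta> \<epsilon> K = integral (cbox (a, a) (a + 1, a + 1))
     (density \<delta> (\<lambda>p. K (fst p) $ 2 - K (snd p) $ 2) 0 \<epsilon>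
       (\<lambda>t. K t $ 1) (\<lambda>t. velocity K t $ 1) (\<lambda>t. K t $ 3) (\<lambda>t. velocity K t $ 3))"

text \<open>First \<open>x\<close> is changed, then \<open>z\<close> by the antisymmetry
  \<open>density_swap\<close>, and finally the cutoff. Every coordinate difference moves by less
  than \<open>\<delta>0 / 4\<close>, so the margin leaves room for \<open>\<delta>\<close>.\<close>

lemma chord_integral_close:
  assumes K: "knot K" "knot L" and "\<delta>0 > 0" "0 < \<delta>" "\<delta> \<le> \<delta>0 / 2"
    and margin: "\<And>t t'. \<bar>L t $ 2 - L t' $ 2\<bar> < \<delta>0 \<Longrightarrow>
      \<delta>0 \<le> \<bar>L t' $ 1 - L t $ 1\<bar> \<or> \<delta>0 \<le> \<bar>L t' $ 3 - L t $ 3 - \<epsilon>\<bar>"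
    and close: "\<And>t i. \<bar>K t $ i - L t $ i\<bar> < \<delta>0 / 8"
  shows "chord_integral a \<delta> \<epsilon> K = chord_integral a \<delta> \<epsilon> L"
proof -
  interpret K: knot K by (rule K)
  interpret L: knot L by (rule K)
  let ?YK = "\<lambda>p::real\<times>real. K (fst p) $ 2 - K (snd p) $ 2" and ?YL = "\<lambda>p::real\<times>real. L (fst p) $ 2 - L (snd p) $ 2"
  let ?I = "\<lambda>f. integral (cbox (a, a) (a + 1, a + 1)) f"
  have Y: "continuous_on UNIV ?YK"
    by (intro continuous_intros continuous_pair K.continuous_D_component)
  have near: "\<bar>(K t' $ i - K t $ i) - (L t' $ i - L t $ i)\<bar> < \<delta>0 / 4" for t t' i
    using close[of t i] close[of t' i] by linarith
  have far: "\<delta>0 \<le> \<bar>L t' $ 1 - L t $ 1\<bar> \<or> \<delta>0 \<le> \<bar>L t' $ 3 - L t $ 3 - \<epsilon>\<bar>"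
    if "\<bar>?YK (t, t')\<bar> < \<delta>0 / 2" for t t'
  proof -
    have "\<bar>K t $ 2 - K t' $ 2\<bar> < \<delta>0 / 2" using that by simp
    then have "\<bar>L t $ 2 - L t' $ 2\<bar> < \<delta>0" using near[of t 2 t'] \<open>\<delta>0 > 0\<close> by linarith
    then show ?thesis by (rule margin)
  qed
  have 1: "?I (density \<delta> ?YK 0 \<epsilon> (\<lambda>t. K t $ 1) (\<lambda>t. velocity K t $ 1) (\<lambda>t. K t $ 3) (\<lambda>t. velocity K t $ 3)) =
      ?I (density \<delta> ?YK 0 \<epsilon> (\<lambda>t. L t $ 1) (\<lambda>t. velocity L t $ 1) (\<lambda>t. K t $ 3) (\<lambda>t. velocity K t $ 3))"
  proof (rule density_integral_change[where \<eta> = "\<delta>0 / 2"])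
    fix t t' assume "\<bar>?YK (t, t')\<bar> < \<delta>0 / 2"
    from far[OF this] show "\<delta> \<le> \<bar>K t' $ 3 - K t $ 3 - \<epsilon>\<bar> \<or>
        \<delta> \<le> K t' $ 1 - K t $ 1 - 0 \<and> \<delta> \<le> L t' $ 1 - L t $ 1 - 0 \<or>
        K t' $ 1 - K t $ 1 - 0 \<le> - \<delta> \<and> L t' $ 1 - L t $ 1 - 0 \<le> - \<delta>"
      using near[of t' 1 t] near[of t' 3 t] assms(3-5) by linarith
  qed (use assms Y in \<open>auto intro: K.D_component_derivative L.D_component_derivative K.continuous_V_component
      L.continuous_V_component simp: K.D_periodic L.D_periodic K.V_periodic\<close>)
  have swapped: "?I (density \<delta> ?YK \<epsilon> 0 (\<lambda>t. K t $ 3) (\<lambda>t. velocity K t $ 3) (\<lambda>t. L t $ 1) (\<lambda>t. velocity L t $ 1)) =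
      ?I (density \<delta> ?YK \<epsilon> 0 (\<lambda>t. L t $ 3) (\<lambda>t. velocity L t $ 3) (\<lambda>t. L t $ 1) (\<lambda>t. velocity L t $ 1))"
  proof (rule density_integral_change[where \<eta> = "\<delta>0 / 2"])
    fix t t' assume "\<bar>?YK (t, t')\<bar> < \<delta>0 / 2"
    from far[OF this] show "\<delta> \<le> \<bar>L t' $ 1 - L t $ 1 - 0\<bar> \<or>
        \<delta> \<le> K t' $ 3 - K t $ 3 - \<epsilon> \<and> \<delta> \<le> L t' $ 3 - L t $ 3 - \<epsilon> \<or>
        K t' $ 3 - K t $ 3 - \<epsilon> \<le> - \<delta> \<and> L t' $ 3 - L t $ 3 - \<epsilon> \<le> - \<delta>"
      using near[of t' 1 t] near[of t' 3 t] assms(3-5) by linarith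
  qed (use assms Y in \<open>auto intro: K.D_component_derivative L.D_component_derivative K.continuous_V_component
      L.continuous_V_component simp: K.D_periodic L.D_periodic L.V_periodic\<close>)
  have 2: "?I (density \<delta> ?YK 0 \<epsilon> (\<lambda>t. L t $ 1) (\<lambda>t. velocity L t $ 1) (\<lambda>t. K t $ 3) (\<lambda>t. velocity K t $ 3)) =
      ?I (density \<delta> ?YK 0 \<epsilon> (\<lambda>t. L t $ 1) (\<lambda>t. velocity L t $ 1) (\<lambda>t. L t $ 3) (\<lambda>t. velocity L t $ 3))"
  proof -
    have "density \<delta> ?YK 0 \<epsilon> u u' w w' = (\<lambda>p. - density \<delta> ?YK \<epsilon> 0 w w' u u' p)" for u u' w w'
      by (rule ext) (rule density_swap)
    then show ?thesis
      using swapped by (simp only: integral_neg)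
  qed
  have 3: "density \<delta> ?YK 0 \<epsilon> (\<lambda>t. L t $ 1) (\<lambda>t. velocity L t $ 1) (\<lambda>t. L t $ 3) (\<lambda>t. velocity L t $ 3) p =
      density \<delta> ?YL 0 \<epsilon> (\<lambda>t. L t $ 1) (\<lambda>t. velocity L t $ 1) (\<lambda>t. L t $ 3) (\<lambda>t. velocity L t $ 3) p" for p
  proof (cases "(0 < ?YK p) = (0 < ?YL p)")
    case False
    then have "\<bar>?YK p\<bar> < \<delta>0 / 2" using near[of "fst p" 2 "snd p"] \<open>\<delta>0 > 0\<close> by linarith
    then have "\<delta> \<le> \<bar>L (snd p) $ 1 - L (fst p) $ 1 - 0\<bar> \<or> \<delta> \<le> \<bar>L (snd p) $ 3 - L (fst p) $ 3 - \<epsilon>\<bar>"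
      using far[of "fst p" "snd p"] assms(3-5) by simp linarith
    then show ?thesis using step_far(3)[OF \<open>0 < \<delta>\<close>] by (auto simp: density_def)
  qed (simp add: density_def)
  show ?thesis unfolding chord_integral_def 1 2 3 ..
qed

locale legendrian_isotopy = knot_isotopy +
  assumes legendrian_H: "\<And>s. s \<in> {0..1} \<Longrightarrow> legendrian_knot (H s)"
begin

lemma legendrian: "s \<in> {0..1} \<Longrightarrow> legendrian (H s)"
  using legendrian_H knot_H by unfold_locales

text \<open>Arbitrarily short chords would accumulate at a parameter where \<open>x'\<close> and \<open>y'\<close>, and so the
  velocity of the Legendrian curve, vanish.\<close>

lemma chord_length:
  "\<exists>\<epsilon>>0. \<forall>s t t'. s \<in> {0..1} \<longrightarrow> H s t $ 1 = H s t' $ 1 \<longrightarrow> H s t $ 2 = H s t' $ 2 \<longrightarrow>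
    H s t $ 3 \<noteq> H s t' $ 3 \<longrightarrow> \<epsilon> \<le> \<bar>H s t $ 3 - H s t' $ 3\<bar>"
proof (rule ccontr)
  assume no: "\<not> ?thesis"
  have "\<exists>s t t'. s \<in> {0..1} \<and> t \<in> {0..1} \<and> \<bar>t' - t\<bar> \<le> 1/2 \<and> H s t $ 1 = H s t' $ 1 \<and> H s t $ 2 = H s t' $ 2 \<and>
      H s t $ 3 \<noteq> H s t' $ 3 \<and> \<bar>H s t $ 3 - H s t' $ 3\<bar> < \<epsilon>" if "\<epsilon> > 0" for \<epsilon>
  proof -
    obtain s t t' where s: "s \<in> {0..1}" "H s t $ 1 = H s t' $ 1" "H s t $ 2 = H s t' $ 2"
        "H s t $ 3 \<noteq> H s t' $ 3" "\<bar>H s t $ 3 - H s t' $ 3\<bar> < \<epsilon>"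
      using no \<open>\<epsilon> > 0\<close> unfolding not_ex not_all de_Morgan_conj not_imp not_le by blast
    interpret knot "H s" by unfold_locales (rule knot_H[OF s(1)])
    define r where "r = t' + of_int (- round (t' - frac t))"
    have "H s (frac t) = H s t" "H s r = H s t'" unfolding r_def by (rule D_frac, rule D_periodic_int)
    moreover have "\<bar>r - frac t\<bar> \<le> 1/2"
      using of_int_round_abs_le[of "t' - frac t"] unfolding r_def by (simp add: abs_minus_commute algebra_simps)
    moreover have "frac t \<in> {0..1}" by (simp add: less_imp_le frac_lt_1)
    ultimately show ?thesis using s by (intro exI[of _ s] exI[of _ "frac t"] exI[of _ r]) simp
  qed
  then have "\<forall>k. \<exists>p. fst p \<in> {0..1} \<and> fst (snd p) \<in> {0..1} \<and> \<bar>snd (snd p) - fst (snd p)\<bar> \<le> 1/2 \<and>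
      H (fst p) (fst (snd p)) $ 1 = H (fst p) (snd (snd p)) $ 1 \<and> H (fst p) (fst (snd p)) $ 2 = H (fst p) (snd (snd p)) $ 2 \<and>
      H (fst p) (fst (snd p)) $ 3 \<noteq> H (fst p) (snd (snd p)) $ 3 \<and>
      \<bar>H (fst p) (fst (snd p)) $ 3 - H (fst p) (snd (snd p)) $ 3\<bar> < inverse (real (Suc k))"
    by (simp only: fst_conv snd_conv split_paired_Ex) (metis inverse_positive_iff_positive of_nat_0_less_iff zero_less_Suc)
  from choice[OF this] obtain f where f: "\<And>k. fst (f k) \<in> {0..1}" "\<And>k. fst (snd (f k)) \<in> {0..1}"
      "\<And>k. \<bar>snd (snd (f k)) - fst (snd (f k))\<bar> \<le> 1/2"
      "\<And>k. H (fst (f k)) (fst (snd (f k))) $ 1 = H (fst (f k)) (snd (snd (f k))) $ 1"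
      "\<And>k. H (fst (f k)) (fst (snd (f k))) $ 2 = H (fst (f k)) (snd (snd (f k))) $ 2"
      "\<And>k. H (fst (f k)) (fst (snd (f k))) $ 3 \<noteq> H (fst (f k)) (snd (snd (f k))) $ 3"
      "\<And>k. \<bar>H (fst (f k)) (fst (snd (f k))) $ 3 - H (fst (f k)) (snd (snd (f k))) $ 3\<bar> < inverse (real (Suc k))"
    by auto
  have mem: "f k \<in> {0..1} \<times> {0..1} \<times> {-1..2}" for k
  proof -
    have "snd (snd (f k)) \<in> {-1..2}"
      using f(2,3)[of k] unfolding abs_le_iff atLeastAtMost_iff by linarith
    then show ?thesis using f(1,2)[of k] by (simp add: mem_Times_iff)
  qed
  have "compact ({0..1} \<times> {0..1} \<times> {-1..2} :: (real \<times> real \<times> real) set)"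
    by (intro compact_Times compact_Icc)
  then obtain l r where lr: "l \<in> {0..1} \<times> {0..1} \<times> {-1..2}" "strict_mono r" "(f \<circ> r) \<longlonglongrightarrow> l"
    using mem unfolding compact_def by blast
  obtain s t t' where l: "l = (s, t, t')" by (cases l)
  have s: "s \<in> {0..1}" using lr(1) l by auto
  interpret leg: legendrian "H s" by (rule legendrian[OF s])
  have lim: "(\<lambda>k. fst (f (r k))) \<longlonglongrightarrow> s" "(\<lambda>k. fst (snd (f (r k)))) \<longlonglongrightarrow> t" "(\<lambda>k. snd (snd (f (r k)))) \<longlonglongrightarrow> t'"
    using tendsto_fst[OF lr(3)] tendsto_fst[OF tendsto_snd[OF lr(3)]] tendsto_snd[OF tendsto_snd[OF lr(3)]]
    by (simp_all add: l o_def)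
  have Hlim: "(\<lambda>k. H (a k) (b k)) \<longlonglongrightarrow> H s \<tau>" if "a \<longlonglongrightarrow> s" "b \<longlonglongrightarrow> \<tau>" for a b \<tau>
    using continuous_on_tendsto_compose[OF continuous_H[of UNIV] tendsto_Pair[OF that]] by simp
  have Vlim: "(\<lambda>k. velocity (H (a k)) (b k)) \<longlonglongrightarrow> velocity (H s) \<tau>" if "a \<longlonglongrightarrow> s" "b \<longlonglongrightarrow> \<tau>" for a b \<tau>
    using continuous_on_tendsto_compose[OF continuous_velocity_H[of UNIV] tendsto_Pair[OF that]] by simp
  have eq: "H s t $ i = H s t' $ i" for i
  proof -
    have "(\<lambda>k. H (fst (f (r k))) (fst (snd (f (r k)))) $ i - H (fst (f (r k))) (snd (snd (f (r k)))) $ i) \<longlonglongrightarrow>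
        H s t $ i - H s t' $ i"
      by (intro tendsto_intros Hlim lim)
    moreover have "(\<lambda>k. H (fst (f (r k))) (fst (snd (f (r k)))) $ i - H (fst (f (r k))) (snd (snd (f (r k)))) $ i) \<longlonglongrightarrow> 0"
    proof (rule Lim_null_comparison)
      show "\<forall>\<^sub>F k in sequentially. norm (H (fst (f (r k))) (fst (snd (f (r k)))) $ i - H (fst (f (r k))) (snd (snd (f (r k)))) $ i) \<le> inverse (real (Suc (r k)))"
        using f(4,5) less_imp_le[OF f(7)] exhaust_3[of i] by (intro always_eventually allI) auto
      show "(\<lambda>k. inverse (real (Suc (r k)))) \<longlonglongrightarrow> 0"
        using LIMSEQ_subseq_LIMSEQ[OF LIMSEQ_inverse_real_of_nat lr(2)] by (simp add: o_def)
    qed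
    ultimately have "H s t $ i - H s t' $ i = 0" by (rule LIMSEQ_unique)
    then show ?thesis by simp
  qed
  \<comment> \<open>The limit chord has length 0 and its parameters are within half a period, so
    they coincide.\<close>
  then have "H s t = H s t'" by (simp add: vec_eq_iff)
  moreover have "\<bar>t' - t\<bar> \<le> 1/2"
    using tendsto_upperbound[OF tendsto_rabs[OF tendsto_diff[OF lim(3) lim(2)]], of "1/2"] f(3) by simp
  ultimately have "t' = t" using leg.D_eq_near[of t' t] by simp
  have zero: "velocity (H s) t $ i = 0" if i: "i = 1 \<or> i = 2" for i
  proof -
    \<comment> \<open>Rolle's theorem for the coordinate \<open>i\<close> between the ends of the
      chord with index \<open>k\<close>.\<close>
    have "\<exists>\<xi>. min (fst (snd (f k))) (snd (snd (f k))) \<le> \<xi> \<and> \<xi> \<le> max (fst (snd (f k))) (snd (snd (f k))) \<and>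
        velocity (H (fst (f k))) \<xi> $ i = 0" for k
    proof -
      interpret knot "H (fst (f k))" by unfold_locales (rule knot_H[OF f(1)])
      have eqk: "H (fst (f k)) (fst (snd (f k))) $ i = H (fst (f k)) (snd (snd (f k))) $ i" using f(4,5)[of k] i by auto
      have ne: "fst (snd (f k)) \<noteq> snd (snd (f k))" using f(6)[of k] by auto
      have *: "\<exists>\<xi>. x < \<xi> \<and> \<xi> < y \<and> velocity (H (fst (f k))) \<xi> $ i = 0"
        if xy: "x < y" "H (fst (f k)) x $ i = H (fst (f k)) y $ i" for x y
      proof -
        obtain \<xi> where "x < \<xi>" "\<xi> < y" "H (fst (f k)) y $ i - H (fst (f k)) x $ i = (y - x) * velocity (H (fst (f k))) \<xi> $ i"
          using MVT2[OF xy(1), of "\<lambda>t. H (fst (f k)) t $ i" "\<lambda>t. velocity (H (fst (f k))) t $ i"] D_component_derivative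
          by blast
        then show ?thesis using xy by auto
      qed
      show ?thesis
      proof (cases "fst (snd (f k)) < snd (snd (f k))")
        case True
        from *[OF this eqk] obtain \<xi> where "fst (snd (f k)) < \<xi>" "\<xi> < snd (snd (f k))"
          "velocity (H (fst (f k))) \<xi> $ i = 0" by blast
        then show ?thesis by (intro exI[of _ \<xi>]) simp
      next
        case False
        then have "snd (snd (f k)) < fst (snd (f k))" using ne by simp
        from *[OF this eqk[symmetric]] obtain \<xi> where "snd (snd (f k)) < \<xi>" "\<xi> < fst (snd (f k))"
          "velocity (H (fst (f k))) \<xi> $ i = 0" by blast
        then show ?thesis by (intro exI[of _ \<xi>]) simp
      qed
    qed
    then have "\<forall>k. \<exists>\<xi>. min (fst (snd (f k))) (snd (snd (f k))) \<le> \<xi> \<and> \<xi> \<le> max (fst (snd (f k))) (snd (snd (f k))) \<and>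
        velocity (H (fst (f k))) \<xi> $ i = 0" by blast
    from choice[OF this] obtain \<xi> where
      \<xi>: "\<And>k. min (fst (snd (f k))) (snd (snd (f k))) \<le> \<xi> k" "\<And>k. \<xi> k \<le> max (fst (snd (f k))) (snd (snd (f k)))"
         "\<And>k. velocity (H (fst (f k))) (\<xi> k) $ i = 0" by auto
    have "(\<lambda>k. \<xi> (r k)) \<longlonglongrightarrow> t"
    proof (rule tendsto_sandwich)
      show "(\<lambda>k. min (fst (snd (f (r k)))) (snd (snd (f (r k))))) \<longlonglongrightarrow> t"
        using tendsto_min[OF lim(2,3)] \<open>t' = t\<close> by simp
      show "(\<lambda>k. max (fst (snd (f (r k)))) (snd (snd (f (r k))))) \<longlonglongrightarrow> t"
        using tendsto_max[OF lim(2,3)] \<open>t' = t\<close> by simp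
    qed (use \<xi> in simp_all)
    from tendsto_vec_nth[OF Vlim[OF lim(1) this], of i]
    have "(\<lambda>k. 0) \<longlonglongrightarrow> velocity (H s) t $ i" by (simp add: \<xi>(3))
    then show ?thesis by (simp add: LIMSEQ_const_iff)
  qed
  show False using leg.V2_nonzero[of t] zero by simp
qed

text \<open>No pair has equal \<open>x\<close>, equal \<open>y\<close> and height difference exactly
  \<open>\<epsilon>\<close>, as chords are longer. So the largest of the three deviations has a
  positive minimum over all times and parameters.\<close>

lemma chord_margin:
  assumes \<epsilon>0: "\<And>s t t'. s \<in> {0..1} \<Longrightarrow> H s t $ 1 = H s t' $ 1 \<Longrightarrow> H s t $ 2 = H s t' $ 2 \<Longrightarrow>
      H s t $ 3 \<noteq> H s t' $ 3 \<Longrightarrow> \<epsilon>0 \<le> \<bar>H s t $ 3 - H s t' $ 3\<bar>"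
    and \<epsilon>: "\<epsilon> \<noteq> 0" "\<bar>\<epsilon>\<bar> < \<epsilon>0"
  obtains \<delta> where "\<delta> > 0" "\<And>s t t'. s \<in> {0..1} \<Longrightarrow> \<bar>H s t $ 2 - H s t' $ 2\<bar> < \<delta> \<Longrightarrow>
      \<delta> \<le> \<bar>H s t' $ 1 - H s t $ 1\<bar> \<or> \<delta> \<le> \<bar>H s t' $ 3 - H s t $ 3 - \<epsilon>\<bar>"
proof -
  let ?C = "{0..1} \<times> {0..1} \<times> {0..1} :: (real \<times> real \<times> real) set"
  define g where "g p = max \<bar>H (fst p) (fst (snd p)) $ 2 - H (fst p) (snd (snd p)) $ 2\<bar>
    (max \<bar>H (fst p) (snd (snd p)) $ 1 - H (fst p) (fst (snd p)) $ 1\<bar>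
      \<bar>H (fst p) (snd (snd p)) $ 3 - H (fst p) (fst (snd p)) $ 3 - \<epsilon>\<bar>)" for p
  have "continuous_on ?C (\<lambda>p. H (fst p) (fst (snd p)))" "continuous_on ?C (\<lambda>p. H (fst p) (snd (snd p)))"
    using continuous_on_compose2[OF continuous_H[of UNIV], of ?C "\<lambda>p. (fst p, fst (snd p))"]
      continuous_on_compose2[OF continuous_H[of UNIV], of ?C "\<lambda>p. (fst p, snd (snd p))"]
    by (simp_all add: continuous_intros)
  then have "continuous_on ?C g" unfolding g_def by (intro continuous_intros)
  moreover have "compact ?C" "?C \<noteq> {}" by (auto intro: compact_Times)
  ultimately obtain p where p: "p \<in> ?C" "\<And>q. q \<in> ?C \<Longrightarrow> g p \<le> g q"
    using continuous_attains_inf[of ?C g] by metis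
  have "g p > 0"
  proof (rule ccontr)
    assume "\<not> g p > 0"
    then have "H (fst p) (fst (snd p)) $ 2 = H (fst p) (snd (snd p)) $ 2" "H (fst p) (fst (snd p)) $ 1 = H (fst p) (snd (snd p)) $ 1"
      "H (fst p) (snd (snd p)) $ 3 - H (fst p) (fst (snd p)) $ 3 = \<epsilon>"
      by (auto simp: g_def less_max_iff_disj)
    then show False using \<epsilon>0[of "fst p" "fst (snd p)" "snd (snd p)"] p(1) \<epsilon> by auto
  qed
  moreover have "g p \<le> \<bar>H s t' $ 1 - H s t $ 1\<bar> \<or> g p \<le> \<bar>H s t' $ 3 - H s t $ 3 - \<epsilon>\<bar>"
    if s: "s \<in> {0..1}" and "\<bar>H s t $ 2 - H s t' $ 2\<bar> < g p" for s t t'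
  proof -
    interpret knot "H s" by unfold_locales (rule knot_H[OF s])
    have "(s, frac t, frac t') \<in> ?C" using s by (simp add: less_imp_le frac_lt_1)
    from p(2)[OF this] have "g p \<le> g (s, frac t, frac t')" .
    also have "g (s, frac t, frac t') = max \<bar>H s t $ 2 - H s t' $ 2\<bar>
        (max \<bar>H s t' $ 1 - H s t $ 1\<bar> \<bar>H s t' $ 3 - H s t $ 3 - \<epsilon>\<bar>)"
      by (simp add: g_def D_frac)
    finally show ?thesis using that(2) unfolding le_max_iff_disj by linarith
  qed
  ultimately show ?thesis using that[of "g p"] by simp
qed

lemma chord_integral_invariant:
  assumes margin: "\<delta>0 > 0" "\<And>s t t'. s \<in> {0..1} \<Longrightarrow> \<bar>H s t $ 2 - H s t' $ 2\<bar> < \<delta>0 \<Longrightarrow>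
      \<delta>0 \<le> \<bar>H s t' $ 1 - H s t $ 1\<bar> \<or> \<delta>0 \<le> \<bar>H s t' $ 3 - H s t $ 3 - \<epsilon>\<bar>"
    and \<delta>: "0 < \<delta>" "\<delta> \<le> \<delta>0 / 2"
  shows "chord_integral a \<delta> \<epsilon> (H 0) = chord_integral a \<delta> \<epsilon> (H 1)"
proof -
  obtain d where d: "d > 0" "\<And>s s' t. s \<in> {0..1} \<Longrightarrow> s' \<in> {0..1} \<Longrightarrow> \<bar>s - s'\<bar> < d \<Longrightarrow> dist (H s t) (H s' t) < \<delta>0 / 8"
  proof (rule uniformly_close_time[where f = H and e = "\<delta>0 / 8"])
    show "H s (t + 1) = H s t" if "s \<in> {0..1}" for s t
      using knot.D_periodic[of "H s"] knot_H[OF that] by (simp add: knot_def)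
  qed (use margin(1) continuous_H in auto)
  have near: "chord_integral a \<delta> \<epsilon> (H s') = chord_integral a \<delta> \<epsilon> (H s)"
    if s: "s \<in> {0..1}" "s' \<in> {0..1}" "\<bar>s' - s\<bar> < d" for s s'
  proof (rule chord_integral_close[OF _ _ margin(1) \<delta> margin(2)[OF s(1)]])
    show "\<bar>H s' t $ i - H s t $ i\<bar> < \<delta>0 / 8" for t i
      using d(2)[OF s(2,1,3), of t] component_le_norm_cart[of "H s' t - H s t" i] by (simp add: dist_norm)
  qed (use knot_H s in \<open>simp_all add: knot_def\<close>)
  show ?thesis
  proof (rule connected_equivalence_relation[of "{0..1::real}" 0 1 "\<lambda>s s'. chord_integral a \<delta> \<epsilon> (H s) = chord_integral a \<delta> \<epsilon> (H s')"])
    fix s :: real assume s: "s \<in> {0..1}"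
    have "openin (top_of_set {0..1}) ({0..1} \<inter> ball s d)" by (rule openin_open_Int) simp
    moreover have "s \<in> {0..1} \<inter> ball s d" using s d(1) by simp
    moreover have "\<forall>s'\<in>{0..1} \<inter> ball s d. chord_integral a \<delta> \<epsilon> (H s) = chord_integral a \<delta> \<epsilon> (H s')"
    proof
      fix s' assume "s' \<in> {0..1} \<inter> ball s d"
      then show "chord_integral a \<delta> \<epsilon> (H s) = chord_integral a \<delta> \<epsilon> (H s')"
        using near[OF s, of s'] by (simp add: dist_real_def abs_minus_commute)
    qed
    ultimately show "\<exists>T. openin (top_of_set {0..1}) T \<and> s \<in> T \<and>
        (\<forall>s'\<in>T. chord_integral a \<delta> \<epsilon> (H s) = chord_integral a \<delta> \<epsilon> (H s'))" by blast
  qed simp_all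
qed

end

text \<open>The order of choices matters: first \<open>\<epsilon>\<close> below all chord lengths,
  then \<open>\<delta>\<close> below the margin that belongs to this
  \<open>\<epsilon>\<close>.\<close>

lemma chord_integral_isotopic:
  assumes "legendrian_isotopic K L"
  obtains \<epsilon>0 where "\<epsilon>0 > 0" "\<And>\<epsilon>. \<epsilon> \<noteq> 0 \<Longrightarrow> \<bar>\<epsilon>\<bar> < \<epsilon>0 \<Longrightarrow>
    \<exists>\<delta>0>0. \<forall>\<delta> a. 0 < \<delta> \<longrightarrow> \<delta> \<le> \<delta>0 \<longrightarrow> chord_integral a \<delta> \<epsilon> K = chord_integral a \<delta> \<epsilon> L"
proof -
  obtain H :: "real \<Rightarrow> real \<Rightarrow> real^3" where H: "smooth (\<lambda>(s, t). H s t)" "\<forall>s\<in>{0..1}. legendrian_knot (H s)"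
      "H 0 = K" "H 1 = L"
    using assms unfolding legendrian_isotopic_def isotopic_through_def by blast
  interpret legendrian_isotopy H using H by unfold_locales (auto simp: legendrian_knot_def)
  obtain \<epsilon>0 where \<epsilon>0: "\<epsilon>0 > 0" "\<And>s t t'. s \<in> {0..1} \<Longrightarrow> H s t $ 1 = H s t' $ 1 \<Longrightarrow> H s t $ 2 = H s t' $ 2 \<Longrightarrow>
      H s t $ 3 \<noteq> H s t' $ 3 \<Longrightarrow> \<epsilon>0 \<le> \<bar>H s t $ 3 - H s t' $ 3\<bar>"
    using chord_length by metis
  show ?thesis
  proof (rule that[OF \<epsilon>0(1)])
    fix \<epsilon> :: real assume \<epsilon>: "\<epsilon> \<noteq> 0" "\<bar>\<epsilon>\<bar> < \<epsilon>0"
    obtain \<delta>0 where \<delta>0: "\<delta>0 > 0" "\<And>s t t'. s \<in> {0..1} \<Longrightarrow> \<bar>H s t $ 2 - H s t' $ 2\<bar> < \<delta>0 \<Longrightarrow>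
        \<delta>0 \<le> \<bar>H s t' $ 1 - H s t $ 1\<bar> \<or> \<delta>0 \<le> \<bar>H s t' $ 3 - H s t $ 3 - \<epsilon>\<bar>"
      using chord_margin[OF \<epsilon>0(2) \<epsilon>] by blast
    then show "\<exists>\<delta>0>0. \<forall>\<delta> a. 0 < \<delta> \<longrightarrow> \<delta> \<le> \<delta>0 \<longrightarrow> chord_integral a \<delta> \<epsilon> K = chord_integral a \<delta> \<epsilon> L"
      using chord_integral_invariant[OF \<delta>0] H(3,4) by (intro exI[of _ "\<delta>0 / 2"]) auto
  qed
qed

section \<open>The chord integral of a generic front\<close>

lemma integral_derivative_interval:
  fixes g :: "real \<Rightarrow> real"
  assumes "a \<le> b" "\<And>t. t \<in> {a..b} \<Longrightarrow> (g has_real_derivative g' t) (at t)"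
  shows "integral (cbox a b) g' = g b - g a"
proof -
  have "(g' has_integral g b - g a) {a..b}"
    by (rule fundamental_theorem_of_calculus)
       (use assms in \<open>auto simp: has_real_derivative_iff_has_vector_derivative intro: has_vector_derivative_at_within\<close>)
  then show ?thesis by (simp add: integral_unique)
qed

text \<open>The integrand is the exterior derivative of \<open>step (u t' - u t) * bump (w t' - w t) dw\<close>. On the
  two edges where \<open>u t' - u t\<close> changes sign, \<open>w t' - w t\<close> is far from \<open>0\<close> at the sign change, so all
  boundary terms are explicit.\<close>

lemma rectangle_integral_standard:
  fixes u u' w w' :: "real \<Rightarrow> real"
  assumes "\<delta> > 0" "l < r" "l' < r'"
    and u: "\<And>t. (u has_real_derivative u' t) (at t)" "continuous_on UNIV u'"
    and w: "\<And>t. (w has_real_derivative w' t) (at t)" "continuous_on UNIV w'"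
    and edge_u: "\<And>t. t \<in> {l..r} \<Longrightarrow> u l' - u t \<le> - \<delta> \<and> \<delta> \<le> u r' - u t"
    and edge_l: "\<And>t'. t' \<in> {l'..r'} \<Longrightarrow> \<bar>u t' - u l\<bar> < \<delta> \<Longrightarrow> \<delta> \<le> w t' - w l - e"
    and edge_r: "\<And>t'. t' \<in> {l'..r'} \<Longrightarrow> \<bar>u t' - u r\<bar> < \<delta> \<Longrightarrow> w t' - w r - e \<le> - \<delta>"
  shows "((\<lambda>p. bump \<delta> (u (snd p) - u (fst p)) * bump \<delta> (w (snd p) - w (fst p) - e) *
       (u' (snd p) * w' (fst p) - u' (fst p) * w' (snd p))) has_integral 1) (cbox (l, l') (r, r'))"
proof -
  let ?R = "cbox (l, l') (r, r')"
  define U W where "U p = u (snd p) - u (fst p)" and "W p = w (snd p) - w (fst p) - e" for p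
  have cont: "continuous_on UNIV u" "continuous_on UNIV w"
    using u(1) w(1) by (meson DERIV_isCont continuous_at_imp_continuous_on)+
  have cUW: "continuous_on UNIV U" "continuous_on UNIV W"
    unfolding U_def W_def by (intro continuous_intros continuous_pair cont)+
  have cb: "continuous_on UNIV (\<lambda>p. bump \<delta> (G p))" "continuous_on UNIV (\<lambda>p. step \<delta> (G p))"
      "continuous_on UNIV (\<lambda>p. bump' \<delta> (G p))" if "continuous_on UNIV G" for G :: "real \<times> real \<Rightarrow> real"
    using that by (auto intro!: continuous_on_compose2[OF continuous_on_bump[of UNIV]]
        continuous_on_compose2[OF continuous_on_step[of UNIV]] continuous_on_compose2[OF continuous_bump'])
  define \<omega> where "\<omega> p = step \<delta> (U p) * bump \<delta> (W p)" for p
  define \<omega>1 where "\<omega>1 p = - bump \<delta> (U p) * u' (fst p) * bump \<delta> (W p) - step \<delta> (U p) * (bump' \<delta> (W p) * w' (fst p))" for p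
  define \<omega>2 where "\<omega>2 p = bump \<delta> (U p) * u' (snd p) * bump \<delta> (W p) + step \<delta> (U p) * (bump' \<delta> (W p) * w' (snd p))" for p
  have d1: "((\<lambda>t. \<omega> (t, t')) has_real_derivative \<omega>1 (t, t')) (at t)" for t t'
    unfolding \<omega>_def \<omega>1_def U_def W_def fst_conv snd_conv
    by (auto intro!: derivative_eq_intros DERIV_chain2[OF step_derivative] DERIV_chain2[OF bump_derivative] u(1) w(1))
  have d2: "((\<lambda>t'. \<omega> (t, t')) has_real_derivative \<omega>2 (t, t')) (at t')" for t t'
    unfolding \<omega>_def \<omega>2_def U_def W_def fst_conv snd_conv
    by (auto intro!: derivative_eq_intros DERIV_chain2[OF step_derivative] DERIV_chain2[OF bump_derivative] u(1) w(1))
  have c1: "continuous_on UNIV (\<lambda>p. \<omega>1 p * w' (snd p))" "continuous_on UNIV (\<lambda>p. \<omega>2 p * w' (fst p))"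
    unfolding \<omega>1_def \<omega>2_def by (intro continuous_intros cb cUW continuous_pair u(2) w(2))+
  have c2: "continuous_on ?R (\<lambda>p. \<omega>1 p * w' (snd p))" "continuous_on ?R (\<lambda>p. \<omega>2 p * w' (fst p))"
    using c1 continuous_on_subset by blast+
  have int: "(\<lambda>p. \<omega>1 p * w' (snd p)) integrable_on ?R" "(\<lambda>p. \<omega>2 p * w' (fst p)) integrable_on ?R"
    using c2 integrable_continuous by blast+
  note far = step_far[OF \<open>\<delta> > 0\<close>]
  have sU: "step \<delta> (U (t, l')) = 0" "step \<delta> (U (t, r')) = 1" if "t \<in> {l..r}" for t
    using far(1,2) edge_u[OF that] by (auto simp: U_def)
  have in_lr: "l \<in> {l..r}" "r \<in> {l..r}" using assms by auto
  have "integral ?R (\<lambda>p. \<omega>1 p * w' (snd p)) =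
      integral (cbox l r) (\<lambda>t. integral (cbox l' r') (\<lambda>t'. \<omega>1 (t, t') * w' t'))"
    using integral_prod_continuous[OF c2(1)] by simp
  also have "\<dots> = integral (cbox l' r') (\<lambda>t'. integral (cbox l r) (\<lambda>t. \<omega>1 (t, t') * w' t'))"
    using integral_swap_continuous[of l l' r r' "\<lambda>t t'. \<omega>1 (t, t') * w' t'"] c2(1) by (simp add: case_prod_beta')
  also have "\<dots> = integral (cbox l' r') (\<lambda>t'. \<omega> (r, t') * w' t' - \<omega> (l, t') * w' t')"
    by (intro integral_cong integral_derivative_interval) (use assms(2) DERIV_cmult_right[OF d1] in \<open>auto simp: less_imp_le\<close>)
  also have "\<dots> = (step \<delta> (U (r, r')) * step \<delta> (W (r, r')) - step \<delta> (U (l, r')) * (step \<delta> (W (l, r')) - 1)) -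
      (step \<delta> (U (r, l')) * step \<delta> (W (r, l')) - step \<delta> (U (l, l')) * (step \<delta> (W (l, l')) - 1))"
  \<comment> \<open>Primitives along the edges \<open>r\<close> and \<open>l\<close>. Where the step
    in \<open>U\<close> varies, the step in \<open>W\<close> is 0 on the edge \<open>r\<close> and 1
    on the edge \<open>l\<close>; the subtracted 1 makes the unwanted term of the product rule
    vanish there too.\<close>
  proof (rule integral_derivative_interval[where g = "\<lambda>t'. step \<delta> (U (r, t')) * step \<delta> (W (r, t')) - step \<delta> (U (l, t')) * (step \<delta> (W (l, t')) - 1)"])
    fix t' assume t': "t' \<in> {l'..r'}"
    have h1: "bump \<delta> (U (r, t')) * step \<delta> (W (r, t')) = 0"
      using far(3)[of "U (r, t')"] far(1)[of "W (r, t')"] edge_r[OF t'] by (cases "\<bar>U (r, t')\<bar> < \<delta>") (auto simp: U_def W_def)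
    have h2: "bump \<delta> (U (l, t')) * (step \<delta> (W (l, t')) - 1) = 0"
      using far(3)[of "U (l, t')"] far(2)[of "W (l, t')"] edge_l[OF t'] by (cases "\<bar>U (l, t')\<bar> < \<delta>") (auto simp: U_def W_def)
    have eq: "\<omega> (r, t') * w' t' - \<omega> (l, t') * w' t' =
        (bump \<delta> (U (r, t')) * step \<delta> (W (r, t'))) * u' t' + step \<delta> (U (r, t')) * (bump \<delta> (W (r, t')) * w' t') -
        ((bump \<delta> (U (l, t')) * (step \<delta> (W (l, t')) - 1)) * u' t' + step \<delta> (U (l, t')) * (bump \<delta> (W (l, t')) * w' t'))"
      unfolding h1 h2 by (simp add: \<omega>_def)
    show "((\<lambda>t'. step \<delta> (U (r, t')) * step \<delta> (W (r, t')) - step \<delta> (U (l, t')) * (step \<delta> (W (l, t')) - 1))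
        has_real_derivative \<omega> (r, t') * w' t' - \<omega> (l, t') * w' t') (at t')"
      unfolding eq unfolding U_def W_def fst_conv snd_conv
      by (auto intro!: derivative_eq_intros DERIV_chain2[OF step_derivative] u(1) w(1) simp: algebra_simps)
  qed (use assms in simp)
  also have "\<dots> = step \<delta> (W (r, r')) - step \<delta> (W (l, r')) + 1"
    using sU[OF in_lr(1)] sU[OF in_lr(2)] by simp
  finally have i1: "integral ?R (\<lambda>p. \<omega>1 p * w' (snd p)) = step \<delta> (W (r, r')) - step \<delta> (W (l, r')) + 1" .
  have "integral ?R (\<lambda>p. \<omega>2 p * w' (fst p)) =
      integral (cbox l r) (\<lambda>t. integral (cbox l' r') (\<lambda>t'. \<omega>2 (t, t') * w' t))"
    using integral_prod_continuous[OF c2(2)] by simp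
  also have "\<dots> = integral (cbox l r) (\<lambda>t. \<omega> (t, r') * w' t - \<omega> (t, l') * w' t)"
    by (intro integral_cong integral_derivative_interval) (use assms(3) DERIV_cmult_right[OF d2] in \<open>auto simp: less_imp_le\<close>)
  also have "\<dots> = integral (cbox l r) (\<lambda>t. bump \<delta> (W (t, r')) * w' t)"
    by (intro integral_cong) (simp add: \<omega>_def sU)
  also have "\<dots> = - step \<delta> (W (r, r')) - - step \<delta> (W (l, r'))"
  proof (rule integral_derivative_interval[where g = "\<lambda>t. - step \<delta> (W (t, r'))"])
    show "((\<lambda>t. - step \<delta> (W (t, r'))) has_real_derivative bump \<delta> (W (t, r')) * w' t) (at t)" for t
      unfolding W_def fst_conv snd_conv by (auto intro!: derivative_eq_intros DERIV_chain2[OF step_derivative] w(1))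
  qed (use assms in simp)
  finally have i2: "integral ?R (\<lambda>p. \<omega>2 p * w' (fst p)) = step \<delta> (W (l, r')) - step \<delta> (W (r, r'))" by simp
  have "((\<lambda>p. \<omega>1 p * w' (snd p) + \<omega>2 p * w' (fst p)) has_integral 1) ?R"
    using has_integral_add[OF integrable_integral[OF int(1)] integrable_integral[OF int(2)]] by (simp add: i1 i2)
  moreover have "\<omega>1 p * w' (snd p) + \<omega>2 p * w' (fst p) = bump \<delta> (U p) * bump \<delta> (W p) * (u' (snd p) * w' (fst p) - u' (fst p) * w' (snd p))" for p
    by (simp add: \<omega>1_def \<omega>2_def algebra_simps)
  ultimately show ?thesis by (simp add: U_def W_def)
qed

text \<open>Reflections of \<open>u\<close> and \<open>w\<close> lead to the standard position:
  \<open>bump\<close> is even and the Jacobian changes by \<open>s1 * s2\<close>.\<close>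

lemma rectangle_integral:
  fixes u u' w w' :: "real \<Rightarrow> real"
  assumes "\<delta> > 0" "l < r" "l' < r'" and s: "s1 = 1 \<or> s1 = - 1" "s2 = 1 \<or> s2 = (- 1 :: real)"
    and u: "\<And>t. (u has_real_derivative u' t) (at t)" "continuous_on UNIV u'"
    and w: "\<And>t. (w has_real_derivative w' t) (at t)" "continuous_on UNIV w'"
    and edge_u: "\<And>t. t \<in> {l..r} \<Longrightarrow> s1 * (u l' - u t) \<le> - \<delta> \<and> \<delta> \<le> s1 * (u r' - u t)"
    and edge_l: "\<And>t'. t' \<in> {l'..r'} \<Longrightarrow> \<bar>u t' - u l\<bar> < \<delta> \<Longrightarrow> \<delta> \<le> s2 * (w t' - w l - e)"
    and edge_r: "\<And>t'. t' \<in> {l'..r'} \<Longrightarrow> \<bar>u t' - u r\<bar> < \<delta> \<Longrightarrow> s2 * (w t' - w r - e) \<le> - \<delta>"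
  shows "((\<lambda>p. bump \<delta> (u (snd p) - u (fst p)) * bump \<delta> (w (snd p) - w (fst p) - e) *
       (u' (snd p) * w' (fst p) - u' (fst p) * w' (snd p))) has_integral s1 * s2) (cbox (l, l') (r, r'))"
proof -
  have abs: "\<bar>s1 * b\<bar> = \<bar>b\<bar>" "bump \<delta> (s1 * b) = bump \<delta> b" "bump \<delta> (s2 * b) = bump \<delta> b" for b
    using s by (auto simp: bump_even)
  have sq: "s1 * s1 = 1" "s2 * s2 = 1" using s by auto
  have "((\<lambda>p. bump \<delta> (s1 * u (snd p) - s1 * u (fst p)) * bump \<delta> (s2 * w (snd p) - s2 * w (fst p) - s2 * e) *
       ((s1 * u' (snd p)) * (s2 * w' (fst p)) - (s1 * u' (fst p)) * (s2 * w' (snd p)))) has_integral 1) (cbox (l, l') (r, r'))"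
  proof (rule rectangle_integral_standard[OF assms(1-3)])
    show "((\<lambda>t. s1 * u t) has_real_derivative s1 * u' t) (at t)" "((\<lambda>t. s2 * w t) has_real_derivative s2 * w' t) (at t)" for t
      by (intro DERIV_cmult u w)+
    show "continuous_on UNIV (\<lambda>t. s1 * u' t)" "continuous_on UNIV (\<lambda>t. s2 * w' t)"
      by (intro continuous_intros u w)+
    show "s1 * u l' - s1 * u t \<le> - \<delta> \<and> \<delta> \<le> s1 * u r' - s1 * u t" if "t \<in> {l..r}" for t
      using edge_u[OF that] by (simp add: right_diff_distrib)
    show "\<delta> \<le> s2 * w t' - s2 * w l - s2 * e" if "t' \<in> {l'..r'}" "\<bar>s1 * u t' - s1 * u l\<bar> < \<delta>" for t'
      using edge_l[OF that(1)] that(2) abs(1)[of "u t' - u l"] by (simp add: right_diff_distrib)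
    show "s2 * w t' - s2 * w r - s2 * e \<le> - \<delta>" if "t' \<in> {l'..r'}" "\<bar>s1 * u t' - s1 * u r\<bar> < \<delta>" for t'
      using edge_r[OF that(1)] that(2) abs(1)[of "u t' - u r"] by (simp add: right_diff_distrib)
  qed
  from has_integral_mult_right[OF this, of "s1 * s2"]
  have "((\<lambda>p. (s1 * s2) * (bump \<delta> (s1 * (u (snd p) - u (fst p))) * bump \<delta> (s2 * (w (snd p) - w (fst p) - e)) *
       ((s1 * u' (snd p)) * (s2 * w' (fst p)) - (s1 * u' (fst p)) * (s2 * w' (snd p))))) has_integral s1 * s2) (cbox (l, l') (r, r'))"
    by (simp add: right_diff_distrib)
  moreover have "(s1 * s2) * (bump \<delta> (s1 * A) * bump \<delta> (s2 * B) * ((s1 * a) * (s2 * b) - (s1 * c) * (s2 * d))) =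
      bump \<delta> A * bump \<delta> B * (a * b - c * d)" for A B a b c d
  proof -
    have "(s1 * s2) * (bump \<delta> A * bump \<delta> B * ((s1 * a) * (s2 * b) - (s1 * c) * (s2 * d))) =
        (s1 * s1) * (s2 * s2) * (bump \<delta> A * bump \<delta> B * (a * b - c * d))" by (simp add: algebra_simps)
    then show ?thesis by (simp add: abs sq)
  qed
  ultimately show ?thesis by (simp only:)
qed

lemma compact_positive:
  fixes f :: "'a::topological_space \<Rightarrow> real"
  assumes "compact K" "continuous_on K f" "\<And>p. p \<in> K \<Longrightarrow> 0 < f p"
  obtains m where "m > 0" "\<And>p. p \<in> K \<Longrightarrow> m \<le> f p"
proof (cases "K = {}")
  case False
  then obtain p where "p \<in> K" "\<forall>q\<in>K. f p \<le> f q" using continuous_attains_inf[OF assms(1) _ assms(2)] by blast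
  then show ?thesis using that[of "f p"] assms(3) by blast
qed (use that[of 1] in auto)

section \<open>Chords of a front and their total weight\<close>

context front_diagram
begin

abbreviation chord_density :: "real \<Rightarrow> real \<Rightarrow> real \<times> real \<Rightarrow> real" where
  "chord_density \<delta> \<epsilon> \<equiv> density \<delta> (\<lambda>p. D (fst p) $ 2 - D (snd p) $ 2) 0 \<epsilon>
       (\<lambda>t. D t $ 1) (\<lambda>t. V t $ 1) (\<lambda>t. D t $ 3) (\<lambda>t. V t $ 3)"

text \<open>The weak inequality makes the condition closed, as the compactness arguments
  require.\<close>

definition chord :: "real \<Rightarrow> real \<Rightarrow> real \<Rightarrow> bool" where
  "chord \<epsilon> t t' \<longleftrightarrow> D t' $ 1 = D t $ 1 \<and> D t' $ 3 = D t $ 3 + \<epsilon> \<and> D t' $ 2 \<le> D t $ 2"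

text \<open>Along the boundary of the rectangle the vector from \<open>(0, \<epsilon>)\<close> to the displacement of the chord
  winds once around \<open>0\<close>, in the direction given by \<open>\<sigma>\<close>.\<close>

definition admissible :: "real \<Rightarrow> real \<Rightarrow> real \<Rightarrow> real \<Rightarrow> real \<Rightarrow> real \<Rightarrow> bool" where
  "admissible \<epsilon> l r l' r' \<sigma> \<longleftrightarrow> l < r \<and> l' < r' \<and> (\<forall>t\<in>{l..r}. \<forall>t'\<in>{l'..r'}. D t' $ 2 < D t $ 2) \<and>
     (\<exists>s1 s2. (s1 = 1 \<or> s1 = - 1) \<and> (s2 = 1 \<or> s2 = - 1) \<and> \<sigma> = s1 * s2 \<and>
       (\<forall>t\<in>{l..r}. s1 * (D l' $ 1 - D t $ 1) < 0 \<and> 0 < s1 * (D r' $ 1 - D t $ 1)) \<and>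
       (\<forall>t'\<in>{l'..r'}. D t' $ 1 = D l $ 1 \<longrightarrow> 0 < s2 * (D t' $ 3 - D l $ 3 - \<epsilon>)) \<and>
       (\<forall>t'\<in>{l'..r'}. D t' $ 1 = D r $ 1 \<longrightarrow> s2 * (D t' $ 3 - D r $ 3 - \<epsilon>) < 0))"

text \<open>Compactness turns the strict inequalities on the boundary into a common margin for
  \<open>\<delta>\<close>, and on the rectangle the cutoff equals 1.\<close>

lemma admissible_integral:
  assumes "admissible \<epsilon> l r l' r' \<sigma>"
  obtains \<delta>1 where "\<delta>1 > 0" "\<And>\<delta>. 0 < \<delta> \<Longrightarrow> \<delta> \<le> \<delta>1 \<Longrightarrow> (chord_density \<delta> \<epsilon> has_integral \<sigma>) (cbox (l, l') (r, r'))"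
proof -
  have lr: "l < r" "l' < r'" and y: "\<And>t t'. t \<in> {l..r} \<Longrightarrow> t' \<in> {l'..r'} \<Longrightarrow> D t' $ 2 < D t $ 2"
    using assms by (auto simp: admissible_def)
  obtain s1 s2 where s: "s1 = 1 \<or> s1 = - 1" "s2 = 1 \<or> s2 = (- 1 :: real)" "\<sigma> = s1 * s2"
    and edges: "\<forall>t\<in>{l..r}. s1 * (D l' $ 1 - D t $ 1) < 0 \<and> 0 < s1 * (D r' $ 1 - D t $ 1)"
      "\<forall>t'\<in>{l'..r'}. D t' $ 1 = D l $ 1 \<longrightarrow> 0 < s2 * (D t' $ 3 - D l $ 3 - \<epsilon>)"
      "\<forall>t'\<in>{l'..r'}. D t' $ 1 = D r $ 1 \<longrightarrow> s2 * (D t' $ 3 - D r $ 3 - \<epsilon>) < 0"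
    using assms unfolding admissible_def by (elim conjE exE) (rule that; assumption)
  have eu: "\<And>t. t \<in> {l..r} \<Longrightarrow> s1 * (D l' $ 1 - D t $ 1) < 0" "\<And>t. t \<in> {l..r} \<Longrightarrow> 0 < s1 * (D r' $ 1 - D t $ 1)"
    and el: "\<And>t'. t' \<in> {l'..r'} \<Longrightarrow> D t' $ 1 = D l $ 1 \<Longrightarrow> 0 < s2 * (D t' $ 3 - D l $ 3 - \<epsilon>)"
    and er: "\<And>t'. t' \<in> {l'..r'} \<Longrightarrow> D t' $ 1 = D r $ 1 \<Longrightarrow> s2 * (D t' $ 3 - D r $ 3 - \<epsilon>) < 0"
    using edges by blast+
  obtain m1 where m1: "m1 > 0" "\<And>t. t \<in> {l..r} \<Longrightarrow> m1 \<le> - (s1 * (D l' $ 1 - D t $ 1))"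
    by (rule compact_positive[of "{l..r}" "\<lambda>t. - (s1 * (D l' $ 1 - D t $ 1))"])
       (use eu in \<open>auto intro!: continuous_intros continuous_D\<close>)
  obtain m2 where m2: "m2 > 0" "\<And>t. t \<in> {l..r} \<Longrightarrow> m2 \<le> s1 * (D r' $ 1 - D t $ 1)"
    by (rule compact_positive[of "{l..r}" "\<lambda>t. s1 * (D r' $ 1 - D t $ 1)"])
       (use eu in \<open>auto intro!: continuous_intros continuous_D\<close>)
  obtain m3 where m3: "m3 > 0" "\<And>t'. t' \<in> {l'..r'} \<Longrightarrow> m3 \<le> max \<bar>D t' $ 1 - D l $ 1\<bar> (s2 * (D t' $ 3 - D l $ 3 - \<epsilon>))"
    by (rule compact_positive[of "{l'..r'}" "\<lambda>t'. max \<bar>D t' $ 1 - D l $ 1\<bar> (s2 * (D t' $ 3 - D l $ 3 - \<epsilon>))"])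
       (use el in \<open>auto intro!: continuous_intros continuous_D simp: less_max_iff_disj\<close>)
  obtain m4 where m4: "m4 > 0" "\<And>t'. t' \<in> {l'..r'} \<Longrightarrow> m4 \<le> max \<bar>D t' $ 1 - D r $ 1\<bar> (- (s2 * (D t' $ 3 - D r $ 3 - \<epsilon>)))"
    by (rule compact_positive[of "{l'..r'}" "\<lambda>t'. max \<bar>D t' $ 1 - D r $ 1\<bar> (- (s2 * (D t' $ 3 - D r $ 3 - \<epsilon>)))"])
       (use er in \<open>auto intro!: continuous_intros continuous_D simp: less_max_iff_disj\<close>)
  define m where "m = Min {m1, m2, m3, m4}"
  have m: "m > 0" "m \<le> m1" "m \<le> m2" "m \<le> m3" "m \<le> m4" using m1 m2 m3 m4 by (auto simp: m_def)
  have "(chord_density \<delta> \<epsilon> has_integral \<sigma>) (cbox (l, l') (r, r'))" if \<delta>: "0 < \<delta>" "\<delta> \<le> m" for \<delta>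
  proof -
    have "((\<lambda>p. bump \<delta> (D (snd p) $ 1 - D (fst p) $ 1) * bump \<delta> (D (snd p) $ 3 - D (fst p) $ 3 - \<epsilon>) *
       (V (snd p) $ 1 * V (fst p) $ 3 - V (fst p) $ 1 * V (snd p) $ 3)) has_integral s1 * s2) (cbox (l, l') (r, r'))"
    proof (rule rectangle_integral[OF \<delta>(1) lr s(1,2) D_component_derivative continuous_V_component
          D_component_derivative continuous_V_component])
      show "s1 * (D l' $ 1 - D t $ 1) \<le> - \<delta> \<and> \<delta> \<le> s1 * (D r' $ 1 - D t $ 1)" if "t \<in> {l..r}" for t
        using m1(2)[OF that] m2(2)[OF that] m \<delta> by linarith
      show "\<delta> \<le> s2 * (D t' $ 3 - D l $ 3 - \<epsilon>)" if "t' \<in> {l'..r'}" "\<bar>D t' $ 1 - D l $ 1\<bar> < \<delta>" for t'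
        using m3(2)[OF that(1)] that(2) m \<delta> by (simp add: le_max_iff_disj)
      show "s2 * (D t' $ 3 - D r $ 3 - \<epsilon>) \<le> - \<delta>" if "t' \<in> {l'..r'}" "\<bar>D t' $ 1 - D r $ 1\<bar> < \<delta>" for t'
        using m4(2)[OF that(1)] that(2) m \<delta> unfolding le_max_iff_disj by linarith
    qed
    then show ?thesis
      unfolding s(3)
    proof (rule has_integral_eq[rotated])
      fix p assume "p \<in> cbox (l, l') (r, r')"
      then have "D (snd p) $ 2 < D (fst p) $ 2" by (intro y) (auto simp: cbox_Pair_eq)
      then show "bump \<delta> (D (snd p) $ 1 - D (fst p) $ 1) * bump \<delta> (D (snd p) $ 3 - D (fst p) $ 3 - \<epsilon>) *
       (V (snd p) $ 1 * V (fst p) $ 3 - V (fst p) $ 1 * V (snd p) $ 3) = chord_density \<delta> \<epsilon> p"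
        by (simp add: density_def)
    qed
  qed
  with m(1) show ?thesis by (rule that)
qed

lemma continuous_pair_D:
  "continuous_on K (\<lambda>p::real\<times>real. D (fst p) $ i)" "continuous_on K (\<lambda>p::real\<times>real. D (snd p) $ i)"
  by (rule continuous_on_subset[OF continuous_pair(1)[OF continuous_D_component] subset_UNIV]
      continuous_on_subset[OF continuous_pair(2)[OF continuous_D_component] subset_UNIV])+

text \<open>Outside of the rectangles either the cutoff is 0 or, by compactness, the displacement
  keeps a distance from \<open>(0, \<epsilon>)\<close>; so for small \<open>\<delta>\<close> the
  density vanishes there.\<close>

lemma chord_integral_sum:
  fixes l r l' r' \<sigma> :: "'i \<Rightarrow> real"
  assumes fin: "finite I" and adm: "\<And>i. i \<in> I \<Longrightarrow> admissible \<epsilon> (l i) (r i) (l' i) (r' i) (\<sigma> i)"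
    and sub: "\<And>i. i \<in> I \<Longrightarrow> cbox (l i, l' i) (r i, r' i) \<subseteq> cbox (a, a) (a + 1, a + 1)"
    and disj: "\<And>i j. i \<in> I \<Longrightarrow> j \<in> I \<Longrightarrow> i \<noteq> j \<Longrightarrow> cbox (l i, l' i) (r i, r' i) \<inter> cbox (l j, l' j) (r j, r' j) = {}"
    and chords: "\<And>t t'. chord \<epsilon> t t' \<Longrightarrow> t \<in> {a..a+1} \<Longrightarrow> t' \<in> {a..a+1} \<Longrightarrow>
      \<exists>i\<in>I. l i < t \<and> t < r i \<and> l' i < t' \<and> t' < r' i"
  shows "\<exists>\<delta>1>0. \<forall>\<delta>. 0 < \<delta> \<longrightarrow> \<delta> \<le> \<delta>1 \<longrightarrow> chord_integral a \<delta> \<epsilon> D = (\<Sum>i\<in>I. \<sigma> i)"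
proof -
  let ?S = "cbox (a, a) (a + 1, a + 1)" and ?R = "\<lambda>i. cbox (l i, l' i) (r i, r' i)"
  let ?O = "\<lambda>i. {l i<..<r i} \<times> {l' i<..<r' i}"
  have "\<forall>i\<in>I. \<exists>\<delta>1>0. \<forall>\<delta>. 0 < \<delta> \<longrightarrow> \<delta> \<le> \<delta>1 \<longrightarrow> (chord_density \<delta> \<epsilon> has_integral \<sigma> i) (?R i)"
  proof
    fix i assume "i \<in> I"
    obtain \<delta>1 where "\<delta>1 > 0" "\<And>\<delta>. 0 < \<delta> \<Longrightarrow> \<delta> \<le> \<delta>1 \<Longrightarrow> (chord_density \<delta> \<epsilon> has_integral \<sigma> i) (?R i)"
      by (rule admissible_integral[OF adm[OF \<open>i \<in> I\<close>]]) auto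
    then show "\<exists>\<delta>1>0. \<forall>\<delta>. 0 < \<delta> \<longrightarrow> \<delta> \<le> \<delta>1 \<longrightarrow> (chord_density \<delta> \<epsilon> has_integral \<sigma> i) (?R i)"
      by (intro exI[of _ \<delta>1]) simp
  qed
  from bchoice[OF this] obtain d where d: "\<And>i. i \<in> I \<Longrightarrow> d i > 0"
    "\<And>i \<delta>. i \<in> I \<Longrightarrow> 0 < \<delta> \<Longrightarrow> \<delta> \<le> d i \<Longrightarrow> (chord_density \<delta> \<epsilon> has_integral \<sigma> i) (?R i)" by blast
  define K where "K = (?S \<inter> {p. D (snd p) $ 2 \<le> D (fst p) $ 2}) - (\<Union>i\<in>I. ?O i)"
  have "closed {p::real\<times>real. D (snd p) $ 2 \<le> D (fst p) $ 2}"
    by (intro closed_Collect_le continuous_pair_D)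
  then have "compact K"
    unfolding K_def by (intro compact_diff compact_Int_closed compact_cbox open_UN ballI open_Times open_greaterThanLessThan)
  moreover have "continuous_on K (\<lambda>p. max \<bar>D (snd p) $ 1 - D (fst p) $ 1\<bar> \<bar>D (snd p) $ 3 - D (fst p) $ 3 - \<epsilon>\<bar>)"
    by (intro continuous_intros continuous_pair_D)
  moreover have "0 < max \<bar>D (snd p) $ 1 - D (fst p) $ 1\<bar> \<bar>D (snd p) $ 3 - D (fst p) $ 3 - \<epsilon>\<bar>" if "p \<in> K" for p
  proof (rule ccontr)
    assume "\<not> ?thesis"
    then have "chord \<epsilon> (fst p) (snd p)" using that by (auto simp: chord_def K_def less_max_iff_disj)
    then show False using chords[of "fst p" "snd p"] that by (force simp: K_def cbox_Pair_eq)
  qed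
  ultimately obtain m where m: "m > 0" "\<And>p. p \<in> K \<Longrightarrow> m \<le> max \<bar>D (snd p) $ 1 - D (fst p) $ 1\<bar> \<bar>D (snd p) $ 3 - D (fst p) $ 3 - \<epsilon>\<bar>"
    by (rule compact_positive) auto
  define \<delta>1 where "\<delta>1 = Min (insert m (d ` I))"
  have \<delta>1: "\<delta>1 > 0" "\<delta>1 \<le> m" "\<And>i. i \<in> I \<Longrightarrow> \<delta>1 \<le> d i" using fin m(1) d(1) by (auto simp: \<delta>1_def)
  have "chord_integral a \<delta> \<epsilon> D = (\<Sum>i\<in>I. \<sigma> i)" if \<delta>: "0 < \<delta>" "\<delta> \<le> \<delta>1" for \<delta>
  proof -
    have "((\<lambda>p. if p \<in> ?R i then chord_density \<delta> \<epsilon> p else 0) has_integral \<sigma> i) ?S" if "i \<in> I" for i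
      using d(2)[OF that \<delta>(1) order_trans[OF \<delta>(2) \<delta>1(3)[OF that]]]
      unfolding has_integral_restrict[OF sub[OF that]] .
    then have "((\<lambda>p. \<Sum>i\<in>I. if p \<in> ?R i then chord_density \<delta> \<epsilon> p else 0) has_integral (\<Sum>i\<in>I. \<sigma> i)) ?S"
      using fin by (intro has_integral_sum)
    then have "(chord_density \<delta> \<epsilon> has_integral (\<Sum>i\<in>I. \<sigma> i)) ?S"
    proof (rule has_integral_eq[rotated])
      fix p assume p: "p \<in> ?S"
      show "(\<Sum>i\<in>I. if p \<in> ?R i then chord_density \<delta> \<epsilon> p else 0) = chord_density \<delta> \<epsilon> p"
      proof (cases "\<exists>i\<in>I. p \<in> ?R i")
        case True
        then obtain i where i: "i \<in> I" "p \<in> ?R i" by blast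
        have "(p \<in> ?R j) = (j = i)" if "j \<in> I" for j using disj[OF that i(1)] i(2) by blast
        then have "(\<Sum>j\<in>I. if p \<in> ?R j then chord_density \<delta> \<epsilon> p else 0) = (\<Sum>j\<in>I. if j = i then chord_density \<delta> \<epsilon> p else 0)"
          by (intro sum.cong) simp_all
        then show ?thesis using fin i(1) by simp
      next
        case False
        then have "chord_density \<delta> \<epsilon> p = 0"
        proof (cases "p \<in> K")
          case True
          then show ?thesis
            using m(2)[OF True] \<delta> \<delta>1(2) step_far(3)[OF \<delta>(1)] by (auto simp: density_def le_max_iff_disj)
        next
          case notK: False
          have "p \<notin> ?O i" if "i \<in> I" for i using False that by (auto simp: cbox_Pair_eq)
          then show ?thesis using notK p by (auto simp: K_def density_def)
        qed
        then show ?thesis by (simp add: sum.neutral)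
      qed
    qed
    then show ?thesis unfolding chord_integral_def by (rule integral_unique)
  qed
  with \<delta>1(1) show ?thesis by blast
qed

text \<open>On the pairs with admissible slopes the distance of the two front points has a positive
  minimum, which bounds \<open>\<epsilon>\<close>.\<close>

lemma chord_free_persists:
  assumes "compact K" "\<And>t t'. (t, t') \<in> K \<Longrightarrow> \<not> chord 0 t t'"
  obtains e where "e > 0" "\<And>\<epsilon> t t'. \<bar>\<epsilon>\<bar> < e \<Longrightarrow> (t, t') \<in> K \<Longrightarrow> \<not> chord \<epsilon> t t'"
proof -
  let ?K = "K \<inter> {p. D (snd p) $ 2 \<le> D (fst p) $ 2}"
  have "closed {p::real\<times>real. D (snd p) $ 2 \<le> D (fst p) $ 2}"
    by (intro closed_Collect_le continuous_pair_D)
  then have "compact ?K" using assms(1) by (rule compact_Int_closed[rotated])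
  moreover have "continuous_on ?K (\<lambda>p. max \<bar>D (snd p) $ 1 - D (fst p) $ 1\<bar> \<bar>D (snd p) $ 3 - D (fst p) $ 3\<bar>)"
    by (intro continuous_intros continuous_pair_D)
  moreover have "0 < max \<bar>D (snd p) $ 1 - D (fst p) $ 1\<bar> \<bar>D (snd p) $ 3 - D (fst p) $ 3\<bar>" if "p \<in> ?K" for p
    using assms(2)[of "fst p" "snd p"] that by (auto simp: chord_def less_max_iff_disj)
  ultimately obtain m where m: "m > 0" "\<And>p. p \<in> ?K \<Longrightarrow> m \<le> max \<bar>D (snd p) $ 1 - D (fst p) $ 1\<bar> \<bar>D (snd p) $ 3 - D (fst p) $ 3\<bar>"
    by (rule compact_positive) auto
  have "\<not> chord \<epsilon> t t'" if "\<bar>\<epsilon>\<bar> < m" "(t, t') \<in> K" for \<epsilon> t t'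
  proof
    assume c: "chord \<epsilon> t t'"
    then have "(t, t') \<in> ?K" using that by (simp add: chord_def)
    from m(2)[OF this] c that(1) m(1) show False by (auto simp: chord_def)
  qed
  with m(1) show ?thesis by (rule that)
qed

lemma edge_persists:
  assumes "compact J" "\<And>t'. t' \<in> J \<Longrightarrow> D t' $ 1 = D t $ 1 \<Longrightarrow> 0 < s * (D t' $ 3 - D t $ 3)" and s: "s = 1 \<or> s = (- 1 :: real)"
  obtains e where "e > 0" "\<And>\<epsilon> t'. \<bar>\<epsilon>\<bar> < e \<Longrightarrow> t' \<in> J \<Longrightarrow> D t' $ 1 = D t $ 1 \<Longrightarrow> 0 < s * (D t' $ 3 - D t $ 3 - \<epsilon>)"
proof -
  have "closed {t'. D t' $ 1 = D t $ 1}" by (intro closed_Collect_eq continuous_D_component continuous_intros)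
  then have "compact (J \<inter> {t'. D t' $ 1 = D t $ 1})" using assms(1) by (rule compact_Int_closed[rotated])
  moreover have "continuous_on (J \<inter> {t'. D t' $ 1 = D t $ 1}) (\<lambda>t'. s * (D t' $ 3 - D t $ 3))"
    by (intro continuous_intros continuous_D)
  moreover have "0 < s * (D t' $ 3 - D t $ 3)" if "t' \<in> J \<inter> {t'. D t' $ 1 = D t $ 1}" for t'
    using assms(2) that by simp
  ultimately obtain m where m: "m > 0" "\<And>t'. t' \<in> J \<inter> {t'. D t' $ 1 = D t $ 1} \<Longrightarrow> m \<le> s * (D t' $ 3 - D t $ 3)"
    by (rule compact_positive) auto
  have "0 < s * (D t' $ 3 - D t $ 3 - \<epsilon>)" if "\<bar>\<epsilon>\<bar> < m" "t' \<in> J" "D t' $ 1 = D t $ 1" for \<epsilon> t'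
  proof -
    have "m \<le> s * (D t' $ 3 - D t $ 3)" using m(2)[of t'] that by simp
    moreover have "s * \<epsilon> \<le> \<bar>\<epsilon>\<bar>" using s by auto
    ultimately show ?thesis using that(1) by (simp add: right_diff_distrib)
  qed
  with m(1) show ?thesis by (rule that)
qed

end

section \<open>Presentations of cyclic racks\<close>

text \<open>The permutation rack of a cyclic shift: right translations do not depend on the second
  argument.\<close>

definition cyclic_rack :: "int \<Rightarrow> int rack_struct" where
  "cyclic_rack d = \<lparr>carrier = {0..<d}, mult = (\<lambda>a b. (a + 1) mod d), quot = (\<lambda>a b. (a - 1) mod d)\<rparr>"

lemma rack_power_cyclic:
  assumes "a \<in> {0..<d}"
  shows "rack_power (cyclic_rack d) a (Suc m) = (a + int m) mod d"
proof (induction m)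
  case (Suc m)
  then show ?case by (simp add: cyclic_rack_def mod_simps algebra_simps)
qed (use assms in simp)

text \<open>The first power is the element itself, so the power \<open>2 * n + 2\<close> applies the
  shift \<open>2 * n + 1\<close> times.\<close>

lemma legendrian_cyclic_rack:
  assumes "d > 0" "d dvd 2 * int n + 1"
  shows "legendrian_rack n (cyclic_rack d)"
proof -
  have "rack_power (cyclic_rack d) x (2 * n + 2) = x" if "x \<in> {0..<d}" for x
  proof -
    have "rack_power (cyclic_rack d) x (2 * n + 2) = (x + (2 * int n + 1)) mod d"
      using rack_power_cyclic[OF that, of "2 * n + 1"] by (simp add: algebra_simps)
    also have "\<dots> = x mod d" using assms(2) by (metis mod_add_right_eq mod_0_imp_dvd dvd_imp_mod_0 add.right_neutral)
    finally show ?thesis using that by simp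
  qed
  moreover have "rack (cyclic_rack d)"
    using assms(1) by (auto simp: rack_def cyclic_rack_def mod_simps)
  ultimately show ?thesis by (simp add: legendrian_rack_def cyclic_rack_def)
qed

section \<open>Conjugation identities and isomorphisms of racks\<close>

context
  fixes R :: "'a rack_struct"
  assumes R: "rack R"
begin

lemma rack_closed:
  "a \<in> carrier R \<Longrightarrow> b \<in> carrier R \<Longrightarrow> mult R a b \<in> carrier R"
  "a \<in> carrier R \<Longrightarrow> b \<in> carrier R \<Longrightarrow> quot R a b \<in> carrier R"
  using R by (auto simp: rack_def)

lemma rack_cancel:
  "a \<in> carrier R \<Longrightarrow> b \<in> carrier R \<Longrightarrow> quot R (mult R a b) b = a"
  "a \<in> carrier R \<Longrightarrow> b \<in> carrier R \<Longrightarrow> mult R (quot R a b) b = a"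
  using R by (auto simp: rack_def)

text \<open>Translation by \<open>b * c\<close> is translation by \<open>b\<close> conjugated by
  that of \<open>c\<close>: self-distributivity applied to \<open>(a / c) * b\<close>.\<close>

lemma rack_mult_mult:
  assumes "a \<in> carrier R" "b \<in> carrier R" "c \<in> carrier R"
  shows "mult R a (mult R b c) = mult R (mult R (quot R a c) b) c"
proof -
  have "mult R (mult R (quot R a c) b) c = mult R (mult R (quot R a c) c) (mult R b c)"
    using R assms rack_closed unfolding rack_def by blast
  then show ?thesis using assms by (simp add: rack_cancel)
qed

lemma rack_mult_quot:
  assumes "a \<in> carrier R" "b \<in> carrier R" "c \<in> carrier R"
  shows "mult R a (quot R b c) = quot R (mult R (mult R a c) b) c"
proof -
  have "mult R (mult R a (quot R b c)) c = mult R (mult R a c) (mult R (quot R b c) c)"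
    using R assms rack_closed unfolding rack_def by blast
  then have "mult R (mult R a (quot R b c)) c = mult R (mult R a c) b" using assms by (simp add: rack_cancel)
  then show ?thesis using rack_cancel(1)[of "mult R a (quot R b c)" c] assms rack_closed by simp
qed

end

lemma rack_isomorphic_sym:
  assumes "rack R" "rack_isomorphic R S"
  shows "rack_isomorphic S R"
proof -
  obtain f where f: "rack_hom R S f" "bij_betw f (carrier R) (carrier S)"
    using assms(2) by (auto simp: rack_isomorphic_def)
  define g where "g = inv_into (carrier R) f"
  have g: "bij_betw g (carrier S) (carrier R)"
    unfolding g_def by (rule bij_betw_inv_into[OF f(2)])
  have gf: "g (f x) = x" if "x \<in> carrier R" for x
    using f(2) that by (simp add: g_def bij_betw_def inv_into_f_f)
  have fg: "f (g y) = y" if "y \<in> carrier S" for y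
    using f(2) that by (simp add: g_def bij_betw_def f_inv_into_f)
  have "g (mult S x y) = mult R (g x) (g y) \<and> g (quot S x y) = quot R (g x) (g y)"
    if "x \<in> carrier S" "y \<in> carrier S" for x y
  proof -
    have in_R: "g x \<in> carrier R" "g y \<in> carrier R" using g that by (auto simp: bij_betw_def)
    then have "f (mult R (g x) (g y)) = mult S x y" "f (quot R (g x) (g y)) = quot S x y"
      using f(1) fg that by (simp_all add: rack_hom_def)
    then show ?thesis using gf rack_closed[OF assms(1) in_R] by metis
  qed
  then have "rack_hom S R g" using g by (auto simp: rack_hom_def bij_betw_def)
  then show ?thesis using g unfolding rack_isomorphic_def by blast
qed

lemma rack_isomorphic_trans:
  assumes "rack_isomorphic R S" "rack_isomorphic S T"
  shows "rack_isomorphic R T"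
proof -
  obtain f where f: "rack_hom R S f" "bij_betw f (carrier R) (carrier S)"
    using assms(1) by (auto simp: rack_isomorphic_def)
  obtain g where g: "rack_hom S T g" "bij_betw g (carrier S) (carrier T)"
    using assms(2) by (auto simp: rack_isomorphic_def)
  have "rack_hom R T (g \<circ> f)"
    using f(1) g(1) unfolding rack_hom_def by (auto simp: image_subset_iff)
  then show ?thesis
    using bij_betw_trans[OF f(2) g(2)] by (auto simp: rack_isomorphic_def)
qed

text \<open>The strands met along an oriented front are \<open>st t\<close>, where \<open>t\<close> runs over the reals and a strand
  contains its right end. The relations say that, if all right translations of the rack agree with
  one map \<open>\<sigma>\<close>, then the strand at \<open>t\<close> is the image of the strand at \<open>0\<close> under \<open>\<sigma>\<close> to the power
  \<open>E t - E 0\<close>.\<close>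

locale circular_presentation =
  fixes n :: nat and X :: "'g set" and Rels and st :: "real \<Rightarrow> 'g" and E :: "real \<Rightarrow> int" and M :: int
  assumes generators: "X = range st"
    and exponent: "st a = st b \<Longrightarrow> gcd (2 * int n + 1) M dvd E a - E b"
    and relations: "r \<in> Rels \<Longrightarrow>
      (\<exists>t s p. r = (Gen (st s), Mult (Gen (st t)) (Gen (st p))) \<and> E s = E t + 1) \<or>
      (\<exists>t s p. r = (Gen (st s), Quot (Gen (st t)) (Gen (st p))) \<and> E s = E t - 1) \<or>
      (\<exists>t s. r = (Gen (st s), rack_power (term_struct X) (Gen (st t)) (n + 1)) \<and> E s = E t + int n)"
    and left: "\<forall>\<^sub>F s in at_left t. st s = st t \<and> E s = E t"
    and right: "\<forall>\<^sub>F s in at_right t. st s = st t \<and> E s = E t \<or>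
      (\<exists>p. (Gen (st s), Mult (Gen (st t)) (Gen (st p))) \<in> Rels \<and> E s = E t + 1) \<or>
      (\<exists>p. (Gen (st s), Quot (Gen (st t)) (Gen (st p))) \<in> Rels \<and> E s = E t - 1) \<or>
      ((Gen (st s), rack_power (term_struct X) (Gen (st t)) (n + 1)) \<in> Rels \<and> E s = E t + int n)"
    and period: "st (t + 1) = st t" "E (t + 1) = E t + M"
begin

abbreviation "R \<equiv> presented_rack n X Rels"
abbreviation "cl \<equiv> pres_class n X Rels"
abbreviation "d \<equiv> gcd (2 * int n + 1) M"

definition gen :: "real \<Rightarrow> 'g rack_term set" where "gen t = cl (Gen (st t))"

lemma rack_R: "rack R"
  using legendrian_rack_presented[of n X Rels] by (simp add: legendrian_rack_def)

lemma Gen_carrier: "Gen (st t) \<in> carrier (term_struct X)"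
  by (simp add: generators)

lemma gen_carrier: "gen t \<in> carrier R"
  using Gen_carrier by (simp add: gen_def presented_rack_carrier)

lemma relation_class:
  assumes "(l, r) \<in> Rels" "l \<in> carrier (term_struct X)" "r \<in> carrier (term_struct X)"
  shows "cl l = cl r"
  using pres_class_eq_iff[OF assms(2)] pres_eq.rel[OF assms] by blast

lemma gen_mult: "(Gen (st s), Mult (Gen (st t)) (Gen (st p))) \<in> Rels \<Longrightarrow> gen s = mult R (gen t) (gen p)"
  using relation_class Gen_carrier by (simp add: gen_def presented_rack_mult)

lemma gen_quot: "(Gen (st s), Quot (Gen (st t)) (Gen (st p))) \<in> Rels \<Longrightarrow> gen s = quot R (gen t) (gen p)"
  using relation_class Gen_carrier by (simp add: gen_def presented_rack_quot)

lemma gen_power: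
  "(Gen (st s), rack_power (term_struct X) (Gen (st t)) (n + 1)) \<in> Rels \<Longrightarrow> gen s = rack_power R (gen t) (n + 1)"
  using relation_class[OF _ Gen_carrier term_power_in_carrier[OF Gen_carrier]] Gen_carrier
  unfolding gen_def by (metis presented_rack_power)

lemma carrier_induct [consumes 1, case_names gen mult quot]:
  assumes "a \<in> carrier R" "\<And>t. P (gen t)"
    and "\<And>a b. a \<in> carrier R \<Longrightarrow> b \<in> carrier R \<Longrightarrow> P a \<Longrightarrow> P b \<Longrightarrow> P (mult R a b)"
    and "\<And>a b. a \<in> carrier R \<Longrightarrow> b \<in> carrier R \<Longrightarrow> P a \<Longrightarrow> P b \<Longrightarrow> P (quot R a b)"
  shows "P a"
proof -
  have "P (cl s)" if "s \<in> carrier (term_struct X)" for s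
    using that
  proof (induction s)
    case (Gen x)
    then obtain t where "x = st t" by (auto simp: generators)
    then show ?case using assms(2)[of t] by (simp only: gen_def)
  next
    case (Mult s t)
    then have "P (mult R (cl s) (cl t))" by (intro assms(3)) (simp_all add: presented_rack_carrier)
    then show ?case using Mult.prems by (simp add: presented_rack_mult)
  next
    case (Quot s t)
    then have "P (quot R (cl s) (cl t))" by (intro assms(4)) (simp_all add: presented_rack_carrier)
    then show ?case using Quot.prems by (simp add: presented_rack_quot)
  qed
  then show ?thesis using assms(1) by (auto simp: presented_rack_carrier)
qed

context
  assumes uniform: "\<And>a t. a \<in> carrier R \<Longrightarrow> mult R a (gen t) = mult R a (gen 0)"
begin

definition \<sigma> :: "'g rack_term set \<Rightarrow> 'g rack_term set" where "\<sigma> a = mult R a (gen 0)"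

lemma \<sigma>_closed: "a \<in> carrier R \<Longrightarrow> \<sigma> a \<in> carrier R"
  unfolding \<sigma>_def by (rule rack_closed(1)[OF rack_R _ gen_carrier])

text \<open>On generators this is the hypothesis; a product or quotient translates by a conjugate,
  and conjugating \<open>\<sigma>\<close> by itself gives \<open>\<sigma>\<close>.\<close>

lemma mult_\<sigma>:
  assumes "b \<in> carrier R"
  shows "\<forall>a\<in>carrier R. mult R a b = \<sigma> a"
  using assms
proof (induction rule: carrier_induct)
  case (gen t)
  show ?case unfolding \<sigma>_def by (intro ballI uniform)
next
  case (mult b c)
  show ?case
  proof
    fix a assume a: "a \<in> carrier R"
    have q: "quot R a c \<in> carrier R" by (rule rack_closed(2)[OF rack_R a mult(2)])
    have "mult R a (mult R b c) = \<sigma> (\<sigma> (quot R a c))"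
      unfolding rack_mult_mult[OF rack_R a mult(1,2)] mult(3)[rule_format, OF q]
        mult(4)[rule_format, OF \<sigma>_closed[OF q]] ..
    also have "\<sigma> (quot R a c) = a"
      using mult(4)[rule_format, OF q] rack_cancel(2)[OF rack_R a mult(2)] by (rule HOL.trans[OF HOL.sym])
    finally show "mult R a (mult R b c) = \<sigma> a" .
  qed
next
  case (quot b c)
  show ?case
  proof
    fix a assume a: "a \<in> carrier R"
    have "mult R a (quot R b c) = quot R (\<sigma> (\<sigma> a)) c"
      unfolding rack_mult_quot[OF rack_R a quot(1,2)] quot(4)[rule_format, OF a]
        quot(3)[rule_format, OF \<sigma>_closed[OF a]] ..
    also have "\<dots> = \<sigma> a"
      using rack_cancel(1)[OF rack_R \<sigma>_closed[OF a] quot(2)]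
      unfolding quot(4)[rule_format, OF \<sigma>_closed[OF a]] .
    finally show "mult R a (quot R b c) = \<sigma> a" .
  qed
qed

lemma \<sigma>_pow_closed: "a \<in> carrier R \<Longrightarrow> (\<sigma> ^^ m) a \<in> carrier R"
  by (induction m) (simp_all add: \<sigma>_closed)

lemma power_\<sigma>: "a \<in> carrier R \<Longrightarrow> rack_power R a (Suc m) = (\<sigma> ^^ m) a"
  by (induction m) (simp_all add: mult_\<sigma> \<sigma>_pow_closed)

lemma \<sigma>_period: "a \<in> carrier R \<Longrightarrow> (\<sigma> ^^ (2 * n + 1)) a = a"
  using legendrian_rack_presented[of n X Rels] power_\<sigma>[of a "2 * n + 1"]
  by (simp add: legendrian_rack_def)

lemma \<sigma>_mod:
  assumes "a \<in> carrier R"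
  shows "(\<sigma> ^^ m) a = (\<sigma> ^^ (m mod (2 * n + 1))) a"
proof -
  have "(\<sigma> ^^ ((2 * n + 1) * k)) b = b" if "b \<in> carrier R" for k b
  proof (induction k)
    case (Suc k)
    have "(\<sigma> ^^ ((2 * n + 1) * Suc k)) b = (\<sigma> ^^ (2 * n + 1)) ((\<sigma> ^^ ((2 * n + 1) * k)) b)"
      by (simp only: mult_Suc_right funpow_add o_apply)
    then show ?case using Suc \<sigma>_period[OF that] by simp
  qed simp
  then have "(\<sigma> ^^ ((2 * n + 1) * (m div (2 * n + 1)))) ((\<sigma> ^^ (m mod (2 * n + 1))) a) = (\<sigma> ^^ (m mod (2 * n + 1))) a"
    using \<sigma>_pow_closed[OF assms] by blast
  then show ?thesis
    by (metis comp_apply funpow_add mult_div_mod_eq)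
qed

text \<open>Integer powers of \<open>\<sigma>\<close>. Reduction modulo the period
  \<open>2 * n + 1\<close> takes the place of an inverse map.\<close>

definition shift :: "int \<Rightarrow> 'g rack_term set \<Rightarrow> 'g rack_term set" where
  "shift k = \<sigma> ^^ nat (k mod (2 * int n + 1))"

lemma shift_closed: "a \<in> carrier R \<Longrightarrow> shift k a \<in> carrier R"
  by (simp add: shift_def \<sigma>_pow_closed)

lemma shift_nat:
  assumes "a \<in> carrier R"
  shows "shift (int m) a = (\<sigma> ^^ m) a"
proof -
  have "nat (int m mod (2 * int n + 1)) = m mod (2 * n + 1)"
    by (metis nat_int zmod_int of_nat_1 of_nat_add of_nat_mult of_nat_numeral)
  then show ?thesis using \<sigma>_mod[OF assms, of m] by (simp add: shift_def)
qed

lemma shift_add: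
  assumes "a \<in> carrier R"
  shows "shift k (shift l a) = shift (k + l) a"
proof -
  let ?N = "2 * int n + 1"
  have "shift k (shift l a) = (\<sigma> ^^ (nat (k mod ?N) + nat (l mod ?N))) a"
    by (simp add: shift_def funpow_add)
  also have "\<dots> = shift (int (nat (k mod ?N) + nat (l mod ?N))) a"
    by (rule shift_nat[OF assms, symmetric])
  also have "\<dots> = shift (k mod ?N + l mod ?N) a" by simp
  also have "\<dots> = shift (k + l) a" by (simp add: shift_def mod_add_eq)
  finally show ?thesis .
qed

lemma shift_0: "shift 0 a = a"
  by (simp add: shift_def)

lemma shift_1: "a \<in> carrier R \<Longrightarrow> shift 1 a = \<sigma> a"
  using shift_nat[of a 1] by simp

lemma quot_shift:
  assumes "a \<in> carrier R" "b \<in> carrier R"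
  shows "quot R a b = shift (- 1) a"
proof -
  have q: "quot R a b \<in> carrier R" using assms by (rule rack_closed(2)[OF rack_R])
  have "shift 1 (quot R a b) = a"
    using mult_\<sigma>[OF assms(2)] q rack_cancel(2)[OF rack_R assms] by (simp add: shift_1)
  then show ?thesis using shift_add[OF q, of "- 1" 1] by (simp add: shift_0)
qed

lemma gen_local: "\<forall>\<^sub>F s in nhds t. gen s = shift (E s - E t) (gen t)"
proof -
  have "\<forall>\<^sub>F s in at_left t. gen s = shift (E s - E t) (gen t)"
    using left by eventually_elim (simp add: gen_def shift_0)
  moreover have "\<forall>\<^sub>F s in at_right t. gen s = shift (E s - E t) (gen t)"
    using right
  proof eventually_elim
    case (elim s)
    then show ?case
    proof (elim disjE exE conjE)
      fix p assume *: "(Gen (st s), Mult (Gen (st t)) (Gen (st p))) \<in> Rels" "E s = E t + 1"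
      then show ?thesis
        using gen_mult[OF *(1)] mult_\<sigma>[OF gen_carrier] gen_carrier by (simp add: shift_1)
    next
      fix p assume *: "(Gen (st s), Quot (Gen (st t)) (Gen (st p))) \<in> Rels" "E s = E t - 1"
      then show ?thesis
        using gen_quot[OF *(1)] quot_shift[OF gen_carrier gen_carrier] by simp
    next
      assume *: "(Gen (st s), rack_power (term_struct X) (Gen (st t)) (n + 1)) \<in> Rels" "E s = E t + int n"
      then show ?thesis
        using gen_power[OF *(1)] power_\<sigma>[OF gen_carrier] shift_nat[OF gen_carrier] by simp
    qed (simp add: gen_def shift_0)
  qed
  moreover have "gen t = shift (E t - E t) (gen t)" by (simp add: shift_0)
  ultimately show ?thesis
    by (simp add: eventually_nhds_conv_at eventually_at_split)
qed

text \<open>The relation holds locally by \<open>gen_local\<close> and is an equivalence relation,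
  so it spreads over the connected line.\<close>

lemma gen_shift: "gen s = shift (E s - E t) (gen t)"
proof (rule connected_equivalence_relation[of UNIV t s "\<lambda>t s. gen s = shift (E s - E t) (gen t)"])
  fix x y z
  show "gen x = shift (E x - E y) (gen y)" if "gen y = shift (E y - E x) (gen x)"
    using shift_add[OF gen_carrier, of "E x - E y" "E y - E x" x] that by (simp add: shift_0)
  show "gen z = shift (E z - E x) (gen x)"
    if "gen y = shift (E y - E x) (gen x)" "gen z = shift (E z - E y) (gen y)"
    using shift_add[OF gen_carrier, of "E z - E y" "E y - E x" x] that by simp
next
  fix x :: real
  obtain U where U: "open U" "x \<in> U" "\<forall>s\<in>U. gen s = shift (E s - E x) (gen x)"
    using gen_local[of x] unfolding eventually_nhds by blast
  have "openin (top_of_set UNIV) U" using U(1) by simp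
  with U(2,3) show "\<exists>U. openin (top_of_set UNIV) U \<and> x \<in> U \<and> (\<forall>s\<in>U. gen s = shift (E s - E x) (gen x))"
    by blast
qed simp_all

text \<open>One turn along the front raises the exponent by \<open>M\<close> and returns to the same
  generator, while \<open>2 * n + 1\<close> is a period of \<open>\<sigma>\<close>; Bezout combines
  both.\<close>

lemma shift_fixed:
  assumes "d dvd k"
  shows "shift k (gen 0) = gen 0"
proof -
  have add: "shift (k + l) (gen 0) = gen 0" if "shift k (gen 0) = gen 0" "shift l (gen 0) = gen 0" for k l
    using shift_add[OF gen_carrier, of k l 0] that by simp
  have neg: "shift (- k) (gen 0) = gen 0" if "shift k (gen 0) = gen 0" for k
    using shift_add[OF gen_carrier, of "- k" k 0] that by (simp add: shift_0)
  have nat_mult: "shift (int j * k) (gen 0) = gen 0" if "shift k (gen 0) = gen 0" for j k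
  proof (induction j)
    case (Suc j)
    then show ?case using add[OF that Suc] by (simp add: algebra_simps)
  qed (simp add: shift_0)
  have mult: "shift (j * k) (gen 0) = gen 0" if "shift k (gen 0) = gen 0" for j k
    using nat_mult[OF that, of "nat j"] neg[OF nat_mult[OF that, of "nat (- j)"]] by (cases "j \<ge> 0") auto
  have "gen 1 = gen 0" "E 1 = E 0 + M" using period[of 0] by (simp_all add: gen_def)
  then have "shift M (gen 0) = gen 0" using gen_shift[of 1 0] by simp
  moreover have "shift (2 * int n + 1) (gen 0) = gen 0" by (simp add: shift_def)
  moreover obtain u v where "u * (2 * int n + 1) + v * M = d" using bezout_int by blast
  ultimately have "shift d (gen 0) = gen 0"
    using add[OF mult[of "2 * int n + 1" u] mult[of M v]] by simp
  moreover obtain j where "k = j * d" using assms by (auto simp: dvd_def mult.commute)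
  ultimately show ?thesis using mult by simp
qed

lemma carrier_shift: "a \<in> carrier R \<Longrightarrow> \<exists>k. a = shift k (gen 0)"
proof (induction rule: carrier_induct)
  case (gen t)
  then show ?case using gen_shift by blast
next
  case (mult a b)
  then obtain k where "a = shift k (gen 0)" by blast
  then have "mult R a b = shift (1 + k) (gen 0)"
    using mult_\<sigma>[OF mult(2)] mult(1) shift_1[of a] shift_add[OF gen_carrier, of 1 k 0] by simp
  then show ?case by blast
next
  case (quot a b)
  then obtain k where "a = shift k (gen 0)" by blast
  then have "quot R a b = shift (- 1 + k) (gen 0)"
    using quot_shift[OF quot(1,2)] shift_add[OF gen_carrier, of "- 1" k 0] by simp
  then show ?case by blast
qed

text \<open>The exponents define a homomorphism to the cyclic rack by the universal property. It is
  injective because every element is some \<open>shift k (gen 0)\<close> and multiples of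
  \<open>d\<close> fix \<open>gen 0\<close>.\<close>

theorem isomorphic_cyclic_rack: "rack_isomorphic R (cyclic_rack d)"
proof -
  have "2 * int n + 1 \<noteq> 0" by presburger
  then have d: "d > 0" by simp
  \<comment> \<open>A generator is met at many parameters; by \<open>exponent\<close> their
    exponents agree modulo \<open>d\<close>.\<close>
  define g where "g x = E (SOME t. st t = x) mod d" for x
  have g: "g (st t) = E t mod d" for t
  proof -
    have "st (SOME s. st s = st t) = st t" by (rule someI) simp
    from exponent[OF this] show ?thesis by (simp add: g_def mod_eq_dvd_iff)
  qed
  have leg: "legendrian_rack n (cyclic_rack d)" by (rule legendrian_cyclic_rack[OF d]) simp
  have gX: "g ` X \<subseteq> carrier (cyclic_rack d)"
    using d by (auto simp: generators g cyclic_rack_def)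
  have "eval_term (cyclic_rack d) g l = eval_term (cyclic_rack d) g r" if "(l, r) \<in> Rels" for l r
    using relations[OF that]
  proof (elim disjE exE conjE)
    fix t s assume *: "(l, r) = (Gen (st s), rack_power (term_struct X) (Gen (st t)) (n + 1))" "E s = E t + int n"
    have "rack_power (cyclic_rack d) (E t mod d) (Suc n) = (E t mod d + int n) mod d"
      by (rule rack_power_cyclic) (use d in simp)
    then show ?thesis using * by (simp add: eval_term_power g mod_simps)
  qed (auto simp: cyclic_rack_def g mod_simps)
  from presented_rack_universal[OF leg gX this]
  obtain f where f: "rack_hom R (cyclic_rack d) f" "\<And>x. x \<in> X \<Longrightarrow> f (cl (Gen x)) = g x" by blast
  have fgen: "f (gen t) = E t mod d" for t 
  proof -
    have "st t \<in> X" by (simp add: generators)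
    then show ?thesis using f(2)[of "st t"] g[of t] by (simp only: gen_def)
  qed
  have f\<sigma>: "f ((\<sigma> ^^ m) (gen 0)) = (E 0 + int m) mod d" for m
  proof (induction m)
    case (Suc m)
    have "f (\<sigma> ((\<sigma> ^^ m) (gen 0))) = (f ((\<sigma> ^^ m) (gen 0)) + 1) mod d"
      using f(1) \<sigma>_pow_closed[OF gen_carrier] gen_carrier by (simp add: \<sigma>_def rack_hom_def cyclic_rack_def)
    then show ?case using Suc by (simp add: mod_simps algebra_simps)
  qed (simp add: fgen)
  have fshift: "f (shift k (gen 0)) = (E 0 + k) mod d" for k
  proof -
    have "f (shift k (gen 0)) = (E 0 + k mod (2 * int n + 1)) mod d"
      using f\<sigma> by (simp add: shift_def)
    also have "\<dots> = (E 0 + k mod (2 * int n + 1) mod d) mod d" by (simp add: mod_simps)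
    also have "k mod (2 * int n + 1) mod d = k mod d" by (rule mod_mod_cancel) simp
    finally show ?thesis by (simp add: mod_simps)
  qed
  have "bij_betw f (carrier R) (carrier (cyclic_rack d))"
  proof (rule bij_betw_imageI)
    show "inj_on f (carrier R)"
    proof (rule inj_onI)
      fix a b assume ab: "a \<in> carrier R" "b \<in> carrier R" "f a = f b"
      then obtain k l where kl: "a = shift k (gen 0)" "b = shift l (gen 0)" using carrier_shift by meson
      then have "(E 0 + k) mod d = (E 0 + l) mod d" using ab fshift by simp
      then have "d dvd k - l" by (simp add: mod_eq_dvd_iff)
      from shift_fixed[OF this] show "a = b"
        using shift_add[OF gen_carrier, of l "k - l" 0] kl by simp
    qed
    show "f ` carrier R = carrier (cyclic_rack d)"
    proof
      show "f ` carrier R \<subseteq> carrier (cyclic_rack d)" using f(1) by (simp add: rack_hom_def)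
      show "carrier (cyclic_rack d) \<subseteq> f ` carrier R"
      proof
        fix i assume "i \<in> carrier (cyclic_rack d)"
        then have "i = f (shift (i - E 0) (gen 0))" by (simp add: fshift cyclic_rack_def)
        then show "i \<in> f ` carrier R" using shift_closed[OF gen_carrier] by blast
      qed
    qed
  qed
  then show ?thesis using f(1) by (auto simp: rack_isomorphic_def)
qed

end

end

section \<open>The strands of a front and their colours\<close>

context front_diagram
begin

section \<open>Breaks of the front and the strands between them\<close>

definition brk :: "real \<Rightarrow> bool" where
  "brk t \<longleftrightarrow> cusp t \<or> (\<exists>p. over p t)"

lemma brk_special: "brk t \<Longrightarrow> special t"
  by (auto simp: brk_def special_def)

lemma brk_breaks: "brk t \<longleftrightarrow> frac t \<in> breaks D"
proof -
  have "(\<exists>p. over p t) \<longleftrightarrow> frac t \<in> snd ` crossings D"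
  proof
    assume "frac t \<in> snd ` crossings D"
    then obtain p where p: "(p, frac t) \<in> crossings D" by force
    then have "frac p = p" by (simp add: crossings_def frac_eq)
    then show "\<exists>p. over p t" using p over_crossings by metis
  qed (force simp: over_crossings)
  moreover have "cusp t \<longleftrightarrow> frac t \<in> cusps D"
    using frac_in[of t] by (simp add: cusps_def V_frac)
  ultimately show ?thesis by (simp add: brk_def breaks_def)
qed

lemma breaks_subset: "breaks D \<subseteq> {0..<1}"
  by (auto simp: breaks_def cusps_def crossings_def)

lemma brk_periodic: "brk (t + of_int k) \<longleftrightarrow> brk t"
  by (simp add: brk_breaks frac_def)

lemma D_break_iff: "D t \<in> D ` breaks D \<longleftrightarrow> brk t"
proof
  assume "D t \<in> D ` breaks D"
  then obtain b where b: "b \<in> breaks D" "D t = D b" by blast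
  then have "frac t = frac b" by (simp add: D_eq_iff frac_eq_iff)
  moreover have "frac b = b" using b breaks_subset by (auto simp: frac_eq)
  ultimately show "brk t" using b by (simp add: brk_breaks)
next
  assume "brk t"
  then show "D t \<in> D ` breaks D" unfolding brk_breaks using D_frac[of t] by (metis imageI)
qed

lemma brk_discrete:
  obtains e where "e > 0" "\<And>s. 0 < \<bar>s - t\<bar> \<Longrightarrow> \<bar>s - t\<bar> < e \<Longrightarrow> \<not> brk s"
  using special_discrete[of t] brk_special by metis

definition comp :: "real \<Rightarrow> (real^3) set" where
  "comp t = connected_component_set (range D - D ` breaks D) (D t)"

lemma comp_strand: "\<not> brk t \<Longrightarrow> comp t \<in> strands D"
  by (auto simp: comp_def strands_def components_def D_break_iff)

lemma D_in_comp: "\<not> brk t \<Longrightarrow> D t \<in> comp t"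
  by (simp add: comp_def D_break_iff)

lemma strand_eq_comp_of_mem:
  assumes "S \<in> strands D" "D t \<in> S"
  shows "\<not> brk t" "S = comp t"
proof -
  obtain x where x: "S = connected_component_set (range D - D ` breaks D) x"
    using assms(1) by (auto simp: strands_def components_def)
  have "S \<subseteq> range D - D ` breaks D" unfolding x by (rule connected_component_subset)
  then show "\<not> brk t" using assms(2) D_break_iff by blast
  show "S = comp t"
    using assms(2) unfolding x comp_def by (intro connected_component_eq[symmetric])
qed

lemma comp_eq:
  assumes "a \<le> b" "\<And>r. a \<le> r \<Longrightarrow> r \<le> b \<Longrightarrow> \<not> brk r"
  shows "comp a = comp b"
proof -
  have "connected (D ` {a..b})" by (intro connected_continuous_image continuous_D) auto
  moreover have "D ` {a..b} \<subseteq> range D - D ` breaks D"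
  proof (rule image_subsetI)
    fix r assume "r \<in> {a..b}"
    then show "D r \<in> range D - D ` breaks D" using assms(2) D_break_iff[of r] by simp
  qed
  ultimately have "connected_component (range D - D ` breaks D) (D a) (D b)"
    using assms(1) unfolding connected_component_def by (intro exI[of _ "D ` {a..b}"]) auto
  then show ?thesis unfolding comp_def by (simp add: connected_component_eq)
qed

lemma comp_periodic: "comp (t + of_int k) = comp t"
  by (simp add: comp_def D_periodic_int)

text \<open>Two arcs that lie on different sides of two breaks are separated: each of the two halves of
  the curve between the breaks is closed.\<close>

lemma comp_separated:
  assumes ab: "\<not> brk a" "\<not> brk b" "a < b" "b < a + 1" and eq: "comp a = comp b"
  shows "(\<forall>r\<in>{a..b}. \<not> brk r) \<or> (\<forall>r\<in>{b..a + 1}. \<not> brk r)"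
proof (rule ccontr)
  assume "\<not> ?thesis"
  then obtain r s where r: "brk r" "a \<le> r" "r \<le> b" and s: "brk s" "b \<le> s" "s \<le> a + 1" by auto
  have "a \<noteq> r" "r \<noteq> b" "b \<noteq> s" using r(1) s(1) ab by blast+
  moreover have "s \<noteq> a + 1" using s(1) ab(1) brk_periodic[of a 1] by auto
  ultimately have o: "a < r" "r < b" "b < s" "s < a + 1" using r s by auto
  let ?A = "D ` {r..s}" and ?B = "D ` {s..r + 1}" and ?C = "comp a"
  have conn: "connected ?C" by (simp add: comp_def)
  have sub: "?C \<subseteq> range D - D ` breaks D" unfolding comp_def by (rule connected_component_subset)
  have cl: "closed ?A" "closed ?B"
    by (intro compact_imp_closed compact_continuous_image continuous_D compact_Icc)+
  have cover: "range D \<subseteq> ?A \<union> ?B"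
  proof
    fix p assume "p \<in> range D"
    then obtain t where t: "p = D t" by blast
    define t' where "t' = r + frac (t - r)"
    have "t' - t = - of_int \<lfloor>t - r\<rfloor>" by (simp add: t'_def frac_def)
    then have "D t' = p" using t by (simp add: D_eq_iff)
    moreover have "r \<le> t'" "t' \<le> r + 1" using frac_in[of "t - r"] by (auto simp: t'_def)
    ultimately show "p \<in> ?A \<union> ?B" by (cases "t' \<le> s") force+
  qed
  have disj: "?A \<inter> ?B \<inter> ?C = {}"
  proof (rule ccontr)
    assume "?A \<inter> ?B \<inter> ?C \<noteq> {}"
    then obtain w where w: "w \<in> ?A" "w \<in> ?B" "w \<in> ?C" by blast
    then obtain x y where xy: "x \<in> {r..s}" "w = D x" "y \<in> {s..r + 1}" "w = D y" by blast
    then have xy: "x \<in> {r..s}" "y \<in> {s..r + 1}" "D x = D y" "D x \<in> ?C" using w(3) by simp_all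
    then have "\<not> brk x" using sub D_break_iff by blast
    obtain k where k: "y - x = of_int k" using xy(3) by (metis D_eq_iff Ints_cases)
    have "0 \<le> y - x" "y - x \<le> 1" using xy by auto
    then have "k = 0 \<or> k = 1" unfolding k by linarith
    then have "x = s \<or> x = r" using k xy by auto
    then show False using \<open>\<not> brk x\<close> r s by auto
  qed
  have "?C \<subseteq> ?A \<union> ?B" using sub cover by blast
  from connected_closedD[OF conn disj this cl] have "?A \<inter> ?C = {} \<or> ?B \<inter> ?C = {}" .
  moreover have "D b \<in> ?A \<inter> ?C" using o D_in_comp[OF ab(2)] eq by auto
  moreover have "D a \<in> ?B \<inter> ?C"
    using o D_in_comp[OF ab(1)] D_periodic[of a] by (auto intro!: image_eqI[of _ _ "a + 1"])
  ultimately show False by blast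
qed

text \<open>The strand arriving at \<open>t\<close>: a break is attributed to the strand that ends
  there, while at other parameters this is the component through \<open>D t\<close>.\<close>

definition strand :: "real \<Rightarrow> (real^3) set" where
  "strand t = (THE S. strand_into D t S)"

definition out :: "real \<Rightarrow> (real^3) set" where
  "out t = (THE S. strand_out_of D t S)"

lemma strand_into_comp:
  assumes e: "\<And>r. t - e < r \<Longrightarrow> r < t \<Longrightarrow> \<not> brk r" and s: "t - e < s" "s < t"
  shows "strand_into D t S \<longleftrightarrow> S = comp s"
proof
  assume S: "strand_into D t S"
  then obtain e' where e': "S \<in> strands D" "e' > 0" "D ` {t - e'<..<t} \<subseteq> S" by (auto simp: strand_into_def)
  define r where "r = max s (t - e' / 2)"
  have r: "s \<le> r" "r < t" "t - e' < r" using s e' by (auto simp: r_def)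
  then have "S = comp r" using e' by (intro strand_eq_comp_of_mem) auto
  also have "\<dots> = comp s" using r s e by (intro comp_eq[symmetric]) auto
  finally show "S = comp s" .
next
  have *: "comp r = comp s" if "t - e < r" "r < t" for r
  proof (cases "r \<le> s")
    case True
    then show ?thesis using that s by (intro comp_eq e) auto
  next
    case False
    then show ?thesis using that s by (intro comp_eq[symmetric] e) auto
  qed
  have "D ` {t - e<..<t} \<subseteq> comp s"
  proof (rule image_subsetI)
    fix r assume "r \<in> {t - e<..<t}"
    then have r: "t - e < r" "r < t" by auto
    show "D r \<in> comp s" using D_in_comp[OF e[OF r]] unfolding *[OF r] .
  qed
  moreover assume "S = comp s"
  ultimately show "strand_into D t S"
    using comp_strand[of s] e s by (auto simp: strand_into_def intro!: exI[of _ e])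
qed

lemma strand_out_comp:
  assumes e: "\<And>r. t < r \<Longrightarrow> r < t + e \<Longrightarrow> \<not> brk r" and s: "t < s" "s < t + e"
  shows "strand_out_of D t S \<longleftrightarrow> S = comp s"
proof
  assume S: "strand_out_of D t S"
  then obtain e' where e': "S \<in> strands D" "e' > 0" "D ` {t<..<t + e'} \<subseteq> S" by (auto simp: strand_out_of_def)
  define r where "r = min s (t + e' / 2)"
  have r: "r \<le> s" "t < r" "r < t + e'" using s e' by (auto simp: r_def)
  then have "S = comp r" using e' by (intro strand_eq_comp_of_mem) auto
  also have "\<dots> = comp s" using r s e by (intro comp_eq) auto
  finally show "S = comp s" .
next
  have *: "comp r = comp s" if "t < r" "r < t + e" for r
  proof (cases "r \<le> s")
    case True
    then show ?thesis using that s by (intro comp_eq e) auto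
  next
    case False
    then show ?thesis using that s by (intro comp_eq[symmetric] e) auto
  qed
  have "D ` {t<..<t + e} \<subseteq> comp s"
  proof (rule image_subsetI)
    fix r assume "r \<in> {t<..<t + e}"
    then have r: "t < r" "r < t + e" by auto
    show "D r \<in> comp s" using D_in_comp[OF e[OF r]] unfolding *[OF r] .
  qed
  moreover assume "S = comp s"
  ultimately show "strand_out_of D t S"
    using comp_strand[of s] e s by (auto simp: strand_out_of_def intro!: exI[of _ e])
qed

lemma brk_interval:
  obtains e where "e > 0" "\<And>r. t - e < r \<Longrightarrow> r < t \<Longrightarrow> \<not> brk r" "\<And>r. t < r \<Longrightarrow> r < t + e \<Longrightarrow> \<not> brk r"
proof -
  obtain e where e: "e > 0" "\<And>s. 0 < \<bar>s - t\<bar> \<Longrightarrow> \<bar>s - t\<bar> < e \<Longrightarrow> \<not> brk s" using brk_discrete[of t] by metis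
  then show ?thesis using that[of e] by simp
qed

lemma strand_into_iff: "strand_into D t S \<longleftrightarrow> S = strand t"
proof -
  obtain e where e: "e > 0" "\<And>r. t - e < r \<Longrightarrow> r < t \<Longrightarrow> \<not> brk r" using brk_interval[of t] by metis
  have "strand_into D t S \<longleftrightarrow> S = comp (t - e / 2)" for S
    using e by (intro strand_into_comp) auto
  then show ?thesis by (simp add: strand_def)
qed

lemma strand_out_iff: "strand_out_of D t S \<longleftrightarrow> S = out t"
proof -
  obtain e where e: "e > 0" "\<And>r. t < r \<Longrightarrow> r < t + e \<Longrightarrow> \<not> brk r" using brk_interval[of t] by metis
  have "strand_out_of D t S \<longleftrightarrow> S = comp (t + e / 2)" for S
    using e by (intro strand_out_comp) auto
  then show ?thesis by (simp add: out_def)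
qed

lemma strand_comp:
  assumes "\<not> brk t"
  shows "strand t = comp t"
proof -
  obtain e where e: "e > 0" "\<And>r. t - e < r \<Longrightarrow> r < t \<Longrightarrow> \<not> brk r" using brk_interval[of t] by metis
  have "strand t = comp (t - e / 2)"
    using strand_into_comp[of t e "t - e / 2"] e strand_into_iff by auto
  also have "\<dots> = comp t"
  proof (rule comp_eq)
    show "\<not> brk r" if "t - e / 2 \<le> r" "r \<le> t" for r using e assms that by (cases "r = t") auto
  qed (use e in auto)
  finally show ?thesis .
qed

lemma strand_left: "\<forall>\<^sub>F s in at_left t. \<not> brk s \<and> strand s = strand t"
proof -
  obtain e where e: "e > 0" "\<And>r. t - e < r \<Longrightarrow> r < t \<Longrightarrow> \<not> brk r" using brk_interval[of t] by metis
  have "\<not> brk s \<and> strand s = strand t" if "t - e < s" "s < t" for s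
    using strand_into_comp[of t e s] e that strand_into_iff strand_comp by auto
  then show ?thesis
    using e(1) by (intro eventually_at_leftI[of "t - e"]) auto
qed

lemma strand_right: "\<forall>\<^sub>F s in at_right t. \<not> brk s \<and> strand s = out t"
proof -
  obtain e where e: "e > 0" "\<And>r. t < r \<Longrightarrow> r < t + e \<Longrightarrow> \<not> brk r" using brk_interval[of t] by metis
  have "\<not> brk s \<and> strand s = out t" if "t < s" "s < t + e" for s
    using strand_out_comp[of t e s] e that strand_out_iff strand_comp by auto
  then show ?thesis
    using e(1) by (intro eventually_at_rightI[of t "t + e"]) auto
qed

lemma out_not_brk:
  assumes "\<not> brk t"
  shows "out t = strand t"
proof -
  obtain e where e: "e > 0" "\<And>r. t < r \<Longrightarrow> r < t + e \<Longrightarrow> \<not> brk r" using brk_interval[of t] by metis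
  have "out t = comp (t + e / 2)"
    using strand_out_comp[of t e "t + e / 2"] e strand_out_iff by auto
  also have "comp t = comp (t + e / 2)"
  proof (rule comp_eq)
    show "\<not> brk r" if "t \<le> r" "r \<le> t + e / 2" for r using e assms that by (cases "r = t") auto
  qed (use e in auto)
  then have "comp (t + e / 2) = strand t" using strand_comp[OF assms] by simp
  finally show ?thesis .
qed

lemma strand_mem_iff:
  assumes "\<not> brk t"
  shows "S \<in> strands D \<and> D t \<in> S \<longleftrightarrow> S = strand t"
  using strand_eq_comp_of_mem[of S t] comp_strand[OF assms] D_in_comp[OF assms] strand_comp[OF assms] by auto

lemma range_strand: "range strand = strands D"
proof (intro equalityI subsetI)
  fix S assume "S \<in> range strand"
  then obtain t where "S = strand t" by blast
  then show "S \<in> strands D" using strand_into_iff[of t S] by (simp add: strand_into_def)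
next
  fix S assume S: "S \<in> strands D"
  then obtain t where t: "S = connected_component_set (range D - D ` breaks D) (D t)"
      "D t \<in> range D - D ` breaks D"
    unfolding strands_def components_def by blast
  have "D t \<in> S" unfolding t(1) mem_Collect_eq using t(2) by (rule connected_component_refl)
  then show "S \<in> range strand" using strand_mem_iff strand_eq_comp_of_mem(1) S by blast
qed

lemma strand_periodic: "strand (t + of_int k) = strand t"
proof -
  obtain e where e: "e > 0" "\<And>r. t - e < r \<Longrightarrow> r < t \<Longrightarrow> \<not> brk r" using brk_interval[of t] by metis
  have "\<not> brk r" if "t + of_int k - e < r" "r < t + of_int k" for r
    using e(2)[of "r + of_int (- k)"] that brk_periodic[of r "- k"] by simp
  then have "strand (t + of_int k) = comp (t + of_int k - e / 2)"
    using strand_into_comp[of "t + of_int k" e "t + of_int k - e / 2"] e(1) strand_into_iff by auto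
  also have "\<dots> = comp (t - e / 2)" using comp_periodic[of "t - e / 2" k] by (simp add: algebra_simps)
  also have "\<dots> = strand t"
    using strand_into_comp[of t e "t - e / 2"] e strand_into_iff by auto
  finally show ?thesis .
qed

lemma out_periodic: "out (t + of_int k) = out t"
proof -
  obtain e where e: "e > 0" "\<And>r. t < r \<Longrightarrow> r < t + e \<Longrightarrow> \<not> brk r" using brk_interval[of t] by metis
  have "\<not> brk r" if "t + of_int k < r" "r < t + of_int k + e" for r
    using e(2)[of "r + of_int (- k)"] that brk_periodic[of r "- k"] by simp
  then have "out (t + of_int k) = comp (t + of_int k + e / 2)"
    using strand_out_comp[of "t + of_int k" e "t + of_int k + e / 2"] e(1) strand_out_iff by auto
  also have "\<dots> = comp (t + e / 2)" using comp_periodic[of "t + e / 2" k] by (simp add: algebra_simps)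
  also have "\<dots> = out t"
    using strand_out_comp[of t e "t + e / 2"] e strand_out_iff by auto
  finally show ?thesis .
qed

section \<open>Exponents along the front\<close>

definition positive :: "real \<Rightarrow> bool" where
  "positive b \<longleftrightarrow> (\<exists>p. (p, b) \<in> crossings D \<and> crossing_sign D (p, b) = 1)"

text \<open>At a cusp the relation \<open>b = a ^ (n + 1)\<close> applies the common translation
  \<open>n\<close> times, since \<open>a ^ 1 = a\<close>.\<close>

definition weight :: "nat \<Rightarrow> real \<Rightarrow> int" where
  "weight n b = (if b \<in> cusps D then int n else if positive b then 1 else - 1)"

text \<open>\<open>\<lceil>t - b\<rceil>\<close> jumps by 1 just after every translate of
  \<open>b\<close>, so the value at a break still belongs to the arriving strand.\<close>

definition exponent :: "nat \<Rightarrow> real \<Rightarrow> int" where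
  "exponent n t = (\<Sum>b\<in>breaks D. weight n b * \<lceil>t - b\<rceil>)"

definition total :: "nat \<Rightarrow> int" where
  "total n = (\<Sum>b\<in>breaks D. weight n b)"

lemma finite_breaks: "finite (breaks D)" "finite (cusps D)" "finite (crossings D)"
  using generic by (auto simp: breaks_def generic_front_def)

lemma exponent_period: "exponent n (t + 1) = exponent n t + total n"
proof -
  have "\<lceil>t + 1 - b\<rceil> = \<lceil>t - b\<rceil> + 1" for b
    by (metis add_diff_eq add.commute ceiling_add_one diff_add_eq)
  then show ?thesis
    by (simp add: exponent_def total_def distrib_left sum.distrib)
qed

lemma exponent_period_int: "exponent n (t + of_int k) = exponent n t + k * total n"
proof -
  have "\<lceil>t + of_int k - b\<rceil> = \<lceil>t - b\<rceil> + k" for b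
    by (metis add_diff_eq add.commute ceiling_add_of_int diff_add_eq)
  then show ?thesis
    by (simp add: exponent_def total_def distrib_left sum.distrib sum_distrib_left mult.commute)
qed

lemma ceiling_left: "\<forall>\<^sub>F s in at_left t. \<lceil>s - b\<rceil> = \<lceil>t - (b::real)\<rceil>"
proof -
  have "of_int (\<lceil>t - b\<rceil> - 1) + b < t" by (simp; linarith)
  from eventually_at_left_real[OF this] show ?thesis
    by eventually_elim (simp add: ceiling_eq_iff; linarith)
qed

lemma ceiling_right:
  "\<forall>\<^sub>F s in at_right t. \<lceil>s - b\<rceil> = \<lceil>t - (b::real)\<rceil> + (if t - b \<in> \<int> then 1 else 0)"
proof (cases "t - b \<in> \<int>")
  case True
  then obtain k where k: "t = b + of_int k" by (metis Ints_cases add.commute diff_add_cancel)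
  have "t < t + 1" by simp
  from eventually_at_right_real[OF this] show ?thesis
  proof eventually_elim
    case (elim s)
    then show ?case using True by (simp add: k ceiling_eq_iff)
  qed
next
  case False
  have "of_int \<lceil>t - b\<rceil> \<noteq> t - b" using False by (metis Ints_of_int)
  then have "t < of_int \<lceil>t - b\<rceil> + b" using le_of_int_ceiling[of "t - b"] by linarith
  from eventually_at_right_real[OF this] show ?thesis
  proof eventually_elim
    case (elim s)
    then show ?case using False by (simp add: ceiling_eq_iff; linarith)
  qed
qed

lemma exponent_left: "\<forall>\<^sub>F s in at_left t. exponent n s = exponent n t"
proof -
  have "\<forall>\<^sub>F s in at_left t. \<forall>b\<in>breaks D. \<lceil>s - b\<rceil> = \<lceil>t - b\<rceil>"
    using finite_breaks(1) ceiling_left by (simp add: eventually_ball_finite)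
  then show ?thesis by eventually_elim (simp add: exponent_def)
qed

lemma exponent_right:
  "\<forall>\<^sub>F s in at_right t. exponent n s = exponent n t + (if brk t then weight n (frac t) else 0)"
proof -
  have "\<forall>\<^sub>F s in at_right t. \<forall>b\<in>breaks D. \<lceil>s - b\<rceil> = \<lceil>t - b\<rceil> + (if t - b \<in> \<int> then 1 else 0)"
    using finite_breaks(1) ceiling_right by (simp add: eventually_ball_finite)
  then show ?thesis
  proof eventually_elim
    case (elim s)
    have "t - b \<in> \<int> \<longleftrightarrow> b = frac t" if "b \<in> breaks D" for b
    proof -
      have "frac b = b" using that breaks_subset by (auto simp: frac_eq)
      then show ?thesis using frac_eq_iff[of t b] by auto
    qed
    then have "exponent n s = (\<Sum>b\<in>breaks D. weight n b * (\<lceil>t - b\<rceil> + (if b = frac t then 1 else 0)))"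
      unfolding exponent_def by (intro sum.cong) (simp_all add: elim)
    also have "\<dots> = exponent n t + (\<Sum>b\<in>breaks D. if b = frac t then weight n b else 0)"
      unfolding exponent_def distrib_left sum.distrib
      by (intro arg_cong2[where f = "(+)"] sum.cong) simp_all
    finally show ?case using finite_breaks(1) by (simp add: brk_breaks)
  qed
qed

lemma exponent_constant:
  assumes "a \<le> b" "\<And>r. r \<in> {a..b} \<Longrightarrow> \<not> brk r"
  shows "exponent n a = exponent n b"
proof (rule connected_equivalence_relation[of "{a..b}" a b "\<lambda>s t. exponent n s = exponent n t"])
  fix t assume t: "t \<in> {a..b}"
  have "\<forall>\<^sub>F s in at_right t. exponent n s = exponent n t"
    using exponent_right[of n t] assms(2)[OF t] by simp
  then have "\<forall>\<^sub>F s in nhds t. exponent n s = exponent n t"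
    using exponent_left[of n t] by (simp add: eventually_nhds_conv_at eventually_at_split)
  then obtain U where U: "open U" "t \<in> U" "\<forall>s\<in>U. exponent n s = exponent n t"
    unfolding eventually_nhds by blast
  have "openin (top_of_set {a..b}) ({a..b} \<inter> U)" by (rule openin_open_Int[OF U(1)])
  moreover have "\<forall>s\<in>{a..b} \<inter> U. exponent n t = exponent n s" using U(3) by (metis IntD2)
  ultimately show "\<exists>T. openin (top_of_set {a..b}) T \<and> t \<in> T \<and> (\<forall>s\<in>T. exponent n t = exponent n s)"
    using t U(2) by (metis IntI)
qed (use assms(1) in simp_all)

text \<open>Two parameters of one strand differ, up to whole turns, by an arc without breaks, and
  only whole turns change the exponent.\<close>

lemma strand_exponent:
  assumes "strand a = strand b"
  shows "total n dvd exponent n a - exponent n b"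
proof -
  have *: "\<exists>s. \<not> brk s \<and> comp s = strand t \<and> exponent n s = exponent n t" for t
  proof -
    have "\<forall>\<^sub>F s in at_left t. \<not> brk s \<and> comp s = strand t \<and> exponent n s = exponent n t"
      using strand_left[of t] exponent_left[of n t] by eventually_elim (metis strand_comp)
    from eventually_happens'[OF trivial_limit_at_left_real this] show ?thesis .
  qed
  obtain s where s: "\<not> brk s" "comp s = strand a" "exponent n s = exponent n a" using *[of a] by (elim exE conjE)
  obtain r where r: "\<not> brk r" "comp r = strand b" "exponent n r = exponent n b" using *[of b] by (elim exE conjE)
  define k where "k = - \<lfloor>r - s\<rfloor>"
  define r' where "r' = r + of_int k"
  have r': "\<not> brk r'" "comp r' = comp s" "exponent n r' = exponent n b + k * total n"
    using r s assms by (simp_all add: r'_def brk_periodic comp_periodic exponent_period_int)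
  have "s \<le> r'" "r' < s + 1" unfolding r'_def k_def by (simp; linarith)+
  have "total n dvd exponent n s - exponent n r'"
  proof (cases "s = r'")
    case False
    then have "s < r'" using \<open>s \<le> r'\<close> by simp
    from comp_separated[OF s(1) r'(1) this \<open>r' < s + 1\<close>] r'(2)
    have "(\<forall>x\<in>{s..r'}. \<not> brk x) \<or> (\<forall>x\<in>{r'..s + 1}. \<not> brk x)" by simp
    then have "exponent n s = exponent n r' \<or> exponent n r' = exponent n (s + 1)"
      using exponent_constant[of s r'] exponent_constant[of r' "s + 1"] \<open>s < r'\<close> \<open>r' < s + 1\<close> by auto
    then show ?thesis using exponent_period[of n s] by auto
  qed simp
  then have "total n dvd exponent n s - exponent n r' + k * total n" by simp
  then show ?thesis using s(3) r'(3) by simp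
qed

section \<open>The defining relations in terms of parameters\<close>

lemma crossings_not_brk:
  assumes "(p, q) \<in> crossings D"
  shows "\<not> brk p" "over p q" "q \<notin> cusps D" "q \<in> breaks D" "frac q = q"
proof -
  have fr: "frac p = p" "frac q = q" using assms by (auto simp: crossings_def frac_eq)
  then show o: "over p q" using assms over_crossings[of p q] by simp
  show "q \<notin> cusps D" using over_regular[OF o] by (simp add: cusps_def)
  show "q \<in> breaks D" "frac q = q" using assms fr by (force simp: breaks_def)+
  show "\<not> brk p"
  proof
    assume "brk p"
    then obtain w where w: "over w p" using over_regular[OF o] by (auto simp: brk_def)
    \<comment> \<open>An over-point that is also an under-point would be a triple point of the
      front.\<close>
    then have "w - p \<in> \<int> \<or> p - q \<in> \<int> \<or> w - q \<in> \<int>"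
      using o no_triple[of w p q] by (auto simp: over_def)
    then show False
      using over_not_int[OF w] over_not_int[OF o] over_not_int[of w q] w o by (auto simp: over_def)
  qed
qed

lemma crossings_unique:
  assumes "(p, q) \<in> crossings D" "(p', q) \<in> crossings D"
  shows "p = p'"
proof -
  have o: "over p q" "over p' q" using crossings_not_brk(2) assms by auto
  then have "p - p' \<in> \<int> \<or> p' - q \<in> \<int> \<or> p - q \<in> \<int>"
    using no_triple[of p p' q] by (auto simp: over_def)
  then have "frac p = frac p'" using over_not_int[OF o(1)] over_not_int[OF o(2)] by (simp add: frac_eq_iff)
  moreover have "frac p = p" "frac p' = p'" using assms by (auto simp: crossings_def frac_eq)
  ultimately show ?thesis by simp
qed

text \<open>The slope difference in \<open>front_det_eq\<close> is positive here, so the directions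
  of the two branches decide the sign.\<close>

lemma crossing_sign_over: "over p q \<Longrightarrow> crossing_sign D (p, q) = sgn (V p $ 1 * V q $ 1)"
  by (simp add: crossing_sign_def front_det_eq over_def sgn_mult)

lemma crossing_sign_cases:
  assumes "(p, q) \<in> crossings D"
  shows "crossing_sign D (p, q) = (if positive q then 1 else - 1)"
proof -
  have "crossing_sign D (p, q) \<noteq> 0"
    using crossing_sign_over[OF crossings_not_brk(2)[OF assms]] over_regular[OF crossings_not_brk(2)[OF assms]]
    by (simp add: sgn_zero_iff)
  then have "crossing_sign D (p, q) = 1 \<or> crossing_sign D (p, q) = - 1"
    by (auto simp: crossing_sign_def sgn_if split: if_splits)
  moreover have "positive q \<longleftrightarrow> crossing_sign D (p, q) = 1"
    unfolding positive_def using crossings_unique assms by metis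
  ultimately show ?thesis by auto
qed

lemma weight_crossing: "(p, q) \<in> crossings D \<Longrightarrow> weight n q = (if positive q then 1 else - 1)"
  using crossings_not_brk(3) by (simp add: weight_def)

lemma positive_relations_iff:
  "r \<in> positive_crossing_relations D \<longleftrightarrow> (\<exists>p q. (p, q) \<in> crossings D \<and> positive q \<and>
     r = (Gen (out q), Mult (Gen (strand q)) (Gen (strand p))))"
proof
  assume "r \<in> positive_crossing_relations D"
  then obtain x x' y c where c: "r = (Gen x', Mult (Gen x) (Gen y))" "c \<in> crossings D"
    "case c of (p, q) \<Rightarrow> crossing_sign D (p, q) = 1 \<and> y \<in> strands D \<and> D p \<in> y \<and> x = strand q \<and> x' = out q"
    unfolding positive_crossing_relations_def strand_into_iff strand_out_iff by blast
  obtain p q where "c = (p, q)" by (cases c)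
  with c have *: "r = (Gen x', Mult (Gen x) (Gen y))" "(p, q) \<in> crossings D"
    "crossing_sign D (p, q) = 1" "y \<in> strands D" "D p \<in> y" "x = strand q" "x' = out q"
    by simp_all
  moreover have "y = strand p" using * strand_mem_iff crossings_not_brk(1) by blast
  moreover have "positive q" using *(3) crossing_sign_cases[OF *(2)] by (auto split: if_splits)
  ultimately show "\<exists>p q. (p, q) \<in> crossings D \<and> positive q \<and> r = (Gen (out q), Mult (Gen (strand q)) (Gen (strand p)))"
    by blast
next
  assume "\<exists>p q. (p, q) \<in> crossings D \<and> positive q \<and> r = (Gen (out q), Mult (Gen (strand q)) (Gen (strand p)))"
  then obtain p q where *: "(p, q) \<in> crossings D" "positive q"
    "r = (Gen (out q), Mult (Gen (strand q)) (Gen (strand p)))" by blast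
  have "strand p \<in> strands D \<and> D p \<in> strand p" using strand_mem_iff crossings_not_brk(1)[OF *(1)] by blast
  moreover have "crossing_sign D (p, q) = 1" using crossing_sign_cases[OF *(1)] *(2) by simp
  ultimately show "r \<in> positive_crossing_relations D"
    unfolding positive_crossing_relations_def strand_into_iff strand_out_iff mem_Collect_eq
    using * by (intro exI[of _ "strand q"] exI[of _ "out q"] exI[of _ "strand p"] conjI bexI[of _ "(p, q)"]) auto
qed

lemma negative_relations_iff:
  "r \<in> negative_crossing_relations D \<longleftrightarrow> (\<exists>p q. (p, q) \<in> crossings D \<and> \<not> positive q \<and>
     r = (Gen (out q), Quot (Gen (strand q)) (Gen (strand p))))"
proof
  assume "r \<in> negative_crossing_relations D"
  then obtain x x' y c where c: "r = (Gen x', Quot (Gen x) (Gen y))" "c \<in> crossings D"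
    "case c of (p, q) \<Rightarrow> crossing_sign D (p, q) = - 1 \<and> y \<in> strands D \<and> D p \<in> y \<and> x = strand q \<and> x' = out q"
    unfolding negative_crossing_relations_def strand_into_iff strand_out_iff by blast
  obtain p q where "c = (p, q)" by (cases c)
  with c have *: "r = (Gen x', Quot (Gen x) (Gen y))" "(p, q) \<in> crossings D"
    "crossing_sign D (p, q) = - 1" "y \<in> strands D" "D p \<in> y" "x = strand q" "x' = out q"
    by simp_all
  moreover have "y = strand p" using * strand_mem_iff crossings_not_brk(1) by blast
  moreover have "\<not> positive q" using *(3) crossing_sign_cases[OF *(2)] by (auto split: if_splits)
  ultimately show "\<exists>p q. (p, q) \<in> crossings D \<and> \<not> positive q \<and> r = (Gen (out q), Quot (Gen (strand q)) (Gen (strand p)))"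
    by blast
next
  assume "\<exists>p q. (p, q) \<in> crossings D \<and> \<not> positive q \<and> r = (Gen (out q), Quot (Gen (strand q)) (Gen (strand p)))"
  then obtain p q where *: "(p, q) \<in> crossings D" "\<not> positive q"
    "r = (Gen (out q), Quot (Gen (strand q)) (Gen (strand p)))" by blast
  have "strand p \<in> strands D \<and> D p \<in> strand p" using strand_mem_iff crossings_not_brk(1)[OF *(1)] by blast
  moreover have "crossing_sign D (p, q) = - 1" using crossing_sign_cases[OF *(1)] *(2) by simp
  ultimately show "r \<in> negative_crossing_relations D"
    unfolding negative_crossing_relations_def strand_into_iff strand_out_iff mem_Collect_eq
    using * by (intro exI[of _ "strand q"] exI[of _ "out q"] exI[of _ "strand p"] conjI bexI[of _ "(p, q)"]) auto
qed

lemma cusp_relations_iff: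
  "r \<in> cusp_relations n D \<longleftrightarrow> (\<exists>c\<in>cusps D.
     r = (Gen (out c), rack_power (term_struct (strands D)) (Gen (strand c)) (n + 1)))"
  unfolding cusp_relations_def strand_into_iff strand_out_iff by auto

definition front_relations :: "nat \<Rightarrow> ((real^3) set rack_term \<times> (real^3) set rack_term) set" where
  "front_relations n = positive_crossing_relations D \<union> negative_crossing_relations D \<union> cusp_relations n D"

lemma exists_right:
  obtains s where "strand s = out t" "exponent n s = exponent n t + (if brk t then weight n (frac t) else 0)"
proof -
  have "\<forall>\<^sub>F s in at_right t. strand s = out t \<and> exponent n s = exponent n t + (if brk t then weight n (frac t) else 0)"
    using strand_right[of t] exponent_right[of n t] by eventually_elim simp
  from eventually_happens'[OF trivial_limit_at_right_real this] show ?thesis using that by blast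
qed

lemma brk_cases:
  assumes "brk t"
  obtains "frac t \<in> cusps D" | p where "(p, frac t) \<in> crossings D"
  using assms unfolding brk_breaks breaks_def by force

text \<open>Brings the geometric strands under the abstract presentation; the strand leaving a break
  is found at parameters just to its right.\<close>

sublocale circular_presentation n "strands D" "front_relations n" strand "exponent n" "total n" for n
proof
  show "strands D = range strand" by (rule range_strand[symmetric])
  show "gcd (2 * int n + 1) (total n) dvd exponent n a - exponent n b" if "strand a = strand b" for a b
    using strand_exponent[OF that, of n] by (meson dvd_trans gcd_dvd2)
  show "(\<exists>t s p. r = (Gen (strand s), Mult (Gen (strand t)) (Gen (strand p))) \<and> exponent n s = exponent n t + 1) \<or>
      (\<exists>t s p. r = (Gen (strand s), Quot (Gen (strand t)) (Gen (strand p))) \<and> exponent n s = exponent n t - 1) \<or>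
      (\<exists>t s. r = (Gen (strand s), rack_power (term_struct (strands D)) (Gen (strand t)) (n + 1)) \<and>
        exponent n s = exponent n t + int n)"
    if "r \<in> front_relations n" for r
    using that unfolding front_relations_def Un_iff positive_relations_iff negative_relations_iff cusp_relations_iff
  proof (elim disjE exE conjE bexE)
    fix p q assume *: "(p, q) \<in> crossings D" "positive q" "r = (Gen (out q), Mult (Gen (strand q)) (Gen (strand p)))"
    obtain s where "strand s = out q" "exponent n s = exponent n q + (if brk q then weight n (frac q) else 0)"
      by (rule exists_right)
    then have "r = (Gen (strand s), Mult (Gen (strand q)) (Gen (strand p))) \<and> exponent n s = exponent n q + 1"
      using * crossings_not_brk[OF *(1)] weight_crossing[OF *(1)] by (simp add: brk_breaks)
    then show ?thesis by blast
  next
    fix p q assume *: "(p, q) \<in> crossings D" "\<not> positive q" "r = (Gen (out q), Quot (Gen (strand q)) (Gen (strand p)))"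
    obtain s where "strand s = out q" "exponent n s = exponent n q + (if brk q then weight n (frac q) else 0)"
      by (rule exists_right)
    then have "r = (Gen (strand s), Quot (Gen (strand q)) (Gen (strand p))) \<and> exponent n s = exponent n q - 1"
      using * crossings_not_brk[OF *(1)] weight_crossing[OF *(1)] by (simp add: brk_breaks)
    then show ?thesis by blast
  next
    fix c assume *: "c \<in> cusps D" "r = (Gen (out c), rack_power (term_struct (strands D)) (Gen (strand c)) (n + 1))"
    obtain s where s: "strand s = out c" "exponent n s = exponent n c + (if brk c then weight n (frac c) else 0)"
      by (rule exists_right)
    have "frac c = c" "brk c" using *(1) by (auto simp: cusps_def frac_eq brk_def)
    then have "exponent n s = exponent n c + int n" using s(2) *(1) by (simp add: weight_def)
    then show ?thesis using * s(1) by metis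
  qed
  show "\<forall>\<^sub>F s in at_left t. strand s = strand t \<and> exponent n s = exponent n t" for t
    using strand_left[of t] exponent_left[of n t] by eventually_elim simp
  show "\<forall>\<^sub>F s in at_right t. strand s = strand t \<and> exponent n s = exponent n t \<or>
      (\<exists>p. (Gen (strand s), Mult (Gen (strand t)) (Gen (strand p))) \<in> front_relations n \<and> exponent n s = exponent n t + 1) \<or>
      (\<exists>p. (Gen (strand s), Quot (Gen (strand t)) (Gen (strand p))) \<in> front_relations n \<and> exponent n s = exponent n t - 1) \<or>
      ((Gen (strand s), rack_power (term_struct (strands D)) (Gen (strand t)) (n + 1)) \<in> front_relations n \<and>
        exponent n s = exponent n t + int n)" for t
    using strand_right[of t] exponent_right[of n t]
  proof eventually_elim
    case (elim s)
    have t: "strand (frac t) = strand t" "out (frac t) = out t"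
      using strand_periodic[of "frac t" "\<lfloor>t\<rfloor>"] out_periodic[of "frac t" "\<lfloor>t\<rfloor>"] by (simp_all add: frac_def)
    show ?case
    proof (cases "brk t")
      case False
      then show ?thesis using elim out_not_brk[OF False] by simp
    next
      case True
      then show ?thesis
      proof (cases rule: brk_cases)
        case 1
        then have "(Gen (out t), rack_power (term_struct (strands D)) (Gen (strand t)) (n + 1)) \<in> front_relations n"
          unfolding front_relations_def Un_iff cusp_relations_iff using t by metis
        then show ?thesis using elim True 1 by (simp add: weight_def)
      next
        case (2 p)
        show ?thesis
        proof (cases "positive (frac t)")
          case True
          have "(Gen (out t), Mult (Gen (strand t)) (Gen (strand p))) \<in> front_relations n"
            unfolding front_relations_def Un_iff positive_relations_iff using t 2 True by metis
          then show ?thesis using elim \<open>brk t\<close> weight_crossing[OF 2] True by auto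
        next
          case False
          have "(Gen (out t), Quot (Gen (strand t)) (Gen (strand p))) \<in> front_relations n"
            unfolding front_relations_def Un_iff negative_relations_iff using t 2 False by metis
          then show ?thesis using elim \<open>brk t\<close> weight_crossing[OF 2] False by auto
        qed
      qed
    qed
  qed
  show "strand (t + 1) = strand t" for t using strand_periodic[of t 1] by simp
  show "exponent n (t + 1) = exponent n t + total n" for t by (rule exponent_period)
qed

end

section \<open>The rack of an unknotted front\<close>

typedef 'a permutation = "{f :: 'a \<Rightarrow> 'a. bij f}"
  by (auto intro: bij_id)

instantiation permutation :: (type) group_add
begin

definition "0 = Abs_permutation id"
definition "f + g = Abs_permutation (Rep_permutation f \<circ> Rep_permutation g)"
definition "- f = Abs_permutation (inv (Rep_permutation f))"
definition "f - g = f + (- g :: 'a permutation)"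

lemma bij_Rep_permutation: "bij (Rep_permutation f)"
  using Rep_permutation by blast

lemma Rep_permutation_plus: "Rep_permutation (f + g) = Rep_permutation f \<circ> Rep_permutation g"
  unfolding plus_permutation_def by (rule Abs_permutation_inverse) (simp add: bij_Rep_permutation bij_comp)

lemma Rep_permutation_zero: "Rep_permutation 0 = id"
  unfolding zero_permutation_def by (rule Abs_permutation_inverse) simp

lemma Rep_permutation_uminus: "Rep_permutation (- f) = inv (Rep_permutation f)"
  unfolding uminus_permutation_def by (rule Abs_permutation_inverse) (simp add: bij_Rep_permutation bij_imp_bij_inv)

instance
proof
  fix f g h :: "'a permutation"
  show "f + g + h = f + (g + h)" "0 + f = f" "f + 0 = f"
    by (simp_all add: Rep_permutation_inject[symmetric] Rep_permutation_plus Rep_permutation_zero o_assoc)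
  show "- f + f = 0"
    by (simp add: Rep_permutation_inject[symmetric] Rep_permutation_plus Rep_permutation_zero
        Rep_permutation_uminus bij_Rep_permutation bij_is_inj)
  show "f + - g = f - g" by (simp add: minus_permutation_def)
qed

end

lemma permutation_eqI: "(\<And>x. Rep_permutation f x = Rep_permutation g x) \<Longrightarrow> f = g"
  by (metis Rep_permutation_inject ext)

text \<open>The identity outside of the carrier makes this a permutation of the whole type, hence an
  element of a group.\<close>

definition translation :: "'a rack_struct \<Rightarrow> 'a \<Rightarrow> 'a permutation" where
  "translation R b = Abs_permutation (\<lambda>x. if x \<in> carrier R then mult R x b else x)"

lemma Rep_translation:
  assumes R: "rack R" and b: "b \<in> carrier R"
  shows "Rep_permutation (translation R b) x = (if x \<in> carrier R then mult R x b else x)"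
    and "Rep_permutation (- translation R b) x = (if x \<in> carrier R then quot R x b else x)"
proof -
  let ?f = "\<lambda>x. if x \<in> carrier R then mult R x b else x"
  let ?g = "\<lambda>x. if x \<in> carrier R then quot R x b else x"
  have inv: "?g (?f y) = y" "?f (?g y) = y" for y
    using rack_closed[OF R _ b] rack_cancel[OF R _ b] by auto
  have "bij ?f" by (rule bij_betw_byWitness[where f' = ?g]) (use inv in auto)
  then have Rep: "Rep_permutation (translation R b) = ?f"
    unfolding translation_def by (intro Abs_permutation_inverse) simp
  then show "Rep_permutation (translation R b) x = ?f x" by simp
  have "inv ?f = ?g" by (rule inv_equality) (use inv in auto)
  then show "Rep_permutation (- translation R b) x = ?g x"
    by (simp only: Rep_permutation_uminus Rep)
qed

text \<open>Self-distributivity as a conjugation; in \<open>+\<close> the right summand is applied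
  first.\<close>

lemma translation_mult:
  assumes R: "rack R" and ab: "a \<in> carrier R" "b \<in> carrier R"
  shows "translation R (mult R a b) = translation R b + translation R a - translation R b"
proof (rule permutation_eqI)
  fix x
  show "Rep_permutation (translation R (mult R a b)) x =
      Rep_permutation (translation R b + translation R a - translation R b) x"
    using rack_mult_mult[OF R _ ab] rack_closed[OF R] ab
    by (simp add: minus_permutation_def Rep_permutation_plus Rep_translation[OF R] del: add_uminus_conv_diff)
qed

lemma translation_quot:
  assumes R: "rack R" and ab: "a \<in> carrier R" "b \<in> carrier R"
  shows "translation R (quot R a b) = - translation R b + translation R a + translation R b"
proof (rule permutation_eqI)
  fix x
  show "Rep_permutation (translation R (quot R a b)) x =
      Rep_permutation (- translation R b + translation R a + translation R b) x"
    using rack_mult_quot[OF R _ ab] rack_closed[OF R] ab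
    by (simp add: Rep_permutation_plus Rep_translation[OF R])
qed

text \<open>Conjugating a translation by itself does not change it, so all powers of
  \<open>a\<close> translate alike. This makes cusps invisible to the colours.\<close>

lemma translation_power:
  assumes R: "rack R" and a: "a \<in> carrier R"
  shows "rack_power R a (Suc m) \<in> carrier R \<and> translation R (rack_power R a (Suc m)) = translation R a"
proof (induction m)
  case (Suc m)
  then show ?case using translation_mult[OF R _ a] rack_closed(1)[OF R _ a] by simp
qed (use a in simp)

section \<open>The colouring of a front by right translations\<close>

context front_diagram
begin

abbreviation strand_gen :: "nat \<Rightarrow> real \<Rightarrow> (real^3) set rack_term set" where
  "strand_gen n \<equiv> circular_presentation.gen n (strands D) (front_relations n) strand"

lemma LR_eq: "LR n D = presented_rack n (strands D) (front_relations n)"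
  by (simp add: LR_def front_relations_def)

definition strand_colour :: "nat \<Rightarrow> real \<Rightarrow> (real^3) set rack_term set permutation" where
  "strand_colour n t = translation (LR n D) (strand_gen n t)"

lemma strand_colour_cong: "strand s = strand t \<Longrightarrow> strand_colour n s = strand_colour n t"
  by (simp add: strand_colour_def gen_def)

lemma strand_colour_left: "\<forall>\<^sub>F s in at_left t. strand_colour n s = strand_colour n t"
  using strand_left[of t] by eventually_elim (metis strand_colour_cong)

lemma strand_colour_right:
  "\<forall>\<^sub>F s in at_right t.
     (brk t \<and> \<not> cusp t \<longrightarrow> (\<exists>p. over p t \<and> strand_colour n s = (if positive (frac t)
         then strand_colour n p + strand_colour n t - strand_colour n p
         else - strand_colour n p + strand_colour n t + strand_colour n p))) \<and>
     (\<not> brk t \<or> cusp t \<longrightarrow> strand_colour n s = strand_colour n t)"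
  using strand_right[of t]
proof eventually_elim
  case (elim s)
  have t: "strand (frac t) = strand t" "out (frac t) = strand s"
    using strand_periodic[of "frac t" "\<lfloor>t\<rfloor>"] out_periodic[of "frac t" "\<lfloor>t\<rfloor>"] elim by (simp_all add: frac_def)
  note R = rack_R[of n] and carr = gen_carrier[of n]
  show ?case
  proof (intro conjI impI)
    assume b: "brk t \<and> \<not> cusp t"
    then obtain p where p: "(p, frac t) \<in> crossings D"
      using brk_cases[of t] by (metis (mono_tags, lifting) V_frac cusps_def mem_Collect_eq)
    have o: "over p t"
      using crossings_not_brk(2)[OF p] over_frac by (metis crossings_def over_crossings crossings_not_brk(5)[OF p])
    show "\<exists>p. over p t \<and> strand_colour n s = (if positive (frac t)
         then strand_colour n p + strand_colour n t - strand_colour n p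
         else - strand_colour n p + strand_colour n t + strand_colour n p)"
    proof (intro exI conjI, rule o)
      show "strand_colour n s = (if positive (frac t)
         then strand_colour n p + strand_colour n t - strand_colour n p
         else - strand_colour n p + strand_colour n t + strand_colour n p)"
      proof (cases "positive (frac t)")
        case True
        then have "(Gen (strand s), Mult (Gen (strand t)) (Gen (strand p))) \<in> front_relations n"
          unfolding front_relations_def Un_iff positive_relations_iff using p t by metis
        then show ?thesis
          using True gen_mult translation_mult[OF R carr carr] by (simp add: strand_colour_def LR_eq)
      next
        case False
        then have "(Gen (strand s), Quot (Gen (strand t)) (Gen (strand p))) \<in> front_relations n"
          unfolding front_relations_def Un_iff negative_relations_iff using p t by metis
        then show ?thesis
          using False gen_quot translation_quot[OF R carr carr] by (simp add: strand_colour_def LR_eq)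
      qed
    qed
  next
    assume b: "\<not> brk t \<or> cusp t"
    show "strand_colour n s = strand_colour n t"
    proof (cases "cusp t")
      case True
      then have "frac t \<in> cusps D" using frac_in[of t] by (simp add: cusps_def V_frac)
      then have "(Gen (strand s), rack_power (term_struct (strands D)) (Gen (strand t)) (n + 1)) \<in> front_relations n"
        unfolding front_relations_def Un_iff cusp_relations_iff using t by metis
      from gen_power[OF this] show ?thesis
        using translation_power[OF R carr] by (simp add: strand_colour_def LR_eq)
    next
      case False
      then have "strand s = strand t" using b out_not_brk elim by simp
      then show ?thesis by (rule strand_colour_cong)
    qed
  qed
qed

text \<open>The direction that carries the inverse is forced by the crossing condition of
  \<open>coloured_front\<close>: with the opposite sign a positive crossing of two branches running
  to the right would require the other conjugation.\<close>

definition signed_colour :: "nat \<Rightarrow> real \<Rightarrow> (real^3) set rack_term set permutation" where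
  "signed_colour n t = (if 0 < V t $ 1 then - strand_colour n t else strand_colour n t)"

lemma V_sign_near:
  assumes "\<not> cusp t"
  shows "\<forall>\<^sub>F s in nhds t. sgn (V s $ 1) = sgn (V t $ 1)"
proof -
  have "open {s. 0 < V s $ 1 * V t $ 1}"
    by (intro open_Collect_less continuous_intros continuous_V)
  then have "\<forall>\<^sub>F s in nhds t. s \<in> {s. 0 < V s $ 1 * V t $ 1}"
    using assms by (intro eventually_nhds_in_open) (auto simp: zero_less_mult_iff linorder_neq_iff)
  then show ?thesis by eventually_elim (auto simp: zero_less_mult_iff sgn_if)
qed

lemma eventually_nhds_sides:
  "eventually P (nhds (t::real)) \<longleftrightarrow> eventually P (at_left t) \<and> eventually P (at_right t) \<and> P t"
  by (simp add: eventually_nhds_conv_at eventually_at_split conj_ac)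

text \<open>At a cusp the direction reverses and the translation stays, so the signed colour is
  inverted. At a crossing the outgoing colour is a conjugate by the over-colour, which for all four
  pairs of directions becomes the crossing condition.\<close>

lemma coloured_front_signed_colour: "coloured_front D (signed_colour n)"
proof
  show "signed_colour n (t + of_int k) = signed_colour n t" for t k
    using strand_colour_cong[OF strand_periodic[of t k]] by (simp add: signed_colour_def V_periodic_int)
  show "\<exists>e>0. \<forall>s. \<bar>s - t\<bar> < e \<longrightarrow> signed_colour n s = signed_colour n t"
    if t: "\<not> cusp t" "\<nexists>p. over p t" for t
  proof -
    have nb: "\<not> brk t" using t by (simp add: brk_def)
    have "\<forall>\<^sub>F s in at_right t. strand_colour n s = strand_colour n t"
      using strand_colour_right[of t n] by eventually_elim (use nb in blast)
    then have "\<forall>\<^sub>F s in nhds t. strand_colour n s = strand_colour n t"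
      using strand_colour_left[of n t] by (simp add: eventually_nhds_sides)
    then have "\<forall>\<^sub>F s in nhds t. signed_colour n s = signed_colour n t"
      using V_sign_near[OF t(1)] by eventually_elim (auto simp: signed_colour_def sgn_if split: if_splits)
    then show ?thesis by (simp add: eventually_nhds_metric dist_real_def)
  qed
  show "\<exists>e>0. \<exists>g. \<forall>s. (t - e < s \<and> s < t \<longrightarrow> signed_colour n s = g) \<and> (t < s \<and> s < t + e \<longrightarrow> signed_colour n s = - g)"
    if t: "cusp t" for t
  proof -
    have right: "\<forall>\<^sub>F s in at_right t. strand_colour n s = strand_colour n t"
      using strand_colour_right[of t n] by eventually_elim (use t in blast)
    obtain e0 where e0: "e0 > 0" "\<And>s. t - e0 < s \<Longrightarrow> s < t \<Longrightarrow> strand_colour n s = strand_colour n t"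
      using strand_colour_left[of n t] unfolding eventually_at_left_field by (metis diff_add_cancel diff_gt_0_iff_gt add_diff_cancel_left' diff_diff_eq2)
    obtain e1 where e1: "e1 > 0" "\<And>s. t < s \<Longrightarrow> s < t + e1 \<Longrightarrow> strand_colour n s = strand_colour n t"
      using right unfolding eventually_at_right_field by (metis add_diff_cancel_left' diff_add_cancel diff_gt_0_iff_gt add.commute)
    obtain d e2 where e2: "d \<noteq> 0" "e2 > 0"
      "\<And>s. 0 < \<bar>s - t\<bar> \<Longrightarrow> \<bar>s - t\<bar> < e2 \<Longrightarrow> 0 < d * (D s $ 1 - D t $ 1) \<and> 0 < d * (s - t) * V s $ 1"
      using cusp_side[OF t] by metis
    define e where "e = Min {e0, e1, e2}"
    have e: "e > 0" "e \<le> e0" "e \<le> e1" "e \<le> e2" using e0(1) e1(1) e2(2) by (auto simp: e_def)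
    define g where "g = (if d < 0 then - strand_colour n t else strand_colour n t)"
    have "signed_colour n s = g" if "t - e < s" "s < t" for s
    proof -
      have "0 < d * (s - t) * V s $ 1" using e2(3)[of s] that e by simp
      then have "d < 0 \<longleftrightarrow> 0 < V s $ 1" using that by (auto simp: zero_less_mult_iff mult_less_0_iff)
      then show ?thesis using e0(2)[of s] that e by (simp add: signed_colour_def g_def)
    qed
    moreover have "signed_colour n s = - g" if "t < s" "s < t + e" for s
    proof -
      have "0 < d * (s - t) * V s $ 1" using e2(3)[of s] that e by simp
      then have "d < 0 \<longleftrightarrow> \<not> 0 < V s $ 1" using that e2(1) by (auto simp: zero_less_mult_iff mult_less_0_iff)
      then show ?thesis using e1(2)[of s] that e by (simp add: signed_colour_def g_def)
    qed
    ultimately show ?thesis using e(1) by (intro exI[of _ e] conjI exI[of _ g]) auto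
  qed
  show "\<exists>e>0. \<exists>g h. signed_colour n p + h = g + signed_colour n p \<and> (\<forall>s. \<bar>s - q\<bar> < e \<longrightarrow>
        (D s $ 1 < D q $ 1 \<longrightarrow> signed_colour n s = g) \<and> (D q $ 1 < D s $ 1 \<longrightarrow> signed_colour n s = h))"
    if pq: "over p q" for p q
  proof -
    let ?c = "strand_colour n"
    have nc: "\<not> cusp p" "\<not> cusp q" using over_regular[OF pq] by auto
    have "brk q" using pq by (auto simp: brk_def)
    have pos: "positive (frac q) \<longleftrightarrow> 0 < V p $ 1 * V q $ 1"
    proof -
      have cr: "(frac p, frac q) \<in> crossings D" using pq over_crossings by blast
      have "crossing_sign D (frac p, frac q) = sgn (V p $ 1 * V q $ 1)"
        using crossing_sign_over[of "frac p" "frac q"] pq over_frac by (simp add: V_frac)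
      then show ?thesis using crossing_sign_cases[OF cr] by (auto simp: sgn_if split: if_splits)
    qed
    define co where "co = (if positive (frac q) then ?c p + ?c q - ?c p else - ?c p + ?c q + ?c p)"
    have right: "\<forall>\<^sub>F s in at_right q. ?c s = co"
      using strand_colour_right[of q n]
    proof eventually_elim
      case (elim s)
      then obtain p' where p': "over p' q" "?c s = (if positive (frac q) then ?c p' + ?c q - ?c p' else - ?c p' + ?c q + ?c p')"
        using \<open>brk q\<close> nc(2) by blast
      have "frac p' = frac p"
        using crossings_unique[of "frac p'" "frac q" "frac p"] p'(1) pq over_crossings by blast
      then have "p' - p \<in> \<int>" by (simp add: frac_eq_iff)
      then obtain k where "p' = p + of_int k" by (metis Ints_cases add.commute diff_add_cancel)
      then have "?c p' = ?c p" using strand_colour_cong[OF strand_periodic[of p k]] by simp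
      then show ?case using p'(2) by (simp add: co_def)
    qed
    obtain e0 where e0: "e0 > 0" "\<And>s. q - e0 < s \<Longrightarrow> s < q \<Longrightarrow> ?c s = ?c q"
      using strand_colour_left[of n q] unfolding eventually_at_left_field by (metis diff_add_cancel diff_gt_0_iff_gt add_diff_cancel_left' diff_diff_eq2)
    obtain e1 where e1: "e1 > 0" "\<And>s. q < s \<Longrightarrow> s < q + e1 \<Longrightarrow> ?c s = co"
      using right unfolding eventually_at_right_field by (metis add_diff_cancel_left' diff_add_cancel diff_gt_0_iff_gt add.commute)
    obtain e2 where e2: "e2 > 0" "\<And>s. \<bar>s - q\<bar> < e2 \<Longrightarrow> sgn (V s $ 1) = sgn (V q $ 1)"
      using V_sign_near[OF nc(2)] by (auto simp: eventually_nhds_metric dist_real_def)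
    define e where "e = Min {e0, e1, e2}"
    have e: "e > 0" "e \<le> e0" "e \<le> e1" "e \<le> e2" using e0(1) e1(1) e2(1) by (auto simp: e_def)
    have mono: "0 < V q $ 1 * (s - q) * (D s $ 1 - D q $ 1)" if "\<bar>s - q\<bar> < e" "s \<noteq> q" for s
    proof -
      have "\<exists>r. \<bar>r - q\<bar> < e \<and> D s $ 1 - D q $ 1 = (s - q) * V r $ 1"
      proof (cases "q < s")
        case True
        then obtain r where "q < r" "r < s" "D s $ 1 - D q $ 1 = (s - q) * V r $ 1"
          using MVT2[of q s "\<lambda>t. D t $ 1" "\<lambda>t. V t $ 1"] D_component_derivative by blast
        then show ?thesis using that by (intro exI[of _ r]) auto
      next
        case False
        then have "s < q" using that by auto
        then obtain r where "s < r" "r < q" "D q $ 1 - D s $ 1 = (q - s) * V r $ 1"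
          using MVT2[of s q "\<lambda>t. D t $ 1" "\<lambda>t. V t $ 1"] D_component_derivative by blast
        then show ?thesis using that by (intro exI[of _ r]) (auto simp: algebra_simps)
      qed
      then obtain r where r: "\<bar>r - q\<bar> < e" "D s $ 1 - D q $ 1 = (s - q) * V r $ 1" by blast
      have "sgn (V r $ 1) = sgn (V q $ 1)" using e2(2)[of r] r e by simp
      then have "0 < V q $ 1 * V r $ 1" using nc(2) by (auto simp: sgn_if zero_less_mult_iff split: if_splits)
      moreover have "0 < (s - q)\<^sup>2" using that(2) by simp
      ultimately have "0 < (V q $ 1 * V r $ 1) * (s - q)\<^sup>2" by (rule mult_pos_pos)
      then show ?thesis by (simp add: r(2) power2_eq_square mult_ac)
    qed
    \<comment> \<open>\<open>g\<close> belongs to smaller \<open>x\<close>: the incoming part of the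
      under-branch if it runs to the right, the outgoing part otherwise.\<close>
    define g h where "g = (if 0 < V q $ 1 then - ?c q else co)" and "h = (if 0 < V q $ 1 then - co else ?c q)"
    have "signed_colour n p + h = g + signed_colour n p"
      unfolding g_def h_def co_def pos signed_colour_def using nc
      by (auto simp: zero_less_mult_iff minus_add add.assoc minus_diff_eq simp del: add_uminus_conv_diff
          simp add: diff_conv_add_uminus)
    moreover have "(D s $ 1 < D q $ 1 \<longrightarrow> signed_colour n s = g) \<and> (D q $ 1 < D s $ 1 \<longrightarrow> signed_colour n s = h)"
      if s: "\<bar>s - q\<bar> < e" for s
    proof -
      have sg: "0 < V s $ 1 \<longleftrightarrow> 0 < V q $ 1" using e2(2)[of s] s e by (auto simp: sgn_if split: if_splits)
      have left_c: "?c s = ?c q" if "s < q" using e0(2)[of s] s e that by auto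
      have right_c: "?c s = co" if "q < s" using e1(2)[of s] s e that by auto
      consider "s = q" | "s < q" | "q < s" by linarith
      then show ?thesis
      proof cases
        case 2
        then have "0 < V q $ 1 \<longleftrightarrow> D s $ 1 < D q $ 1" "0 < V q $ 1 \<or> D q $ 1 < D s $ 1"
          using mono[OF s] by (auto simp: zero_less_mult_iff mult_less_0_iff)
        then show ?thesis using left_c[OF 2] sg by (auto simp: signed_colour_def g_def h_def)
      next
        case 3
        then have "0 < V q $ 1 \<longleftrightarrow> D q $ 1 < D s $ 1" "0 < V q $ 1 \<or> D s $ 1 < D q $ 1"
          using mono[OF s] by (auto simp: zero_less_mult_iff mult_less_0_iff)
        then show ?thesis using right_c[OF 3] sg by (auto simp: signed_colour_def g_def h_def)
      qed simp
    qed
    ultimately show ?thesis using e(1) by (intro exI[of _ e] conjI exI[of _ g] exI[of _ h]) auto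
  qed
qed

text \<open>Commuting colours are unchanged by the conjugation at a crossing, and cusps preserve
  them; so the colour is locally constant along the line.\<close>

lemma unknotted_translations:
  assumes h: "homeomorphism UNIV UNIV \<Phi> \<Psi>" "\<Phi> ` range D = range unknot"
  shows "strand_colour n s = strand_colour n t"
proof -
  let ?c = "strand_colour n"
  interpret C: coloured_front D "signed_colour n" by (rule coloured_front_signed_colour)
  \<comment> \<open>The colour at \<open>t\<close> is also taken just to the left of
    \<open>t\<close>, where no parameter is special.\<close>
  have near: "\<exists>r. \<not> special r \<and> ?c r = ?c t" for t
  proof -
    obtain e where e: "e > 0" "\<And>s. 0 < \<bar>s - t\<bar> \<Longrightarrow> \<bar>s - t\<bar> < e \<Longrightarrow> \<not> special s" by (rule special_discrete[of t]) blast
    have "t - e < t" using e(1) by simp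
    from eventually_at_left_real[OF this] strand_colour_left[of n t]
    have "\<forall>\<^sub>F r in at_left t. \<not> special r \<and> ?c r = ?c t"
    proof eventually_elim
      case (elim r)
      then show ?case using e(2)[of r] by auto
    qed
    from eventually_happens'[OF trivial_limit_at_left_real this] show ?thesis .
  qed
  have comm: "?c s + ?c t = ?c t + ?c s" for s t
  proof -
    obtain r r' where r: "\<not> special r" "?c r = ?c s" "\<not> special r'" "?c r' = ?c t" using near by metis
    have *: "signed_colour n r + signed_colour n r' = signed_colour n r' + signed_colour n r"
      by (rule C.unknotted_colours_commute[OF h r(1,3)])
    \<comment> \<open>Commuting with \<open>- u\<close> implies commuting with \<open>u\<close>;
      this removes the signs from the two colours one after the other.\<close>
    have inv: "u + v = v + u" if "- u + v = v + - u" for u v :: "(real^3) set rack_term set permutation"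
    proof -
      have "u + (- u + v) + u = u + (v + - u) + u" by (simp only: that)
      then show ?thesis by (simp add: add.assoc)
    qed
    have c1: "- ?c r + signed_colour n r' = signed_colour n r' + - ?c r \<or> ?c r + signed_colour n r' = signed_colour n r' + ?c r"
      using * by (auto simp: signed_colour_def split: if_splits)
    then have c2: "?c r + signed_colour n r' = signed_colour n r' + ?c r" using inv by blast
    then have "- ?c r' + ?c r = ?c r + - ?c r' \<or> ?c r' + ?c r = ?c r + ?c r'"
      by (auto simp: signed_colour_def split: if_splits)
    then have "?c r' + ?c r = ?c r + ?c r'" using inv by blast
    then show ?thesis by (simp add: r)
  qed
  show ?thesis
  proof (rule connected_equivalence_relation[of UNIV s t "\<lambda>s t. ?c s = ?c t"])
    fix t :: real
    have "\<forall>\<^sub>F s in at_right t. ?c s = ?c t"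
      using strand_colour_right[of t n]
    proof eventually_elim
      case (elim s)
      have "?c p + ?c t - ?c p = ?c t" "- ?c p + ?c t + ?c p = ?c t" for p
        by (simp only: comm[of p t] add_diff_cancel, simp only: add.assoc comm[of t p] minus_add_cancel)
      then show ?case using elim by (auto split: if_splits)
    qed
    then have "\<forall>\<^sub>F s in nhds t. ?c s = ?c t"
      using strand_colour_left[of n t] by (simp add: eventually_nhds_sides)
    then obtain U where U: "open U" "t \<in> U" "\<forall>s\<in>U. ?c s = ?c t" unfolding eventually_nhds by blast
    have "openin (top_of_set UNIV) U" using U(1) by simp
    with U(2,3) show "\<exists>U. openin (top_of_set UNIV) U \<and> t \<in> U \<and> (\<forall>s\<in>U. ?c t = ?c s)" by metis
  qed simp_all
qed

theorem unknotted_front_rack: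
  assumes h: "homeomorphism UNIV UNIV \<Phi> \<Psi>" "\<Phi> ` range D = range unknot"
  shows "rack_isomorphic (LR n D) (cyclic_rack (gcd (2 * int n + 1) (total n)))"
proof -
  have "mult (LR n D) a (strand_gen n t) = mult (LR n D) a (strand_gen n 0)" if "a \<in> carrier (LR n D)" for a t
  proof -
    have R: "rack (LR n D)" and carr: "strand_gen n t \<in> carrier (LR n D)" for t
      using rack_R[of n] gen_carrier[where n = n and t = t] by (simp_all add: LR_eq)
    show ?thesis
      using arg_cong[OF unknotted_translations[OF h, of n t 0], of "\<lambda>f. Rep_permutation f a"] that
      by (simp add: strand_colour_def Rep_translation(1)[OF R carr])
  qed
  then show ?thesis
    unfolding LR_eq by (rule isomorphic_cyclic_rack)
qed

lemma total_eq: "\<exists>w :: int. real_of_int w = writhe D \<and> total n = w + int n * int (card (cusps D))"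
proof -
  let ?w = "\<lambda>c. if positive (snd c) then 1 else - 1 :: int"
  have inj: "inj_on snd (crossings D)"
    using crossings_unique by (auto simp: inj_on_def)
  have disj: "cusps D \<inter> snd ` crossings D = {}" using crossings_not_brk(3) by auto
  have "total n = (\<Sum>b\<in>cusps D. weight n b) + (\<Sum>b\<in>snd ` crossings D. weight n b)"
    unfolding total_def breaks_def by (rule sum.union_disjoint) (use finite_breaks disj in auto)
  also have "(\<Sum>b\<in>cusps D. weight n b) = int n * int (card (cusps D))" by (simp add: weight_def)
  also have "(\<Sum>b\<in>snd ` crossings D. weight n b) = (\<Sum>c\<in>crossings D. ?w c)"
    unfolding sum.reindex[OF inj] by (intro sum.cong) (auto simp: weight_crossing)
  finally have "total n = (\<Sum>c\<in>crossings D. ?w c) + int n * int (card (cusps D))" by simp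
  moreover have "real_of_int (\<Sum>c\<in>crossings D. ?w c) = writhe D"
    unfolding writhe_def of_int_sum by (intro sum.cong) (auto simp: crossing_sign_cases)
  ultimately show ?thesis by blast
qed

text \<open>Modulo \<open>2 * n + 1\<close> the total exponent is \<open>- n\<close> times twice the Thurston-Bennequin number.\<close>

lemma gcd_total: "\<exists>T :: int. real_of_int T = 2 * tb_front D \<and> gcd (2 * int n + 1) (total n) = gcd (2 * int n + 1) (int n * T)"
proof -
  obtain w where w: "real_of_int w = writhe D" "total n = w + int n * int (card (cusps D))" using total_eq by blast
  define T where "T = 2 * w - int (card (cusps D))"
  \<comment> \<open>The writhe is rewritten with \<open>1 = (2 * n + 1) - 2 * n\<close>.\<close>
  have "total n = - (int n * T) + w * (2 * int n + 1)"
    unfolding w(2) T_def by (simp add: algebra_simps)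
  then have "gcd (2 * int n + 1) (total n) = gcd (2 * int n + 1) (- (int n * T))"
    using gcd_add_mult[of "2 * int n + 1" w "- (int n * T)"] by (simp only: add.commute)
  moreover have "real_of_int T = 2 * tb_front D" by (simp add: T_def tb_front_def w(1))
  ultimately show ?thesis by (intro exI[of _ T]) simp
qed

end

lemma unknotted_fronts_isomorphic:
  assumes "legendrian_knot D1" "generic_front D1" "homeomorphism UNIV UNIV \<Phi>1 \<Psi>1" "\<Phi>1 ` range D1 = range unknot"
    and "legendrian_knot D2" "generic_front D2" "homeomorphism UNIV UNIV \<Phi>2 \<Psi>2" "\<Phi>2 ` range D2 = range unknot"
    and tb: "tb_front D1 = tb_front D2"
  shows "rack_isomorphic (LR n D1) (LR n D2)"
proof -
  interpret F1: front_diagram D1 using assms by unfold_locales (auto simp: legendrian_knot_def)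
  interpret F2: front_diagram D2 using assms by unfold_locales (auto simp: legendrian_knot_def)
  obtain T1 where T1: "real_of_int T1 = 2 * tb_front D1"
    "gcd (2 * int n + 1) (F1.total n) = gcd (2 * int n + 1) (int n * T1)" using F1.gcd_total by blast
  obtain T2 where T2: "real_of_int T2 = 2 * tb_front D2"
    "gcd (2 * int n + 1) (F2.total n) = gcd (2 * int n + 1) (int n * T2)" using F2.gcd_total by blast
  have "T1 = T2" using T1(1) T2(1) tb by simp
  then have "rack_isomorphic (LR n D1) (cyclic_rack (gcd (2 * int n + 1) (F2.total n)))"
    using F1.unknotted_front_rack[OF assms(3,4), of n] unfolding T1(2) T2(2) by simp
  moreover have "rack_isomorphic (cyclic_rack (gcd (2 * int n + 1) (F2.total n))) (LR n D2)"
    using F2.rack_R[of n] F2.unknotted_front_rack[OF assms(7,8), of n]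
    unfolding F2.LR_eq by (rule rack_isomorphic_sym)
  ultimately show ?thesis by (rule rack_isomorphic_trans)
qed

section \<open>The Thurston-Bennequin number as a count of chords\<close>

context front_diagram
begin

text \<open>The chords with displacement \<open>\<epsilon>\<close> in the square of radius \<open>\<rho>\<close> around \<open>(q, p)\<close> have total weight \<open>\<nu>\<close>.\<close>

definition isolated :: "real \<Rightarrow> real \<Rightarrow> real \<Rightarrow> real \<Rightarrow> real \<Rightarrow> bool" where
  "isolated \<epsilon> q p \<rho> \<nu> \<longleftrightarrow>
     (\<exists>l r l' r'. admissible \<epsilon> l r l' r' \<nu> \<and> q - \<rho> \<le> l \<and> r \<le> q + \<rho> \<and> p - \<rho> \<le> l' \<and> r' \<le> p + \<rho> \<and>
       (\<forall>t t'. chord \<epsilon> t t' \<longrightarrow> \<bar>t - q\<bar> \<le> \<rho> \<longrightarrow> \<bar>t' - p\<bar> \<le> \<rho> \<longrightarrow> l < t \<and> t < r \<and> l' < t' \<and> t' < r')) \<or>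
     \<nu> = 0 \<and> (\<forall>t t'. chord \<epsilon> t t' \<longrightarrow> \<bar>t - q\<bar> \<le> \<rho> \<longrightarrow> \<not> \<bar>t' - p\<bar> \<le> \<rho>)"

lemma near_less:
  fixes f :: "real \<Rightarrow> real"
  assumes "isCont f t" "f t < b"
  obtains r where "r > 0" "\<And>s. \<bar>s - t\<bar> \<le> r \<Longrightarrow> f s < b"
proof -
  have "\<forall>\<^sub>F s in nhds t. f s < b"
    using assms by (metis isCont_def order_tendsto_iff tendsto_at_iff_tendsto_nhds)
  then obtain d where "d > 0" "\<And>s. dist s t < d \<Longrightarrow> f s < b" by (auto simp: eventually_nhds_metric)
  then show ?thesis by (intro that[of "d / 2"]) (auto simp: dist_real_def)
qed

lemma isCont_D: "isCont (\<lambda>t. D t $ i) t" and isCont_V: "isCont (\<lambda>t. V t $ i) t"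
  using continuous_D_component[of UNIV i] continuous_V_component[of UNIV i] by (auto simp: continuous_on_eq_continuous_at)

lemma admissibleI:
  assumes "l < r" "l' < r'" "s1 = 1 \<or> s1 = - 1" "s2 = 1 \<or> s2 = - 1"
    and "\<And>t t'. t \<in> {l..r} \<Longrightarrow> t' \<in> {l'..r'} \<Longrightarrow> D t' $ 2 < D t $ 2"
    and "\<And>t. t \<in> {l..r} \<Longrightarrow> s1 * (D l' $ 1 - D t $ 1) < 0" "\<And>t. t \<in> {l..r} \<Longrightarrow> 0 < s1 * (D r' $ 1 - D t $ 1)"
    and "\<And>t'. t' \<in> {l'..r'} \<Longrightarrow> D t' $ 1 = D l $ 1 \<Longrightarrow> 0 < s2 * (D t' $ 3 - D l $ 3 - \<epsilon>)"
    and "\<And>t'. t' \<in> {l'..r'} \<Longrightarrow> D t' $ 1 = D r $ 1 \<Longrightarrow> s2 * (D t' $ 3 - D r $ 3 - \<epsilon>) < 0"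
  shows "admissible \<epsilon> l r l' r' (s1 * s2)"
  unfolding admissible_def
  by (intro conjI ballI assms; (rule exI[of _ s1], rule exI[of _ s2], intro conjI ballI impI HOL.refl assms)?)

text \<open>At a transverse crossing the displacement has a nonzero Jacobian whose sign is that of
  the crossing, so one chord persists for small \<open>\<epsilon>\<close>. Here \<open>t\<close>
  runs near \<open>q\<close> because \<open>t'\<close> must have the smaller slope.\<close>

lemma crossing_isolated:
  assumes "over p q"
  obtains \<rho>0 where "\<rho>0 > 0" "\<And>\<rho>. 0 < \<rho> \<Longrightarrow> \<rho> \<le> \<rho>0 \<Longrightarrow>
    \<exists>e>0. \<forall>\<epsilon>. \<bar>\<epsilon>\<bar> < e \<longrightarrow> isolated \<epsilon> q p \<rho> (crossing_sign D (p, q))"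
proof -
  have reg: "V p $ 1 \<noteq> 0" "V q $ 1 \<noteq> 0" and y: "D p $ 2 < D q $ 2" and pq: "D p $ 1 = D q $ 1" "D p $ 3 = D q $ 3"
    using assms over_regular[OF assms] by (auto simp: over_def front_eq_iff)
  define s1 s2 where "s1 = sgn (V p $ 1)" and "s2 = sgn (V q $ 1)"
  have s: "s1 = 1 \<or> s1 = - 1" "s2 = 1 \<or> s2 = - 1" using reg by (auto simp: s1_def s2_def sgn_if)
  have sign: "crossing_sign D (p, q) = s1 * s2" by (simp add: crossing_sign_over[OF assms] s1_def s2_def sgn_mult)
  define m where "m = (D p $ 2 + D q $ 2) / 2"
  have sp: "- (s1 * V p $ 1) < 0" "- (s2 * V q $ 1) < 0" using reg by (auto simp: s1_def s2_def sgn_if)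
  have my: "D p $ 2 < m" "- D q $ 2 < - m" using y by (auto simp: m_def)
  obtain r1 where r1: "r1 > 0" "\<And>t'. \<bar>t' - p\<bar> \<le> r1 \<Longrightarrow> D t' $ 2 < m"
    using near_less[OF isCont_D my(1)] by blast
  obtain r2 where r2: "r2 > 0" "\<And>t. \<bar>t - q\<bar> \<le> r2 \<Longrightarrow> - D t $ 2 < - m"
    by (rule near_less[where f = "\<lambda>t. - D t $ 2" and t = q, OF _ my(2)]) (auto intro!: continuous_intros isCont_D)
  obtain r3 where r3: "r3 > 0" "\<And>t'. \<bar>t' - p\<bar> \<le> r3 \<Longrightarrow> - (s1 * V t' $ 1) < 0"
    by (rule near_less[where f = "\<lambda>t. - (s1 * V t $ 1)" and t = p, OF _ sp(1)]) (auto intro!: continuous_intros isCont_V)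
  obtain r4 where r4: "r4 > 0" "\<And>t. \<bar>t - q\<bar> \<le> r4 \<Longrightarrow> - (s2 * V t $ 1) < 0"
    by (rule near_less[where f = "\<lambda>t. - (s2 * V t $ 1)" and t = q, OF _ sp(2)]) (auto intro!: continuous_intros isCont_V)
  define \<rho>0 where "\<rho>0 = Min {r1, r2, r3, r4}"
  have \<rho>0: "\<rho>0 > 0" "\<rho>0 \<le> r1" "\<rho>0 \<le> r2" "\<rho>0 \<le> r3" "\<rho>0 \<le> r4" using r1 r2 r3 r4 by (auto simp: \<rho>0_def)
  have ylt: "D t' $ 2 < D t $ 2" if "\<bar>t - q\<bar> \<le> \<rho>0" "\<bar>t' - p\<bar> \<le> \<rho>0" for t t'
    using r1(2)[of t'] r2(2)[of t] that \<rho>0 by linarith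
  have V1: "0 < s1 * V t' $ 1" if "\<bar>t' - p\<bar> \<le> \<rho>0" for t' using r3(2)[of t'] that \<rho>0 by linarith
  have V2: "0 < s2 * V t $ 1" if "\<bar>t - q\<bar> \<le> \<rho>0" for t using r4(2)[of t] that \<rho>0 by linarith
  have inc1: "s1 * D a $ 1 < s1 * D b $ 1" if "a < b" "\<bar>a - p\<bar> \<le> \<rho>0" "\<bar>b - p\<bar> \<le> \<rho>0" for a b
  proof (rule DERIV_pos_imp_increasing[OF that(1)])
    fix x assume "a \<le> x" "x \<le> b"
    then show "\<exists>y. ((\<lambda>t. s1 * D t $ 1) has_real_derivative y) (at x) \<and> 0 < y"
      using V1[of x] that DERIV_cmult[OF D_component_derivative] by (intro exI[of _ "s1 * V x $ 1"]) auto
  qed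
  have inc2: "s2 * D a $ 1 < s2 * D b $ 1" if "a < b" "\<bar>a - q\<bar> \<le> \<rho>0" "\<bar>b - q\<bar> \<le> \<rho>0" for a b
  proof (rule DERIV_pos_imp_increasing[OF that(1)])
    fix x assume "a \<le> x" "x \<le> b"
    then show "\<exists>y. ((\<lambda>t. s2 * D t $ 1) has_real_derivative y) (at x) \<and> 0 < y"
      using V2[of x] that DERIV_cmult[OF D_component_derivative] by (intro exI[of _ "s2 * V x $ 1"]) auto
  qed
  \<comment> \<open>Both branches start at the crossing, and all slopes near \<open>p\<close> are
    smaller than those near \<open>q\<close>.\<close>
  have slope: "\<exists>k<0. D t' $ 3 - D t $ 3 = k * (D t $ 1 - D q $ 1)"
    if t: "\<bar>t - q\<bar> \<le> \<rho>0" "\<bar>t' - p\<bar> \<le> \<rho>0" "D t' $ 1 = D t $ 1" "t \<noteq> q" for t t'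
  proof -
    have "D t $ 1 \<noteq> D q $ 1" using inc2[of t q] inc2[of q t] t \<rho>0(1) by (metis abs_0 diff_self less_imp_le less_irrefl linorder_cases)
    then have "t' \<noteq> p" using t(3) pq by auto
    obtain \<xi> where \<xi>: "\<xi> \<in> open_segment t q" "D t $ 3 - D q $ 3 = D \<xi> $ 2 * (D t $ 1 - D q $ 1)"
    proof (rule front_slope[OF t(4)])
      fix r assume "r \<in> open_segment t q"
      then have "\<bar>r - q\<bar> \<le> \<rho>0" using t(1) by (auto simp: open_segment_eq_real_ivl split: if_splits)
      then show "V r $ 1 \<noteq> 0" using V2[of r] by auto
    qed
    obtain \<xi>' where \<xi>': "\<xi>' \<in> open_segment t' p" "D t' $ 3 - D p $ 3 = D \<xi>' $ 2 * (D t' $ 1 - D p $ 1)"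
    proof (rule front_slope[OF \<open>t' \<noteq> p\<close>])
      fix r assume "r \<in> open_segment t' p"
      then have "\<bar>r - p\<bar> \<le> \<rho>0" using t(2) by (auto simp: open_segment_eq_real_ivl split: if_splits)
      then show "V r $ 1 \<noteq> 0" using V1[of r] by auto
    qed
    have "D \<xi>' $ 2 < D \<xi> $ 2"
      using \<xi>(1) \<xi>'(1) t(1,2) by (intro ylt) (auto simp: open_segment_eq_real_ivl split: if_splits)
    moreover have "D t' $ 3 - D t $ 3 = (D \<xi>' $ 2 - D \<xi> $ 2) * (D t $ 1 - D q $ 1)"
      using \<xi>(2) \<xi>'(2) pq t(3) by (simp add: algebra_simps)
    ultimately show ?thesis by (intro exI[of _ "D \<xi>' $ 2 - D \<xi> $ 2"]) simp
  qed
  show ?thesis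
  proof (rule that[OF \<rho>0(1)])
    fix \<rho> assume \<rho>: "0 < \<rho>" "\<rho> \<le> \<rho>0"
    have c: "s1 * (D (p - \<rho>) $ 1 - D q $ 1) < 0" "0 < s1 * (D (p + \<rho>) $ 1 - D q $ 1)"
      using inc1[of "p - \<rho>" p] inc1[of p "p + \<rho>"] \<rho> pq by (auto simp: right_diff_distrib)
    \<comment> \<open>The \<open>t\<close>-side is shortened until its \<open>x\<close>-values lie
      strictly between those at the ends \<open>p - \<rho>\<close> and \<open>p + \<rho>\<close> of
      the other side.\<close>
    obtain r5 where r5: "r5 > 0" "\<And>t. \<bar>t - q\<bar> \<le> r5 \<Longrightarrow> s1 * (D (p - \<rho>) $ 1 - D t $ 1) < 0"
      by (rule near_less[where f = "\<lambda>t. s1 * (D (p - \<rho>) $ 1 - D t $ 1)" and t = q, OF _ c(1)]) (auto intro!: continuous_intros isCont_D)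
    have c': "- (s1 * (D (p + \<rho>) $ 1 - D q $ 1)) < 0" using c(2) by simp
    obtain r6 where r6: "r6 > 0" "\<And>t. \<bar>t - q\<bar> \<le> r6 \<Longrightarrow> - (s1 * (D (p + \<rho>) $ 1 - D t $ 1)) < 0"
      by (rule near_less[where f = "\<lambda>t. - (s1 * (D (p + \<rho>) $ 1 - D t $ 1))" and t = q, OF _ c']) (auto intro!: continuous_intros isCont_D)
    define \<rho>1 where "\<rho>1 = Min {\<rho>, r5, r6}"
    have \<rho>1: "\<rho>1 > 0" "\<rho>1 \<le> \<rho>" "\<rho>1 \<le> r5" "\<rho>1 \<le> r6" using \<rho> r5 r6 by (auto simp: \<rho>1_def)
    let ?J = "{p - \<rho>..p + \<rho>}"
    \<comment> \<open>The closed square minus the open rectangle; without chords at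
      \<open>\<epsilon> = 0\<close>, it stays without chords for small
      \<open>\<epsilon>\<close>.\<close>
    let ?K = "{q - \<rho>..q + \<rho>} \<times> ?J - {q - \<rho>1<..<q + \<rho>1} \<times> {p - \<rho><..<p + \<rho>}"
    have xl: "s2 * (D (q - \<rho>1) $ 1 - D q $ 1) < 0" and xr: "0 < s2 * (D (q + \<rho>1) $ 1 - D q $ 1)"
      using inc2[of "q - \<rho>1" q] inc2[of q "q + \<rho>1"] \<rho>1 \<rho> by (auto simp: right_diff_distrib)
    obtain e1 where e1: "e1 > 0" "\<And>\<epsilon> t'. \<bar>\<epsilon>\<bar> < e1 \<Longrightarrow> t' \<in> ?J \<Longrightarrow> D t' $ 1 = D (q - \<rho>1) $ 1 \<Longrightarrow> 0 < s2 * (D t' $ 3 - D (q - \<rho>1) $ 3 - \<epsilon>)"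
    proof (rule edge_persists[of ?J "q - \<rho>1" s2])
      fix t' assume t': "t' \<in> ?J" "D t' $ 1 = D (q - \<rho>1) $ 1"
      obtain k where k: "k < 0" "D t' $ 3 - D (q - \<rho>1) $ 3 = k * (D (q - \<rho>1) $ 1 - D q $ 1)"
        using slope[of "q - \<rho>1" t'] t' \<rho>1 \<rho> by (smt (verit) atLeastAtMost_iff)
      have "0 < k * (s2 * (D (q - \<rho>1) $ 1 - D q $ 1))" using k(1) xl by (rule mult_neg_neg)
      then show "0 < s2 * (D t' $ 3 - D (q - \<rho>1) $ 3)" unfolding k(2) by (simp add: mult_ac)
    qed (use s in auto)
    obtain e2 where e2: "e2 > 0" "\<And>\<epsilon> t'. \<bar>\<epsilon>\<bar> < e2 \<Longrightarrow> t' \<in> ?J \<Longrightarrow> D t' $ 1 = D (q + \<rho>1) $ 1 \<Longrightarrow> 0 < - s2 * (D t' $ 3 - D (q + \<rho>1) $ 3 - \<epsilon>)"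
    proof (rule edge_persists[of ?J "q + \<rho>1" "- s2"])
      fix t' assume t': "t' \<in> ?J" "D t' $ 1 = D (q + \<rho>1) $ 1"
      obtain k where k: "k < 0" "D t' $ 3 - D (q + \<rho>1) $ 3 = k * (D (q + \<rho>1) $ 1 - D q $ 1)"
        using slope[of "q + \<rho>1" t'] t' \<rho>1 \<rho> by (smt (verit) atLeastAtMost_iff)
      have "k * (s2 * (D (q + \<rho>1) $ 1 - D q $ 1)) < 0" using k(1) xr by (rule mult_neg_pos)
      then show "0 < - s2 * (D t' $ 3 - D (q + \<rho>1) $ 3)" unfolding k(2) by (simp add: mult_ac)
    qed (use s in auto)
    obtain e3 where e3: "e3 > 0" "\<And>\<epsilon> t t'. \<bar>\<epsilon>\<bar> < e3 \<Longrightarrow> (t, t') \<in> ?K \<Longrightarrow> \<not> chord \<epsilon> t t'"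
    proof (rule chord_free_persists[of ?K])
      show "compact ?K" by (intro compact_diff compact_Times compact_Icc open_Times open_greaterThanLessThan)
      fix t t' assume K: "(t, t') \<in> ?K"
      show "\<not> chord 0 t t'"
      proof
        assume ch: "chord 0 t t'"
        have b: "\<bar>t - q\<bar> \<le> \<rho>0" "\<bar>t' - p\<bar> \<le> \<rho>0" "D t' $ 1 = D t $ 1" using K \<rho> ch by (auto simp: chord_def)
        show False
        proof (cases "t = q")
          case True
          then have "t' = p" using inc1[of t' p] inc1[of p t'] b pq \<rho>0(1) by (cases t' p rule: linorder_cases) auto
          then show False using True K \<rho> \<rho>1 by auto
        next
          case False
          then obtain k where k: "k < 0" "D t' $ 3 - D t $ 3 = k * (D t $ 1 - D q $ 1)" using slope b by blast
          moreover have "D t' $ 3 - D t $ 3 = 0" using ch by (simp add: chord_def)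
          ultimately have "D t $ 1 = D q $ 1" by simp
          then show False using inc2[of t q] inc2[of q t] b False \<rho>0(1) by (cases t q rule: linorder_cases) auto
        qed
      qed
    qed auto
    have "isolated \<epsilon> q p \<rho> (crossing_sign D (p, q))" if \<epsilon>: "\<bar>\<epsilon>\<bar> < Min {e1, e2, e3}" for \<epsilon>
    proof -
      have \<epsilon>': "\<bar>\<epsilon>\<bar> < e1" "\<bar>\<epsilon>\<bar> < e2" "\<bar>\<epsilon>\<bar> < e3" using \<epsilon> by auto
      have "admissible \<epsilon> (q - \<rho>1) (q + \<rho>1) (p - \<rho>) (p + \<rho>) (crossing_sign D (p, q))"
        unfolding admissible_def
      proof (intro conjI ballI exI impI)
        show "s1 * (D (p - \<rho>) $ 1 - D t $ 1) < 0" "0 < s1 * (D (p + \<rho>) $ 1 - D t $ 1)"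
          if "t \<in> {q - \<rho>1..q + \<rho>1}" for t
          using r5(2)[of t] r6(2)[of t] that \<rho>1 by auto
        show "s2 * (D t' $ 3 - D (q + \<rho>1) $ 3 - \<epsilon>) < 0" if "t' \<in> ?J" "D t' $ 1 = D (q + \<rho>1) $ 1" for t'
          using e2(2)[OF \<epsilon>'(2) that] by simp
        show "D t' $ 2 < D t $ 2" if "t \<in> {q - \<rho>1..q + \<rho>1}" "t' \<in> ?J" for t t'
          using that \<rho> \<rho>1 by (intro ylt) auto
      qed (use s sign \<rho> \<rho>1 e1(2)[OF \<epsilon>'(1)] in auto)
      moreover have "q - \<rho>1 < t \<and> t < q + \<rho>1 \<and> p - \<rho> < t' \<and> t' < p + \<rho>"
        if "chord \<epsilon> t t'" "\<bar>t - q\<bar> \<le> \<rho>" "\<bar>t' - p\<bar> \<le> \<rho>" for t t'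
        using e3(2)[OF \<epsilon>'(3), of t t'] that by force
      ultimately show ?thesis
        unfolding isolated_def using \<rho>1 by (intro disjI1 exI[of _ "q - \<rho>1"] exI[of _ "q + \<rho>1"] exI[of _ "p - \<rho>"] exI[of _ "p + \<rho>"]) auto
    qed
    then show "\<exists>e>0. \<forall>\<epsilon>. \<bar>\<epsilon>\<bar> < e \<longrightarrow> isolated \<epsilon> q p \<rho> (crossing_sign D (p, q))"
      using e1(1) e2(1) e3(1) by (intro exI[of _ "Min {e1, e2, e3}"]) auto
  qed
qed

lemma cusp_between:
  assumes "D s $ 1 = D t $ 1" "s \<noteq> t"
  shows "\<exists>z. min s t < z \<and> z < max s t \<and> cusp z"
proof (rule ccontr)
  assume n: "\<not> ?thesis"
  have "min s t = max s t"
  proof (rule x_inj)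
    show "\<not> cusp z" if "min s t < z" "z < max s t" for z using n that by blast
  qed (use assms(1) in \<open>simp_all add: min_def max_def\<close>)
  then show False using assms(2) by (simp add: min_def max_def split: if_splits)
qed

text \<open>The branch that is in front at a cusp passes on one side of the other branch only, so a short
  chord appears for exactly one sign of \<open>\<epsilon>\<close>.\<close>

lemma cusp_isolated:
  assumes "cusp c"
  obtains \<kappa> \<rho>0 :: real where "\<kappa> = 1 \<or> \<kappa> = - 1" "\<rho>0 > 0" "\<And>\<rho>. 0 < \<rho> \<Longrightarrow> \<rho> \<le> \<rho>0 \<Longrightarrow>
    \<exists>e>0. \<forall>\<epsilon>. \<epsilon> \<noteq> 0 \<longrightarrow> \<bar>\<epsilon>\<bar> < e \<longrightarrow> isolated \<epsilon> c c \<rho> (if \<kappa> * \<epsilon> < 0 then - 1 else 0)"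
proof -
  obtain d e where d: "d \<noteq> 0" "e > 0"
    "\<And>t. 0 < \<bar>t - c\<bar> \<Longrightarrow> \<bar>t - c\<bar> < e \<Longrightarrow> 0 < d * (D t $ 1 - D c $ 1) \<and> 0 < d * (t - c) * V t $ 1"
    using cusp_side[OF assms] by blast
  define \<kappa> where "\<kappa> = sgn d"
  have \<kappa>: "\<kappa> = 1 \<or> \<kappa> = - 1" using d(1) by (auto simp: \<kappa>_def sgn_if)
  define \<tau> where "\<tau> = sgn (V c $ 2)"
  have \<tau>: "\<tau> = 1 \<or> \<tau> = - 1" using V2_nonzero[OF assms] by (auto simp: \<tau>_def sgn_if)
  have V2: "- (\<tau> * V c $ 2) < 0" using V2_nonzero[OF assms] by (auto simp: \<tau>_def sgn_if)
  obtain r1 where r1: "r1 > 0" "\<And>t. \<bar>t - c\<bar> \<le> r1 \<Longrightarrow> - (\<tau> * V t $ 2) < 0"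
    by (rule near_less[where f = "\<lambda>t. - (\<tau> * V t $ 2)" and t = c, OF _ V2]) (auto intro!: continuous_intros isCont_V)
  obtain r2 where r2: "r2 > 0" "\<And>t. \<bar>t - c\<bar> \<le> r2 \<Longrightarrow> \<bar>D t $ 2 - D c $ 2\<bar> < 1"
    by (rule near_less[where f = "\<lambda>t. \<bar>D t $ 2 - D c $ 2\<bar>" and t = c and b = 1]) (auto intro!: continuous_intros isCont_D)
  define \<rho>0 where "\<rho>0 = Min {r1, r2, e / 2}"
  have \<rho>0: "\<rho>0 > 0" "\<rho>0 \<le> r1" "\<rho>0 \<le> r2" "\<rho>0 < e" using r1 r2 d(2) by (auto simp: \<rho>0_def)
  have x: "0 < \<kappa> * (D t $ 1 - D c $ 1)" if "\<bar>t - c\<bar> \<le> \<rho>0" "t \<noteq> c" for t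
  proof -
    have "0 < d * (D t $ 1 - D c $ 1)" using d(3)[of t] that \<rho>0 by simp
    then show ?thesis by (auto simp: \<kappa>_def sgn_if zero_less_mult_iff)
  qed
  have regular: "\<not> cusp t" if "\<bar>t - c\<bar> \<le> \<rho>0" "t \<noteq> c" for t
    using d(3)[of t] that \<rho>0 by auto
  have y: "0 < \<tau> * (D b $ 2 - D a $ 2)" if "a < b" "\<bar>a - c\<bar> \<le> \<rho>0" "\<bar>b - c\<bar> \<le> \<rho>0" for a b
  proof -
    obtain z where z: "a < z" "z < b" "D b $ 2 - D a $ 2 = (b - a) * V z $ 2"
      using MVT2[OF \<open>a < b\<close>, of "\<lambda>t. D t $ 2" "\<lambda>t. V t $ 2"] D_component_derivative by blast
    then have "0 < \<tau> * V z $ 2" using r1(2)[of z] that \<rho>0 by auto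
    then have "0 < (b - a) * (\<tau> * V z $ 2)" using that(1) by simp
    then show ?thesis unfolding z(3) by (simp add: mult_ac)
  qed
  \<comment> \<open>\<open>u\<close> is the direction of the parameter in which \<open>y\<close>
    decreases near the cusp, so a chord starts before \<open>c\<close> and ends after
    \<open>c\<close> in this direction.\<close>
  define u where "u = - \<tau>"
  have u: "u = 1 \<or> u = - 1" "\<tau> = - u" using \<tau> by (auto simp: u_def)
  have ylt: "D t' $ 2 < D t $ 2" if "0 < u * (t' - t)" "\<bar>t - c\<bar> \<le> \<rho>0" "\<bar>t' - c\<bar> \<le> \<rho>0" for t t'
    using u(1)
  proof
    assume "u = 1" then show ?thesis using y[of t t'] that u(2) by simp
  next
    assume "u = - 1" then show ?thesis using y[of t' t] that u(2) by simp
  qed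
  \<comment> \<open>\<open>k\<close> is a difference of slopes on the two arcs, negative by the
    choice of \<open>u\<close>; the bound 2 comes from the bound 1 in \<open>r2\<close>.\<close>
  have slope: "\<exists>k<0. \<bar>k\<bar> \<le> 2 \<and> D t' $ 3 - D t $ 3 = k * (D t $ 1 - D c $ 1)"
    if t: "\<bar>t - c\<bar> \<le> \<rho>0" "\<bar>t' - c\<bar> \<le> \<rho>0" "D t' $ 1 = D t $ 1" "0 < u * (c - t)" "0 < u * (t' - c)" for t t'
  proof -
    have ne: "t \<noteq> c" "t' \<noteq> c" using t(4,5) by auto
    have seg: "\<bar>r - c\<bar> \<le> \<rho>0" "r \<noteq> c" "0 < (s - c) * (r - c)" if "r \<in> open_segment s c" "\<bar>s - c\<bar> \<le> \<rho>0" for r s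
      using that by (auto simp: open_segment_eq_real_ivl zero_less_mult_iff split: if_splits)
    obtain \<xi> where \<xi>: "\<xi> \<in> open_segment t c" "D t $ 3 - D c $ 3 = D \<xi> $ 2 * (D t $ 1 - D c $ 1)"
    proof (rule front_slope[OF ne(1)])
      show "V r $ 1 \<noteq> 0" if "r \<in> open_segment t c" for r using regular seg(1,2)[OF that t(1)] by blast
    qed
    obtain \<xi>' where \<xi>': "\<xi>' \<in> open_segment t' c" "D t' $ 3 - D c $ 3 = D \<xi>' $ 2 * (D t' $ 1 - D c $ 1)"
    proof (rule front_slope[OF ne(2)])
      show "V r $ 1 \<noteq> 0" if "r \<in> open_segment t' c" for r using regular seg(1,2)[OF that t(2)] by blast
    qed
    note s = seg[OF \<xi>(1) t(1)] seg[OF \<xi>'(1) t(2)]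
    have "0 < u * (\<xi>' - \<xi>)"
      using u(1) s(3,6) t(4,5) by (auto simp: zero_less_mult_iff)
    then have "D \<xi>' $ 2 < D \<xi> $ 2" using s by (intro ylt)
    moreover have "\<bar>D \<xi>' $ 2 - D \<xi> $ 2\<bar> \<le> 2"
      using r2(2)[of \<xi>] r2(2)[of \<xi>'] s \<rho>0 by linarith
    moreover have "D t' $ 3 - D t $ 3 = (D \<xi>' $ 2 - D \<xi> $ 2) * (D t $ 1 - D c $ 1)"
      using \<xi>(2) \<xi>'(2) t(3) by (simp add: algebra_simps)
    ultimately show ?thesis by (intro exI[of _ "D \<xi>' $ 2 - D \<xi> $ 2"]) simp
  qed
  \<comment> \<open>Equal \<open>x\<close> at different parameters forces a cusp in between, and
    \<open>c\<close> is the only one nearby.\<close>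
  have chord: "0 < u * (c - t) \<and> 0 < u * (t' - c)" if ch: "chord \<epsilon> t t'" "\<epsilon> \<noteq> 0" and t: "\<bar>t - c\<bar> \<le> \<rho>0" "\<bar>t' - c\<bar> \<le> \<rho>0" for \<epsilon> t t'
  proof -
    have "t \<noteq> t'" using ch by (auto simp: chord_def)
    have "\<not> 0 < u * (t - t')" using ylt[of t t'] t ch by (auto simp: chord_def)
    then have lt: "0 < u * (t' - t)" using u(1) \<open>t \<noteq> t'\<close> by auto
    obtain z where z: "min t t' < z" "z < max t t'" "cusp z"
      using cusp_between[of t t'] ch(1) \<open>t \<noteq> t'\<close> unfolding chord_def by metis
    then have "\<bar>z - c\<bar> \<le> \<rho>0" using t by auto
    then have "z = c" using regular z(3) by blast
    then show ?thesis using z(1,2) lt u(1) by (auto simp: min_def max_def split: if_splits)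
  qed
  show ?thesis
  proof (rule that[OF \<kappa> \<rho>0(1)])
    fix \<rho> assume \<rho>: "0 < \<rho>" "\<rho> \<le> \<rho>0"
    define B where "B = c + u * \<rho>"
    have B: "\<bar>B - c\<bar> = \<rho>" "u * (B - c) = \<rho>" using u(1) \<rho>(1) by (auto simp: B_def)
    have xB: "\<kappa> * (D c $ 1 - D B $ 1) < 0" using x[of B] B \<rho> by (auto simp: right_diff_distrib)
    obtain r3 where r3: "r3 > 0" "\<And>t. \<bar>t - c\<bar> \<le> r3 \<Longrightarrow> \<kappa> * (D t $ 1 - D B $ 1) < 0"
      by (rule near_less[where f = "\<lambda>t. \<kappa> * (D t $ 1 - D B $ 1)" and t = c, OF _ xB]) (auto intro!: continuous_intros isCont_D)
    \<comment> \<open>Before \<open>c\<close> only parameters are kept whose \<open>x\<close> stays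
      short of that of the outer end \<open>B\<close>, so the edge \<open>t' = B\<close> meets no
      chord.\<close>
    define \<alpha>1 where "\<alpha>1 = min \<rho> r3"
    have \<alpha>1: "0 < \<alpha>1" "\<alpha>1 \<le> \<rho>" "\<alpha>1 \<le> r3" using \<rho> r3(1) by (auto simp: \<alpha>1_def)
    define A1 where "A1 = c - u * \<alpha>1"
    have A1: "\<bar>A1 - c\<bar> = \<alpha>1" "u * (c - A1) = \<alpha>1" using u(1) \<alpha>1(1) by (auto simp: A1_def)
    have T': "0 < u * (t' - c)" "\<bar>t' - c\<bar> \<le> \<rho>0" if "t' \<in> closed_segment c B" "t' \<noteq> c" for t'
      using that u(1) \<rho> by (auto simp: B_def closed_segment_eq_real_ivl split: if_splits)
    obtain e1 where e1: "e1 > 0" "\<And>\<epsilon> t'. \<bar>\<epsilon>\<bar> < e1 \<Longrightarrow> t' \<in> closed_segment c B \<Longrightarrow> D t' $ 1 = D A1 $ 1 \<Longrightarrow>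
        0 < - \<kappa> * (D t' $ 3 - D A1 $ 3 - \<epsilon>)"
    proof (rule edge_persists[of "closed_segment c B" A1 "- \<kappa>"])
      fix t' assume t': "t' \<in> closed_segment c B" "D t' $ 1 = D A1 $ 1"
      have xA: "0 < \<kappa> * (D A1 $ 1 - D c $ 1)" using x[of A1] A1 \<alpha>1 \<rho> by auto
      then have "t' \<noteq> c" using t'(2) by auto
      obtain k where k: "k < 0" "D t' $ 3 - D A1 $ 3 = k * (D A1 $ 1 - D c $ 1)"
        using slope[of A1 t'] T'[OF t'(1) \<open>t' \<noteq> c\<close>] t'(2) A1 \<alpha>1 \<rho> by auto
      have "k * (\<kappa> * (D A1 $ 1 - D c $ 1)) < 0" using k(1) xA by (rule mult_neg_pos)
      then show "0 < - \<kappa> * (D t' $ 3 - D A1 $ 3)" unfolding k(2) by (simp add: mult_ac)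
    qed (use \<kappa> in auto)
    let ?K = "{(t, t'). \<alpha>1 \<le> u * (c - t) \<and> u * (c - t) \<le> \<rho> \<and> 0 \<le> u * (t' - c) \<and> u * (t' - c) \<le> \<rho>}"
    obtain e2 where e2: "e2 > 0" "\<And>\<epsilon> t t'. \<bar>\<epsilon>\<bar> < e2 \<Longrightarrow> (t, t') \<in> ?K \<Longrightarrow> \<not> chord \<epsilon> t t'"
    proof (rule chord_free_persists[of ?K])
      have "?K = ({c - \<rho>..c + \<rho>} \<inter> {t. \<alpha>1 \<le> u * (c - t)}) \<times> ({c - \<rho>..c + \<rho>} \<inter> {t'. 0 \<le> u * (t' - c)})"
        using u(1) \<alpha>1 by auto
      moreover have "compact \<dots>"
        by (intro compact_Times compact_Int_closed compact_Icc closed_Collect_le continuous_intros)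
      ultimately show "compact ?K" by simp
      fix t t' assume K: "(t, t') \<in> ?K"
      show "\<not> chord 0 t t'"
      proof
        assume ch: "chord 0 t t'"
        have b: "\<bar>t - c\<bar> \<le> \<rho>0" "\<bar>t' - c\<bar> \<le> \<rho>0" "0 < u * (c - t)" "D t' $ 1 = D t $ 1" "t \<noteq> c"
          using K \<rho> \<alpha>1 u(1) ch by (auto simp: chord_def)
        have xt: "D t $ 1 \<noteq> D c $ 1" using x[of t] b by auto
        then have "t' \<noteq> c" using b by auto
        then have "0 < u * (t' - c)" using K u(1) by auto
        then obtain k where "k < 0" "D t' $ 3 - D t $ 3 = k * (D t $ 1 - D c $ 1)" using slope b by blast
        then show False using xt ch by (auto simp: chord_def)
      qed
    qed auto
    have "isolated \<epsilon> c c \<rho> (if \<kappa> * \<epsilon> < 0 then - 1 else 0)" if \<epsilon>: "\<epsilon> \<noteq> 0" "\<bar>\<epsilon>\<bar> < min e1 e2" for \<epsilon>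
    proof (cases "\<kappa> * \<epsilon> < 0")
      case False
      \<comment> \<open>The height difference \<open>k * (D t $ 1 - D c $ 1)\<close> has the sign of
        \<open>- \<kappa>\<close> and cannot equal \<open>\<epsilon>\<close> here.\<close>
      have "\<not> chord \<epsilon> t t'" if b: "\<bar>t - c\<bar> \<le> \<rho>" "\<bar>t' - c\<bar> \<le> \<rho>" for t t'
      proof
        assume ch: "chord \<epsilon> t t'"
        have b': "\<bar>t - c\<bar> \<le> \<rho>0" "\<bar>t' - c\<bar> \<le> \<rho>0" using b \<rho> by auto
        have side: "0 < u * (c - t)" "0 < u * (t' - c)" using chord[OF ch \<epsilon>(1) b'] by auto
        then obtain k where k: "k < 0" "D t' $ 3 - D t $ 3 = k * (D t $ 1 - D c $ 1)"
          using slope[OF b'] ch by (auto simp: chord_def)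
        have "\<epsilon> = k * (D t $ 1 - D c $ 1)" using k(2) ch by (simp add: chord_def)
        moreover have "t \<noteq> c" using side(1) by auto
        then have "0 < \<kappa> * (D t $ 1 - D c $ 1)" using x[of t] b'(1) by simp
        then have "k * (\<kappa> * (D t $ 1 - D c $ 1)) < 0" using k(1) by (simp add: mult_neg_pos)
        ultimately show False using False by (simp add: mult_ac)
      qed
      then show ?thesis using False unfolding isolated_def by auto
    next
      case True
      have "2 * \<bar>D c $ 1 - D c $ 1\<bar> < \<bar>\<epsilon>\<bar>" using \<epsilon>(1) by simp
      \<comment> \<open>Near the tip height differences are at most twice the
        \<open>x\<close>-distance, hence below the size of \<open>\<epsilon>\<close>; the inner end
        \<open>A2\<close> is placed in this zone.\<close>
      then obtain r4 where r4: "r4 > 0" "\<And>t. \<bar>t - c\<bar> \<le> r4 \<Longrightarrow> 2 * \<bar>D t $ 1 - D c $ 1\<bar> < \<bar>\<epsilon>\<bar>"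
        by (rule near_less[where f = "\<lambda>t. 2 * \<bar>D t $ 1 - D c $ 1\<bar>" and t = c, rotated]) (auto intro!: continuous_intros isCont_D)
      define \<alpha>2 where "\<alpha>2 = min (\<alpha>1 / 2) r4"
      have \<alpha>2: "0 < \<alpha>2" "\<alpha>2 < \<alpha>1" "\<alpha>2 \<le> r4" using \<alpha>1 r4(1) by (auto simp: \<alpha>2_def)
      define A2 where "A2 = c - u * \<alpha>2"
      have A2: "\<bar>A2 - c\<bar> = \<alpha>2" "u * (c - A2) = \<alpha>2" using u(1) \<alpha>2(1) by (auto simp: A2_def)
      have T: "\<alpha>2 \<le> u * (c - t)" "u * (c - t) \<le> \<alpha>1" "\<bar>t - c\<bar> \<le> \<alpha>1" if "t \<in> closed_segment A1 A2" for t
        using that u(1) \<alpha>2 by (auto simp: A1_def A2_def closed_segment_eq_real_ivl split: if_splits)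
      have E0: "D t' $ 2 < D t $ 2" if "t \<in> closed_segment A1 A2" "t' \<in> closed_segment c B" for t t'
      proof (rule ylt)
        show "\<bar>t' - c\<bar> \<le> \<rho>0" using T'(2)[OF that(2)] \<rho>0(1) by (cases "t' = c") auto
        have "0 \<le> u * (t' - c)" using T'(1)[OF that(2)] by (cases "t' = c") auto
        then show "0 < u * (t' - t)" using T(1)[OF that(1)] \<alpha>2(1) by (simp add: right_diff_distrib)
        show "\<bar>t - c\<bar> \<le> \<rho>0" using T(3)[OF that(1)] \<alpha>1 \<rho> by simp
      qed
      have E1: "\<kappa> * (D c $ 1 - D t $ 1) < 0" "0 < \<kappa> * (D B $ 1 - D t $ 1)" if "t \<in> closed_segment A1 A2" for t
      proof -
        have "\<bar>t - c\<bar> \<le> \<rho>0" "t \<noteq> c" using T[OF that] \<alpha>1 \<alpha>2 \<rho> by auto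
        from x[OF this] show "\<kappa> * (D c $ 1 - D t $ 1) < 0" by (simp add: right_diff_distrib)
        show "0 < \<kappa> * (D B $ 1 - D t $ 1)" using r3(2)[of t] T(3)[OF that] \<alpha>1 by (simp add: right_diff_distrib)
      qed
      have E2: "\<kappa> * (D t' $ 3 - D A1 $ 3 - \<epsilon>) < 0" if "t' \<in> closed_segment c B" "D t' $ 1 = D A1 $ 1" for t'
        using e1(2)[OF _ that, of \<epsilon>] \<epsilon>(2) by simp
      have small: "\<alpha>2 < u * (c - t)" if ch: "D t' $ 1 = D t $ 1" "\<bar>t - c\<bar> \<le> \<rho>" "\<bar>t' - c\<bar> \<le> \<rho>" "0 < u * (c - t)" "0 < u * (t' - c)"
          "\<bar>\<epsilon>\<bar> \<le> \<bar>D t' $ 3 - D t $ 3\<bar>" for t t'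
      proof (rule ccontr)
        assume "\<not> ?thesis"
        then have "\<bar>t - c\<bar> \<le> r4" using ch(4) u(1) \<alpha>2 by auto
        obtain k where k: "\<bar>k\<bar> \<le> 2" "D t' $ 3 - D t $ 3 = k * (D t $ 1 - D c $ 1)"
          using slope[of t t'] ch \<rho> by auto
        have "\<bar>D t' $ 3 - D t $ 3\<bar> = \<bar>k\<bar> * \<bar>D t $ 1 - D c $ 1\<bar>" unfolding k(2) by (rule abs_mult)
        also have "\<dots> \<le> 2 * \<bar>D t $ 1 - D c $ 1\<bar>" using k(1) by (rule mult_right_mono) simp
        also have "\<dots> < \<bar>\<epsilon>\<bar>" using r4(2) \<open>\<bar>t - c\<bar> \<le> r4\<close> by blast
        finally show False using ch(6) by simp
      qed
      have E3: "0 < \<kappa> * (D t' $ 3 - D A2 $ 3 - \<epsilon>)" if t': "t' \<in> closed_segment c B" "D t' $ 1 = D A2 $ 1" for t'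
      proof -
        have "t' \<noteq> c" using x[of A2] A2 \<alpha>2 \<alpha>1 \<rho> t'(2) by auto
        have "\<bar>t' - c\<bar> \<le> \<rho>" using t'(1) u(1) \<rho>(1) by (auto simp: B_def closed_segment_eq_real_ivl split: if_splits)
        then have "\<bar>D t' $ 3 - D A2 $ 3\<bar> < \<bar>\<epsilon>\<bar>"
          using small[of t' A2] t'(2) T'(1)[OF t'(1) \<open>t' \<noteq> c\<close>] A2 \<alpha>2 \<alpha>1 by force
        then show ?thesis using True \<kappa> by auto
      qed
      have chords: "\<alpha>2 < u * (c - t) \<and> u * (c - t) < \<alpha>1 \<and> 0 < u * (t' - c) \<and> u * (t' - c) < \<rho>"
        if ch: "chord \<epsilon> t t'" and b: "\<bar>t - c\<bar> \<le> \<rho>" "\<bar>t' - c\<bar> \<le> \<rho>" for t t'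
      proof -
        have b': "\<bar>t - c\<bar> \<le> \<rho>0" "\<bar>t' - c\<bar> \<le> \<rho>0" using b \<rho> by auto
        have side: "0 < u * (c - t)" "0 < u * (t' - c)" using chord[OF ch \<epsilon>(1) b'] by auto
        have 1: "\<alpha>2 < u * (c - t)" using small[of t' t] ch b side by (simp add: chord_def)
        have le: "u * (t' - c) \<le> \<rho>" "u * (c - t) \<le> \<rho>" using b u(1) by auto
        have 2: "u * (c - t) < \<alpha>1"
        proof (rule ccontr)
          assume "\<not> ?thesis"
          then have "(t, t') \<in> ?K" using le side by simp
          then show False using e2(2)[of \<epsilon> t t'] \<epsilon>(2) ch by simp
        qed
        have "u * (t' - c) \<noteq> \<rho>"
        proof
          assume "u * (t' - c) = \<rho>"
          then have "t' = B" using u(1) by (auto simp: B_def)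
          moreover have "\<bar>t - c\<bar> \<le> r3" using 2 side(1) u(1) \<alpha>1 by auto
          ultimately show False using r3(2)[of t] ch by (simp add: chord_def)
        qed
        with 1 2 le side show ?thesis by simp
      qed
      \<comment> \<open>The order of the interval ends depends on \<open>u\<close>, but in both
        cases the two signs are opposite, and their product is \<open>- 1\<close>.\<close>
      show ?thesis
        using u(1)
      proof
        assume u1: "u = 1"
        have seg: "closed_segment A1 A2 = {A1..A2}" "closed_segment c B = {c..B}" "A1 < A2" "c < B"
          using u1 \<alpha>2 \<rho> by (auto simp: A1_def A2_def B_def closed_segment_eq_real_ivl)
        have "admissible \<epsilon> A1 A2 c B (\<kappa> * (- \<kappa>))"
          by (rule admissibleI) (use seg E0 E1 E2 E3 \<kappa> in auto)
        moreover have "\<kappa> * (- \<kappa>) = - 1" using \<kappa> by auto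
        moreover have "A1 < t \<and> t < A2 \<and> c < t' \<and> t' < B" if "chord \<epsilon> t t'" "\<bar>t - c\<bar> \<le> \<rho>" "\<bar>t' - c\<bar> \<le> \<rho>" for t t'
          using chords[OF that] u1 by (auto simp: A1_def A2_def B_def)
        ultimately show ?thesis
          unfolding isolated_def using True u1 \<alpha>1 \<alpha>2 \<rho>
          by (intro disjI1 exI[of _ A1] exI[of _ A2] exI[of _ c] exI[of _ B]) (simp add: A1_def A2_def B_def)
      next
        assume u1: "u = - 1"
        have seg: "closed_segment A1 A2 = {A2..A1}" "closed_segment c B = {B..c}" "A2 < A1" "B < c"
          using u1 \<alpha>2 \<rho> by (auto simp: A1_def A2_def B_def closed_segment_eq_real_ivl)
        have "admissible \<epsilon> A2 A1 B c (- \<kappa> * \<kappa>)"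
          by (rule admissibleI) (use seg E0 E1 E2 E3 \<kappa> in auto)
        moreover have "- \<kappa> * \<kappa> = - 1" using \<kappa> by auto
        moreover have "A2 < t \<and> t < A1 \<and> B < t' \<and> t' < c" if "chord \<epsilon> t t'" "\<bar>t - c\<bar> \<le> \<rho>" "\<bar>t' - c\<bar> \<le> \<rho>" for t t'
          using chords[OF that] u1 by (auto simp: A1_def A2_def B_def)
        ultimately show ?thesis
          unfolding isolated_def using True u1 \<alpha>1 \<alpha>2 \<rho>
          by (intro disjI1 exI[of _ A2] exI[of _ A1] exI[of _ B] exI[of _ c]) (simp add: A1_def A2_def B_def)
      qed
    qed
    then show "\<exists>e>0. \<forall>\<epsilon>. \<epsilon> \<noteq> 0 \<longrightarrow> \<bar>\<epsilon>\<bar> < e \<longrightarrow> isolated \<epsilon> c c \<rho> (if \<kappa> * \<epsilon> < 0 then - 1 else 0)"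
      using e1(1) e2(1) by (intro exI[of _ "min e1 e2"]) auto
  qed
qed

end

context front_diagram
begin

text \<open>The squares around the centres are disjoint and catch all chords. A square without a
  rectangle has weight 0, so it can be left out of the sum.\<close>

lemma isolated_sum:
  assumes fin: "finite J" and "\<rho> > 0"
    and iso: "\<And>q p. (q, p) \<in> J \<Longrightarrow> isolated \<epsilon> q p \<rho> (w (q, p))"
    and inside: "\<And>q p. (q, p) \<in> J \<Longrightarrow> a \<le> q - \<rho> \<and> q + \<rho> \<le> a + 1 \<and> a \<le> p - \<rho> \<and> p + \<rho> \<le> a + 1"
    and disj: "\<And>q p q' p'. (q, p) \<in> J \<Longrightarrow> (q', p') \<in> J \<Longrightarrow> (q, p) \<noteq> (q', p') \<Longrightarrow> 2 * \<rho> < max \<bar>q - q'\<bar> \<bar>p - p'\<bar>"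
    and chords: "\<And>t t'. chord \<epsilon> t t' \<Longrightarrow> t \<in> {a..a+1} \<Longrightarrow> t' \<in> {a..a+1} \<Longrightarrow>
      \<exists>(q, p)\<in>J. \<bar>t - q\<bar> \<le> \<rho> \<and> \<bar>t' - p\<bar> \<le> \<rho>"
  shows "\<exists>\<delta>1>0. \<forall>\<delta>. 0 < \<delta> \<longrightarrow> \<delta> \<le> \<delta>1 \<longrightarrow> chord_integral a \<delta> \<epsilon> D = (\<Sum>c\<in>J. w c)"
proof -
  define rect where "rect c l r l' r' \<longleftrightarrow> admissible \<epsilon> l r l' r' (w c) \<and>
      fst c - \<rho> \<le> l \<and> r \<le> fst c + \<rho> \<and> snd c - \<rho> \<le> l' \<and> r' \<le> snd c + \<rho> \<and>
      (\<forall>t t'. chord \<epsilon> t t' \<longrightarrow> \<bar>t - fst c\<bar> \<le> \<rho> \<longrightarrow> \<bar>t' - snd c\<bar> \<le> \<rho> \<longrightarrow> l < t \<and> t < r \<and> l' < t' \<and> t' < r')" for c l r l' r'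
  define I where "I = {c\<in>J. \<exists>l r l' r'. rect c l r l' r'}"
  \<comment> \<open>The four bounds are packed into one function of an index, so that one
    application of choice yields all of them.\<close>
  have "\<forall>c\<in>I. \<exists>L. rect c (L 0) (L 1) (L 2) (L (3::nat))"
  proof
    fix c assume "c \<in> I"
    then obtain l r l' r' where "rect c l r l' r'" by (auto simp: I_def)
    then show "\<exists>L. rect c (L 0) (L 1) (L 2) (L (3::nat))"
      by (intro exI[of _ "(!) [l, r, l', r']"]) simp
  qed
  from bchoice[OF this] obtain L where L: "\<And>c. c \<in> I \<Longrightarrow> rect c (L c 0) (L c 1) (L c 2) (L c (3::nat))" by blast
  let ?l = "\<lambda>c. L c 0" and ?r = "\<lambda>c. L c 1" and ?l' = "\<lambda>c. L c 2" and ?r' = "\<lambda>c. L c 3"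
  have L': "admissible \<epsilon> (?l c) (?r c) (?l' c) (?r' c) (w c)"
      "fst c - \<rho> \<le> ?l c" "?r c \<le> fst c + \<rho>" "snd c - \<rho> \<le> ?l' c" "?r' c \<le> snd c + \<rho>" if "c \<in> I" for c
    using L[OF that] by (simp_all add: rect_def)
  have L_chord: "?l c < t \<and> t < ?r c \<and> ?l' c < t' \<and> t' < ?r' c"
    if "c \<in> I" "chord \<epsilon> t t'" "\<bar>t - fst c\<bar> \<le> \<rho>" "\<bar>t' - snd c\<bar> \<le> \<rho>" for c t t'
    using L[OF that(1)] that(2-4) by (simp add: rect_def)
  have IJ: "c \<in> J" if "c \<in> I" for c using that by (simp add: I_def)
  have iso': "(\<exists>l r l' r'. rect c l r l' r') \<or>
      w c = 0 \<and> (\<forall>t t'. chord \<epsilon> t t' \<longrightarrow> \<bar>t - fst c\<bar> \<le> \<rho> \<longrightarrow> \<not> \<bar>t' - snd c\<bar> \<le> \<rho>)" if "c \<in> J" for c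
    using iso[of "fst c" "snd c"] that unfolding isolated_def rect_def by simp
  have empty: "w c = 0 \<and> (\<forall>t t'. chord \<epsilon> t t' \<longrightarrow> \<bar>t - fst c\<bar> \<le> \<rho> \<longrightarrow> \<not> \<bar>t' - snd c\<bar> \<le> \<rho>)"
    if "c \<in> J" "c \<notin> I" for c
    using iso'[OF that(1)] that by (simp add: I_def)
  have "\<exists>\<delta>1>0. \<forall>\<delta>. 0 < \<delta> \<longrightarrow> \<delta> \<le> \<delta>1 \<longrightarrow> chord_integral a \<delta> \<epsilon> D = (\<Sum>c\<in>I. w c)"
  proof (rule chord_integral_sum[where l = ?l and r = ?r and l' = ?l' and r' = ?r'])
    show "finite I" using fin by (simp add: I_def)
    show "cbox (?l c, ?l' c) (?r c, ?r' c) \<subseteq> cbox (a, a) (a + 1, a + 1)" if "c \<in> I" for c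
      using L'[OF that] inside[of "fst c" "snd c"] IJ[OF that] by (force simp: cbox_Pair_eq)
    show "cbox (?l c, ?l' c) (?r c, ?r' c) \<inter> cbox (?l b, ?l' b) (?r b, ?r' b) = {}"
      if cb: "c \<in> I" "b \<in> I" "c \<noteq> b" for c b
    proof (rule ccontr)
      assume "\<not> ?thesis"
      then obtain x where x: "x \<in> cbox (?l c, ?l' c) (?r c, ?r' c)" "x \<in> cbox (?l b, ?l' b) (?r b, ?r' b)" by blast
      then have "fst x \<in> {?l c..?r c}" "snd x \<in> {?l' c..?r' c}" "fst x \<in> {?l b..?r b}" "snd x \<in> {?l' b..?r' b}"
        by (simp_all add: cbox_Pair_eq mem_Times_iff)
      then have "\<bar>fst c - fst b\<bar> \<le> 2 * \<rho>" "\<bar>snd c - snd b\<bar> \<le> 2 * \<rho>"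
        using L'(2-5)[OF cb(1)] L'(2-5)[OF cb(2)] unfolding atLeastAtMost_iff by linarith+
      then show False using disj[of "fst c" "snd c" "fst b" "snd b"] IJ cb by auto
    qed
    show "\<exists>c\<in>I. ?l c < t \<and> t < ?r c \<and> ?l' c < t' \<and> t' < ?r' c"
      if t: "chord \<epsilon> t t'" "t \<in> {a..a + 1}" "t' \<in> {a..a + 1}" for t t'
    proof -
      obtain c where c: "c \<in> J" "\<bar>t - fst c\<bar> \<le> \<rho>" "\<bar>t' - snd c\<bar> \<le> \<rho>" using chords[OF t] by force
      then have "c \<in> I" using empty[of c] t(1) by blast
      then show ?thesis using L_chord[OF _ t(1) c(2,3)] by blast
    qed
  qed (rule L'(1))
  moreover have "(\<Sum>c\<in>I. w c) = (\<Sum>c\<in>J. w c)"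
    using empty IJ by (intro sum.mono_neutral_left[OF fin]) auto
  ultimately show ?thesis by simp
qed

end

section \<open>Summation over all crossings and cusps\<close>

lemma finite_positive:
  assumes "finite A" "\<And>x. x \<in> A \<Longrightarrow> \<exists>e>0. \<forall>e'. 0 < e' \<longrightarrow> e' \<le> e \<longrightarrow> P x (e'::real)"
  shows "\<exists>e>0. \<forall>e'. 0 < e' \<longrightarrow> e' \<le> e \<longrightarrow> (\<forall>x\<in>A. P x e')"
  using assms
proof (induction A rule: finite_induct)
  case empty
  then show ?case by (intro exI[of _ 1]) simp
next
  case (insert x A)
  obtain e where e: "e > 0" "\<forall>e'. 0 < e' \<longrightarrow> e' \<le> e \<longrightarrow> (\<forall>x\<in>A. P x e')" using insert by auto
  obtain f where f: "f > 0" "\<forall>e'. 0 < e' \<longrightarrow> e' \<le> f \<longrightarrow> P x e'" using insert.prems[of x] by auto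
  show ?case using e f by (intro exI[of _ "min e f"]) auto
qed

context front_diagram
begin

text \<open>The under-parameter comes first, because a chord ends at the smaller slope, that is on
  the over-branch.\<close>

definition crossing_centres :: "real \<Rightarrow> (real \<times> real) set" where
  "crossing_centres a = {(q, p). q \<in> {a<..<a + 1} \<and> p \<in> {a<..<a + 1} \<and> over p q}"

definition cusp_centres :: "real \<Rightarrow> (real \<times> real) set" where
  "cusp_centres a = {(c, c) | c. c \<in> {a<..<a + 1} \<and> cusp c}"

lemma unit_interval_eq:
  assumes "s \<in> {a<..<a + 1}" "t \<in> {a<..<a + 1}" "frac s = frac (t::real)"
  shows "s = t"
proof -
  have "s - t \<in> \<int>" using assms(3) by (simp add: frac_eq_iff)
  then show ?thesis using D_eq_near[of s t] assms(1,2) by (auto simp: D_eq_iff)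
qed

lemma special_representative:
  assumes "special t" "\<not> special a"
  obtains s where "s \<in> {a<..<a + 1}" "frac s = frac t"
proof -
  define s where "s = t + of_int (- \<lfloor>t - a\<rfloor>)"
  have "special s" unfolding s_def special_periodic by (rule assms(1))
  then have "s \<noteq> a" using assms(2) by auto
  moreover have "a \<le> s" "s < a + 1" unfolding s_def by (simp; linarith)+
  moreover have "frac s = frac t" by (simp add: frac_eq_iff s_def)
  ultimately show ?thesis using that[of s] by auto
qed

lemma crossing_centres_bij:
  assumes "\<not> special a"
  shows "bij_betw (\<lambda>(q, p). (frac p, frac q)) (crossing_centres a) (crossings D)"
  unfolding bij_betw_def
proof (intro conjI equalityI subsetI)
  show "inj_on (\<lambda>(q, p). (frac p, frac q)) (crossing_centres a)"
    by (rule inj_onI) (auto simp: crossing_centres_def intro: unit_interval_eq)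
  show "c \<in> crossings D" if "c \<in> (\<lambda>(q, p). (frac p, frac q)) ` crossing_centres a" for c
    using that by (auto simp: crossing_centres_def over_crossings)
  fix c assume c: "c \<in> crossings D"
  obtain p q where pq: "c = (p, q)" by (cases c)
  have fr: "frac p = p" "frac q = q" using c pq by (auto simp: crossings_def frac_eq)
  have o: "over p q" using c pq fr by (simp add: over_crossings)
  then have "special p" "special q" by (auto simp: special_def)
  then obtain s t where st: "s \<in> {a<..<a + 1}" "frac s = frac p" "t \<in> {a<..<a + 1}" "frac t = frac q"
    using special_representative assms by metis
  then have "over s t" using o by (simp add: over_crossings)
  then have "(t, s) \<in> crossing_centres a" using st by (simp add: crossing_centres_def)
  then show "c \<in> (\<lambda>(q, p). (frac p, frac q)) ` crossing_centres a"
    by (rule rev_image_eqI) (use pq fr st in simp)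
qed

lemma cusp_centres_bij:
  assumes "\<not> special a"
  shows "bij_betw (\<lambda>(c, c'). frac c) (cusp_centres a) (cusps D)"
  unfolding bij_betw_def
proof (intro conjI equalityI subsetI)
  show "inj_on (\<lambda>(c, c'). frac c) (cusp_centres a)"
    by (rule inj_onI) (auto simp: cusp_centres_def intro: unit_interval_eq)
  show "c \<in> cusps D" if "c \<in> (\<lambda>(c, c'). frac c) ` cusp_centres a" for c
    using that frac_in by (auto simp: cusp_centres_def cusps_def V_frac)
  fix c assume c: "c \<in> cusps D"
  then have fr: "frac c = c" and "cusp c" by (auto simp: cusps_def frac_eq)
  then have "special c" by (simp add: special_def)
  then obtain s where s: "s \<in> {a<..<a + 1}" "frac s = frac c" using special_representative assms by metis
  then have "cusp s" using \<open>cusp c\<close> by (metis V_frac)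
  then have "(s, s) \<in> cusp_centres a" using s by (simp add: cusp_centres_def)
  then show "c \<in> (\<lambda>(c, c'). frac c) ` cusp_centres a"
    by (rule rev_image_eqI) (use fr s in simp)
qed

lemma finite_centres:
  assumes "\<not> special a"
  shows "finite (crossing_centres a)" "finite (cusp_centres a)"
  using bij_betw_finite[OF crossing_centres_bij[OF assms]] bij_betw_finite[OF cusp_centres_bij[OF assms]]
    finite_breaks by simp_all

lemma sum_crossing_centres:
  assumes "\<not> special a"
  shows "(\<Sum>(q, p)\<in>crossing_centres a. crossing_sign D (p, q)) = writhe D"
proof -
  have "writhe D = (\<Sum>(q, p)\<in>crossing_centres a. crossing_sign D (frac p, frac q))"
    unfolding writhe_def sum.reindex_bij_betw[OF crossing_centres_bij[OF assms], symmetric]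
    by (simp add: case_prod_beta)
  then show ?thesis by (simp add: crossing_sign_def front_det_eq D_frac V_frac)
qed

text \<open>Pairs away from integer parameter distance are treated by compactness. Near the diagonal
  Rolle's theorem puts a cusp in between, and across the base point \<open>a\<close> chords are
  impossible because no cusp is near.\<close>

lemma chords_near_centres:
  assumes a: "\<not> special a" and "\<rho> > 0"
  shows "\<exists>e>0. \<forall>\<epsilon> t t'. \<epsilon> \<noteq> 0 \<longrightarrow> \<bar>\<epsilon>\<bar> < e \<longrightarrow> chord \<epsilon> t t' \<longrightarrow> t \<in> {a..a+1} \<longrightarrow> t' \<in> {a..a+1} \<longrightarrow>
    (\<exists>(q, p)\<in>crossing_centres a \<union> cusp_centres a. \<bar>t - q\<bar> \<le> \<rho> \<and> \<bar>t' - p\<bar> \<le> \<rho>)"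
proof -
  let ?J = "crossing_centres a \<union> cusp_centres a"
  obtain e0 where e0: "e0 > 0" "\<And>s. 0 < \<bar>s - a\<bar> \<Longrightarrow> \<bar>s - a\<bar> < e0 \<Longrightarrow> \<not> special s"
    using special_discrete[of a] by blast
  have no_cusp: "\<not> cusp s" if "\<bar>s - a\<bar> < e0" for s
    using e0(2)[of s] a that by (cases "s = a") (auto simp: special_def)
  define \<eta> where "\<eta> = min \<rho> (min e0 (1 / 3))"
  have \<eta>: "0 < \<eta>" "\<eta> \<le> \<rho>" "\<eta> \<le> e0" "\<eta> < 1 / 2" using \<open>\<rho> > 0\<close> e0(1) by (auto simp: \<eta>_def)
  let ?K = "({a..a+1} \<times> {a..a+1}) \<inter> {x. \<eta> \<le> \<bar>snd x - fst x\<bar>} \<inter> {x. \<bar>snd x - fst x\<bar> \<le> 1 - \<eta>} -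
      (\<Union>c\<in>?J. {fst c - \<rho><..<fst c + \<rho>} \<times> {snd c - \<rho><..<snd c + \<rho>})"
  obtain e where e: "e > 0" "\<And>\<epsilon> t t'. \<bar>\<epsilon>\<bar> < e \<Longrightarrow> (t, t') \<in> ?K \<Longrightarrow> \<not> chord \<epsilon> t t'"
  proof (rule chord_free_persists[of ?K])
    show "compact ?K"
      by (intro compact_diff compact_Int_closed compact_Times compact_Icc closed_Collect_le open_UN ballI open_Times
          open_greaterThanLessThan continuous_intros)
    fix t t' assume K: "(t, t') \<in> ?K"
    show "\<not> chord 0 t t'"
    proof
      assume ch: "chord 0 t t'"
      have front: "front D t' = front D t" using ch by (simp add: chord_def front_eq_iff)
      have "t' - t \<notin> \<int>"
      proof
        assume "t' - t \<in> \<int>"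
        then have "t' = t" using D_eq_near[of t' t] K \<eta>(1) by (auto simp: D_eq_iff)
        then show False using K \<eta>(1) by simp
      qed
      then have o: "over t' t"
        using same_front[OF front] ch by (auto simp: chord_def over_def)
      then have "special t" "special t'" by (auto simp: special_def)
      moreover have "\<not> special (a + 1)" using a special_periodic[of a 1] by simp
      ultimately have "t \<noteq> a" "t \<noteq> a + 1" "t' \<noteq> a" "t' \<noteq> a + 1" using a by auto
      then have "(t, t') \<in> crossing_centres a" using K o by (simp add: crossing_centres_def)
      then show False using K \<open>\<rho> > 0\<close> by force
    qed
  qed auto
  have "\<exists>(q, p)\<in>?J. \<bar>t - q\<bar> \<le> \<rho> \<and> \<bar>t' - p\<bar> \<le> \<rho>"
    if \<epsilon>: "\<epsilon> \<noteq> 0" "\<bar>\<epsilon>\<bar> < e" and ch: "chord \<epsilon> t t'" and t: "t \<in> {a..a+1}" "t' \<in> {a..a+1}" for \<epsilon> t t'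
  proof -
    \<comment> \<open>Pairs near the opposite corners are translated next to \<open>a\<close>, where
      two parameters with equal \<open>x\<close> would enclose a cusp.\<close>
    have wrap: False if "s \<in> {a - \<eta><..<a + \<eta>}" "s' \<in> {a - \<eta><..<a + \<eta>}" "D s = D t" "D s' = D t'" for s s'
    proof -
      have x: "D s $ 1 = D s' $ 1" and z: "D s' $ 3 = D s $ 3 + \<epsilon>" using ch that(3,4) by (simp_all add: chord_def)
      then have "s \<noteq> s'" using \<epsilon>(1) by auto
      from cusp_between[OF x this] obtain z where "min s s' < z" "z < max s s'" "cusp z" by blast
      moreover from this have "\<bar>z - a\<bar> < e0" using that(1,2) \<eta> by auto
      ultimately show False using no_cusp by blast
    qed
    consider "(t, t') \<in> ?K" | c where "c \<in> ?J" "\<bar>t - fst c\<bar> < \<rho>" "\<bar>t' - snd c\<bar> < \<rho>"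
      | "\<bar>t' - t\<bar> < \<eta>" | "1 - \<eta> < t' - t" | "1 - \<eta> < t - t'"
    proof (cases "\<exists>c\<in>?J. \<bar>t - fst c\<bar> < \<rho> \<and> \<bar>t' - snd c\<bar> < \<rho>")
      case False
      then have out: "(t, t') \<notin> (\<Union>c\<in>?J. {fst c - \<rho><..<fst c + \<rho>} \<times> {snd c - \<rho><..<snd c + \<rho>})" by force
      show ?thesis
      proof (cases "\<eta> \<le> \<bar>t' - t\<bar> \<and> \<bar>t' - t\<bar> \<le> 1 - \<eta>")
        case True
        then have "(t, t') \<in> ?K" using out t by simp
        then show ?thesis by (rule that(1))
      next
        case False
        then show ?thesis using that(3-5) by linarith
      qed
    qed (use that(2) in blast)
    then show ?thesis
    proof cases
      case 1
      then show ?thesis using e(2)[OF \<epsilon>(2)] ch by blast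
    next
      case (2 c)
      then show ?thesis by (intro bexI[of _ c]) auto
    next
      case 3
      have "t \<noteq> t'" using ch \<epsilon>(1) by (auto simp: chord_def)
      then obtain z where z: "min t t' < z" "z < max t t'" "cusp z"
        using cusp_between[of t t'] ch unfolding chord_def by metis
      then have "(z, z) \<in> ?J" using t by (auto simp: cusp_centres_def)
      moreover have "\<bar>t - z\<bar> \<le> \<rho>" "\<bar>t' - z\<bar> \<le> \<rho>" using z(1,2) 3 \<eta> by linarith+
      ultimately show ?thesis by (intro bexI[of _ "(z, z)"]) auto
    next
      case 4
      then show ?thesis using wrap[of t "t' - 1"] t D_periodic[of "t' - 1"] \<eta> by simp
    next
      case 5
      then show ?thesis using wrap[of "t - 1" t'] t D_periodic[of "t - 1"] \<eta> by simp
    qed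
  qed
  then show ?thesis using e(1) by blast
qed

text \<open>The radius \<open>\<rho>\<close> is fixed first, small enough to separate the finitely
  many centres, then \<open>\<epsilon>\<close>, and \<open>\<delta>\<close> last. As
  \<open>a\<close> is not special, no centre lies on the boundary of the period square.\<close>

lemma chord_integral_tb:
  assumes a: "\<not> special a"
  shows "\<exists>e>0. \<forall>\<epsilon>. 0 < \<epsilon> \<longrightarrow> \<epsilon> < e \<longrightarrow> (\<exists>\<delta>1>0. \<forall>\<delta>. 0 < \<delta> \<longrightarrow> \<delta> \<le> \<delta>1 \<longrightarrow>
    chord_integral a \<delta> \<epsilon> D + chord_integral a \<delta> (- \<epsilon>) D = 2 * tb_front D)"
proof -
  let ?X = "crossing_centres a" and ?C = "cusp_centres a"
  note fin = finite_centres[OF a]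
  have disj: "?X \<inter> ?C = {}" by (auto simp: crossing_centres_def cusp_centres_def over_def)
  have "\<forall>c\<in>?C. \<exists>\<kappa>. (\<kappa> = 1 \<or> \<kappa> = - 1) \<and> (\<exists>\<rho>0>0. \<forall>\<rho>. 0 < \<rho> \<longrightarrow> \<rho> \<le> \<rho>0 \<longrightarrow>
    (\<exists>e>0. \<forall>\<epsilon>. \<epsilon> \<noteq> 0 \<longrightarrow> \<bar>\<epsilon>\<bar> < e \<longrightarrow> isolated \<epsilon> (fst c) (snd c) \<rho> (if \<kappa> * \<epsilon> < 0 then - 1 else 0)))"
  proof
    fix c assume "c \<in> ?C"
    then have c: "cusp (fst c)" "snd c = fst c" by (auto simp: cusp_centres_def)
    show "\<exists>\<kappa>. (\<kappa> = 1 \<or> \<kappa> = - 1) \<and> (\<exists>\<rho>0>0. \<forall>\<rho>. 0 < \<rho> \<longrightarrow> \<rho> \<le> \<rho>0 \<longrightarrow>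
      (\<exists>e>0. \<forall>\<epsilon>. \<epsilon> \<noteq> 0 \<longrightarrow> \<bar>\<epsilon>\<bar> < e \<longrightarrow> isolated \<epsilon> (fst c) (snd c) \<rho> (if \<kappa> * \<epsilon> < 0 then - 1 else 0)))"
      unfolding c(2)
    proof (rule cusp_isolated[OF c(1)])
      fix \<kappa> \<rho>0 :: real
      assume *: "\<kappa> = 1 \<or> \<kappa> = - 1" "\<rho>0 > 0" "\<And>\<rho>. 0 < \<rho> \<Longrightarrow> \<rho> \<le> \<rho>0 \<Longrightarrow>
        \<exists>e>0. \<forall>\<epsilon>. \<epsilon> \<noteq> 0 \<longrightarrow> \<bar>\<epsilon>\<bar> < e \<longrightarrow> isolated \<epsilon> (fst c) (fst c) \<rho> (if \<kappa> * \<epsilon> < 0 then - 1 else 0)"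
      show "\<exists>\<kappa>. (\<kappa> = 1 \<or> \<kappa> = - 1) \<and> (\<exists>\<rho>0>0. \<forall>\<rho>. 0 < \<rho> \<longrightarrow> \<rho> \<le> \<rho>0 \<longrightarrow>
        (\<exists>e>0. \<forall>\<epsilon>. \<epsilon> \<noteq> 0 \<longrightarrow> \<bar>\<epsilon>\<bar> < e \<longrightarrow> isolated \<epsilon> (fst c) (fst c) \<rho> (if \<kappa> * \<epsilon> < 0 then - 1 else 0)))"
        by (intro exI[of _ \<kappa>] conjI exI[of _ \<rho>0] allI impI *)
    qed
  qed
  from bchoice[OF this] obtain \<kappa> where \<kappa>: "\<And>c. c \<in> ?C \<Longrightarrow> \<kappa> c = 1 \<or> \<kappa> c = - 1"
    "\<And>c. c \<in> ?C \<Longrightarrow> \<exists>\<rho>0>0. \<forall>\<rho>. 0 < \<rho> \<longrightarrow> \<rho> \<le> \<rho>0 \<longrightarrow>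
      (\<exists>e>0. \<forall>\<epsilon>. \<epsilon> \<noteq> 0 \<longrightarrow> \<bar>\<epsilon>\<bar> < e \<longrightarrow> isolated \<epsilon> (fst c) (snd c) \<rho> (if \<kappa> c * \<epsilon> < 0 then - 1 else 0))"
    by blast
  define w where "w \<epsilon> c = (if c \<in> ?C then if \<kappa> c * \<epsilon> < 0 then - 1 else 0 else crossing_sign D (snd c, fst c))" for \<epsilon> c
  let ?J = "?X \<union> ?C"
  have finJ: "finite ?J" using fin by simp
  have iso: "\<exists>\<rho>0>0. \<forall>\<rho>. 0 < \<rho> \<longrightarrow> \<rho> \<le> \<rho>0 \<longrightarrow>
      (\<exists>e>0. \<forall>\<epsilon>. \<epsilon> \<noteq> 0 \<longrightarrow> \<bar>\<epsilon>\<bar> < e \<longrightarrow> isolated \<epsilon> (fst c) (snd c) \<rho> (w \<epsilon> c))" if c: "c \<in> ?J" for c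
  proof (cases "c \<in> ?C")
    case True
    then show ?thesis using \<kappa>(2)[OF True] by (simp only: w_def if_True)
  next
    case False
    then have "over (snd c) (fst c)" using c by (auto simp: crossing_centres_def)
    then show ?thesis
    proof (rule crossing_isolated)
      fix \<rho>0 assume *: "\<rho>0 > 0" "\<And>\<rho>. 0 < \<rho> \<Longrightarrow> \<rho> \<le> \<rho>0 \<Longrightarrow>
        \<exists>e>0. \<forall>\<epsilon>. \<bar>\<epsilon>\<bar> < e \<longrightarrow> isolated \<epsilon> (fst c) (snd c) \<rho> (crossing_sign D (snd c, fst c))"
      have w: "w \<epsilon> c = crossing_sign D (snd c, fst c)" for \<epsilon> using False by (simp add: w_def)
      show ?thesis
      proof (rule exI[of _ \<rho>0], intro conjI allI impI *(1))
        fix \<rho> assume "0 < \<rho>" "\<rho> \<le> \<rho>0"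
        from *(2)[OF this] obtain e where
          "e > 0" "\<forall>\<epsilon>. \<bar>\<epsilon>\<bar> < e \<longrightarrow> isolated \<epsilon> (fst c) (snd c) \<rho> (crossing_sign D (snd c, fst c))" by blast
        then show "\<exists>e>0. \<forall>\<epsilon>. \<epsilon> \<noteq> 0 \<longrightarrow> \<bar>\<epsilon>\<bar> < e \<longrightarrow> isolated \<epsilon> (fst c) (snd c) \<rho> (w \<epsilon> c)"
          unfolding w by (intro exI[of _ e]) simp
      qed
    qed
  qed
  have "\<exists>\<rho>0>0. \<forall>\<rho>. 0 < \<rho> \<longrightarrow> \<rho> \<le> \<rho>0 \<longrightarrow> (\<forall>c\<in>?J. (\<exists>e>0. \<forall>\<epsilon>. \<epsilon> \<noteq> 0 \<longrightarrow> \<bar>\<epsilon>\<bar> < e \<longrightarrow> isolated \<epsilon> (fst c) (snd c) \<rho> (w \<epsilon> c)))"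
    using finJ iso by (rule finite_positive)
  then obtain \<rho>1 where \<rho>1: "\<rho>1 > 0" "\<And>\<rho> c. 0 < \<rho> \<Longrightarrow> \<rho> \<le> \<rho>1 \<Longrightarrow> c \<in> ?J \<Longrightarrow>
      \<exists>e>0. \<forall>\<epsilon>. \<epsilon> \<noteq> 0 \<longrightarrow> \<bar>\<epsilon>\<bar> < e \<longrightarrow> isolated \<epsilon> (fst c) (snd c) \<rho> (w \<epsilon> c)" by blast
  have "\<exists>\<rho>0>0. \<forall>\<rho>. 0 < \<rho> \<longrightarrow> \<rho> \<le> \<rho>0 \<longrightarrow> (\<forall>c\<in>?J. a \<le> fst c - \<rho> \<and> fst c + \<rho> \<le> a + 1 \<and> a \<le> snd c - \<rho> \<and> snd c + \<rho> \<le> a + 1)"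
  proof (rule finite_positive[OF finJ])
    fix c assume "c \<in> ?J"
    then have c: "fst c \<in> {a<..<a + 1}" "snd c \<in> {a<..<a + 1}" by (auto simp: crossing_centres_def cusp_centres_def)
    then show "\<exists>e>0. \<forall>e'. 0 < e' \<longrightarrow> e' \<le> e \<longrightarrow> a \<le> fst c - e' \<and> fst c + e' \<le> a + 1 \<and> a \<le> snd c - e' \<and> snd c + e' \<le> a + 1"
      by (intro exI[of _ "Min {fst c - a, a + 1 - fst c, snd c - a, a + 1 - snd c}"]) auto
  qed
  then obtain \<rho>2 where \<rho>2: "\<rho>2 > 0" "\<And>\<rho> c. 0 < \<rho> \<Longrightarrow> \<rho> \<le> \<rho>2 \<Longrightarrow> c \<in> ?J \<Longrightarrow>
      a \<le> fst c - \<rho> \<and> fst c + \<rho> \<le> a + 1 \<and> a \<le> snd c - \<rho> \<and> snd c + \<rho> \<le> a + 1" by blast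
  have "\<exists>\<rho>0>0. \<forall>\<rho>. 0 < \<rho> \<longrightarrow> \<rho> \<le> \<rho>0 \<longrightarrow> (\<forall>cb\<in>{cb\<in>?J \<times> ?J. fst cb \<noteq> snd cb}.
      2 * \<rho> < max \<bar>fst (fst cb) - fst (snd cb)\<bar> \<bar>snd (fst cb) - snd (snd cb)\<bar>)"
  proof (rule finite_positive)
    show "finite {cb\<in>?J \<times> ?J. fst cb \<noteq> snd cb}" using finJ by simp
    fix cb assume "cb \<in> {cb\<in>?J \<times> ?J. fst cb \<noteq> snd cb}"
    then have "0 < max \<bar>fst (fst cb) - fst (snd cb)\<bar> \<bar>snd (fst cb) - snd (snd cb)\<bar>" (is "0 < ?m")
      by (auto simp: prod_eq_iff less_max_iff_disj)
    then show "\<exists>e>0. \<forall>e'. 0 < e' \<longrightarrow> e' \<le> e \<longrightarrow> 2 * e' < ?m" by (intro exI[of _ "?m / 3"]) auto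
  qed
  then obtain \<rho>3 where \<rho>3: "\<rho>3 > 0" "\<And>\<rho> c b. 0 < \<rho> \<Longrightarrow> \<rho> \<le> \<rho>3 \<Longrightarrow> c \<in> ?J \<Longrightarrow> b \<in> ?J \<Longrightarrow> c \<noteq> b \<Longrightarrow>
      2 * \<rho> < max \<bar>fst c - fst b\<bar> \<bar>snd c - snd b\<bar>" by fastforce
  define \<rho> where "\<rho> = Min {\<rho>1, \<rho>2, \<rho>3}"
  have \<rho>: "\<rho> > 0" "\<rho> \<le> \<rho>1" "\<rho> \<le> \<rho>2" "\<rho> \<le> \<rho>3" using \<rho>1(1) \<rho>2(1) \<rho>3(1) by (auto simp: \<rho>_def)
  have "\<exists>e>0. \<forall>e'. 0 < e' \<longrightarrow> e' \<le> e \<longrightarrow> (\<forall>c\<in>?J. isolated e' (fst c) (snd c) \<rho> (w e' c) \<and> isolated (- e') (fst c) (snd c) \<rho> (w (- e') c))"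
  proof (rule finite_positive[OF finJ])
    fix c assume "c \<in> ?J"
    from \<rho>1(2)[OF \<rho>(1,2) this] obtain e where
      "e > 0" "\<forall>\<epsilon>. \<epsilon> \<noteq> 0 \<longrightarrow> \<bar>\<epsilon>\<bar> < e \<longrightarrow> isolated \<epsilon> (fst c) (snd c) \<rho> (w \<epsilon> c)" by blast
    then show "\<exists>e>0. \<forall>e'. 0 < e' \<longrightarrow> e' \<le> e \<longrightarrow> isolated e' (fst c) (snd c) \<rho> (w e' c) \<and> isolated (- e') (fst c) (snd c) \<rho> (w (- e') c)"
      by (intro exI[of _ "e / 2"]) simp
  qed
  then obtain e1 where e1: "e1 > 0" "\<And>\<epsilon> c. 0 < \<epsilon> \<Longrightarrow> \<epsilon> \<le> e1 \<Longrightarrow> c \<in> ?J \<Longrightarrow> isolated \<epsilon> (fst c) (snd c) \<rho> (w \<epsilon> c)"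
    "\<And>\<epsilon> c. 0 < \<epsilon> \<Longrightarrow> \<epsilon> \<le> e1 \<Longrightarrow> c \<in> ?J \<Longrightarrow> isolated (- \<epsilon>) (fst c) (snd c) \<rho> (w (- \<epsilon>) c)" by blast
  obtain e2 where e2: "e2 > 0" "\<And>\<epsilon> t t'. \<epsilon> \<noteq> 0 \<Longrightarrow> \<bar>\<epsilon>\<bar> < e2 \<Longrightarrow> chord \<epsilon> t t' \<Longrightarrow> t \<in> {a..a+1} \<Longrightarrow> t' \<in> {a..a+1} \<Longrightarrow>
      \<exists>(q, p)\<in>?J. \<bar>t - q\<bar> \<le> \<rho> \<and> \<bar>t' - p\<bar> \<le> \<rho>"
    using chords_near_centres[OF a \<rho>(1)] by blast
  have count: "\<exists>\<delta>1>0. \<forall>\<delta>. 0 < \<delta> \<longrightarrow> \<delta> \<le> \<delta>1 \<longrightarrow> chord_integral a \<delta> \<epsilon> D = (\<Sum>c\<in>?J. w \<epsilon> c)"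
    if \<epsilon>: "\<epsilon> \<noteq> 0" "\<bar>\<epsilon>\<bar> < min e1 e2" for \<epsilon>
  proof (rule isolated_sum[OF finJ \<rho>(1)])
    show "isolated \<epsilon> q p \<rho> (w \<epsilon> (q, p))" if "(q, p) \<in> ?J" for q p
      using e1(2)[of \<epsilon>, OF _ _ that] e1(3)[of "- \<epsilon>", OF _ _ that] \<epsilon> by (cases "0 < \<epsilon>") auto
    show "a \<le> q - \<rho> \<and> q + \<rho> \<le> a + 1 \<and> a \<le> p - \<rho> \<and> p + \<rho> \<le> a + 1" if "(q, p) \<in> ?J" for q p
      using \<rho>2(2)[OF \<rho>(1,3) that] by simp
    show "2 * \<rho> < max \<bar>q - q'\<bar> \<bar>p - p'\<bar>" if "(q, p) \<in> ?J" "(q', p') \<in> ?J" "(q, p) \<noteq> (q', p')" for q p q' p'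
      using \<rho>3(2)[OF \<rho>(1,4) that] by simp
  qed (use e2(2) \<epsilon> in simp)
  have total: "(\<Sum>c\<in>?J. w \<epsilon> c) + (\<Sum>c\<in>?J. w (- \<epsilon>) c) = 2 * tb_front D" if "\<epsilon> \<noteq> 0" for \<epsilon>
  proof -
    have "(\<Sum>c\<in>?J. w \<epsilon> c) + (\<Sum>c\<in>?J. w (- \<epsilon>) c) = (\<Sum>c\<in>?J. w \<epsilon> c + w (- \<epsilon>) c)"
      by (simp add: sum.distrib)
    also have "\<dots> = (\<Sum>c\<in>?X. w \<epsilon> c + w (- \<epsilon>) c) + (\<Sum>c\<in>?C. w \<epsilon> c + w (- \<epsilon>) c)"
      by (rule sum.union_disjoint[OF fin disj])
    also have "(\<Sum>c\<in>?X. w \<epsilon> c + w (- \<epsilon>) c) = (\<Sum>(q, p)\<in>?X. 2 * crossing_sign D (p, q))"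
      using disj by (intro sum.cong) (auto simp: w_def)
    also have "\<dots> = 2 * writhe D"
      unfolding sum_crossing_centres[OF a, symmetric] sum_distrib_left by (simp add: case_prod_beta)
    also have "(\<Sum>c\<in>?C. w \<epsilon> c + w (- \<epsilon>) c) = (\<Sum>c\<in>?C. - 1)"
    proof (rule sum.cong)
      fix c assume "c \<in> ?C"
      then show "w \<epsilon> c + w (- \<epsilon>) c = - 1" using \<kappa>(1)[of c] that by (auto simp: w_def)
    qed simp
    also have "\<dots> = - real (card (cusps D))"
      using bij_betw_same_card[OF cusp_centres_bij[OF a]] by simp
    finally show ?thesis by (simp add: tb_front_def)
  qed
  show ?thesis
  proof (rule exI[of _ "min e1 e2"], intro conjI allI impI)
    fix \<epsilon> assume \<epsilon>: "0 < \<epsilon>" "\<epsilon> < min e1 e2"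
    obtain d1 where d1: "d1 > 0" "\<forall>\<delta>. 0 < \<delta> \<longrightarrow> \<delta> \<le> d1 \<longrightarrow> chord_integral a \<delta> \<epsilon> D = (\<Sum>c\<in>?J. w \<epsilon> c)"
      using count[of \<epsilon>] \<epsilon> by auto
    obtain d2 where d2: "d2 > 0" "\<forall>\<delta>. 0 < \<delta> \<longrightarrow> \<delta> \<le> d2 \<longrightarrow> chord_integral a \<delta> (- \<epsilon>) D = (\<Sum>c\<in>?J. w (- \<epsilon>) c)"
      using count[of "- \<epsilon>"] \<epsilon> by auto
    show "\<exists>\<delta>1>0. \<forall>\<delta>. 0 < \<delta> \<longrightarrow> \<delta> \<le> \<delta>1 \<longrightarrow>
        chord_integral a \<delta> \<epsilon> D + chord_integral a \<delta> (- \<epsilon>) D = 2 * tb_front D"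
      using d1 d2 total[of \<epsilon>] \<epsilon>(1) by (intro exI[of _ "min d1 d2"]) simp
  qed (use e1(1) e2(1) in simp)
qed

end

section \<open>Independence of the front and the comparison of the racks\<close>

lemma front_projection_diagram: "front_projection_of L D \<Longrightarrow> front_diagram D"
  unfolding front_projection_of_def legendrian_isotopic_def isotopic_through_def
  by unfold_locales (auto simp: legendrian_knot_def)

text \<open>The comparison passes through \<open>L\<close>, whose own front may be degenerate, at a
  common \<open>a\<close>, \<open>\<epsilon>\<close> and \<open>\<delta>\<close> below the
  thresholds of both fronts and both signs of \<open>\<epsilon>\<close>.\<close>

lemma tb_front_invariant:
  assumes "front_projection_of L D" "front_projection_of L D'"
  shows "tb_front D = tb_front D'"
proof -
  interpret F: front_diagram D using assms(1) by (rule front_projection_diagram)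
  interpret F': front_diagram D' using assms(2) by (rule front_projection_diagram)
  obtain e where e: "e > 0" "\<And>s. 0 < \<bar>s - 0\<bar> \<Longrightarrow> \<bar>s - 0\<bar> < e \<Longrightarrow> \<not> F.special s"
    using F.special_discrete[of 0] by blast
  obtain e' where e': "e' > 0" "\<And>s. 0 < \<bar>s - 0\<bar> \<Longrightarrow> \<bar>s - 0\<bar> < e' \<Longrightarrow> \<not> F'.special s"
    using F'.special_discrete[of 0] by blast
  define a where "a = min e e' / 2"
  have near: "0 < \<bar>a - 0\<bar>" "\<bar>a - 0\<bar> < e" "\<bar>a - 0\<bar> < e'" using e(1) e'(1) by (auto simp: a_def min_def)
  note a = e(2)[OF near(1,2)] e'(2)[OF near(1,3)]
  obtain e1 where e1: "e1 > 0" "\<And>\<epsilon>. 0 < \<epsilon> \<Longrightarrow> \<epsilon> < e1 \<Longrightarrow> \<exists>\<delta>1>0. \<forall>\<delta>. 0 < \<delta> \<longrightarrow> \<delta> \<le> \<delta>1 \<longrightarrow>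
      chord_integral a \<delta> \<epsilon> D + chord_integral a \<delta> (- \<epsilon>) D = 2 * tb_front D"
    using F.chord_integral_tb[OF a(1)] by blast
  obtain e2 where e2: "e2 > 0" "\<And>\<epsilon>. 0 < \<epsilon> \<Longrightarrow> \<epsilon> < e2 \<Longrightarrow> \<exists>\<delta>1>0. \<forall>\<delta>. 0 < \<delta> \<longrightarrow> \<delta> \<le> \<delta>1 \<longrightarrow>
      chord_integral a \<delta> \<epsilon> D' + chord_integral a \<delta> (- \<epsilon>) D' = 2 * tb_front D'"
    using F'.chord_integral_tb[OF a(2)] by blast
  have iso: "legendrian_isotopic L D" "legendrian_isotopic L D'"
    using assms by (simp_all add: front_projection_of_def)
  obtain e3 where e3: "e3 > 0" "\<And>\<epsilon>. \<epsilon> \<noteq> 0 \<Longrightarrow> \<bar>\<epsilon>\<bar> < e3 \<Longrightarrow>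
      \<exists>\<delta>0>0. \<forall>\<delta> a. 0 < \<delta> \<longrightarrow> \<delta> \<le> \<delta>0 \<longrightarrow> chord_integral a \<delta> \<epsilon> L = chord_integral a \<delta> \<epsilon> D"
    using chord_integral_isotopic[OF iso(1)] by metis
  obtain e4 where e4: "e4 > 0" "\<And>\<epsilon>. \<epsilon> \<noteq> 0 \<Longrightarrow> \<bar>\<epsilon>\<bar> < e4 \<Longrightarrow>
      \<exists>\<delta>0>0. \<forall>\<delta> a. 0 < \<delta> \<longrightarrow> \<delta> \<le> \<delta>0 \<longrightarrow> chord_integral a \<delta> \<epsilon> L = chord_integral a \<delta> \<epsilon> D'"
    using chord_integral_isotopic[OF iso(2)] by metis
  define \<epsilon> where "\<epsilon> = Min {e1, e2, e3, e4} / 2"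
  have \<epsilon>: "0 < \<epsilon>" "\<epsilon> < e1" "\<epsilon> < e2" "\<epsilon> < e3" "\<epsilon> < e4"
    using e1(1) e2(1) e3(1) e4(1) by (auto simp: \<epsilon>_def min_def)
  have ev: "\<exists>\<delta>0>0. \<forall>\<delta>. 0 < \<delta> \<longrightarrow> \<delta> \<le> \<delta>0 \<longrightarrow> chord_integral a \<delta> \<epsilon>' D = chord_integral a \<delta> \<epsilon>' D'"
    if \<epsilon>': "\<epsilon>' \<noteq> 0" "\<bar>\<epsilon>'\<bar> < e3" "\<bar>\<epsilon>'\<bar> < e4" for \<epsilon>'
  proof -
    obtain d1 where "d1 > 0" "\<forall>\<delta> a. 0 < \<delta> \<longrightarrow> \<delta> \<le> d1 \<longrightarrow> chord_integral a \<delta> \<epsilon>' L = chord_integral a \<delta> \<epsilon>' D"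
      using e3(2)[OF \<epsilon>'(1,2)] by blast
    moreover obtain d2 where "d2 > 0" "\<forall>\<delta> a. 0 < \<delta> \<longrightarrow> \<delta> \<le> d2 \<longrightarrow> chord_integral a \<delta> \<epsilon>' L = chord_integral a \<delta> \<epsilon>' D'"
      using e4(2)[OF \<epsilon>'(1,3)] by blast
    ultimately show ?thesis by (intro exI[of _ "min d1 d2"]) auto
  qed
  obtain d1 where d1: "d1 > 0" "\<forall>\<delta>. 0 < \<delta> \<longrightarrow> \<delta> \<le> d1 \<longrightarrow> chord_integral a \<delta> \<epsilon> D + chord_integral a \<delta> (- \<epsilon>) D = 2 * tb_front D"
    using e1(2)[OF \<epsilon>(1,2)] by blast
  obtain d2 where d2: "d2 > 0" "\<forall>\<delta>. 0 < \<delta> \<longrightarrow> \<delta> \<le> d2 \<longrightarrow> chord_integral a \<delta> \<epsilon> D' + chord_integral a \<delta> (- \<epsilon>) D' = 2 * tb_front D'"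
    using e2(2)[OF \<epsilon>(1,3)] by blast
  obtain d3 where d3: "d3 > 0" "\<forall>\<delta>. 0 < \<delta> \<longrightarrow> \<delta> \<le> d3 \<longrightarrow> chord_integral a \<delta> \<epsilon> D = chord_integral a \<delta> \<epsilon> D'"
    using ev[of \<epsilon>] \<epsilon> by auto
  obtain d4 where d4: "d4 > 0" "\<forall>\<delta>. 0 < \<delta> \<longrightarrow> \<delta> \<le> d4 \<longrightarrow> chord_integral a \<delta> (- \<epsilon>) D = chord_integral a \<delta> (- \<epsilon>) D'"
    using ev[of "- \<epsilon>"] \<epsilon> by auto
  define \<delta> where "\<delta> = Min {d1, d2, d3, d4}"
  have \<delta>: "0 < \<delta>" "\<delta> \<le> d1" "\<delta> \<le> d2" "\<delta> \<le> d3" "\<delta> \<le> d4" using d1(1) d2(1) d3(1) d4(1) by (auto simp: \<delta>_def)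
  have "2 * tb_front D = chord_integral a \<delta> \<epsilon> D + chord_integral a \<delta> (- \<epsilon>) D" using d1(2) \<delta> by simp
  also have "\<dots> = chord_integral a \<delta> \<epsilon> D' + chord_integral a \<delta> (- \<epsilon>) D'" using d3(2) d4(2) \<delta> by simp
  also have "\<dots> = 2 * tb_front D'" using d2(2) \<delta> by simp
  finally show ?thesis by simp
qed

lemma tb_eq_tb_front: "front_projection_of L D \<Longrightarrow> tb L = tb_front D"
  unfolding tb_def by (rule the_equality) (auto dest: tb_front_invariant)

theorem theorem3p2:
  fixes L1 L2 :: "real \<Rightarrow> real^3"
  assumes "legendrian_knot L1" and "legendrian_knot L2"
    and "topologically_trivial L1" and "topologically_trivial L2"
    and "tb L1 = tb L2"
  shows "\<forall>n::nat. \<forall>D1 D2. front_projection_of L1 D1 \<and> front_projection_of L2 D2 \<longrightarrow>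
           rack_isomorphic (LR n D1) (LR n D2)"
proof (intro allI impI, elim conjE)
  fix n D1 D2
  assume D: "front_projection_of L1 D1" "front_projection_of L2 D2"
  interpret F1: front_diagram D1 using D(1) by (rule front_projection_diagram)
  interpret F2: front_diagram D2 using D(2) by (rule front_projection_diagram)
  have iso: "legendrian_isotopic L1 D1" "legendrian_isotopic L2 D2"
    using D by (simp_all add: front_projection_of_def)
  obtain \<Phi>1 \<Psi>1 where h1: "homeomorphism UNIV UNIV \<Phi>1 \<Psi>1" "\<Phi>1 ` range D1 = range unknot"
    using assms(3) iso(1) by (rule trivial_front_homeomorphism)
  obtain \<Phi>2 \<Psi>2 where h2: "homeomorphism UNIV UNIV \<Phi>2 \<Psi>2" "\<Phi>2 ` range D2 = range unknot"
    using assms(4) iso(2) by (rule trivial_front_homeomorphism)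
  \<comment> \<open>\<open>tb\<close> is a definite description; its uniqueness lets it be evaluated
    at the given fronts.\<close>
  have "tb_front D1 = tb_front D2"
    using assms(5) tb_eq_tb_front[OF D(1)] tb_eq_tb_front[OF D(2)] by simp
  then show "rack_isomorphic (LR n D1) (LR n D2)"
    by (rule unknotted_fronts_isomorphic[OF F1.legendrian F1.generic h1 F2.legendrian F2.generic h2])
qed

end
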